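(* Let $\mathbf{g}$ be a complex simple Lie algebra, let $O_{min}$ be the minimal nilpotent orbit of $\mathbf{g}$ and let $\tilde{O}_{min}$ be the normalisation of its closure. Then $\tilde{O}_{min}$ has a unique symplectic structure of weight $1$ up to constant except when $\mathbf{g} = sp(2n)$. That is, if $\mathbf{g}$ is not isomorphic to $sp(2n)$ for any $n$, then a symplectic 2-form of weight $1$ on the smooth locus of $\tilde{O}_{min}$ exists, and any two such forms differ by multiplication by some $\lambda \in \mathbf{C}^*$.
   Context: The minimal nilpotent orbit is the unique nonzero nilpotent adjoint orbit of minimal dimension. $\tilde{O}_{min}$ carries the $\mathbf{C}^*$-action induced by scalar multiplication on $\mathbf{g}$. A symplectic structure on $\tilde O_{min}$ is an algebraic, $d$-closed, everywhere non-degenerate 2-form $\omega$ on its smooth locus; it has weight $l$ if $\phi_t^*\omega = t^l\omega$ for all $t \in \mathbf{C}^*$, where $\{\phi_t\}$ is the action. (The Kostant–Kirillov form has weight $1$.) *)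

theory Defs
  imports
    "HOL-Analysis.Analysis"
    "HOL-Library.Function_Algebras"
    "HOL-Library.Extended_Nat"
    "Jordan_Normal_Form.Matrix"
begin

section \<open>Complex Lie algebras\<close>

text \<open>The underlying vector space is the whole type \<open>'g\<close> with scalar multiplication \<open>smul\<close>.\<close>

locale complex_lie_algebra =
  fixes smul :: "complex \<Rightarrow> 'g::ab_group_add \<Rightarrow> 'g"
    and br :: "'g \<Rightarrow> 'g \<Rightarrow> 'g"
  assumes finite_dimensional: "\<exists>B. finite_dimensional_vector_space smul B"
    and linear_right: "Vector_Spaces.linear smul smul (\<lambda>y. br x y)"
    and linear_left: "Vector_Spaces.linear smul smul (\<lambda>x. br x y)"
    and alternating: "br x x = 0"
    and jacobi: "br x (br y z) + br y (br z x) + br z (br x y) = 0"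

definition lie_ideal ::
    "(complex \<Rightarrow> 'g::ab_group_add \<Rightarrow> 'g) \<Rightarrow> ('g \<Rightarrow> 'g \<Rightarrow> 'g) \<Rightarrow> 'g set \<Rightarrow> bool" where
  "lie_ideal smul br I \<longleftrightarrow> module.subspace smul I \<and> (\<forall>x. \<forall>y\<in>I. br x y \<in> I)"

locale simple_complex_lie_algebra = complex_lie_algebra +
  assumes nonabelian: "\<exists>x y. br x y \<noteq> 0"
    and simple: "lie_ideal smul br I \<Longrightarrow> I = {0} \<or> I = UNIV"

subsection \<open>The symplectic Lie algebra\<close>

definition symplectic_gram :: "nat \<Rightarrow> complex mat" where
  "symplectic_gram n = four_block_mat (0\<^sub>m n n) (1\<^sub>m n) (- (1\<^sub>m n)) (0\<^sub>m n n)"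

definition sp_carrier :: "nat \<Rightarrow> complex mat set" where
  "sp_carrier n = {M \<in> carrier_mat (2 * n) (2 * n).
     transpose_mat M * symplectic_gram n + symplectic_gram n * M = 0\<^sub>m (2 * n) (2 * n)}"

text \<open>\<open>isomorphic_to_sp smul br n\<close>: the Lie algebra is isomorphic to \<open>sp(2n)\<close>, the
  symplectic \<open>2n \<times> 2n\<close>-matrices with the commutator as bracket.\<close>

definition isomorphic_to_sp ::
    "(complex \<Rightarrow> 'g::ab_group_add \<Rightarrow> 'g) \<Rightarrow> ('g \<Rightarrow> 'g \<Rightarrow> 'g) \<Rightarrow> nat \<Rightarrow> bool" where
  "isomorphic_to_sp smul br n \<longleftrightarrow>
     (\<exists>F :: 'g \<Rightarrow> complex mat.
        bij_betw F UNIV (sp_carrier n) \<and>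
        (\<forall>x y. F (x + y) = F x + F y) \<and>
        (\<forall>c x. F (smul c x) = c \<cdot>\<^sub>m F x) \<and>
        (\<forall>x y. F (br x y) = F x * F y - F y * F x))"

subsection \<open>The adjoint group and its nilpotent orbits\<close>

text \<open>The exponential of an endomorphism \<open>T\<close>; convergence of the series in the finite-dimensional
  space \<open>'g\<close> is tested against all linear functionals.\<close>

definition exp_endo ::
    "(complex \<Rightarrow> 'g::ab_group_add \<Rightarrow> 'g) \<Rightarrow> ('g \<Rightarrow> 'g) \<Rightarrow> 'g \<Rightarrow> 'g" where
  "exp_endo smul T y =
     (THE z. \<forall>l. Vector_Spaces.linear smul (*) l \<longrightarrow>
        (\<lambda>k. l ((T ^^ k) y) / fact k) sums l z)"

text \<open>The subgroup of \<open>GL(g)\<close> generated by all \<open>exp (ad x)\<close>; closure under inverses is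
  automatic, the inverse of \<open>exp (ad x)\<close> being \<open>exp (ad (- x))\<close>.\<close>

inductive_set adjoint_group ::
    "(complex \<Rightarrow> 'g::ab_group_add \<Rightarrow> 'g) \<Rightarrow> ('g \<Rightarrow> 'g \<Rightarrow> 'g) \<Rightarrow> ('g \<Rightarrow> 'g) set"
  for smul br where
  one: "id \<in> adjoint_group smul br"
| exp_ad: "u \<in> adjoint_group smul br \<Longrightarrow> exp_endo smul (br x) \<circ> u \<in> adjoint_group smul br"

definition adjoint_orbit ::
    "(complex \<Rightarrow> 'g::ab_group_add \<Rightarrow> 'g) \<Rightarrow> ('g \<Rightarrow> 'g \<Rightarrow> 'g) \<Rightarrow> 'g \<Rightarrow> 'g set" where
  "adjoint_orbit smul br x = {u x | u. u \<in> adjoint_group smul br}"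

definition ad_nilpotent :: "('g::zero \<Rightarrow> 'g \<Rightarrow> 'g) \<Rightarrow> 'g \<Rightarrow> bool" where
  "ad_nilpotent br x \<longleftrightarrow> (\<exists>k. \<forall>y. (br x ^^ k) y = 0)"

definition nonzero_nilpotent_orbit ::
    "(complex \<Rightarrow> 'g::ab_group_add \<Rightarrow> 'g) \<Rightarrow> ('g \<Rightarrow> 'g \<Rightarrow> 'g) \<Rightarrow> 'g set \<Rightarrow> bool" where
  "nonzero_nilpotent_orbit smul br Orb \<longleftrightarrow>
     (\<exists>x. x \<noteq> 0 \<and> ad_nilpotent br x \<and> Orb = adjoint_orbit smul br x)"

section \<open>Affine varieties\<close>

text \<open>An affine variety is given by its set of points \<open>X\<close> and its algebra \<open>A\<close> of regular functions.
  Functions on \<open>X\<close> are represented as functions on the ambient type vanishing off \<open>X\<close>, so the unit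
  of the algebra is \<open>restr X 1\<close>.\<close>

definition restr :: "'x set \<Rightarrow> ('x \<Rightarrow> complex) \<Rightarrow> 'x \<Rightarrow> complex" where
  "restr X f = (\<lambda>x. if x \<in> X then f x else 0)"

definition fun_scale :: "complex \<Rightarrow> ('b \<Rightarrow> complex) \<Rightarrow> 'b \<Rightarrow> complex" where
  "fun_scale c f = (\<lambda>x. c * f x)"

lemma vector_space_fun_scale: "vector_space fun_scale"
  by unfold_locales (auto simp: fun_scale_def fun_eq_iff algebra_simps)

inductive_set generated_algebra :: "'x set \<Rightarrow> ('x \<Rightarrow> complex) set \<Rightarrow> ('x \<Rightarrow> complex) set"
  for X G where
  const: "restr X (\<lambda>_. c) \<in> generated_algebra X G"
| gen: "f \<in> G \<Longrightarrow> restr X f \<in> generated_algebra X G"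
| add: "f \<in> generated_algebra X G \<Longrightarrow> h \<in> generated_algebra X G \<Longrightarrow>
    f + h \<in> generated_algebra X G"
| mult: "f \<in> generated_algebra X G \<Longrightarrow> h \<in> generated_algebra X G \<Longrightarrow>
    f * h \<in> generated_algebra X G"

definition algebra_hom :: "'x set \<Rightarrow> ('x \<Rightarrow> complex) set \<Rightarrow> (('x \<Rightarrow> complex) \<Rightarrow> complex) \<Rightarrow> bool" where
  "algebra_hom X A \<eta> \<longleftrightarrow>
     (\<forall>c. \<eta> (restr X (\<lambda>_. c)) = c) \<and>
     (\<forall>f\<in>A. \<forall>h\<in>A. \<eta> (f + h) = \<eta> f + \<eta> h \<and> \<eta> (f * h) = \<eta> f * \<eta> h)"

text \<open>Irreducible affine varieties over the complex numbers: \<open>A\<close> is a finitely generated domain, and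
  the points of \<open>X\<close> correspond to the algebra homomorphisms from \<open>A\<close> to the complex numbers.\<close>

definition affine_variety :: "'x set \<Rightarrow> ('x \<Rightarrow> complex) set \<Rightarrow> bool" where
  "affine_variety X A \<longleftrightarrow>
     X \<noteq> {} \<and>
     (\<exists>G. finite G \<and> A = generated_algebra X G) \<and>
     (\<forall>f\<in>A. \<forall>h\<in>A. f * h = 0 \<longrightarrow> f = 0 \<or> h = 0) \<and>
     (\<forall>\<eta>. algebra_hom X A \<eta> \<longrightarrow> (\<exists>!x. x \<in> X \<and> (\<forall>f\<in>A. \<eta> f = f x)))"

definition zariski :: "'x set \<Rightarrow> ('x \<Rightarrow> complex) set \<Rightarrow> 'x topology" where
  "zariski X A = topology_generated_by {{x \<in> X. f x \<noteq> 0} | f. f \<in> A}"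

definition irreducible_subset :: "'x topology \<Rightarrow> 'x set \<Rightarrow> bool" where
  "irreducible_subset T Z \<longleftrightarrow>
     Z \<noteq> {} \<and>
     (\<forall>C D. closedin T C \<and> closedin T D \<and> Z \<subseteq> C \<union> D \<longrightarrow> Z \<subseteq> C \<or> Z \<subseteq> D)"

definition krull_dim :: "'x topology \<Rightarrow> enat" where
  "krull_dim T = Sup {enat n | n. \<exists>Z :: nat \<Rightarrow> 'x set.
     (\<forall>i\<le>n. closedin T (Z i) \<and> irreducible_subset T (Z i)) \<and> (\<forall>i<n. Z i \<subset> Z (Suc i))}"

subsection \<open>Subvarieties of a vector space\<close>

definition coordinate_ring ::
    "(complex \<Rightarrow> 'g::ab_group_add \<Rightarrow> 'g) \<Rightarrow> 'g set \<Rightarrow> ('g \<Rightarrow> complex) set" where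
  "coordinate_ring smul Y = generated_algebra Y {l. Vector_Spaces.linear smul (*) l}"

abbreviation zariski_space :: "(complex \<Rightarrow> 'g::ab_group_add \<Rightarrow> 'g) \<Rightarrow> 'g topology" where
  "zariski_space smul \<equiv> zariski UNIV (coordinate_ring smul UNIV)"

definition variety_dim :: "(complex \<Rightarrow> 'g::ab_group_add \<Rightarrow> 'g) \<Rightarrow> 'g set \<Rightarrow> enat" where
  "variety_dim smul Y = krull_dim (subtopology (zariski_space smul) Y)"

definition minimal_nilpotent_orbit ::
    "(complex \<Rightarrow> 'g::ab_group_add \<Rightarrow> 'g) \<Rightarrow> ('g \<Rightarrow> 'g \<Rightarrow> 'g) \<Rightarrow> 'g set \<Rightarrow> bool" where
  "minimal_nilpotent_orbit smul br Orb \<longleftrightarrow>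
     nonzero_nilpotent_orbit smul br Orb \<and>
     (\<forall>Orb'. nonzero_nilpotent_orbit smul br Orb' \<longrightarrow>
        variety_dim smul Orb \<le> variety_dim smul Orb')"

subsection \<open>Morphisms and normalisation\<close>

definition pullback :: "'x set \<Rightarrow> ('x \<Rightarrow> 'y) \<Rightarrow> ('y \<Rightarrow> complex) \<Rightarrow> 'x \<Rightarrow> complex" where
  "pullback X \<nu> f = restr X (f \<circ> \<nu>)"

definition variety_morphism ::
    "'x set \<Rightarrow> ('x \<Rightarrow> complex) set \<Rightarrow> 'y set \<Rightarrow> ('y \<Rightarrow> complex) set \<Rightarrow> ('x \<Rightarrow> 'y) \<Rightarrow> bool" where
  "variety_morphism X A Y B \<nu> \<longleftrightarrow> \<nu> ` X \<subseteq> Y \<and> (\<forall>f\<in>B. pullback X \<nu> f \<in> A)"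

definition finite_morphism ::
    "'x set \<Rightarrow> ('x \<Rightarrow> complex) set \<Rightarrow> 'y set \<Rightarrow> ('y \<Rightarrow> complex) set \<Rightarrow> ('x \<Rightarrow> 'y) \<Rightarrow> bool" where
  "finite_morphism X A Y B \<nu> \<longleftrightarrow>
     variety_morphism X A Y B \<nu> \<and>
     (\<exists>G. finite G \<and> G \<subseteq> A \<and>
        (\<forall>a\<in>A. \<exists>c. (\<forall>e\<in>G. c e \<in> B) \<and> a = (\<Sum>e\<in>G. pullback X \<nu> (c e) * e)))"

text \<open>Birationality: \<open>\<nu>\<close> is dominant and the induced embedding of function fields is surjective, i.e.
  every fraction \<open>p / q\<close> equals some \<open>\<nu>\<^sup>* f / \<nu>\<^sup>* h\<close>.\<close>

definition birational_morphism ::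
    "'x set \<Rightarrow> ('x \<Rightarrow> complex) set \<Rightarrow> 'y set \<Rightarrow> ('y \<Rightarrow> complex) set \<Rightarrow> ('x \<Rightarrow> 'y) \<Rightarrow> bool" where
  "birational_morphism X A Y B \<nu> \<longleftrightarrow>
     variety_morphism X A Y B \<nu> \<and>
     (\<forall>f\<in>B. pullback X \<nu> f = 0 \<longrightarrow> f = 0) \<and>
     (\<forall>p\<in>A. \<forall>q\<in>A. q \<noteq> 0 \<longrightarrow>
        (\<exists>f\<in>B. \<exists>h\<in>B. h \<noteq> 0 \<and> p * pullback X \<nu> h = q * pullback X \<nu> f))"

text \<open>\<open>A\<close> is integrally closed in its field of fractions; the monic equation satisfied by \<open>p / q\<close> is
  multiplied by the \<open>n\<close>-th power of \<open>q\<close>.\<close>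

definition normal_variety :: "'x set \<Rightarrow> ('x \<Rightarrow> complex) set \<Rightarrow> bool" where
  "normal_variety X A \<longleftrightarrow>
     affine_variety X A \<and>
     (\<forall>p\<in>A. \<forall>q\<in>A. q \<noteq> 0 \<longrightarrow>
        (\<exists>n>0. \<exists>c :: nat \<Rightarrow> 'x \<Rightarrow> complex. (\<forall>i<n. c i \<in> A) \<and>
           p ^ n + (\<Sum>i<n. c i * p ^ i * q ^ (n - i)) = 0) \<longrightarrow>
        (\<exists>r\<in>A. p = r * q))"

definition normalisation ::
    "'x set \<Rightarrow> ('x \<Rightarrow> complex) set \<Rightarrow> 'y set \<Rightarrow> ('y \<Rightarrow> complex) set \<Rightarrow> ('x \<Rightarrow> 'y) \<Rightarrow> bool" where
  "normalisation X A Y B \<nu> \<longleftrightarrow>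
     normal_variety X A \<and> finite_morphism X A Y B \<nu> \<and> birational_morphism X A Y B \<nu>"

text \<open>The action of the multiplicative group on \<open>X\<close> lifting scalar multiplication along
  \<open>\<nu>\<close>. The lift is unique when \<open>\<nu>\<close> is a normalisation.\<close>

definition induced_scaling_action ::
    "(complex \<Rightarrow> 'g \<Rightarrow> 'g) \<Rightarrow> 'x set \<Rightarrow> ('x \<Rightarrow> complex) set \<Rightarrow> ('x \<Rightarrow> 'g) \<Rightarrow>
     (complex \<Rightarrow> 'x \<Rightarrow> 'x) \<Rightarrow> bool" where
  "induced_scaling_action smul X A \<nu> \<phi> \<longleftrightarrow>
     (\<forall>t. t \<noteq> 0 \<longrightarrow> variety_morphism X A X A (\<phi> t)) \<and>
     (\<forall>x\<in>X. \<phi> 1 x = x) \<and>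
     (\<forall>s t. s \<noteq> 0 \<longrightarrow> t \<noteq> 0 \<longrightarrow> (\<forall>x\<in>X. \<phi> (s * t) x = \<phi> s (\<phi> t x))) \<and>
     (\<forall>t. t \<noteq> 0 \<longrightarrow> (\<forall>x\<in>X. \<nu> (\<phi> t x) = smul t (\<nu> x)))"

section \<open>Symplectic structures\<close>

text \<open>The Zariski tangent space at \<open>x\<close>: point derivations of \<open>A\<close>. They are set to zero off \<open>A\<close>, so
  that they form a vector space of the right dimension.\<close>

definition tangent_space ::
    "('x \<Rightarrow> complex) set \<Rightarrow> 'x \<Rightarrow> (('x \<Rightarrow> complex) \<Rightarrow> complex) set" where
  "tangent_space A x = {D.
     (\<forall>f. f \<notin> A \<longrightarrow> D f = 0) \<and>
     (\<forall>f\<in>A. \<forall>h\<in>A. D (f + h) = D f + D h) \<and>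
     (\<forall>c. \<forall>f\<in>A. D (fun_scale c f) = c * D f) \<and>
     (\<forall>f\<in>A. \<forall>h\<in>A. D (f * h) = f x * D h + h x * D f)}"

definition smooth_locus :: "'x set \<Rightarrow> ('x \<Rightarrow> complex) set \<Rightarrow> 'x set" where
  "smooth_locus X A =
     {x \<in> X. enat (vector_space.dim fun_scale (tangent_space A x)) = krull_dim (zariski X A)}"

type_synonym 'x tangent = "('x \<Rightarrow> complex) \<Rightarrow> complex"
type_synonym 'x two_form = "'x \<Rightarrow> 'x tangent \<Rightarrow> 'x tangent \<Rightarrow> complex"

definition wedge2 ::
    "('x \<Rightarrow> complex) \<Rightarrow> ('x \<Rightarrow> complex) \<Rightarrow> 'x tangent \<Rightarrow> 'x tangent \<Rightarrow> complex" where
  "wedge2 g h D E = D g * E h - D h * E g"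

text \<open>A list of triples \<open>(a, g, h)\<close> together with a denominator \<open>b\<close> denotes the 2-form
  \<open>\<Sum> (a / b) dg \<and> dh\<close> on the principal open set where \<open>b\<close> does not vanish.\<close>

definition kaehler_form ::
    "('x \<Rightarrow> complex) \<Rightarrow> (('x \<Rightarrow> complex) \<times> ('x \<Rightarrow> complex) \<times> ('x \<Rightarrow> complex)) list \<Rightarrow> 'x two_form" where
  "kaehler_form b ts x D E = (\<Sum>(a, g, h)\<leftarrow>ts. a x / b x * wedge2 g h D E)"

definition tangent_quot ::
    "'x \<Rightarrow> 'x tangent \<Rightarrow> ('x \<Rightarrow> complex) \<Rightarrow> ('x \<Rightarrow> complex) \<Rightarrow> complex" where
  "tangent_quot x D a b = (D a * b x - a x * D b) / (b x)\<^sup>2"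

text \<open>The exterior derivative \<open>\<Sum> d(a / b) \<and> dg \<and> dh\<close> of such an expression.\<close>

definition kaehler_d ::
    "('x \<Rightarrow> complex) \<Rightarrow> (('x \<Rightarrow> complex) \<times> ('x \<Rightarrow> complex) \<times> ('x \<Rightarrow> complex)) list \<Rightarrow>
     'x \<Rightarrow> 'x tangent \<Rightarrow> 'x tangent \<Rightarrow> 'x tangent \<Rightarrow> complex" where
  "kaehler_d b ts x D E F = (\<Sum>(a, g, h)\<leftarrow>ts.
      tangent_quot x D a b * wedge2 g h E F
    - tangent_quot x E a b * wedge2 g h D F
    + tangent_quot x F a b * wedge2 g h D E)"

definition represents_on_principal_open ::
    "'x set \<Rightarrow> ('x \<Rightarrow> complex) set \<Rightarrow> 'x two_form \<Rightarrow>
     ('x \<Rightarrow> complex) \<Rightarrow> (('x \<Rightarrow> complex) \<times> ('x \<Rightarrow> complex) \<times> ('x \<Rightarrow> complex)) list \<Rightarrow> bool" where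
  "represents_on_principal_open X A \<omega> b ts \<longleftrightarrow>
     b \<in> A \<and> set ts \<subseteq> A \<times> A \<times> A \<and>
     (\<forall>x\<in>smooth_locus X A. b x \<noteq> 0 \<longrightarrow>
        (\<forall>D\<in>tangent_space A x. \<forall>E\<in>tangent_space A x. \<omega> x D E = kaehler_form b ts x D E))"

text \<open>Forms live on the smooth locus; values at other points or on non-tangent arguments are
  irrelevant.\<close>

definition algebraic_2form :: "'x set \<Rightarrow> ('x \<Rightarrow> complex) set \<Rightarrow> 'x two_form \<Rightarrow> bool" where
  "algebraic_2form X A \<omega> \<longleftrightarrow>
     (\<forall>x\<in>smooth_locus X A. \<exists>b ts. b x \<noteq> 0 \<and> represents_on_principal_open X A \<omega> b ts)"

definition d_closed :: "'x set \<Rightarrow> ('x \<Rightarrow> complex) set \<Rightarrow> 'x two_form \<Rightarrow> bool" where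
  "d_closed X A \<omega> \<longleftrightarrow>
     (\<forall>b ts. represents_on_principal_open X A \<omega> b ts \<longrightarrow>
        (\<forall>x\<in>smooth_locus X A. b x \<noteq> 0 \<longrightarrow>
           (\<forall>D\<in>tangent_space A x. \<forall>E\<in>tangent_space A x. \<forall>F\<in>tangent_space A x.
              kaehler_d b ts x D E F = 0)))"

definition nondegenerate :: "'x set \<Rightarrow> ('x \<Rightarrow> complex) set \<Rightarrow> 'x two_form \<Rightarrow> bool" where
  "nondegenerate X A \<omega> \<longleftrightarrow>
     (\<forall>x\<in>smooth_locus X A. \<forall>D\<in>tangent_space A x.
        (\<forall>E\<in>tangent_space A x. \<omega> x D E = 0) \<longrightarrow> D = 0)"

definition symplectic_structure :: "'x set \<Rightarrow> ('x \<Rightarrow> complex) set \<Rightarrow> 'x two_form \<Rightarrow> bool" where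
  "symplectic_structure X A \<omega> \<longleftrightarrow>
     algebraic_2form X A \<omega> \<and> d_closed X A \<omega> \<and> nondegenerate X A \<omega>"

definition tangent_map ::
    "'x set \<Rightarrow> ('x \<Rightarrow> complex) set \<Rightarrow> ('x \<Rightarrow> 'x) \<Rightarrow> 'x tangent \<Rightarrow> 'x tangent" where
  "tangent_map X A u D = (\<lambda>f. if f \<in> A then D (pullback X u f) else 0)"

definition has_weight ::
    "'x set \<Rightarrow> ('x \<Rightarrow> complex) set \<Rightarrow> (complex \<Rightarrow> 'x \<Rightarrow> 'x) \<Rightarrow> 'x two_form \<Rightarrow> int \<Rightarrow> bool" where
  "has_weight X A \<phi> \<omega> l \<longleftrightarrow>
     (\<forall>t. t \<noteq> 0 \<longrightarrow>
        (\<forall>x\<in>smooth_locus X A. \<forall>D\<in>tangent_space A x. \<forall>E\<in>tangent_space A x.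
           \<omega> (\<phi> t x) (tangent_map X A (\<phi> t) D) (tangent_map X A (\<phi> t) E) = t powi l * \<omega> x D E))"

end

(* The minimal orbit is the cone E of extremal elements, [x,[x,y]] = -2 B(x,y) x, where B is a
multiple of the Killing form. Extremal elements exist by a leading-term argument that uses no
classification; they form one orbit, every other nilpotent orbit contains a family with one more
parameter than E has coordinates, and the closure of E is E with the origin.

Over E the normalisation is bijective, because its conductor is stable under the adjoint group.
Over the origin the grading of the coordinate ring yields dim g > dim E point derivations, so the
smooth locus lies over E, where the Kostant-Kirillov form B(z,[a,b]) of ([a,z],[b,z]) exists.

For uniqueness let Om be a form of weight 1. If g is not symplectic, the tangent space of E at e is
spanned by e, some [e,f] and the directions y of planes C e + C y in the closure of E. On such a
plane the function z |-> Om_z(e,y) is holomorphic off the origin and homogeneous of degree -1, so it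
vanishes. Hence Om_z(z,[a,z]) = -g(z) B(z,a) with g of degree 0, and g is constant by Liouville's
theorem along the curves exp (s ad f) e. Since Om is closed of weight 1, its contraction with the
Euler field determines it: Om is g times the Kostant-Kirillov form. *)
theory Submission
  imports Defs "HOL-Complex_Analysis.Complex_Analysis" "Jordan_Normal_Form.Char_Poly"
begin

no_notation vector_scalar_mult (infixl "*s" 70)

text \<open>The type \<open>'g\<close> carries no topology and comes without roots, and this shapes
  the proof. Limits and derivatives are tested on linear functionals along curves in one complex
  variable; the identity theorem, removable singularities and Liouville's theorem then take the
  place of dimension theory and properness. In place of roots stands one pair of extremal elements
  with B(e,f) = 1: the factor -2 makes e, [e,f], f an sl2-triple, and the extremal identities force
  a grading by -2, ..., 2 with lines at both ends. The hypothesis on sp enters once. If the cone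
  contains no plane through e in a direction of degree 1, then degree 0 acts on degree 1 by all of
  sp, and g is the full symplectic algebra of C + G 1 + C. Otherwise the plane directions span
  degree 1, since a set stable under degree 0 has an orthogonal consisting of plane directions, and
  no nonzero plane direction is orthogonal to all others. The normalisation is given only as a ring.
  Its points over E are algebra homomorphisms evaluated through the conductor; over the origin the
  dilation by 2 splits functions into homogeneous parts.\<close>

locale lie_alg = finite_dimensional_vector_space smul Basis + complex_lie_algebra smul br
 for smul :: "complex => 'g::ab_group_add => 'g" (infixr "*s" 75)
  and Basis :: "'g set"
  and br :: "'g => 'g => 'g"
begin

section \<open>Linear functionals, endomorphisms and the bracket\<close>

abbreviation lf :: "('g => complex) => bool" where "lf \<equiv> Vector_Spaces.linear smul (*)"
abbreviation le :: "('g => 'g) => bool" where "le \<equiv> Vector_Spaces.linear smul smul"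

lemma lf_iff: "lf l \<longleftrightarrow> (ALL x y. l (x + y) = l x + l y) & (ALL c x. l (c *s x) = c * l x)"
 unfolding Vector_Spaces.linear_iff using vector_space_axioms vector_space_over_itself.vector_space_axioms by auto

lemma le_iff: "le T \<longleftrightarrow> (ALL x y. T (x + y) = T x + T y) & (ALL c x. T (c *s x) = c *s T x)"
 unfolding Vector_Spaces.linear_iff using vector_space_axioms by auto

lemma lfI: "(!!x y. l (x + y) = l x + l y) ==> (!!c x. l (c *s x) = c * l x) ==> lf l" by (simp add: lf_iff)
lemma leI: "(!!x y. T (x + y) = T x + T y) ==> (!!c x. T (c *s x) = c *s T x) ==> le T" by (simp add: le_iff)

lemma lf_add: "lf l ==> l (x + y) = l x + l y" and lf_scale: "lf l ==> l (c *s x) = c * l x" by (simp_all add: lf_iff)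
lemma lf_0: "lf l ==> l 0 = 0" using lf_scale[of l 0 0] by simp
lemma lf_minus: "lf l ==> l (- x) = - l x" using lf_scale[of l "-1" x] by simp
lemma lf_diff: "lf l ==> l (x - y) = l x - l y" using lf_add[of l x "-y"] lf_minus by simp
lemma lf_sum: "lf l ==> l (sum f A) = (\<Sum>a\<in>A. l (f a))" by (induction A rule: infinite_finite_induct) (simp_all add: lf_0 lf_add)
lemmas lfs = lf_add lf_scale lf_0 lf_minus lf_diff

lemma le_add: "le T ==> T (x + y) = T x + T y" and le_scale: "le T ==> T (c *s x) = c *s T x" by (simp_all add: le_iff)
lemma le_0: "le T ==> T 0 = 0" using le_scale[of T 0 0] by simp
lemma le_minus: "le T ==> T (- x) = - T x" using le_scale[of T "-1" x] by simp
lemma le_diff: "le T ==> T (x - y) = T x - T y" using le_add[of T x "-y"] le_minus by simp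
lemma le_sum: "le T ==> T (sum f A) = (\<Sum>a\<in>A. T (f a))" by (induction A rule: infinite_finite_induct) (simp_all add: le_0 le_add)
lemmas les = le_add le_scale le_0 le_minus le_diff

lemma lf_comp: "lf l ==> le T ==> lf (%x. l (T x))" by (simp add: lf_iff le_iff)
lemma le_comp: "le S ==> le T ==> le (%x. S (T x))" by (simp add: le_iff)
lemma le_plus: "le S ==> le T ==> le (%x. S x + T x)" by (simp add: le_iff scale_right_distrib)
lemma le_id: "le (%x. x)" by (simp add: le_iff)
lemma le_pow: "le T ==> le (T ^^ n)"
proof (induction n)
 case 0 show ?case using le_id by simp
next
 case (Suc n) thus ?case using le_comp[of T "T ^^ n"] by auto
qed
lemma lf_plus: "lf l ==> lf m ==> lf (%x. l x + m x)" by (simp add: lf_iff algebra_simps)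
lemma lf_times: "lf l ==> lf (%x. c * l x)" by (simp add: lf_iff algebra_simps)

lemma le_br: "le (br x)" and le_br2: "le (%x. br x y)" using linear_right linear_left by auto
lemma br_add_r: "br x (y + z) = br x y + br x z" and br_scale_r: "br x (c *s y) = c *s br x y"
 and br_0_r: "br x 0 = 0" and br_minus_r: "br x (- y) = - br x y" and br_diff_r: "br x (y - z) = br x y - br x z"
 using les[OF le_br] by auto
lemma br_add_l: "br (y + z) x = br y x + br z x" and br_scale_l: "br (c *s y) x = c *s br y x"
 and br_0_l: "br 0 x = 0" and br_minus_l: "br (- y) x = - br y x" and br_diff_l: "br (y - z) x = br y x - br z x"
 using les[OF le_br2] by auto
lemmas brs = br_add_r br_scale_r br_0_r br_minus_r br_diff_r br_add_l br_scale_l br_0_l br_minus_l br_diff_l alternating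
lemma br_sum_r: "br x (sum f A) = (\<Sum>a\<in>A. br x (f a))" by (rule le_sum[OF le_br])
lemma br_sum_l: "br (sum f A) x = (\<Sum>a\<in>A. br (f a) x)" by (rule le_sum[OF le_br2])
lemma anti: "br y x = - br x y"
proof -
 have "br (x + y) (x + y) = 0" by (rule alternating)
 hence "br x y + br y x = 0" by (simp add: brs del: alternating) (simp add: alternating algebra_simps)
 thus ?thesis by (metis add_eq_0_iff)
qed
lemma leib: "br x (br y z) = br (br x y) z + br y (br x z)"
proof -
 have "br x (br y z) + br y (br z x) + br z (br x y) = 0" by (rule jacobi)
 moreover have "br y (br z x) = - br y (br x z)" by (subst anti) (simp add: brs)
 moreover have "br z (br x y) = - br (br x y) z" by (rule anti)
 ultimately show ?thesis by (simp add: algebra_simps)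
qed
lemma leib2: "br (br x y) z = br x (br y z) - br y (br x z)" by (simp add: leib[of x y z])

subsection \<open>Coordinates\<close>

definition co :: "'g => 'g => complex" where "co b v = representation Basis v b"
lemma lf_co: "lf (co b)" unfolding co_def using linear_representation[OF independent_Basis span_Basis] by simp
lemma co_sum: "(\<Sum>b\<in>Basis. co b v *s b) = v"
 unfolding co_def using sum_representation_eq[OF independent_Basis _ finite_Basis subset_refl, of v] span_Basis by auto
lemma co_Basis: "b : Basis ==> co c b = (if c = b then 1 else 0)"
 unfolding co_def using representation_basis[OF independent_Basis, of b] by auto
lemma co_lf: "lf l ==> l v = (\<Sum>b\<in>Basis. co b v * l b)" using lf_sum[of l "%b. co b v *s b" Basis] by (simp add: co_sum lfs)
lemma co_le: "le T ==> T v = (\<Sum>b\<in>Basis. co b v *s T b)" using le_sum[of T "%b. co b v *s b" Basis] by (simp add: co_sum les)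
lemma eqI_lf: "(!!l. lf l ==> l x = l y) ==> x = y" using co_sum[of x] co_sum[of y] lf_co by (metis (mono_tags, lifting) sum.cong)
lemma eq0I_lf: "(!!l. lf l ==> l x = 0) ==> x = 0" by (rule eqI_lf) (simp add: lf_0)
lemma lf_separate: "subspace W ==> x ~: W ==> EX l. lf l & (ALL w:W. l w = 0) & l x = 1"
proof -
 assume W: "subspace W" and x: "x ~: W"
 obtain C where C: "C \<subseteq> W" "independent C" "W = span C" using basis_subspace_exists[OF W] by metis
 have xC: "x ~: C" using x C by auto
 have ind: "independent (insert x C)" using independent_insertI[of x C] C x by auto
 interpret vp: vector_space_pair smul "(*) :: complex => complex => complex" by (unfold_locales)
 obtain l where l: "lf l" "ALL b:insert x C. l b = (if b = x then 1 else 0)"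
  using vp.linear_independent_extend[OF ind, of "%b. if b = x then 1 else 0"] by blast
 have z: "ALL b:C. l b = 0" using l(2) xC by auto
 have "l w = 0" if "w : span C" for w using that
 proof (induction rule: span_induct_alt)
  case base thus ?case using l(1) by (rule lf_0)
 next
  case (step c b y) thus ?case using z l(1) by (simp add: lfs)
 qed
 thus ?thesis using l C by auto
qed
lemma lf_bilin_expand: "lf l ==> l (br u v) = (\<Sum>b\<in>Basis. \<Sum>c\<in>Basis. co b u * co c v * l (br b c))"
proof -
 assume l: "lf l"
 have "l (br u v) = (\<Sum>b\<in>Basis. co b u * l (br b v))" by (rule co_lf[OF lf_comp[OF l le_br2]])
 also have "\<dots> = (\<Sum>b\<in>Basis. co b u * (\<Sum>c\<in>Basis. co c v * l (br b c)))"
  by (rule sum.cong[OF refl], subst co_lf[OF lf_comp[OF l le_br]]) simp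
 finally show ?thesis by (simp add: sum_distrib_left mult.assoc)
qed

subsection \<open>Vector-valued curves\<close>

text \<open>\<open>'g\<close> has no topology, so curves are differentiated through all linear
  functionals; \<open>vhol\<close> treats holomorphy in the same way.\<close>

definition vder :: "(complex => 'g) => 'g => complex => bool" where
 "vder ga v t \<longleftrightarrow> (ALL l. lf l --> ((%s. l (ga s)) has_field_derivative l v) (at t))"
definition vhol :: "(complex => 'g) => complex set => bool" where
 "vhol ga U \<longleftrightarrow> (ALL l. lf l --> (%s. l (ga s)) holomorphic_on U)"

lemma vder_const: "vder (%_. c) 0 t" unfolding vder_def by (simp add: lf_0)
lemma vder_add: "vder ga v t ==> vder dl w t ==> vder (%s. ga s + dl s) (v + w) t" unfolding vder_def by (auto simp: lfs intro!: DERIV_add)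
lemma vder_scale: "(f has_field_derivative d) (at t) ==> vder ga v t ==> vder (%s. f s *s ga s) (d *s ga t + f t *s v) t"
 unfolding vder_def by (auto simp: lfs intro!: derivative_eq_intros)
lemma vder_line: "vder (%s. x + s *s y) y t" unfolding vder_def by (auto simp: lfs intro!: derivative_eq_intros)
lemma vder_br: assumes "vder ga v t" "vder dl w t"
 shows "vder (%s. br (ga s) (dl s)) (br v (dl t) + br (ga t) w) t" unfolding vder_def
proof (intro allI impI)
 fix l assume l: "lf l"
 have *: "((%s. co b (ga s) * co c (dl s) * l (br b c)) has_field_derivative
  co b v * co c (dl t) * l (br b c) + co b (ga t) * co c w * l (br b c)) (at t)" for b c
  using assms[unfolded vder_def, rule_format, OF lf_co] by (auto intro!: derivative_eq_intros simp: algebra_simps)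
 have "((%s. \<Sum>b\<in>Basis. \<Sum>c\<in>Basis. co b (ga s) * co c (dl s) * l (br b c)) has_field_derivative
  (\<Sum>b\<in>Basis. \<Sum>c\<in>Basis. co b v * co c (dl t) * l (br b c) + co b (ga t) * co c w * l (br b c))) (at t)"
  by (intro DERIV_sum *)
 thus "((%s. l (br (ga s) (dl s))) has_field_derivative l (br v (dl t) + br (ga t) w)) (at t)"
  unfolding lf_bilin_expand[OF l, of "ga _" "dl _"] lf_add[OF l]
   lf_bilin_expand[OF l, of v "dl t"] lf_bilin_expand[OF l, of "ga t" w] by (simp add: sum.distrib)
qed
lemma vder_vhol: "(!!t. EX v. vder ga v t) ==> vhol ga U" unfolding vhol_def vder_def
 by (meson field_differentiable_def field_differentiable_at_within holomorphic_on_def)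
lemma vhol_const: "vhol (%_. c) U" unfolding vhol_def by auto
lemma vhol_add: "vhol ga U ==> vhol dl U ==> vhol (%s. ga s + dl s) U" unfolding vhol_def by (auto simp: lfs intro!: holomorphic_intros)
lemma vhol_scale: "f holomorphic_on U ==> vhol ga U ==> vhol (%s. f s *s ga s) U"
 unfolding vhol_def by (auto simp: lfs intro!: holomorphic_intros)
lemma vhol_sum: "(!!i. i : I ==> vhol (ga i) U) ==> vhol (%s. \<Sum>i\<in>I. ga i s) U"
 by (induction I rule: infinite_finite_induct) (auto intro: vhol_const vhol_add)
lemma vhol_le: "le T ==> vhol ga U ==> vhol (%s. T (ga s)) U" unfolding vhol_def using lf_comp by blast
lemma vhol_br: assumes "vhol ga U" "vhol dl U" shows "vhol (%s. br (ga s) (dl s)) U" unfolding vhol_def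
proof (intro allI impI)
 fix l assume l: "lf l"
 show "(%s. l (br (ga s) (dl s))) holomorphic_on U" unfolding lf_bilin_expand[OF l, of "ga _" "dl _"]
  using assms[unfolded vhol_def, rule_format, OF lf_co] by (intro holomorphic_intros)
qed
lemmas vhol_intros = vhol_const vhol_add vhol_scale vhol_sum vhol_br

text \<open>By continuity at 0. This is how the degenerations below are performed: an identity
  between curves is checked for s ~= 0 and then read off at s = 0.\<close>

lemma hol_eq_at_0:
 fixes f g :: "complex => complex"
 assumes "f holomorphic_on UNIV" "g holomorphic_on UNIV" "!!s. s ~= 0 ==> f s = g s"
 shows "f 0 = g 0"
proof -
 have c: "isCont f 0" "isCont g 0" using assms holomorphic_on_imp_continuous_on continuous_on_eq_continuous_at open_UNIV by blast+
 have "((%s. f s - g s) \<longlongrightarrow> f 0 - g 0) (at 0)" using c by (intro tendsto_diff) (auto simp: isCont_def)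
 moreover have "((%s. f s - g s) \<longlongrightarrow> 0) (at 0)"
  using assms(3) by (intro tendsto_eventually) (simp add: eventually_at_filter)
 ultimately show ?thesis using tendsto_unique[of "at (0::complex)"] by (metis at_neq_bot eq_iff_diff_eq_0)
qed
lemma vhol_eq_at_0: "vhol ga UNIV ==> vhol dl UNIV ==> (!!s. s ~= 0 ==> ga s = dl s) ==> ga 0 = dl 0"
 by (rule eqI_lf) (auto simp: vhol_def intro: hol_eq_at_0[of "%s. _ (ga s)" "%s. _ (dl s)"])

subsection \<open>Exponentials of endomorphisms\<close>

definition nrm :: "'g => real" where "nrm v = (\<Sum>b\<in>Basis. cmod (co b v))"
lemma lf_bound: "lf l ==> EX K>=0. ALL v. cmod (l v) \<le> K * nrm v"
proof -
 assume l: "lf l"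
 let ?K = "\<Sum>b\<in>Basis. cmod (l b)"
 have "cmod (l v) \<le> ?K * nrm v" for v
 proof -
  have "cmod (l v) \<le> (\<Sum>b\<in>Basis. cmod (co b v) * cmod (l b))"
   by (subst co_lf[OF l]) (metis (no_types, lifting) norm_mult norm_sum sum.cong)
  also have "\<dots> \<le> (\<Sum>b\<in>Basis. cmod (co b v) * ?K)"
   by (intro sum_mono mult_left_mono member_le_sum) (auto simp: finite_Basis)
  also have "\<dots> = nrm v * ?K" unfolding nrm_def by (rule sum_distrib_right[symmetric])
  finally show ?thesis by (simp add: mult.commute)
 qed
 thus ?thesis by (intro exI[of _ ?K]) (auto intro: sum_nonneg)
qed
lemma le_bound: "le T ==> EX M>=0. ALL v. nrm (T v) \<le> M * nrm v"
proof -
 assume T: "le T"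
 have "EX K>=0. ALL v. cmod (co b (T v)) \<le> K * nrm v" for b by (rule lf_bound[OF lf_comp[OF lf_co T]])
 then obtain K where K: "!!b. K b \<ge> 0" "!!b v. cmod (co b (T v)) \<le> K b * nrm v" by metis
 have "nrm (T v) \<le> (\<Sum>b\<in>Basis. K b) * nrm v" for v unfolding nrm_def[of "T v"] sum_distrib_right by (intro sum_mono K)
 thus ?thesis using K(1) by (intro exI[of _ "\<Sum>b\<in>Basis. K b"]) (auto intro: sum_nonneg)
qed

lemma summable_exp: "le T ==> lf l ==> summable (%k. l ((T ^^ k) y) / fact k)"
proof -
 assume T: "le T" and l: "lf l"
 obtain M where M: "M \<ge> 0" "!!v. nrm (T v) \<le> M * nrm v" using le_bound[OF T] by auto
 obtain K where K: "K \<ge> 0" "!!v. cmod (l v) \<le> K * nrm v" using lf_bound[OF l] by auto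
 have p: "nrm ((T ^^ k) y) \<le> M ^ k * nrm y" for k
 proof (induction k)
  case (Suc k)
  have "nrm ((T ^^ Suc k) y) \<le> M * nrm ((T ^^ k) y)" using M(2) by simp
  also have "\<dots> \<le> M * (M ^ k * nrm y)" using Suc M(1) by (intro mult_left_mono)
  finally show ?case by simp
 qed simp
 have "cmod (l ((T ^^ k) y) / fact k) \<le> K * nrm y * (M ^ k /\<^sub>R fact k)" for k
 proof -
  have "cmod (l ((T ^^ k) y)) \<le> K * (M ^ k * nrm y)" using K(2) p K(1) by (meson mult_left_mono order_trans)
  hence "cmod (l ((T ^^ k) y)) / fact k \<le> K * (M ^ k * nrm y) / fact k" by (rule divide_right_mono) simp
  thus ?thesis by (simp add: norm_divide divide_simps ac_simps)
 qed
 thus ?thesis by (rule summable_comparison_test'[OF summable_mult[OF summable_exp_generic], rotated])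
qed

text \<open>The candidate for the definite description in \<open>exp_endo\<close> is assembled from
  the coordinate series; functionals separate points, so it is the only one.\<close>

lemma exp_endo_sums: assumes T: "le T" and l: "lf l"
 shows "(%k. l ((T ^^ k) y) / fact k) sums l (exp_endo smul T y)"
proof -
 let ?P = "%z. ALL l. lf l --> (%k. l ((T ^^ k) y) / fact k) sums l z"
 define z where "z = (\<Sum>b\<in>Basis. (\<Sum>k. co b ((T ^^ k) y) / fact k) *s b)"
 have 1: "?P z"
 proof (intro allI impI)
  fix l assume l: "lf l"
  have "(%k. \<Sum>b\<in>Basis. (co b ((T ^^ k) y) / fact k) * l b) sums (\<Sum>b\<in>Basis. (\<Sum>k. co b ((T ^^ k) y) / fact k) * l b)"
   by (intro sums_sum sums_mult2 summable_sums summable_exp[OF T lf_co])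
  thus "(%k. l ((T ^^ k) y) / fact k) sums l z" unfolding z_def lf_sum[OF l] lf_scale[OF l] co_lf[OF l, of "(T ^^ _) y"]
   by (simp add: sum_divide_distrib)
 qed
 have 2: "z' = z" if "?P z'" for z' by (rule eqI_lf) (use that 1 sums_unique2 in blast)
 have "?P (exp_endo smul T y)" unfolding exp_endo_def using 1 2 by (rule theI)
 thus ?thesis using l by blast
qed

lemma exp_endo_eqI: assumes T: "le T" and "!!l. lf l ==> (%k. l ((T ^^ k) y) / fact k) sums l z"
 shows "exp_endo smul T y = z"
proof (rule eqI_lf)
 fix l assume l: "lf l"
 show "l (exp_endo smul T y) = l z" by (rule sums_unique2[OF exp_endo_sums[OF T l] assms(2)[OF l]])
qed

lemma exp_endo_nilp: assumes T: "le T" and n: "(T ^^ n) y = 0"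
 shows "exp_endo smul T y = (\<Sum>k<n. (1 / fact k) *s (T ^^ k) y)"
proof (rule exp_endo_eqI[OF T])
 fix l assume l: "lf l"
 have z: "(T ^^ k) y = 0" if "k \<ge> n" for k
 proof -
  have "(T ^^ k) y = (T ^^ (k - n)) ((T ^^ n) y)" using that by (metis comp_apply funpow_add le_add_diff_inverse2)
  thus ?thesis using n le_0[OF le_pow[OF T]] by simp
 qed
 have "(%k. l ((T ^^ k) y) / fact k) sums (\<Sum>k<n. l ((T ^^ k) y) / fact k)" by (rule sums_finite) (auto simp: z lf_0[OF l])
 thus "(%k. l ((T ^^ k) y) / fact k) sums l (\<Sum>k<n. (1 / fact k) *s (T ^^ k) y)" by (simp add: lf_sum[OF l] lf_scale[OF l])
qed

definition ex :: "'g => complex => 'g => 'g" where "ex a t = exp_endo smul (br (t *s a))"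

lemma br_scale_pow: "((br (t *s a)) ^^ k) y = t ^ k *s ((br a) ^^ k) y" by (induction k) (simp_all add: brs)

lemma ex_sums: assumes l: "lf l" shows "(%k. l ((br a ^^ k) y) / fact k * t ^ k) sums l (ex a t y)"
 using exp_endo_sums[OF le_br l, of "t *s a" y] unfolding ex_def br_scale_pow lf_scale[OF l] by (simp add: mult.commute)

lemma ex_commute: "br a (ex a t y) = ex a t (br a y)"
proof (rule eqI_lf)
 fix l assume l: "lf l"
 have "(%k. l (br a ((br a ^^ k) y)) / fact k * t ^ k) sums l (br a (ex a t y))" by (rule ex_sums[OF lf_comp[OF l le_br]])
 moreover have "(%k. l ((br a ^^ k) (br a y)) / fact k * t ^ k) sums l (ex a t (br a y))" by (rule ex_sums[OF l])
 ultimately show "l (br a (ex a t y)) = l (ex a t (br a y))" by (simp add: funpow_swap1 sums_unique2)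
qed

lemma ex_vder: "vder (%t. ex a t y) (br a (ex a t y)) t" unfolding vder_def
proof (intro allI impI)
 fix l assume l: "lf l"
 let ?c = "%k. l ((br a ^^ k) y) / fact k"
 have s: "summable (%k. ?c k * z ^ k)" for z using ex_sums[OF l] sums_summable by blast
 have d: "((%z. \<Sum>k. ?c k * z ^ k) has_field_derivative (\<Sum>k. diffs ?c k * t ^ k)) (at t)"
  by (rule termdiffs_strong_converges_everywhere[OF s])
 have "(%k. l ((br a ^^ k) (br a y)) / fact k * t ^ k) sums l (ex a t (br a y))" by (rule ex_sums[OF l])
 moreover have "diffs ?c k = l ((br a ^^ k) (br a y)) / fact k" for k
 proof -
  have "of_nat (Suc k) * (x / fact (Suc k)) = x / (fact k :: complex)" for x by (simp add: fact_Suc del: of_nat_Suc)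
  thus ?thesis unfolding diffs_def funpow_Suc_right comp_def .
 qed
 ultimately have e: "(\<Sum>k. diffs ?c k * t ^ k) = l (br a (ex a t y))" by (simp add: sums_iff ex_commute)
 show "((%s. l (ex a s y)) has_field_derivative l (br a (ex a t y))) (at t)"
  using d unfolding e using ex_sums[OF l, of a y] by (simp add: sums_iff)
qed

lemma ex_0: "ex a 0 y = y" unfolding ex_def by (subst exp_endo_nilp[OF le_br, of 1]) (simp_all add: brs)
lemma le_ex: "le (ex a t)"
proof (rule leI)
 fix x y
 show "ex a t (x + y) = ex a t x + ex a t y"
 proof (rule eqI_lf)
  fix l assume l: "lf l"
  have "(%k. l ((br a ^^ k) x) / fact k * t ^ k + l ((br a ^^ k) y) / fact k * t ^ k) sums (l (ex a t x) + l (ex a t y))"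
   by (intro sums_add ex_sums[OF l])
  moreover have "l ((br a ^^ k) (x + y)) / fact k * t ^ k = l ((br a ^^ k) x) / fact k * t ^ k + l ((br a ^^ k) y) / fact k * t ^ k" for k
   by (simp add: le_add[OF le_pow[OF le_br]] lf_add[OF l] field_simps)
  ultimately show "l (ex a t (x + y)) = l (ex a t x + ex a t y)"
   using ex_sums[OF l, of a "x + y" t] by (simp add: lf_add[OF l] sums_unique2)
 qed
next
 fix c x
 show "ex a t (c *s x) = c *s ex a t x"
 proof (rule eqI_lf)
  fix l assume l: "lf l"
  have "(%k. c * (l ((br a ^^ k) x) / fact k * t ^ k)) sums (c * l (ex a t x))" by (intro sums_mult ex_sums[OF l])
  thus "l (ex a t (c *s x)) = l (c *s ex a t x)"
   using ex_sums[OF l, of a "c *s x" t] by (simp add: lf_scale[OF l] le_scale[OF le_pow[OF le_br]] sums_unique2 mult.assoc)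
 qed
qed

text \<open>All iterated derivatives of a functional along ga are given by powers of ad a, so the
  Taylor series at 0 is the exponential series. Multiplicativity and the group law of
  \<open>ex\<close> follow by checking that both sides solve the same equation.\<close>

lemma ode_unique:
 assumes "!!t. vder ga (br a (ga t)) t"
 shows "ga t = ex a t (ga 0)"
proof (rule eqI_lf)
 fix l assume l: "lf l"
 have d: "((%s. l ((br a ^^ k) (ga s))) has_field_derivative l ((br a ^^ Suc k) (ga s))) (at s)" for k s
  using assms[of s, unfolded vder_def, rule_format, OF lf_comp[OF l le_pow[OF le_br]], of k a] by (simp add: funpow_swap1)
 have dd: "(deriv ^^ k) (%s. l (ga s)) = (%s. l ((br a ^^ k) (ga s)))" for k
 proof (induction k)
  case (Suc k)
  have "(deriv ^^ Suc k) (%s. l (ga s)) = deriv (%s. l ((br a ^^ k) (ga s)))" using Suc by simp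
  also have "\<dots> = (%s. l ((br a ^^ Suc k) (ga s)))" using d DERIV_imp_deriv by blast
  finally show ?case .
 qed simp
 have h: "(%s. l (ga s)) holomorphic_on ball 0 (cmod t + 1)"
  using d[of 0] by (auto simp: holomorphic_on_def field_differentiable_def intro: has_field_derivative_at_within)
 have "(%k. (deriv ^^ k) (%s. l (ga s)) 0 / fact k * (t - 0) ^ k) sums l (ga t)" by (rule holomorphic_power_series[OF h]) simp
 thus "l (ga t) = l (ex a t (ga 0))" unfolding dd using ex_sums[OF l, of a "ga 0" t] by (simp add: sums_unique2)
qed

lemma ex_hom: "ex a t (br y z) = br (ex a t y) (ex a t z)"
proof -
 have "vder (%t. br (ex a t y) (ex a t z)) (br a (br (ex a t y) (ex a t z))) t" for t by (subst leib) (intro vder_br ex_vder)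
 from ode_unique[OF this, of t] show ?thesis by (simp add: ex_0)
qed
lemma ex_add: "ex a s (ex a t y) = ex a (s + t) y"
proof -
 have "vder (%s. ex a (s + t) y) (br a (ex a (s + t) y)) s" for s unfolding vder_def
 proof (intro allI impI)
  fix l assume l: "lf l"
  have "((%t. l (ex a t y)) has_field_derivative l (br a (ex a (s + t) y))) (at (s + t))" using ex_vder l unfolding vder_def by blast
  thus "((%s. l (ex a (s + t) y)) has_field_derivative l (br a (ex a (s + t) y))) (at s)" by (rule DERIV_shift[THEN iffD1])
 qed
 from ode_unique[OF this, of s] show ?thesis by simp
qed
lemma ex_inv: "ex a t (ex a (- t) y) = y" "ex a (- t) (ex a t y) = y" by (simp_all add: ex_add ex_0)
lemma ex_minus: "ex (- a) t = ex a (- t)" by (simp add: ex_def)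
lemma ex_vhol: "vhol (%t. ex a t y) U" using ex_vder by (intro vder_vhol) blast
lemma ex_scaleD: "ex (c *s a) t = ex a (t * c)" by (simp add: ex_def)
lemma ex_eigen: assumes "br a y = c *s y" shows "ex a t y = exp (t * c) *s y"
proof -
 have "vder (%t. exp (t * c) *s y) ((exp (t * c) * c) *s y) t" for t unfolding vder_def by (auto simp: lfs intro!: derivative_eq_intros)
 hence "vder (%t. exp (t * c) *s y) (br a (exp (t * c) *s y)) t" for t using assms by (simp add: brs)
 from ode_unique[OF this, of t] show ?thesis by simp
qed
lemma ex_nilp: "((br a) ^^ n) y = 0 ==> ex a t y = (\<Sum>k<n. (t ^ k / fact k) *s ((br a) ^^ k) y)"
 unfolding ex_def by (subst exp_endo_nilp[OF le_br, of n]) (auto simp: br_scale_pow)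

subsection \<open>The adjoint group\<close>

abbreviation "Gr \<equiv> adjoint_group smul br"

lemma exp_endo_ex: "exp_endo smul (br x) = ex x 1" by (simp add: ex_def)
lemma ex_Gr: "ex a t : Gr" using adjoint_group.exp_ad[OF adjoint_group.one, of smul br "t *s a"] by (simp add: ex_def)
lemma Gr_le: "u : Gr ==> le u"
 by (induction rule: adjoint_group.induct) (auto simp: exp_endo_ex o_def id_def intro: le_comp[OF le_ex] le_id)
lemma Gr_comp: "u : Gr ==> v : Gr ==> u \<circ> v : Gr"
 by (induction rule: adjoint_group.induct) (auto simp: comp_assoc intro: adjoint_group.exp_ad)
lemma Gr_inv: "u : Gr ==> EX v:Gr. ALL x. u (v x) = x & v (u x) = x"
proof (induction rule: adjoint_group.induct)
 case one thus ?case using adjoint_group.one by (intro bexI[of _ id]) auto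
next
 case (exp_ad u x)
 then obtain v where v: "v : Gr" "!!x. u (v x) = x & v (u x) = x" by auto
 show ?case by (rule bexI[of _ "v \<circ> ex x (-1)"]) (auto simp: exp_endo_ex v ex_inv intro: Gr_comp[OF v(1) ex_Gr])
qed
text \<open>Multiply every exponent in a word of exponentials by t. Entire paths inside the group
  let the identity theorem and Liouville's theorem be applied on whole orbits.\<close>

lemma Gr_path: "u : Gr ==> EX U. (ALL x. U 0 x = x) & (ALL x. U 1 x = u x) & (ALL t. U t : Gr) & (ALL x. vhol (%t. U t x) UNIV)"
proof (induction rule: adjoint_group.induct)
 case one
 have "id : Gr" by (rule adjoint_group.one)
 thus ?case using vhol_const by (intro exI[of _ "%t. id"]) (simp add: id_def)
next
 case (exp_ad u a)
 then obtain U where U: "!!x. U 0 x = x" "!!x. U 1 x = u x" "!!t. U t : Gr" "!!x. vhol (%t. U t x) UNIV" by blast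
 have "vhol (%t. ex a t (U t x)) UNIV" for x unfolding co_le[OF le_ex, of a _ "U _ x"]
  using U(4)[unfolded vhol_def, rule_format, OF lf_co] by (intro vhol_sum vhol_scale ex_vhol)
 thus ?case using U Gr_comp[OF ex_Gr U(3)] by (intro exI[of _ "%t. ex a t \<circ> U t"]) (simp add: ex_0 exp_endo_ex o_def)
qed

text \<open>Otherwise a functional that vanishes on W and is 1 at [a,w] would have derivative 1
  along a curve on which it is constantly 0.\<close>

lemma stable_derivative:
 assumes W: "subspace W" and st: "!!t. ex a t w : W" shows "br a w : W"
proof (rule ccontr)
 assume "br a w ~: W"
 then obtain l where l: "lf l" "!!w. w : W ==> l w = 0" "l (br a w) = 1" using lf_separate[OF W] by blast
 have "((%t. l (ex a t w)) has_field_derivative l (br a (ex a 0 w))) (at 0)" using ex_vder l(1) unfolding vder_def by blast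
 hence "((%t. 0) has_field_derivative 1) (at (0::complex))" using st l by (simp add: ex_0)
 hence "(1::complex) = 0" by (rule DERIV_unique) (rule DERIV_const)
 thus False by simp
qed

end

locale simple_lie = lie_alg smul Basis br + simple_complex_lie_algebra smul br
 for smul :: "complex => 'g::ab_group_add => 'g" (infixr "*s" 75)
  and Basis :: "'g set"
  and br :: "'g => 'g => 'g"
begin

lemma ideal_UNIV: "subspace I ==> (!!x y. y : I ==> br x y : I) ==> z : I ==> z ~= 0 ==> I = UNIV"
 using simple[of I] by (auto simp: lie_ideal_def)

text \<open>Infinitesimal invariance turns the span of an exponentially stable set into an ideal.
  Applied to sandwich elements, to extremal elements and to whole orbits.\<close>

lemma orbit_spans:
 assumes "x ~= 0" "x : S" "!!y a t. y : S ==> ex a t y : S"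
 shows "span S = UNIV"
proof (rule ideal_UNIV[of _ x])
 show "subspace (span S)" by simp
 show "x : span S" using assms span_base by auto
 fix a y assume "y : span S"
 thus "br a y : span S"
 proof (induction rule: span_induct_alt)
  case (step c b y)
  have "br a b : span S" by (rule stable_derivative) (auto intro: span_base assms step)
  thus ?case using step by (simp add: brs span_add span_scale)
 qed (simp add: brs span_zero)
qed fact

lemma centre_trivial: assumes "!!x. br x z = 0" shows "z = 0"
proof (rule ccontr)
 assume "z ~= 0"
 have "{z. ALL x. br x z = 0} = UNIV"
  by (rule ideal_UNIV[of _ z]) (use \<open>z ~= 0\<close> assms in \<open>auto simp: subspace_def brs\<close>)
 hence "!!x y. br x y = 0" by auto
 thus False using nonabelian by simp
qed

end

section \<open>Polynomials in an endomorphism and eigenvectors\<close>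

locale complex_fdvs = finite_dimensional_vector_space smul Basis
 for smul :: "complex => 'b::ab_group_add => 'b" (infixr "*s" 75) and Basis :: "'b set"
begin

definition pa :: "('b => 'b) => complex poly => 'b => 'b" where
 "pa T p v = fold_coeffs (%a r. a *s v + T r) p 0"

context fixes T assumes T: "Vector_Spaces.linear smul smul T" begin

lemma T_rules: "T (x + y) = T x + T y" "T (c *s x) = c *s T x" "T 0 = 0"
proof -
 interpret t: Vector_Spaces.linear smul smul T by (rule T)
 show "T (x + y) = T x + T y" "T (c *s x) = c *s T x" "T 0 = 0" by (simp_all add: t.add t.scale)
qed
lemma pa_0: "pa T 0 v = 0" by (simp add: pa_def)
lemma pa_pCons: "pa T (pCons a p) v = a *s v + T (pa T p v)" by (cases "p = 0 & a = 0") (auto simp: pa_def T_rules)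
lemma pa_add: "pa T (p + q) v = pa T p v + pa T q v"
 by (induction p q rule: poly_induct2) (simp_all add: pa_0 pa_pCons T_rules scale_left_distrib)
lemma pa_smult: "pa T (Polynomial.smult c p) v = c *s pa T p v" by (induction p) (simp_all add: pa_0 pa_pCons T_rules scale_right_distrib)
lemma pa_monom: "pa T (monom c n) v = c *s (T ^^ n) v"
proof (induction n)
 case 0 show ?case by (simp add: monom_0 pa_pCons pa_0 T_rules)
next
 case (Suc n) thus ?case by (simp add: monom_Suc pa_pCons T_rules)
qed
lemma pa_sum: "pa T (sum f I) v = (\<Sum>i\<in>I. pa T (f i) v)" by (induction I rule: infinite_finite_induct) (simp_all add: pa_0 pa_add)

text \<open>The iterates T^0 v, ..., T^d v with d the dimension are too many to be independent. A
  repeated iterate is treated apart, since dependence concerns the set of iterates and not the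
  family.\<close>

lemma annihilating_poly: "EX p. p ~= 0 & pa T p v = 0"
proof (cases "inj_on (%i. (T ^^ i) v) {..card Basis}")
 case False
 then obtain i j where ij: "i ~= j" "(T ^^ i) v = (T ^^ j) v" by (auto simp: inj_on_def)
 have "monom 1 i + monom (-1) j ~= (0 :: complex poly)"
 proof
  assume "monom 1 i + monom (-1) j = (0 :: complex poly)"
  hence "coeff (monom 1 i + monom (-1) j) i = (0::complex)" by simp
  thus False using ij(1) by simp
 qed
 moreover have "pa T (monom 1 i + monom (-1) j) v = 0" by (simp add: pa_add pa_monom ij)
 ultimately show ?thesis by blast
next
 case True
 let ?S = "(%i. (T ^^ i) v) ` {..card Basis}"
 have "card ?S = Suc (card Basis)" using True by (simp add: card_image)
 hence "dependent ?S" using independent_card_le_dim[of ?S UNIV] by fastforce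
 then obtain u where u: "EX x:?S. u x ~= 0" "(\<Sum>x\<in>?S. u x *s x) = 0"
  unfolding dependent_finite[OF finite_imageI[OF finite_atMost]] by blast
 then obtain i where i: "i \<le> card Basis" "u ((T ^^ i) v) ~= 0" by auto
 let ?p = "\<Sum>i\<le>card Basis. monom (u ((T ^^ i) v)) i"
 have "coeff ?p i = u ((T ^^ i) v)" using i(1) by (simp add: coeff_sum)
 hence "?p ~= 0" using i(2) by auto
 moreover have "pa T ?p v = 0" using u(2) sum.reindex[OF True, of "%x. u x *s x"] by (simp add: pa_sum pa_monom)
 ultimately show ?thesis by blast
qed

text \<open>Split a root c off an annihilating polynomial: either the cofactor q already annihilates
  v and has smaller degree, or q(T) v is an eigenvector, and it lies in W because W is
  stable.\<close>

lemma eigenvector_exists: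
 assumes W: "subspace W" "!!x. x : W ==> T x : W" and v: "v : W" "v ~= 0"
 shows "EX c x. x : W & x ~= 0 & T x = c *s x"
proof -
 have paW: "pa T p v : W" for p by (induction p) (auto simp: pa_0 pa_pCons W v subspace_add subspace_scale subspace_0)
 have *: "EX c x. x : W & x ~= 0 & T x = c *s x" if "p ~= 0" "pa T p v = 0" for p using that
 proof (induction "degree p" arbitrary: p)
  case 0
  then obtain c where "p = [:c:]" using degree_eq_zeroE by metis
  thus ?case using 0 v by (simp add: pa_pCons pa_0 T_rules)
 next
  case (Suc n)
  have "\<not> constant (poly p)" using Suc(2) by (simp add: constant_degree)
  then obtain c where "poly p c = 0" using fundamental_theorem_of_algebra by blast
  then obtain q where q: "p = [:-c, 1:] * q" using poly_eq_0_iff_dvd dvdE by metis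
  have e: "pa T p v = T (pa T q v) + (- c) *s pa T q v"
  proof -
   have "p = pCons 0 q + Polynomial.smult (- c) q" unfolding q by simp
   thus ?thesis by (simp only: pa_add pa_smult pa_pCons T_rules) simp
  qed
  show ?case
  proof (cases "pa T q v = 0")
   case True
   have "q ~= 0" using q Suc(3) by auto
   hence "degree q = n" using Suc(2) degree_mult_eq[of "[:-c,1:]" q] unfolding q by simp
   thus ?thesis using Suc(1)[of q] True \<open>q ~= 0\<close> by blast
  next
   case False
   thus ?thesis using e Suc(4) paW[of q] by auto
  qed
 qed
 show ?thesis using annihilating_poly * by blast
qed

end
end

context simple_lie begin

sublocale cv: complex_fdvs smul Basis by unfold_locales

lemma double_0: "x + x = 0 ==> x = (0::'g)"
proof -
 assume "x + x = 0"
 moreover have "x + x = 2 *s x" using scale_left_distrib[of 1 1 x] by simp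
 ultimately show ?thesis by simp
qed

subsection \<open>Absence of sandwich elements\<close>

definition sandwich :: "'g => bool" where "sandwich x \<longleftrightarrow> (ALL y. br x (br x y) = 0)"

lemma sandwichD: "sandwich x ==> br x (br x y) = 0" by (simp add: sandwich_def)
text \<open>Expand ad [x,[x,y]] = 0: the outer terms contain ad(x)^2 and drop out, the middle one
  occurs twice.\<close>

lemma sandwich_mid: assumes x: "sandwich x" shows "br x (br y (br x z)) = 0"
proof -
 have "br (br x (br x y)) z = - (br x (br y (br x z)) + br x (br y (br x z)))"
  by (simp add: leib2[of x "br x y"]) (simp add: leib2[of x y] brs sandwichD[OF x])
 moreover have "br (br x (br x y)) z = 0" by (simp add: sandwichD[OF x] brs)
 ultimately have "br x (br y (br x z)) + br x (br y (br x z)) = 0" by (metis neg_equal_0_iff_equal)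
 thus ?thesis by (rule double_0)
qed
lemma sandwich_br: assumes x: "sandwich x" and y: "sandwich y" shows "sandwich (br x y)" unfolding sandwich_def leib2
 by (simp add: brs sandwichD[OF x] sandwichD[OF y] sandwich_mid[OF x])
lemma sandwich_ex: assumes x: "sandwich x" shows "sandwich (ex a t x)" unfolding sandwich_def
 by (metis ex_hom ex_inv sandwichD x le_0 le_ex)

text \<open>Jacobson's theorem on weakly closed sets: a bracket-closed set of nilpotent elements acts
 nilpotently on every subquotient.\<close>

lemma jacobson:
 assumes "ALL x:Q. sandwich x" "0 : Q" "ALL x:Q. ALL y:Q. br x y : Q"
  and "subspace U" "subspace W" "W \<subseteq> U" "W ~= U"
  and "ALL x:Q. ALL u:U. br x u : U" "ALL x:Q. ALL w:W. br x w : W"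
 shows "EX u:U - W. ALL x:Q. br x u : W" using assms
proof (induction "dim Q" arbitrary: Q U W rule: less_induct)
 case (less Q U W)
 note Q = less.prems(1-3) and U = less.prems(4) and W = less.prems(5) and UW = less.prems(6,7) and st = less.prems(8,9)
 show ?case
 proof (cases "Q \<subseteq> {0}")
  case True
  obtain u where "u : U" "u ~: W" using UW by auto
  moreover have "br x u : W" if "x : Q" for x using that True W by (auto simp: brs subspace_0)
  ultimately show ?thesis by auto
 next
  case False
  \<comment> \<open>R will be a bracket-closed subset of Q of the largest dimension below
    \<open>dim Q\<close>. The induction hypothesis applies to R acting on any stable subspace,
    including \<open>span Q\<close> itself.\<close>
  let ?P = "%R. R \<subseteq> Q & 0 : R & (ALL x:R. ALL y:R. br x y : R) & dim R < dim Q"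
  obtain q0 where q0: "q0 : Q" "q0 ~= 0" using False by auto
  have "dim {q0} \<le> dim Q" using q0 by (intro dim_subset) auto
  hence P0: "?P {0}" using Q(2) q0 by (simp add: brs)
  have "ALL R. ?P R --> dim R < dim Q" by auto
  from ex_has_greatest_nat[of ?P "{0}" dim "dim Q", OF P0 this] obtain R
   where R: "?P R" and Rmax: "!!R'. ?P R' ==> dim R' \<le> dim R" by blast
  let ?L = "span R"
  have RQ: "R \<subseteq> Q" using R by blast
  have brR: "br x y : ?L" if "x : R" "y : ?L" for x y using that(2)
  proof (induction rule: span_induct_alt)
   case (step c y z) thus ?case using R that(1) by (simp add: brs span_add span_scale span_base)
  qed (simp add: brs span_zero)
  have brLQ: "br x y : span Q" if "x : Q" "y : span Q" for x y using that(2)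
  proof (induction rule: span_induct_alt)
   case (step c y z) thus ?case using Q that(1) by (simp add: brs span_add span_scale span_base)
  qed (simp add: brs span_zero)
  have brL2: "br y x : V" if "ALL y:S. br y x : V" "y : span S" "subspace V" for x y S V using that(2)
  proof (induction rule: span_induct_alt)
   case (step c y z) thus ?case using that by (auto simp: brs intro!: subspace_add subspace_scale)
  qed (simp add: brs subspace_0 that)
  have QL: "\<not> Q \<subseteq> ?L"
  proof
   assume "Q \<subseteq> ?L"
   hence "dim Q \<le> dim R" using dim_mono by blast
   thus False using R by simp
  qed
  text \<open>A stable subspace between \<open>span R\<close> and \<open>span Q\<close>, maximal among those meeting \<open>Q\<close> only
   inside \<open>span R\<close>, produces an element normalising \<open>span R\<close>.\<close>
  let ?K = "%K. subspace K & ?L \<subseteq> K & K \<subseteq> span Q & (ALL x:R. ALL u:K. br x u : K) & Q \<inter> K \<subseteq> ?L"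
  have K0: "?K ?L" using brR RQ span_mono by auto
  have "ALL K. ?K K --> dim K < Suc (card Basis)" using dim_subset_UNIV by (auto simp: dimension_def less_Suc_eq_le)
  from ex_has_greatest_nat[of ?K ?L dim, OF K0 this] obtain K
   where K: "?K K" and Kmax: "!!K'. ?K K' ==> dim K' \<le> dim K" by blast
  have KQ: "K ~= span Q" using K QL span_superset[of Q] by auto
  have "EX u:span Q - K. ALL x:R. br x u : K" by (rule less.hyps) (use R Q K KQ brLQ RQ in auto)
  then obtain u where u: "u : span Q" "u ~: K" "ALL x:R. br x u : K" by auto
  let ?K1 = "{u:span Q. ALL x:R. br x u : K}"
  have sK1: "subspace ?K1" using K by (auto simp: subspace_def brs span_add span_scale)
  have KK1: "K \<subseteq> ?K1" using K by auto
  have "span K = K" using K by simp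
  moreover have "span ?K1 = ?K1" using sK1 by auto
  moreover have "u : ?K1" using u by simp
  hence "K ~= ?K1" using u(2) by metis
  ultimately have "dim K < dim ?K1" using KK1 by (intro dim_psubset) (simp only: psubset_eq, simp)
  hence "\<not> ?K ?K1" using Kmax leD by blast
  moreover have "ALL x:R. ALL u:?K1. br x u : ?K1" using K by auto
  ultimately have "\<not> Q \<inter> ?K1 \<subseteq> ?L" using sK1 K by auto
  then obtain s where s: "s : Q" "s ~: ?L" "ALL x:R. br x s : K" by auto
  \<comment> \<open>[x,s] lies in Q, which is closed, and in K, and K meets Q only inside
    \<open>span R\<close>; so s normalises \<open>span R\<close>.\<close>
  have sR: "br x s : ?L" if "x : R" for x using s that K Q RQ by blast
  have sL: "br x s : ?L" if "x : ?L" for x by (rule brL2[of R]) (use sR that in auto)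
  let ?Q1 = "Q \<inter> ?L" and ?Q2 = "insert s (Q \<inter> ?L)"
  have LL: "br x y : ?L" if "x : ?L" "y : ?L" for x y by (rule brL2[of R]) (use brR that in auto)
  have cl2: "br x y : ?Q2" if "x : ?Q2" "y : ?Q2" for x y
  proof (cases "x = s"; cases "y = s")
   assume "x = s" "y = s" thus ?thesis using Q by (simp add: brs span_zero)
  next
   assume a: "x = s" "y ~= s"
   hence "br y s : ?L" using that sL by auto
   hence "br s y : ?L" by (subst anti) (rule span_neg)
   thus ?thesis using a that Q s by auto
  next
   assume a: "x ~= s" "y = s"
   thus ?thesis using that sL Q s by auto
  next
   assume a: "x ~= s" "y ~= s"
   thus ?thesis using that LL Q by auto
  qed
  have RQ2: "R \<subseteq> ?Q2" using RQ span_superset by auto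
  have "span R \<subset> span ?Q2" using span_mono[OF RQ2] s span_base[of s ?Q2] by auto
  hence "dim R < dim ?Q2" by (rule dim_psubset)
  hence "\<not> ?P ?Q2" using Rmax leD by blast
  hence "dim Q \<le> dim ?Q2" using cl2 Q s span_zero by auto
  hence spQ: "span ?Q2 = span Q" using dim_eq_span[of ?Q2 Q] s by auto
  have "dim ?Q1 \<le> dim R" using dim_mono[of ?Q1 R] by auto
  hence d1: "dim ?Q1 < dim Q" using R by simp
  have "EX u:U - W. ALL x:?Q1. br x u : W" by (rule less.hyps[OF d1]) (use Q LL U W UW st span_zero in auto)
  then obtain u where u: "u : U" "u ~: W" "!!x. x : ?Q1 ==> br x u : W" by auto
  \<comment> \<open>The vector u that the smaller set moves into W is kept or replaced by [s,u]; the
    square of ad s is zero, so one replacement suffices.\<close>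
  have "EX u:U - W. ALL x:?Q2. br x u : W"
  proof (cases "br s u : W")
   case True thus ?thesis using u by auto
  next
   case False
   have "br x (br s u) : W" if x: "x : ?Q1" for x
   proof -
    have "br x s : ?Q1" using x sL Q s by auto
    thus ?thesis using u x st s W by (subst leib) (auto intro!: subspace_add)
   qed
   moreover have "br s (br s u) = 0" using Q s sandwichD by blast
   ultimately show ?thesis using False st s u W by (intro bexI[of _ "br s u"]) (auto simp: subspace_0)
  qed
  then obtain u where u: "u : U" "u ~: W" "ALL x:?Q2. br x u : W" by auto
  have "br x u : W" if "x : Q" for x by (rule brL2[of ?Q2]) (use u W spQ that span_base in auto)
  thus ?thesis using u by auto
 qed
qed

text \<open>Sandwiches are stable under exponentials, so a nonzero one makes them span g; they are
  also closed under brackets, so Jacobson's theorem with W = 0 gives a nonzero vector killed by all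
  of them. It would be central.\<close>

theorem no_sandwich: assumes x: "sandwich x" shows "x = 0"
proof (rule ccontr)
 assume x0: "x ~= 0"
 let ?Q = "{x. sandwich x}"
 have sp: "span ?Q = UNIV" by (rule orbit_spans[of x]) (use x x0 sandwich_ex in auto)
 have "EX u:UNIV - {0}. ALL x:?Q. br x u : {0}"
 proof (rule jacobson)
  show "{0} ~= (UNIV :: 'g set)" using x0 by auto
 qed (use sandwich_br in \<open>auto simp: subspace_def brs\<close>, auto simp: sandwich_def brs)
 then obtain u where u: "u ~= 0" "!!x. sandwich x ==> br x u = 0" by auto
 have "br y u = 0" if "y : span ?Q" for y using that
 proof (induction rule: span_induct_alt)
  case (step c y z) thus ?case using u by (simp add: brs)
 qed (simp add: brs)
 thus False using centre_trivial[of u] u sp by auto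
qed

subsection \<open>Existence of extremal elements\<close>

text \<open>For \<open>V = ad n\<close> with \<open>V\<^sup>m = 0\<close> compare the leading terms in \<open>t = 1 / s\<close> of
 \<open>ad (exp (t V) y)\<^sup>j = exp (t V) (ad y)\<^sup>j exp (- t V)\<close>.\<close>

lemma top_power:
 assumes nil: "!!y. (br n ^^ m) y = 0" and m: "m \<ge> 2" and w: "w = (br n ^^ (m - 1)) y"
 shows "br w (br w (br w z)) = 0"
  and "br w (br w z) = (-1) ^ (m - 1) *s (br n ^^ (m - 1)) (br y (br y ((br n ^^ (m - 1)) z)))"
proof -
 \<comment> \<open>For s ~= 0 these are s^(m-1) exp(V/s) and s^(m-1) exp(-V/s). Written without
   denominators they are polynomial in s, and at s = 0 only the terms with V^(m-1) survive.\<close>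
 define A where "A s z = (\<Sum>k<m. (s ^ (m - 1 - k) / fact k) *s (br n ^^ k) z)" for s :: complex and z
 define Bs where "Bs s z = (\<Sum>k<m. ((- 1) ^ k * s ^ (m - 1 - k) / fact k) *s (br n ^^ k) z)" for s :: complex and z
 have leA: "le (A s)" for s
  by (rule leI) (simp_all add: A_def les[OF le_pow[OF le_br]] scale_right_distrib sum.distrib scale_sum_right mult.commute)
 have holA: "vhol (%s. A s z) UNIV" and holB: "vhol (%s. Bs s z) UNIV" for z
  unfolding A_def Bs_def by (intro vhol_intros holomorphic_intros; simp)+
 have Ae: "A s z = s ^ (m - 1) *s ex n (1 / s) z" and Be: "Bs s z = s ^ (m - 1) *s ex n (- 1 / s) z" if s: "s ~= 0" for s z
 proof -
  have p: "s ^ (m - 1 - k) / fact k = s ^ (m - 1) * ((1 / s) ^ k / fact k)"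
   "(- 1) ^ k * s ^ (m - 1 - k) / fact k = s ^ (m - 1) * ((- 1 / s) ^ k / fact k)" if "k < m" for k
  proof -
   have "s ^ (m - 1) = s ^ (m - 1 - k) * s ^ k" using that by (subst power_add[symmetric]) simp
   moreover have "s ^ k * (- (1 / s)) ^ k = (- 1) ^ k" using s by (subst power_mult_distrib[symmetric]) simp
   ultimately show "s ^ (m - 1 - k) / fact k = s ^ (m - 1) * ((1 / s) ^ k / fact k)"
    "(- 1) ^ k * s ^ (m - 1 - k) / fact k = s ^ (m - 1) * ((- 1 / s) ^ k / fact k)" using s by (simp_all add: power_divide)
  qed
  show "A s z = s ^ (m - 1) *s ex n (1 / s) z" unfolding A_def ex_nilp[OF nil] scale_sum_right scale_scale
   by (rule sum.cong) (simp_all only: p lessThan_iff)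
  show "Bs s z = s ^ (m - 1) *s ex n (- 1 / s) z" unfolding Bs_def ex_nilp[OF nil] scale_sum_right scale_scale
   by (rule sum.cong) (simp_all only: p lessThan_iff)
 qed
 have conj: "br (A s y) x = s ^ (m - 1) *s ex n (1 / s) (br y (ex n (- 1 / s) x))" if s: "s ~= 0" for s x
  using ex_inv(1)[of n "1 / s" x] by (simp add: Ae[OF s] ex_hom brs)
 have sq: "br (A s y) (br (A s y) z) = A s (br y (br y (Bs s z)))" if s: "s ~= 0" for s
  by (simp only: conj[OF s]) (simp add: Ae[OF s] Be[OF s] ex_inv le_scale[OF le_ex] br_scale_r mult.commute)
 \<comment> \<open>Three conjugated factors carry s^(3(m-1)), while A and Bs absorb only two of
   these powers; the remaining s^(m-1) makes the cube vanish at s = 0.\<close>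
 have cu: "br (A s y) (br (A s y) (br (A s y) z)) = s ^ (m - 1) *s A s (br y (br y (br y (Bs s z))))" if s: "s ~= 0" for s
  by (simp only: conj[OF s]) (simp add: Ae[OF s] Be[OF s] ex_inv le_scale[OF le_ex] br_scale_r mult.commute mult.left_commute)
 have holAB: "vhol (%s. A s (ga s)) UNIV" if "vhol ga UNIV" for ga
  unfolding A_def by (intro vhol_intros holomorphic_intros vhol_le[OF le_pow[OF le_br]] that; simp)
 have s2: "br (A 0 y) (br (A 0 y) z) = A 0 (br y (br y (Bs 0 z)))"
  by (rule vhol_eq_at_0[where ga = "%s. br (A s y) (br (A s y) z)" and dl = "%s. A s (br y (br y (Bs s z)))"])
   (intro vhol_br holA holB vhol_const, intro holAB vhol_br holB vhol_const, rule sq)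
 have s3: "br (A 0 y) (br (A 0 y) (br (A 0 y) z)) = 0 ^ (m - 1) *s A 0 (br y (br y (br y (Bs 0 z))))"
  by (rule vhol_eq_at_0[where ga = "%s. br (A s y) (br (A s y) (br (A s y) z))" and
     dl = "%s. s ^ (m - 1) *s A s (br y (br y (br y (Bs s z))))"])
   (intro vhol_br holA holB vhol_const, intro vhol_scale holAB vhol_br holB vhol_const holomorphic_intros, rule cu)
 let ?c = "1 / fact (m - 1) :: complex"
 have z: "(0::complex) ^ (m - 1 - k) = (if k = m - 1 then 1 else 0)" if "k < m" for k using that by auto
 have A0: "A 0 x = ?c *s (br n ^^ (m - 1)) x" for x
 proof -
  have "A 0 x = (\<Sum>k<m. if k = m - 1 then ?c *s (br n ^^ (m - 1)) x else 0)" unfolding A_def by (rule sum.cong) (auto simp: z)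
  thus ?thesis using m by simp
 qed
 have B0: "Bs 0 x = ((-1) ^ (m - 1) * ?c) *s (br n ^^ (m - 1)) x" for x
 proof -
  have "Bs 0 x = (\<Sum>k<m. if k = m - 1 then ((-1) ^ (m - 1) * ?c) *s (br n ^^ (m - 1)) x else 0)"
   unfolding Bs_def by (rule sum.cong) (auto simp: z)
  thus ?thesis using m by simp
 qed
 have m1: "m - 1 ~= 0" using m by simp
 have c0: "?c ~= 0" by simp
 have A0w: "A 0 y = ?c *s w" by (simp only: A0 w)
 have "(?c * ?c * ?c) *s br w (br w (br w z)) = 0" using s3 m1 by (simp add: A0w brs)
 thus "br w (br w (br w z)) = 0" by simp
 have "(?c * ?c) *s br w (br w z) =
  (?c * ?c) *s ((-1) ^ (m - 1) *s (br n ^^ (m - 1)) (br y (br y ((br n ^^ (m - 1)) z))))"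
  using s2 by (simp add: A0w) (simp add: A0 B0 brs les[OF le_pow[OF le_br]] mult.commute)
 thus "br w (br w z) = (-1) ^ (m - 1) *s (br n ^^ (m - 1)) (br y (br y ((br n ^^ (m - 1)) z)))"
  using c0 by (simp only: scale_cancel_left) simp
qed

lemma subspace_image_le: assumes T: "le T" and S: "subspace S" shows "subspace (T ` S)" unfolding subspace_def
proof (intro conjI ballI allI)
 show "0 : T ` S" using subspace_0[OF S] le_0[OF T] by simp
next
 fix x y assume "x : T ` S" "y : T ` S"
 then obtain a b where "x = T a" "a : S" "y = T b" "b : S" by blast
 thus "x + y : T ` S" using subspace_add[OF S] le_add[OF T] by (metis image_eqI)
next
 fix c x assume "x : T ` S"
 then obtain a where "x = T a" "a : S" by blast
 thus "c *s x : T ` S" using subspace_scale[OF S] le_scale[OF T] by (metis image_eqI)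
qed

lemma inj_on_if_onto: assumes T: "le T" and J: "subspace J" and e: "T ` J = J" shows "inj_on T J"
proof -
 interpret ve: vector_space_pair smul smul by unfold_locales
 obtain Bs where Bs: "Bs \<subseteq> J" "independent Bs" "J = span Bs" using basis_subspace_exists[OF J] by metis
 have fB: "finite Bs" using Bs finiteI_independent by blast
 have sp: "span (T ` Bs) = J" using ve.linear_span_image[OF T, of Bs] e Bs by simp
 have "card Bs = dim J" using Bs(2,3) dim_span_eq_card_independent by metis
 hence d: "card (T ` Bs) \<le> dim J" using card_image_le[OF fB, of T] by simp
 have TJ: "T ` Bs \<subseteq> J" using Bs e by blast
 have ind: "independent (T ` Bs)" by (rule card_le_dim_spanning[OF TJ _ _ d]) (use sp fB in auto)
 have "card (T ` Bs) = dim J" using ind sp by (metis dim_span_eq_card_independent)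
 hence "inj_on T Bs" using \<open>card Bs = dim J\<close> fB by (simp add: eq_card_imp_inj_on)
 thus ?thesis using ve.linear_inj_on_span_independent_image[OF T ind] Bs by simp
qed

text \<open>Among nonzero v with ad(v)^3 = 0 take one whose V^2 = ad(v)^2 has least rank, with image
  J. If V^2 y ~= 0, then V^2 y competes with v and its square is V^2 ad(y)^2 V^2, so V^2 ad(y)^2 is
  bijective on J. Along a line y + t z this quadratic pencil becomes singular for some t, hence V^2
  (y + t z) = 0 there: V^2 has rank one, and a generator of its image is extremal.\<close>

lemma extremal_exists:
 assumes n: "n ~= 0" "ad_nilpotent br n"
 shows "EX e. e ~= 0 & (ALL y. EX c. br e (br e y) = c *s e)"
proof -
 define C where "C = {v. v ~= 0 & (ALL z. br v (br v (br v z)) = 0)}"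
 define rk where "rk v = dim (range (%z. br v (br v z)))" for v
 have "EX v. v : C"
 proof -
  define m where "m = (LEAST k. ALL y. (br n ^^ k) y = 0)"
  have nil: "!!y. (br n ^^ m) y = 0" using LeastI_ex[OF n(2)[unfolded ad_nilpotent_def]] unfolding m_def by blast
  have m2: "m \<ge> 2"
  proof (rule ccontr)
   assume "\<not> m \<ge> 2"
   then consider "m = 0" | "m = 1" by linarith
   thus False
   proof cases
    case 1 thus False using nil[of n] n(1) by simp
   next
    case 2
    hence "!!y. br n y = 0" using nil by simp
    hence "!!y. br y n = 0" using anti[of n] by simp
    thus False using centre_trivial n(1) by blast
   qed
  qed
  hence "\<not> (ALL y. (br n ^^ (m - 1)) y = 0)" using not_less_Least[of "m - 1", folded m_def] unfolding m_def by force
  then obtain y where "(br n ^^ (m - 1)) y ~= 0" by blast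
  thus ?thesis using top_power(1)[OF nil m2 refl, of y] unfolding C_def by blast
 qed
 then obtain v0 where v0: "v0 : C" by blast
 from ex_has_least_nat[of "%v. v : C" v0 rk, OF v0]
 obtain v where v: "v : C" and min: "!!w. w : C ==> rk v \<le> rk w" by blast
 let ?V = "%z. br v (br v z)"
 have leV: "le ?V" by (rule le_comp[OF le_br le_br])
 define J where "J = range ?V"
 have sJ: "subspace J" unfolding J_def by (rule subspace_image_le[OF leV subspace_UNIV])
 have nil: "!!y. (br v ^^ 3) y = 0" using v by (simp add: C_def numeral_3_eq_3)
 have V2: "(br v ^^ (3 - 1)) y = ?V y" for y by (simp add: numeral_2_eq_2)
 have sq: "br (?V y) (br (?V y) z) = ?V (br y (br y (?V z)))" for y z
  using top_power(2)[OF nil _ V2[symmetric], of y z] by (simp add: numeral_2_eq_2)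
 have C: "?V y : C" if "?V y ~= 0" for y using top_power(1)[OF nil _ V2[symmetric], of y] that by (simp add: C_def)
 have rangeJ: "range (%z. br (?V y) (br (?V y) z)) = J" if y: "?V y ~= 0" for y
 proof -
  have "range (%z. br (?V y) (br (?V y) z)) \<subseteq> J" unfolding sq J_def by auto
  moreover have "subspace (range (%z. br (?V y) (br (?V y) z)))" by (rule subspace_image_le[OF le_comp[OF le_br le_br] subspace_UNIV])
  moreover have "dim J \<le> dim (range (%z. br (?V y) (br (?V y) z)))" using min[OF C[OF y]] by (simp add: rk_def J_def)
  ultimately show ?thesis using subspace_dim_equal sJ by metis
 qed
 have VYY: "(%j. ?V (br y (br y j))) ` J = J" if y: "?V y ~= 0" for y using rangeJ[OF y] unfolding sq J_def by (simp add: image_image)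
 have inj: "j = 0" if y: "?V y ~= 0" and j: "j : J" "?V (br y (br y j)) = 0" for y j
 proof -
  have le: "le (%j. ?V (br y (br y j)))" by (rule le_comp[OF leV le_comp[OF le_br le_br]])
  have "inj_on (%j. ?V (br y (br y j))) J" by (rule inj_on_if_onto[OF le sJ VYY[OF y]])
  thus ?thesis by (rule inj_onD) (use j subspace_0[OF sJ] in \<open>simp_all add: brs\<close>)
 qed
 text \<open>The quadratic pencil \<open>j \<mapsto> V\<^sup>2 (ad (y + t z))\<^sup>2 j\<close> on \<open>J\<close> is linearised on pairs.\<close>
 have dependent: False if y: "!!t. ?V (y + t *s z) ~= 0" and z: "?V z ~= 0" for y z
 proof -
  interpret pr: finite_dimensional_vector_space_prod smul smul Basis Basis by unfold_locales
  interpret cp: complex_fdvs pr.scale "pr.Basis_pair" by unfold_locales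
  let ?A0 = "%j. ?V (br y (br y j))" and ?A1 = "%j. ?V (br y (br z j) + br z (br y j))" and ?A2 = "%j. ?V (br z (br z j))"
  have l0: "le ?A0" "le ?A1" "le ?A2" by (rule le_comp[OF leV le_comp[OF le_br le_br]], rule le_comp[OF leV le_plus[OF le_comp[OF le_br le_br] le_comp[OF le_br le_br]]],
    rule le_comp[OF leV le_comp[OF le_br le_br]])
  have "inj_on ?A2 J" by (rule inj_on_if_onto[OF l0(3) sJ VYY[OF z]])
  then obtain I where I: "range I \<subseteq> J" "le I" "!!j. j : J ==> I (?A2 j) = j"
   using pr.linear_exists_left_inverse_on[OF l0(3) sJ] by blast
  have I2: "?A2 (I j) = j" if "j : J" for j using I(3) VYY[OF z] that by (metis (no_types, lifting) image_iff)
  \<comment> \<open>Companion form of the pencil, with I inverse to \<open>?A2\<close> on J: an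
    eigenvector for t is a pair (j, t j) annihilated in its first entry by A0 + t A1 + t^2
    A2.\<close>
  define K where "K p = (snd p, - I (?A0 (fst p)) - I (?A1 (snd p)))" for p
  have lK: "Vector_Spaces.linear pr.scale pr.scale K" unfolding Vector_Spaces.linear_iff using pr.p.vector_space_axioms
   by (auto simp: K_def pr.scale_def les[OF I(2)] brs algebra_simps)
  have KJ: "K p : J \<times> J" if "p : J \<times> J" for p
  proof -
   have "- I (?A0 (fst p)) - I (?A1 (snd p)) : J" using I(1) by (intro subspace_diff[OF sJ] subspace_neg[OF sJ]) auto
   thus ?thesis using that by (auto simp: K_def)
  qed
  have "(?V z, 0) : J \<times> J" "(?V z, 0) ~= 0" using z subspace_0[OF sJ] by (auto simp: J_def zero_prod_def)
  from cp.eigenvector_exists[OF lK pr.subspace_Times[OF sJ sJ] KJ this]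
  obtain t p where p: "p : J \<times> J" "p ~= 0" "K p = pr.scale t p" by blast
  obtain j w where jw: "p = (j, w)" by (cases p)
  have w: "w = t *s j" and e: "- I (?A0 j) - I (?A1 w) = t *s w" using p(3) unfolding K_def jw pr.scale_def fst_conv snd_conv prod.inject by blast+
  have jJ: "j : J" and j0: "j ~= 0" using p jw w by (auto simp: zero_prod_def)
  have A0J: "?A0 j : J" "?A1 w : J" by (auto simp: J_def)
  have "?A2 (- I (?A0 j) - I (?A1 w)) = - ?A0 j - ?A1 w" using I2[OF A0J(1)] I2[OF A0J(2)] by (simp only: brs)
  hence e2: "?A2 (t *s w) = - ?A0 j - ?A1 w" using e by simp
  have "?A0 j + ?A1 w + ?A2 (t *s w) = 0" unfolding e2 by simp
  hence "?V (br (y + t *s z) (br (y + t *s z) j)) = 0" by (simp add: w brs algebra_simps)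
  thus False using inj[OF y jJ] j0 by blast
 qed
 have v0: "v ~= 0" using v by (simp add: C_def)
 then obtain z where z: "?V z ~= 0" using no_sandwich[of v] by (auto simp: sandwich_def)
 let ?e = "?V z"
 have line: "EX c. ?V y = c *s ?e" for y
 proof -
  obtain t where "?V (y + t *s z) = 0" using dependent[of y z] z by blast
  hence "?V y = (- t) *s ?e" by (simp add: brs add_eq_0_iff2)
  thus ?thesis by blast
 qed
 have "EX c. br ?e (br ?e y) = c *s ?e" for y unfolding sq by (rule line)
 thus ?thesis using z by blast
qed

end

context lie_alg begin

lemma comb1: assumes "A = Bs" "!!l. lf l ==> l C - l D = k * (l A - l Bs)" shows "C = D" by (rule eqI_lf) (use assms in simp)
lemma comb2: assumes "A = Bs" "A' = B'" "!!l. lf l ==> l C - l D = k * (l A - l Bs) + k' * (l A' - l B')" shows "C = D"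
 by (rule eqI_lf) (use assms in simp)

subsection \<open>Traces and the Killing form\<close>

definition tr :: "('g => 'g) => complex" where "tr T = (\<Sum>b\<in>Basis. co b (T b))"

lemma tr_add: "tr (%x. S x + T x) = tr S + tr T" by (simp add: tr_def lf_add[OF lf_co] sum.distrib)
lemma tr_diff: "tr (%x. S x - T x) = tr S - tr T" by (simp add: tr_def lf_diff[OF lf_co] sum_subtractf)
lemma tr_scale: "tr (%x. c *s T x) = c * tr T" by (simp add: tr_def lf_scale[OF lf_co] sum_distrib_left)
lemma tr_sum: "tr (%x. \<Sum>i\<in>I. T i x) = (\<Sum>i\<in>I. tr (T i))" unfolding tr_def lf_sum[OF lf_co] by (rule sum.swap)
lemma tr_rank1: "lf l ==> tr (%x. l x *s c) = l c" unfolding tr_def lf_scale[OF lf_co] by (subst co_lf[of l c]) (simp_all add: mult.commute)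
lemma tr_comm: assumes S: "le S" and T: "le T" shows "tr (%x. S (T x)) = tr (%x. T (S x))"
proof -
 have e: "tr (%x. S (T x)) = (\<Sum>b\<in>Basis. \<Sum>c\<in>Basis. co c (T b) * co b (S c))" if "le S" for S T
  unfolding tr_def by (rule sum.cong[OF refl]) (rule co_lf[OF lf_comp[OF lf_co that]])
 show ?thesis unfolding e[OF S] e[OF T] by (subst sum.swap) (simp add: mult.commute)
qed

lemma tr_idempotent:
 assumes P: "le P" "!!x. P (P x) = P x"
 shows "EX k::nat. tr P = of_nat k"
proof -
 have sR: "subspace (range P)" by (rule module_hom.subspace_image[OF _ subspace_UNIV]) (use P(1) in \<open>simp add: module_hom_iff_linear\<close>)
 obtain C where C: "C \<subseteq> range P" "independent C" "range P = span C" using basis_subspace_exists[OF sR] by metis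
 have fC: "finite C" using C finiteI_independent by blast
 define l where "l c x = representation C (P x) c" for c x
 have Px: "P x : span C" for x using C(3) by blast
 have lf_l: "lf (l c)" for c
  by (rule lfI) (simp_all add: l_def les[OF P(1)] representation_add[OF C(2) Px Px] representation_scale[OF C(2) Px])
 have "P x = (\<Sum>c\<in>C. l c x *s c)" for x unfolding l_def using sum_representation_eq[OF C(2) Px fC subset_refl] by simp
 hence "P = (%x. \<Sum>c\<in>C. l c x *s c)" by auto
 hence "tr P = (\<Sum>c\<in>C. tr (%x. l c x *s c))" by (simp only: tr_sum[of "%c x. l c x *s c" C])
 also have "\<dots> = (\<Sum>c\<in>C. l c c)" by (simp add: tr_rank1[OF lf_l])
 also have "\<dots> = (\<Sum>c\<in>C. 1)"
 proof (rule sum.cong[OF refl])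
  fix c assume c: "c : C"
  hence "P c = c" using C(1) P(2) by auto
  thus "l c c = 1" unfolding l_def using representation_basis[OF C(2) c] by simp
 qed
 finally show ?thesis by auto
qed

lemma projection_exists:
 assumes W: "subspace W"
 shows "EX P. le P & range P \<subseteq> W & (ALL w:W. P w = w)"
proof -
 interpret ve: vector_space_pair smul smul by unfold_locales
 have i: "inj_on (%x. x) W" by auto
 show ?thesis using ve.linear_exists_left_inverse_on[OF le_id W i] by metis
qed

text \<open>With Q the complement of a projection onto ker N one has N = N Q, and tr (N Q) = tr (Q
  N). The operator Q N vanishes at one power less, because the last nonzero power of N maps into ker
  N.\<close>

lemma tr_nilpotent:
 assumes "le N" "!!x. (N ^^ m) x = 0" shows "tr N = 0" using assms
proof (induction m arbitrary: N)
 case 0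
 hence "N b = 0" for b by simp
 thus ?case by (simp add: tr_def lf_0[OF lf_co])
next
 case (Suc m)
 note N = Suc.prems(1)
 show ?case
 proof (cases "m = 0")
  case True
  hence "N b = 0" for b using Suc.prems(2)[of b] by simp
  thus ?thesis by (simp add: tr_def lf_0[OF lf_co])
 next
  case False
  have W: "subspace {x. N x = 0}" unfolding subspace_def by (simp add: les[OF N])
  obtain P where P: "le P" "range P \<subseteq> {x. N x = 0}" "!!w. N w = 0 ==> P w = w" using projection_exists[OF W] by blast
  have NP: "N (P x) = 0" for x using P(2) by blast
  define Q where "Q x = x - P x" for x
  have leQ: "le Q" by (rule leI) (simp_all add: Q_def les[OF P(1)] algebra_simps)
  have NQ: "N (Q x) = N x" for x by (simp add: Q_def les[OF N] NP)
  have c: "((%x. Q (N x)) ^^ k) (Q y) = Q ((N ^^ k) y)" for k y by (induction k) (simp_all add: NQ)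
  have "tr (%x. Q (N x)) = 0"
  proof (rule Suc.IH)
   show "le (%x. Q (N x))" by (rule le_comp[OF leQ N])
   fix x
   obtain k where m: "m = Suc k" using False not0_implies_Suc by blast
   have "((%x. Q (N x)) ^^ m) x = Q ((N ^^ m) x)" unfolding m funpow_Suc_right comp_def by (rule c)
   moreover have "N ((N ^^ m) x) = 0" using Suc.prems(2)[of x] by simp
   hence "Q ((N ^^ m) x) = 0" using P(3) by (simp add: Q_def)
   ultimately show "((%x. Q (N x)) ^^ m) x = 0" by simp
  qed
  moreover have "tr (%x. Q (N x)) = tr (%x. N (Q x))" by (rule tr_comm[OF leQ N])
  ultimately show ?thesis by (simp add: NQ)
 qed
qed

definition kil :: "'g => 'g => complex" where "kil x y = tr (%z. br x (br y z))"

lemma kil_sym: "kil x y = kil y x" unfolding kil_def by (rule tr_comm[OF le_br le_br])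
lemma kil_lf: "lf (kil x)" by (rule lfI) (simp_all add: kil_def brs tr_add tr_scale)
lemma kil_inv: "kil (br x y) z = kil x (br y z)"
proof -
 have "tr (%w. br y (br x (br z w))) = tr (%w. br x (br z (br y w)))" by (rule tr_comm[OF le_br le_comp[OF le_br le_br]])
 thus ?thesis unfolding kil_def leib2 brs by (simp add: tr_diff)
qed

text \<open>ad n and ad z commute, so their product is nilpotent and has trace 0.\<close>

lemma kil_nilpotent: assumes n: "ad_nilpotent br n" and z: "br n z = 0" shows "kil n z = 0"
proof -
 have c: "br z (br n w) = br n (br z w)" for w using leib[of n z w] z by (simp add: brs)
 obtain k where k: "!!y. (br n ^^ k) y = 0" using n unfolding ad_nilpotent_def by blast
 have p: "((%w. br n (br z w)) ^^ j) w = (br z ^^ j) ((br n ^^ j) w)" for j w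
 proof (induction j)
  case (Suc j)
  have q: "br n ((br z ^^ i) v) = (br z ^^ i) (br n v)" for i v by (induction i) (simp_all flip: c)
  show ?case using Suc by (simp add: q flip: c)
 qed simp
 show ?thesis unfolding kil_def by (rule tr_nilpotent[OF le_comp[OF le_br le_br], where m = k]) (simp add: p k le_0[OF le_pow[OF le_br]])
qed

end

text \<open>What is kept of the Killing form, scaled to value 1 on an extremal pair.
  \<open>B_nilp\<close> is the trace argument for commuting elements in usable form, and the factor
  -2 turns a pair with B e f = 1 into an sl2-triple.\<close>

locale extremal_lie = simple_lie smul Basis br
 for smul :: "complex => 'g::ab_group_add => 'g" (infixr "*s" 75)
  and Basis :: "'g set"
  and br :: "'g => 'g => 'g" +
 fixes B :: "'g => 'g => complex"
 assumes B_sym: "B x y = B y x"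
  and B_lf: "Vector_Spaces.linear smul (*) (B x)"
  and B_inv: "B (br x y) z = B x (br y z)"
  and B_nondeg: "(!!y. B x y = 0) ==> x = 0"
  and B_nilp: "ad_nilpotent br n ==> br n z = 0 ==> B n z = 0"
  and B_extremal: "EX e. e ~= 0 & (ALL y. br e (br e y) = (- 2 * B e y) *s e)"

section \<open>Extremal pairs and the scaling of the Killing form\<close>

context simple_lie begin

text \<open>Extremality with its functional rh still free; rh becomes \<open>B e\<close> once the
  Killing form is known to be nonzero.\<close>

definition ext1 :: "'g => ('g => complex) => bool" where
 "ext1 e rh \<longleftrightarrow> e ~= 0 & (ALL y. br e (br e y) = (- 2 * rh y) *s e)"

lemma ext1_lf: assumes "ext1 e rh" shows "lf rh"
proof (rule lfI)
 have e: "e ~= 0" "!!y. br e (br e y) = (- 2 * rh y) *s e" using assms by (auto simp: ext1_def)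
 fix x y c
 have "(- 2 * rh (x + y)) *s e = (- 2 * (rh x + rh y)) *s e"
  by (simp only: e(2)[symmetric] brs) (simp only: e(2) scale_left_distrib[symmetric] distrib_left)
 thus "rh (x + y) = rh x + rh y" using e(1) by (simp only: scale_cancel_right mult_cancel_left) simp
 have "(- 2 * rh (c *s x)) *s e = (- 2 * (c * rh x)) *s e" by (simp only: e(2)[symmetric] brs) (simp add: e(2))
 thus "rh (c *s x) = c * rh x" using e(1) by simp
qed

lemma ext1_ex: assumes "ext1 e rh" shows "ext1 (ex a t e) (%y. rh (ex a (-t) y))"
proof -
 have e: "e ~= 0" "!!y. br e (br e y) = (- 2 * rh y) *s e" using assms by (auto simp: ext1_def)
 have "ex a t e ~= 0" using e(1) ex_inv(2)[of a t e] le_0[OF le_ex] by metis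
 moreover have "br (ex a t e) (br (ex a t e) y) = (- 2 * rh (ex a (-t) y)) *s ex a t e" for y
 proof -
  have "br (ex a t e) (br (ex a t e) y) = ex a t (br e (br e (ex a (- t) y)))" by (simp add: ex_hom ex_inv)
  thus ?thesis by (simp only: e(2) le_scale[OF le_ex])
 qed
 ultimately show ?thesis by (simp add: ext1_def)
qed

text \<open>Extremal elements span g. If rh vanished on all of them, e would be a sandwich.\<close>

lemma extremal_pair:
 assumes "ext1 e rh"
 obtains f \<mu> where "ext1 f \<mu>" "rh f = 1"
proof -
 have e: "e ~= 0" "!!y. br e (br e y) = (- 2 * rh y) *s e" using assms by (auto simp: ext1_def)
 let ?S = "{v. EX \<mu>. ext1 v \<mu>}"
 have sp: "span ?S = UNIV"
 proof (rule orbit_spans[of e])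
  show "ex a t y : ?S" if y: "y : ?S" for y a t
  proof -
   obtain \<mu> where "ext1 y \<mu>" using y by blast
   from ext1_ex[OF this, of a t] show ?thesis by blast
  qed
 qed (use e assms in blast)+
 have "EX v:?S. rh v ~= 0"
 proof (rule ccontr)
  assume n: "\<not> (EX v:?S. rh v ~= 0)"
  have "rh v = 0" if "v : span ?S" for v using that
  proof (induction rule: span_induct_alt)
   case base show ?case by (rule lf_0[OF ext1_lf[OF assms]])
  next
   case (step c y z) 
   hence "rh y = 0" using n by blast
   thus ?case using step(2) lfs[OF ext1_lf[OF assms]] by simp
  qed
  hence "sandwich e" using sp by (simp add: sandwich_def e)
  thus False using no_sandwich e by blast
 qed
 then obtain v \<mu> where v: "ext1 v \<mu>" "rh v ~= 0" by blast
 show ?thesis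
 proof (rule that)
  let ?c = "1 / rh v"
  show "ext1 (?c *s v) (%y. ?c * \<mu> y)" using v by (simp add: ext1_def brs mult.commute)
  show "rh (?c *s v) = 1" using v lf_scale[OF ext1_lf[OF assms]] by simp
 qed
qed

text \<open>For an extremal pair the operator \<open>K = ad e \<circ> ad f\<close> differs from a projection by an
 operator of rank two and trace two, so its trace \<open>kil e f\<close> is a positive integer.\<close>

lemma kil_extremal_pair:
 assumes "ext1 e rh" "ext1 f \<mu>" "rh f = 1"
 shows "kil e f ~= 0"
proof -
 have e: "e ~= 0" "!!y. br e (br e y) = (- 2 * rh y) *s e" using assms by (auto simp: ext1_def)
 have f: "f ~= 0" "!!y. br f (br f y) = (- 2 * \<mu> y) *s f" using assms by (auto simp: ext1_def)
 note l = lfs[OF ext1_lf[OF assms(1)]] lfs[OF ext1_lf[OF assms(2)]]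
 define h where "h = br e f"
 have eh: "br e h = (- 2) *s e" unfolding h_def by (simp add: e assms(3))
 have he: "br h e = 2 *s e" using anti[of e h] eh by simp
 have fe: "br f e = - h" unfolding h_def by (rule anti)
 have fh': "br f h = (2 * \<mu> e) *s f"
 proof -
  have "br f h = - br f (br f e)" by (simp add: fe brs)
  thus ?thesis by (simp add: f(2))
 qed
 have hf': "br h f = (- 2 * \<mu> e) *s f" using anti[of f h] fh' by simp
 have h0: "h ~= 0" using he e(1) by (auto simp: brs)
 have "br h h = (2 - 2 * \<mu> e) *s h"
 proof -
  have "br h (br e f) = br (br h e) f + br e (br h f)" by (rule leib)
  thus ?thesis by (simp add: he hf' brs h_def[symmetric])
 qed
 hence \<mu>e: "\<mu> e = 1" using h0 by (simp add: brs)
 have fh: "br f h = 2 *s f" using fh' \<mu>e by simp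
 have rhh: "rh h = 0" using e(2)[of h] e(1) by (simp add: eh brs)
 have \<mu>h: "\<mu> h = 0" using f(2)[of h] f(1) by (simp add: fh brs)
 \<comment> \<open>Obtained by expanding ad [e,[e,f]] = -2 ad e in ad e and ad f; \<open>FVF\<close>
   is the same with e and f exchanged.\<close>
 have VFV: "br e (br f (br e y)) = br e y - rh (br f y) *s e + rh y *s h" for y
 proof -
  have "br (br e (br e f)) y = br e (br e (br f y)) - br e (br f (br e y)) - (br e (br f (br e y)) - br f (br e (br e y)))"
   by (simp only: leib2 brs)
  moreover have "br (br e (br e f)) y = (- 2) *s br e y" unfolding e(2) assms(3) by (simp add: brs)
  ultimately have "(- 2) *s br e y = (- 2 * rh (br f y)) *s e - br e (br f (br e y)) - (br e (br f (br e y)) - (2 * rh y) *s h)"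
   by (simp add: e(2) fe brs)
  thus ?thesis by (rule comb1[where k = "1/2"]) (simp add: lfs field_simps)
 qed
 have FVF: "br f (br e (br f y)) = br f y - \<mu> (br e y) *s f - \<mu> y *s h" for y
 proof -
  have "br (br f (br f e)) y = br f (br f (br e y)) - br f (br e (br f y)) - (br f (br e (br f y)) - br e (br f (br f y)))"
   by (simp only: leib2 brs)
  moreover have "br (br f (br f e)) y = (- 2) *s br f y" unfolding f(2) \<mu>e by (simp add: brs)
  ultimately have "(- 2) *s br f y = (- 2 * \<mu> (br e y)) *s f - br f (br e (br f y)) - (br f (br e (br f y)) + (2 * \<mu> y) *s h)"
   by (simp add: f(2) h_def[symmetric] brs)
  thus ?thesis by (rule comb1[where k = "1/2"]) (simp add: lfs field_simps)
 qed
 have VFVF: "br e (br f (br e (br f y))) = br e (br f y) + (2 * \<mu> y) *s e + rh (br f y) *s h" for y by (simp add: VFV f(2) l assms(3))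
 have dual: "\<mu> (br e y) = - rh (br f y)" for y
 proof -
  have "br e (br f (br e (br f y))) = br e (br f y) - \<mu> (br e y) *s h + (2 * \<mu> y) *s e"
   unfolding FVF by (simp add: brs eh h_def[symmetric])
  hence "(\<mu> (br e y) + rh (br f y)) *s h = 0" unfolding VFVF by (simp add: algebra_simps)
  thus ?thesis using h0 by (simp add: add_eq_0_iff2 del: scale_left_distrib)
 qed
 \<comment> \<open>The two subtracted rank-one operators make P idempotent. Their traces are \<mu> e
   = 1 and rh [f,h] / 2 = 1, so \<open>kil e f\<close> is the rank of P plus 2.\<close>
 define P where "P y = br e (br f y) - \<mu> y *s e - (rh (br f y) / 2) *s h" for y
 have "le P" by (rule leI) (simp_all add: P_def brs l algebra_simps add_divide_distrib)
 moreover have "P (P y) = P y" for y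
 proof -
  have k: "br f (P y) = br f (br e (br f y)) + \<mu> y *s h - rh (br f y) *s f" by (simp add: P_def brs fe fh)
  have 1: "br e (br f (P y)) = br e (br f y)" unfolding k by (simp add: brs VFVF eh h_def[symmetric])
  have 2: "\<mu> (P y) = \<mu> y" by (simp add: P_def l \<mu>e \<mu>h dual f(2) assms(3))
  have 3: "rh (br f (P y)) = rh (br f y)" unfolding k by (simp add: FVF l dual rhh)
  show ?thesis using 1 2 3 by (simp add: P_def)
 qed
 ultimately obtain k :: nat where k: "tr P = of_nat k" using tr_idempotent by blast
 have "br e (br f y) = P y + \<mu> y *s e + (rh (br f y) / 2) *s h" for y by (simp add: P_def)
 hence "(%y. br e (br f y)) = (%y. P y + \<mu> y *s e + (rh (br f y) / 2) *s h)" by auto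
 moreover have "lf (%y. rh (br f y) / 2)" by (rule lfI) (simp_all add: brs l add_divide_distrib)
 ultimately have "kil e f = of_nat k + \<mu> e + rh (br f h) / 2"
  by (simp only: kil_def tr_add k tr_rank1[OF ext1_lf[OF assms(2)]] tr_rank1[of "%y. rh (br f y) / 2"])
 also have "\<dots> = of_nat (k + 2)" by (simp add: \<mu>e fh l assms(3))
 finally show ?thesis using of_nat_eq_0_iff[where 'a=complex, of "k + 2"] by simp
qed

theorem extremal_lie_exists:
 assumes "EX n. n ~= 0 & ad_nilpotent br n"
 shows "EX B. extremal_lie smul Basis br B"
proof -
 obtain e where e: "e ~= 0" "!!y. EX c. br e (br e y) = c *s e" using extremal_exists assms by blast
 then obtain c where c: "!!y. br e (br e y) = c y *s e" by metis
 have 1: "ext1 e (%y. - c y / 2)" using e(1) c by (simp add: ext1_def)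
 obtain f \<mu> where f: "ext1 f \<mu>" "- c f / 2 = 1" using extremal_pair[OF 1] by metis
 let ?k = "kil e f"
 have k: "?k ~= 0" by (rule kil_extremal_pair[OF 1 f])
 have rad: "x = 0" if x: "!!y. kil x y = 0" for x
 proof (rule ccontr)
  assume "x ~= 0"
  have "{x. ALL y. kil x y = 0} = UNIV"
  proof (rule ideal_UNIV[of _ x])
   have "kil (a + b) y = kil a y + kil b y" "kil (c *s a) y = c * kil a y" "kil 0 y = 0" for a b c y
    using lfs[OF kil_lf, of y] by (simp_all add: kil_sym[of _ y])
   thus "subspace {x. ALL y. kil x y = 0}" by (simp add: subspace_def)
   fix a b assume "b : {x. ALL y. kil x y = 0}"
   hence b: "!!y. kil b y = 0" by simp
   have "kil (br a b) y = 0" for y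
    by (metis lf_minus kil_lf anti b kil_sym kil_inv)
   thus "br a b : {x. ALL y. kil x y = 0}" by simp
  qed (use x \<open>x ~= 0\<close> in auto)
  thus False using k by blast
 qed
 define B where "B x y = kil x y / ?k" for x y
 have sw: "kil (br e x) z = - kil x (br e z)" for x z
 proof -
  have "kil (br e x) z = - kil (br x e) z" using lf_minus[OF kil_lf, of z "br x e"] anti[of e x] by (simp add: kil_sym[of _ z])
  thus ?thesis by (simp add: kil_inv)
 qed
 \<comment> \<open>The two functionals are compared by moving ad(e)^2 from y to f: this gives c y *
   kil e f = c f * kil y e, and c f = -2.\<close>
 have ce: "c y = - 2 * B e y" for y
 proof -
  have "c y * kil e f = c f * kil y e"
  proof -
   have "kil (br e (br e y)) f = kil y (br e (br e f))" by (simp add: sw)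
   thus ?thesis using lf_scale[OF kil_lf, of f "c y" e] lf_scale[OF kil_lf, of y "c f" e] by (simp only: c) (simp add: kil_sym[of _ f])
  qed
  moreover have "c f = - 2"
  proof -
   have "- c f = 2" using f(2) by (simp add: field_simps)
   thus ?thesis by (metis minus_minus)
  qed
  ultimately show ?thesis using k by (simp add: B_def field_simps kil_sym[of y e])
 qed
 have "extremal_lie smul Basis br B"
 proof unfold_locales
  fix x y z c
  show "B x y = B y x" by (simp add: B_def kil_sym)
  show "B x (y + z) = B x y + B x z" "B x (c *s y) = c * B x y" by (simp_all add: B_def lfs[OF kil_lf] add_divide_distrib)
  show "B (br x y) z = B x (br y z)" by (simp add: B_def kil_inv)
  show "x = 0" if "!!y. B x y = 0"
  proof (rule rad)
   fix y show "kil x y = 0" using that[of y] k by (simp add: B_def)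
  qed
  show "B n z = 0" if "ad_nilpotent br n" "br n z = 0" for n z using kil_nilpotent[OF that] by (simp add: B_def)
  show "EX e. e ~= 0 & (ALL y. br e (br e y) = (- 2 * B e y) *s e)" using e(1) c ce by auto
 qed
 thus ?thesis by auto
qed

end

context extremal_lie begin

subsection \<open>The invariant form and extremal elements\<close>

lemma B_lf2: "lf (%x. B x y)" using B_lf[of y] by (simp add: B_sym[of _ y])
lemma B_r: "B x (y + z) = B x y + B x z" "B x (c *s y) = c * B x y" "B x 0 = 0" "B x (- y) = - B x y" "B x (y - z) = B x y - B x z"
 using lfs[OF B_lf] by auto
lemma B_l: "B (y + z) x = B y x + B z x" "B (c *s y) x = c * B y x" "B 0 x = 0" "B (- y) x = - B y x" "B (y - z) x = B y x - B z x"
 using lfs[OF B_lf2] by auto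
lemmas bs = B_r B_l
lemma B_inv2: "B (br x y) z = - B y (br x z)" using anti[of x y] by (simp add: bs B_inv)
lemma B_pow: "B ((br a ^^ k) x) y = (-1) ^ k * B x ((br a ^^ k) y)"
proof (induction k arbitrary: y)
 case (Suc k)
 have "B ((br a ^^ Suc k) x) y = - B ((br a ^^ k) x) (br a y)" by (simp add: B_inv2)
 also have "\<dots> = (-1) ^ Suc k * B x ((br a ^^ k) (br a y))" using Suc[of "br a y"] by simp
 also have "(br a ^^ k) (br a y) = (br a ^^ Suc k) y" by (simp add: funpow_swap1)
 finally show ?case .
qed simp
lemma B_ex: "B (ex a t x) y = B x (ex a (- t) y)"
proof -
 have "(%k. B ((br a ^^ k) x) y / fact k * t ^ k) sums B (ex a t x) y" by (rule ex_sums[OF B_lf2])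
 moreover have "(%k. B x ((br a ^^ k) y) / fact k * (- t) ^ k) sums B x (ex a (- t) y)" by (rule ex_sums[OF B_lf])
 moreover have "B ((br a ^^ k) x) y / fact k * t ^ k = B x ((br a ^^ k) y) / fact k * (- t) ^ k" for k
  by (simp add: B_pow power_minus[of t])
 ultimately show ?thesis by (simp add: sums_unique2)
qed
lemma B_ex2: "B (ex a t x) (ex a t y) = B x y" by (simp add: B_ex ex_inv)
lemma B_representing: assumes l: "lf l" shows "EX z. ALL y. l y = B z y"
proof -
 define T where "T z = (\<Sum>b\<in>Basis. B z b *s b)" for z
 have le: "le T" by (rule leI) (simp_all add: T_def bs scale_left_distrib sum.distrib scale_sum_right)
 have c: "co b (T z) = B z b" if "b : Basis" for b z
  using that by (simp add: T_def lf_sum[OF lf_co] lf_scale[OF lf_co] co_Basis finite_Basis if_distrib cong: if_cong)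
 have eq: "B z y = (\<Sum>b\<in>Basis. co b y * B z b)" for z y by (rule co_lf[OF B_lf])
 have "inj T"
 proof (rule injI)
  fix x y assume "T x = T y"
  hence "B x b = B y b" if "b : Basis" for b using c[OF that] by metis
  hence "B x v = B y v" for v unfolding eq[of x v] eq[of y v] by simp
  hence "B (x - y) v = 0" for v by (simp add: bs)
  thus "x = y" using B_nondeg[of "x - y"] by simp
 qed
 hence "surj T" using linear_inj_imp_surj[OF le] by blast
 then obtain z where z: "T z = (\<Sum>b\<in>Basis. l b *s b)" by (metis surjD)
 have "B z b = l b" if "b : Basis" for b using c[OF that, of z] that unfolding z
  by (simp add: lf_sum[OF lf_co] lf_scale[OF lf_co] co_Basis finite_Basis if_distrib cong: if_cong)
 hence "l y = B z y" for y unfolding eq[of z y] co_lf[OF l, of y] by simp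
 thus ?thesis by blast
qed

text \<open>\<open>[n, g]\<close> is the orthogonal complement of the centraliser of \<open>n\<close>, which is orthogonal to
 the nilpotent element \<open>n\<close>.\<close>

lemma nilpotent_grading:
 assumes n: "ad_nilpotent br n" shows "EX h. br h n = n"
proof (rule ccontr)
 assume c: "\<nexists>h. br h n = n"
 have s: "subspace (range (%h. br h n))" by (rule subspace_image_le[OF le_br2 subspace_UNIV])
 have "n ~: range (%h. br h n)" using c by (metis rangeE)
 then obtain l where l: "lf l" "ALL w:range (%h. br h n). l w = 0" "l n = 1" using lf_separate[OF s] by blast
 obtain z where z: "!!y. l y = B z y" using B_representing[OF l(1)] by blast
 have "B (br n z) y = 0" for y
 proof -
  have "B (br n z) y = - B z (br n y)" by (rule B_inv2)
  also have "\<dots> = B z (br y n)" using anti[of n y] by (simp add: bs)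
  finally show ?thesis using l(2) z by auto
 qed
 hence "br n z = 0" by (rule B_nondeg)
 hence "B n z = 0" by (rule B_nilp[OF n])
 thus False using l(3) z[of n] B_sym[of n z] by simp
qed

definition E0 :: "'g set" where "E0 = {x. ALL y. br x (br x y) = (- 2 * B x y) *s x}"
definition E :: "'g set" where "E = E0 - {0}"

lemma E0D: "x : E0 ==> br x (br x y) = (- 2 * B x y) *s x" by (simp add: E0_def)
lemma E_E0: "x : E ==> x : E0" and E_0: "x : E ==> x ~= 0" by (auto simp: E_def)
lemma zero_E0: "0 : E0" by (simp add: E0_def brs)
lemma E_nonempty: "E ~= {}" using B_extremal by (auto simp: E_def E0_def)
lemma E0_scale: "x : E0 ==> c *s x : E0" by (auto simp: E0_def brs bs mult.commute)
lemma E0_ex: "x : E0 ==> ex a t x : E0"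
proof -
 assume x: "x : E0"
 have "br (ex a t x) (br (ex a t x) y) = ex a t (br x (br x (ex a (- t) y)))" for y by (simp add: ex_hom ex_inv)
 thus ?thesis unfolding E0_def by (simp add: E0D[OF x] B_ex les[OF le_ex])
qed
lemma ex_eq_0: "ex a t x = 0 \<longleftrightarrow> x = 0" using ex_inv(2)[of a t x] le_0[OF le_ex] by metis
lemma E_ex: "x : E ==> ex a t x : E" by (auto simp: E_def E0_ex ex_eq_0)
lemma E_scale: "x : E ==> c ~= 0 ==> c *s x : E" by (auto simp: E_def E0_scale)
lemma E_Gr: "u : Gr ==> x : E ==> u x : E" by (induction rule: adjoint_group.induct) (auto simp: exp_endo_ex E_ex)
lemma vhol_B: "vhol ga U ==> (%s. B (ga s) y) holomorphic_on U" unfolding vhol_def using B_lf2 by blast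
lemma E0_limit: assumes ga: "vhol ga UNIV" and E: "!!s. s ~= 0 ==> ga s : E0" shows "ga 0 : E0" unfolding E0_def
proof (intro CollectI allI)
 fix y
 show "br (ga 0) (br (ga 0) y) = (- 2 * B (ga 0) y) *s ga 0"
  by (rule vhol_eq_at_0[where ga = "%s. br (ga s) (br (ga s) y)" and dl = "%s. (- 2 * B (ga s) y) *s ga s"])
   (intro vhol_br ga vhol_const, intro vhol_scale ga holomorphic_intros vhol_B, use E E0D in blast)
qed
lemma E_spans: "span E = UNIV"
proof -
 obtain e where "e : E" using E_nonempty by auto
 thus ?thesis using orbit_spans[of e E] E_ex E_0 by blast
qed
lemma E_pairing: assumes "v ~= 0" shows "EX f:E. B v f ~= 0"
proof (rule ccontr)
 assume n: "\<not> (EX f:E. B v f ~= 0)"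
 have "B v y = 0" if "y : span E" for y using that by (induction rule: span_induct_alt) (use n in \<open>auto simp: bs\<close>)
 thus False using B_nondeg[of v] E_spans assms by auto
qed
lemma E_pair: assumes "x : E" shows "EX f:E. B x f = 1"
proof -
 obtain f where f: "f : E" "B x f ~= 0" using E_pairing E_0[OF assms] by blast
 thus ?thesis by (intro bexI[of _ "(1 / B x f) *s f"]) (auto simp: bs intro: E_scale)
qed
lemma E_isotropic: "x : E0 ==> B x x = 0" using E0D[of x x] by (cases "x = 0") (auto simp: brs bs)
lemma E_nilpotent: "x : E0 ==> ad_nilpotent br x" unfolding ad_nilpotent_def by (intro exI[of _ 3]) (simp add: numeral_3_eq_3 E0D brs)

end

text \<open>Any e in E has such an f by \<open>E_pair\<close>. The sl2-triple e, h, f grades g by ad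
  h with weights -2, ..., 2, the outer ones one-dimensional: the contact grading that is usually
  read off from the highest root.\<close>

locale triple = extremal_lie smul Basis br B
 for smul :: "complex => 'g::ab_group_add => 'g" (infixr "*s" 75)
  and Basis :: "'g set" and br B +
 fixes e f :: 'g
 assumes eE: "e : E" and fE: "f : E" and ef: "B e f = 1"
begin

definition h where "h = br e f"

lemma fe1: "B f e = 1" using ef B_sym by simp
lemma VV: "br e (br e y) = (- 2 * B e y) *s e" and FF: "br f (br f y) = (- 2 * B f y) *s f" using eE fE E_E0 E0D by auto
lemma eh: "br e h = (- 2) *s e" by (simp add: h_def VV ef)
lemma he: "br h e = 2 *s e" using anti[of e h] eh by simp
lemma fe: "br f e = - h" unfolding h_def by (rule anti)
lemma fh: "br f h = 2 *s f"
proof -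
 have "br f h = - br f (br f e)" by (simp add: fe brs)
 thus ?thesis by (simp add: FF fe1)
qed
lemma hf: "br h f = (- 2) *s f" using anti[of f h] fh by simp
lemma Bs: "B e e = 0" "B f f = 0" "B e h = 0" "B h e = 0" "B f h = 0" "B h f = 0" "B h h = 2"
proof -
 show ee: "B e e = 0" and ff: "B f f = 0" using E_isotropic E_E0 eE fE by auto
 show eh0: "B e h = 0" by (simp add: h_def B_inv[symmetric] brs bs)
 show fh0: "B f h = 0" using B_inv2[of f e f] B_sym[of f h] by (simp add: fe bs brs)
 show "B h e = 0" "B h f = 0" using eh0 fh0 B_sym by auto
 show "B h h = 2" using B_inv[of e f h] by (simp add: h_def[symmetric] fh bs ef)
qed
lemma e0: "e ~= 0" and f0: "f ~= 0" using eE fE E_0 by auto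

definition G :: "complex => 'g set" where "G k = {x. br h x = k *s x}"

lemma GD: "x : G k ==> br h x = k *s x" by (simp add: G_def)
lemma subspace_G: "subspace (G k)" by (simp add: subspace_def G_def brs scale_right_distrib)
lemma eG: "e : G 2" and fG: "f : G (-2)" and hG: "h : G 0" by (simp_all add: G_def he hf brs)
lemma G_br: "x : G i ==> y : G j ==> br x y : G (i + j)" unfolding G_def using leib[of h x y] by (simp add: brs scale_left_distrib)
lemma G_br': "x : G i ==> y : G j ==> k = i + j ==> br x y : G k" using G_br by simp
lemma G_orth: assumes "x : G i" "y : G j" "i + j ~= 0" shows "B x y = 0"
proof -
 have "B (br h x) y = - B x (br h y)" by (rule B_inv2)
 hence "(i + j) * B x y = 0" using assms(1,2) by (simp add: G_def bs algebra_simps)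
 thus ?thesis using assms(3) by simp
qed

text \<open>\<open>prc\<close> projects onto the orthogonal complement of e, h, f. There ad e ad f
  and ad f ad e are the projections to weights 1 and -1, and what is left, together with the
  h-component, has weight 0; the decomposition into weights comes out of the extremal
  identities.\<close>

definition prc where "prc x = x - B x f *s e - B x e *s f - (B x h / 2) *s h"
definition p1 where "p1 x = br e (br f (prc x))"
definition pm where "pm x = br f (br e (prc x))"
definition p0 where "p0 x = x - B x f *s e - p1 x - pm x - B x e *s f"

lemma decomp: "x = B x f *s e + p1 x + p0 x + pm x + B x e *s f" by (simp add: p0_def)
lemma le_prc: "le prc" by (rule leI) (simp_all add: prc_def bs algebra_simps add_divide_distrib)
lemma le_p1: "le p1" unfolding p1_def by (rule le_comp[OF le_br le_comp[OF le_br le_prc]])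
lemma le_pm: "le pm" unfolding pm_def by (rule le_comp[OF le_br le_comp[OF le_br le_prc]])
lemma le_p0: "le p0" by (rule leI) (simp_all add: p0_def les[OF le_p1] les[OF le_pm] bs algebra_simps)

lemma prc_orth: "B e (prc x) = 0" "B f (prc x) = 0" "B h (prc x) = 0" by (simp_all add: prc_def bs Bs ef fe1 B_sym[of _ x])
lemma VVF: "br e (br e (br f (prc x))) = 0" using prc_orth(3)[of x] by (simp add: VV B_inv[symmetric] h_def[symmetric])
lemma FFV: "br f (br f (br e (prc x))) = 0" using prc_orth(3)[of x] by (simp add: FF B_inv[symmetric] fe bs)
lemma VFV: "br e (br f (br e (prc x))) = br e (prc x)"
proof -
 let ?y = "prc x"
 have "br (br e (br e f)) ?y = br e (br e (br f ?y)) - br e (br f (br e ?y)) - (br e (br f (br e ?y)) - br f (br e (br e ?y)))"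
  by (simp only: leib2 brs)
 hence "(- 2) *s br e ?y = - br e (br f (br e ?y)) - br e (br f (br e ?y))" by (simp add: VVF) (simp add: VV prc_orth ef brs)
 thus ?thesis by (rule comb1[where k = "1/2"]) (simp add: lfs field_simps)
qed
lemma FVF: "br f (br e (br f (prc x))) = br f (prc x)"
proof -
 let ?y = "prc x"
 have "br (br f (br f e)) ?y = br f (br f (br e ?y)) - br f (br e (br f ?y)) - (br f (br e (br f ?y)) - br e (br f (br f ?y)))"
  by (simp only: leib2 brs)
 hence "(- 2) *s br f ?y = - br f (br e (br f ?y)) - br f (br e (br f ?y))" by (simp add: FFV) (simp add: FF prc_orth fe1 brs)
 thus ?thesis by (rule comb1[where k = "1/2"]) (simp add: lfs field_simps)
qed
lemma h_act: "br h y = br e (br f y) - br f (br e y)" by (simp add: h_def leib2)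
lemma p1G: "p1 x : G 1" unfolding G_def by (simp add: h_act p1_def FVF VVF brs)
lemma pmG: "pm x : G (-1)" unfolding G_def by (simp add: h_act pm_def VFV FFV brs)
lemma p0G: "p0 x : G 0"
proof -
 have 1: "br h (prc x) = p1 x - pm x" by (simp add: h_act p1_def pm_def)
 have 2: "p0 x = prc x + (B x h / 2) *s h - p1 x - pm x" by (simp add: p0_def prc_def)
 have "br h (p0 x) = 0" unfolding 2 using 1 GD[OF p1G, of x] GD[OF pmG, of x] by (simp add: brs)
 thus ?thesis by (simp add: G_def)
qed

text \<open>Weights i and j are orthogonal unless i + j = 0, so by nondegeneracy x needs testing
  only in weight -k. For k outside -2, ..., 2 no test remains and x = 0.\<close>

lemma G_eqI:
 assumes "x : G k" "k ~= 2 ==> B x f = 0 \<or> k ~= 2" "k = 2 ==> B x f = 0" "k = -2 ==> B x e = 0"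
  "k = 1 ==> ALL y:G (-1). B x y = 0" "k = -1 ==> ALL y:G 1. B x y = 0" "k = 0 ==> ALL y:G 0. B x y = 0"
 shows "x = 0"
proof (rule B_nondeg)
 fix y
 have "B x f = 0" using G_orth[OF assms(1) fG] assms(3) by auto
 moreover have "B x e = 0" using G_orth[OF assms(1) eG] assms(4) by (cases "k = -2") (auto simp: eq_neg_iff_add_eq_0)
 moreover have "B x (p1 y) = 0" using G_orth[OF assms(1) p1G] assms(6) p1G by (cases "k = -1") (auto simp: eq_neg_iff_add_eq_0)
 moreover have "B x (pm y) = 0" using G_orth[OF assms(1) pmG] assms(5) pmG by auto
 moreover have "B x (p0 y) = 0" using G_orth[OF assms(1) p0G] assms(7) p0G by auto
 ultimately show "B x y = 0" by (subst decomp[of y]) (simp add: bs)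
qed
lemma G_2: "x : G 2 ==> x = B x f *s e"
proof -
 assume x: "x : G 2"
 have "x - B x f *s e = 0"
  by (rule G_eqI[of _ 2]) (use x eG in \<open>auto simp: bs ef intro!: subspace_diff subspace_scale subspace_G\<close>)
 thus ?thesis by simp
qed
lemma G_m2: "x : G (-2) ==> x = B x e *s f"
proof -
 assume x: "x : G (-2)"
 have "x - B x e *s f = 0"
  by (rule G_eqI[of _ "-2"]) (use x fG in \<open>auto simp: bs fe1 intro!: subspace_diff subspace_scale subspace_G\<close>)
 thus ?thesis by simp
qed
lemma G_other: "x : G k ==> k ~: {-2,-1,0,1,2} ==> x = 0" by (rule G_eqI[of x k]) auto
lemma G_3: "x : G 3 ==> x = 0" and G_m3: "x : G (-3) ==> x = 0" by (rule G_other, assumption, simp)+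
lemma G1_0: "x : G 1 ==> (!!y. y : G (-1) ==> B x y = 0) ==> x = 0" by (rule G_eqI[of x 1]) auto
lemma Gm1_0: "x : G (-1) ==> (!!y. y : G 1 ==> B x y = 0) ==> x = 0" by (rule G_eqI[of x "-1"]) auto
lemma G0_0: "x : G 0 ==> (!!y. y : G 0 ==> B x y = 0) ==> x = 0" by (rule G_eqI[of x 0]) auto

lemma e_G1: "x : G 1 ==> br e x = 0" using G_br[OF eG, of x 1] G_3 by simp
lemma f_Gm1: "x : G (-1) ==> br f x = 0" using G_br[OF fG, of x "-1"] G_m3 by simp
lemma f_G1: "x : G 1 ==> br f x : G (-1)" using G_br[OF fG, of x 1] by simp
lemma e_Gm1: "x : G (-1) ==> br e x : G 1" using G_br[OF eG, of x "-1"] by simp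
lemma ef_G1: "x : G 1 ==> br e (br f x) = x" using h_act[of x] e_G1[of x] by (simp add: GD brs)
lemma fe_Gm1: "x : G (-1) ==> br f (br e x) = x" using h_act[of x] f_Gm1[of x] by (simp add: GD brs)
lemma e_G0: "x : G 0 ==> br e x = (- B x h) *s e"
proof -
 assume x: "x : G 0"
 have "br e x = B (br e x) f *s e" by (rule G_2) (use G_br[OF eG x] in simp)
 moreover have "B (br e x) f = - B x h" by (simp add: B_inv2 h_def)
 ultimately show ?thesis by simp
qed
lemma f_G0: "x : G 0 ==> br f x = B x h *s f"
proof -
 assume x: "x : G 0"
 have "br f x = B (br f x) e *s f" by (rule G_m2) (use G_br[OF fG x] in simp)
 moreover have "B (br f x) e = B x h" by (simp add: B_inv2 fe bs)
 ultimately show ?thesis by simp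
qed
lemma G1_G1: "x : G 1 ==> y : G 1 ==> br x y = B (br x y) f *s e" using G_2[of "br x y"] G_br[of x 1 y 1] by simp
lemma Gm1_Gm1: "x : G (-1) ==> y : G (-1) ==> br x y = B (br x y) e *s f" using G_m2[of "br x y"] G_br[of x "-1" y "-1"] by simp

subsection \<open>Normal forms under the unipotent radical\<close>

text \<open>No component of weight 1 and none along h: these are the components that the
  exponentials of G (-1) and of f can clear as soon as B x f ~= 0.\<close>

definition slice :: "'g => bool" where
 "slice x \<longleftrightarrow> (ALL y:G (-1). B x y = 0) & B x h = 0"

lemma ex_Gm1_f: "y : G (-1) ==> ex y t f = f" using ex_nilp[of 1 y f t] f_Gm1[of y] anti[of f y] by simp
lemma ex_Gm1_Gm1: assumes "y : G (-1)" "z : G (-1)" shows "ex y t z = z + (t * B (br y z) e) *s f"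
proof -
 have "br y f = 0" using f_Gm1[of y] anti[of f y] assms by simp
 hence "(br y ^^ 2) z = 0" using Gm1_Gm1[OF assms] by (simp add: numeral_2_eq_2) (metis br_scale_r scale_zero_right)
 from ex_nilp[OF this, of t] have "ex y t z = z + t *s br y z" by (simp add: numeral_2_eq_2)
 thus ?thesis using Gm1_Gm1[OF assms] by (metis scale_scale)
qed
lemma ex_Gm1_h: assumes "y : G (-1)" shows "ex y t h = h + t *s y"
proof -
 have "br y h = y" using GD[OF assms] anti[of h y] by simp
 hence "(br y ^^ 2) h = 0" by (simp add: numeral_2_eq_2 brs)
 from ex_nilp[OF this, of t] show ?thesis using \<open>br y h = y\<close> by (simp add: numeral_2_eq_2)
qed
lemma ex_f_Gm1: "y : G (-1) ==> ex f t y = y" using ex_nilp[of 1 f y t] f_Gm1[of y] by simp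
lemma ex_f_h: "ex f t h = h + (2 * t) *s f"
proof -
 have "(br f ^^ 2) h = 0" by (simp add: numeral_2_eq_2 fh brs)
 from ex_nilp[OF this, of t] show ?thesis by (simp add: numeral_2_eq_2 fh)
qed
lemma ex_f_f: "ex f t f = f" using ex_nilp[of 1 f f t] by (simp add: brs)

lemma coords_ex:
 assumes y: "y : G (-1)"
 shows "B (ex y 1 x) f = B x f"
  and "z : G (-1) ==> B (ex y 1 x) z = B x z - B (br y z) e * B x f"
  and "B (ex y 1 x) h = B x h - B x y" using y by (simp_all add: B_ex ex_Gm1_f ex_Gm1_Gm1 ex_Gm1_h bs)
lemma coords_f:
 shows "B (ex f s x) f = B x f" and "z : G (-1) ==> B (ex f s x) z = B x z"
  and "B (ex f s x) h = B x h - 2 * s * B x f" by (simp_all add: B_ex ex_f_f ex_f_Gm1 ex_f_h bs)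

lemma normal_form:
 assumes C: "B x f ~= 0"
 shows "EX y:G (-1). EX s. slice (ex f s (ex y 1 x)) & B (ex f s (ex y 1 x)) f = B x f"
proof -
 \<comment> \<open>exp(ad y) changes B x z by -B [y,z] e * B x f; this y makes the change cancel B x
   z for every z in G (-1).\<close>
 define y where "y = (1 / B x f) *s br f (p1 x)"
 have y: "y : G (-1)" unfolding y_def by (intro subspace_scale subspace_G f_G1 p1G)
 \<comment> \<open>exp(s ad f) lowers the pairing with h by 2 s B x f.\<close>
 define s where "s = B (ex y 1 x) h / (2 * B x f)"
 have "B (br y z) e * B x f = B x z" if z: "z : G (-1)" for z
 proof -
  have "B (br (br f (p1 x)) z) e = - B (br f (p1 x)) (br e z)" using anti[of z e] by (simp add: B_inv bs)
  also have "\<dots> = B (p1 x) (br f (br e z))" by (simp add: B_inv2)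
  also have "\<dots> = B (p1 x) z" using z by (simp add: fe_Gm1)
  also have "\<dots> = B x z" using G_orth[OF eG z] G_orth[OF fG z] G_orth[OF pmG z] G_orth[OF p0G z]
   by (subst (2) decomp[of x]) (simp add: bs)
  finally show ?thesis using C by (simp add: y_def brs bs)
 qed
 hence "slice (ex f s (ex y 1 x))" using y C by (simp add: slice_def coords_f coords_ex s_def)
 thus ?thesis using y by (intro bexI[of _ y] exI[of _ s]) (simp_all add: coords_f coords_ex)
qed

lemma slice_decomp: "slice x ==> x = B x f *s e + p0 x + pm x + B x e *s f"
proof -
 assume s: "slice x"
 have "p1 x = 0"
 proof (rule G1_0[OF p1G])
  fix z assume z: "z : G (-1)"
  have "B x z = B (p1 x) z" using G_orth[OF eG z] G_orth[OF fG z] G_orth[OF pmG z] G_orth[OF p0G z]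
   by (subst (1) decomp[of x]) (simp add: bs)
  thus "B (p1 x) z = 0" using s z by (simp add: slice_def)
 qed
 thus ?thesis using decomp[of x] by simp
qed
lemma p0_h: "B (p0 x) h = B x h" using G_orth[OF p1G hG, of x] G_orth[OF pmG hG, of x] by (subst (2) decomp[of x]) (simp add: bs Bs)

text \<open>Evaluate the extremal identity at f: on a slice both sides are explicit, and what
  remains is a relation among the parts of weights 0, -1 and -2.\<close>

lemma slice_extremal: assumes s: "slice x" and E: "x : E0" and C: "B x f ~= 0" shows "x = B x f *s e"
proof -
 let ?C = "B x f" and ?d = "B x e"
 have ph: "B (p0 x) h = 0" using s by (simp add: p0_h slice_def)
 have x: "x = ?C *s e + p0 x + pm x + ?d *s f" by (rule slice_decomp[OF s])
 have xf: "br x f = ?C *s h"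
 proof -
  have "br (p0 x) f = 0" using f_G0[OF p0G, of x] anti[of f "p0 x"] ph by simp
  moreover have "br (pm x) f = 0" using f_Gm1[OF pmG, of x] anti[of f "pm x"] by simp
  ultimately show ?thesis by (subst x) (simp add: brs h_def)
 qed
 have "br x h = (- 2 * ?C) *s e + pm x + (2 * ?d) *s f" using GD[OF p0G, of x] GD[OF pmG, of x] anti[of h "p0 x"] anti[of h "pm x"] eh fh
  by (subst x) (simp add: brs mult.commute)
 hence "br x (br x f) = ?C *s ((- 2 * ?C) *s e + pm x + (2 * ?d) *s f)" by (simp add: xf brs)
 moreover have "br x (br x f) = (- 2 * ?C) *s x" using E0D[OF E, of f] by simp
 ultimately have "?C *s ((- 2 * ?C) *s e + pm x + (2 * ?d) *s f) = ?C *s ((-2) *s x)" by (simp add: mult.commute)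
 hence "(- 2 * ?C) *s e + pm x + (2 * ?d) *s f = (-2) *s x" using C by (simp only: scale_cancel_left) simp
 hence 1: "2 *s p0 x + 3 *s pm x + (4 * ?d) *s f = 0"
  by (subst (asm) (3) x) (rule comb1[where k = 1], assumption, simp add: lfs algebra_simps)
 \<comment> \<open>Applying ad h twice separates the three weights, so each part vanishes.\<close>
 have hh: "br h (2 *s p0 x + 3 *s pm x + (4 * ?d) *s f) = (-3) *s pm x + (-8 * ?d) *s f"
  using GD[OF p0G, of x] GD[OF pmG, of x] hf by (simp add: brs)
 hence 2: "(-3) *s pm x + (-8 * ?d) *s f = 0" using 1 by (simp add: brs)
 have "br h ((-3) *s pm x + (-8 * ?d) *s f) = 3 *s pm x + (16 * ?d) *s f" using GD[OF pmG, of x] hf by (simp add: brs)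
 hence 3: "3 *s pm x + (16 * ?d) *s f = 0" unfolding 2 by (simp add: brs)
 have "(8 * ?d) *s f = 0" by (rule comb2[OF 2 3, where k = 1 and k' = 1]) (simp add: lfs algebra_simps)
 hence d: "?d = 0" using f0 by simp
 hence "pm x = 0" "p0 x = 0" using 1 3 by auto
 thus ?thesis using x d by simp
qed

end

section \<open>Dimension of varieties\<close>

subsection \<open>Zariski topologies\<close>

lemma generated_algebra_off: "f : generated_algebra X G ==> x ~: X ==> f x = 0"
 by (induction rule: generated_algebra.induct) (auto simp: restr_def)
lemma generated_algebra_restr: "f : generated_algebra X G ==> restr X f = f" using generated_algebra_off by (fastforce simp: restr_def)

lemma sum_function_apply: "(\<Sum>i\<in>I. F i) y = (\<Sum>i\<in>I. (F i y :: complex))"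
 by (induction I rule: infinite_finite_induct) simp_all

definition locus :: "'x set => ('x => complex) set => 'x set" where
 "locus Y F = {x:Y. ALL f:F. f x = 0}"
lemma mem_locus: "x : locus Y F \<longleftrightarrow> x : Y & (ALL f:F. f x = 0)" by (simp add: locus_def)

text \<open>Stated for an arbitrary function set so that the same dimension arguments serve subsets
  of g with polynomials and X with its own ring.\<close>

definition zero_loci :: "'x topology => 'x set => ('x => complex) set => bool" where
 "zero_loci T Y R \<longleftrightarrow> (ALL C. closedin T C \<longleftrightarrow> (\<exists>F\<subseteq>R. C = locus Y F))"

lemma zero_lociD: "zero_loci T Y R ==> closedin T C ==> EX F. F \<subseteq> R & C = locus Y F"
 and zero_lociI: "zero_loci T Y R ==> F \<subseteq> R ==> closedin T (locus Y F)" by (auto simp: zero_loci_def)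

text \<open>Everywhere defined functions under pointwise operations; elements of
  \<open>generated_algebra\<close> vanish off X, which would force \<open>restr\<close> into every
  computation.\<close>

definition function_algebra :: "('x => complex) set => bool" where
 "function_algebra R \<longleftrightarrow> (ALL c. (%_. c) : R) &
  (ALL f:R. ALL g:R. (%x. f x + g x) : R & (%x. f x * g x) : R)"

lemma fa_const: "function_algebra R ==> (%_. c) : R"
 and fa_add: "function_algebra R ==> f : R ==> g : R ==> (%x. f x + g x) : R"
 and fa_mult: "function_algebra R ==> f : R ==> g : R ==> (%x. f x * g x) : R" by (auto simp: function_algebra_def)
lemma fa_cmult: "function_algebra R ==> f : R ==> (%x. c * f x) : R" using fa_mult[of R "%_. c" f] fa_const by blast
lemma fa_diff: "function_algebra R ==> f : R ==> g : R ==> (%x. f x - g x) : R"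
 using fa_add[of R f "%x. (-1) * g x"] fa_cmult[of R g "-1"] by simp
lemma fa_pow: "function_algebra R ==> f : R ==> (%x. f x ^ n) : R" by (induction n) (simp_all add: fa_const fa_mult)
lemma fa_sum: "function_algebra R ==> (!!i. i : I ==> f i : R) ==> (%x. \<Sum>i\<in>I. f i x) : R"
 by (induction I rule: infinite_finite_induct) (simp_all add: fa_const fa_add)
lemma function_algebra_generated: "function_algebra {g. restr X g : generated_algebra X G}" unfolding function_algebra_def
proof (intro conjI allI ballI)
 show "(%_. c) : {g. restr X g : generated_algebra X G}" for c using generated_algebra.const by auto
 fix f g assume "f : {g. restr X g : generated_algebra X G}" "g : {g. restr X g : generated_algebra X G}"
 moreover have "restr X (%x. f x + g x) = restr X f + restr X g" "restr X (%x. f x * g x) = restr X f * restr X g"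
  by (auto simp: restr_def)
 ultimately show "(%x. f x + g x) : {g. restr X g : generated_algebra X G}"
  "(%x. f x * g x) : {g. restr X g : generated_algebra X G}" using generated_algebra.add generated_algebra.mult by auto
qed

lemma zero_loci_zariski: "zero_loci (zariski X (generated_algebra X G)) X {g. restr X g : generated_algebra X G}"
proof -
 let ?A = "generated_algebra X G" and ?R = "{g. restr X g : generated_algebra X G}"
 let ?S = "{{x : X. f x ~= 0} | f. f : ?A}"
 define W where "W F = {x:X. EX f:F. f x ~= 0}" for F :: "('a => complex) set"
 have memW: "x : W F \<longleftrightarrow> x : X & (EX f:F. f x ~= 0)" for x F by (simp add: W_def)
 have op: "\<exists>F\<subseteq>?A. U = W F" if "generate_topology_on ?S U" for U using that
 proof (induction rule: generate_topology_on.induct)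
  case Empty
  have "{} = W {}" by (simp add: W_def)
  thus ?case by auto
 next
  case (Int a b)
  then obtain F H where F: "F \<subseteq> ?A" "a = W F" and H: "H \<subseteq> ?A" "b = W H" by metis
  let ?P = "(%(f, g). f * g) ` (F \<times> H)"
  have "a \<inter> b = W ?P" by (rule Set.set_eqI) (simp add: F H memW, metis)
  moreover have "?P \<subseteq> ?A" using F(1) H(1) by (auto intro!: generated_algebra.mult)
  ultimately show ?case by metis
 next
  case (UN K)
  then obtain F where F: "!!k. k : K ==> F k \<subseteq> ?A & k = W (F k)" by metis
  have "x : \<Union>K \<longleftrightarrow> x : W (\<Union>k\<in>K. F k)" for x
  proof -
   have "x : \<Union>K \<longleftrightarrow> (EX k:K. x : W (F k))" using F by simp
   thus ?thesis by (auto simp: memW)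
  qed
  hence "\<Union>K = W (\<Union>k\<in>K. F k)" by auto
  moreover have "(\<Union>k\<in>K. F k) \<subseteq> ?A" using F by auto
  ultimately show ?case by metis
 next
  case (Basis s)
  then obtain f where f: "f : ?A" "s = {x:X. f x ~= 0}" by auto
  hence "s = W {f}" by (simp add: W_def)
  thus ?case using f(1) by auto
 qed
 have op2: "openin (zariski X ?A) U \<longleftrightarrow> (\<exists>F\<subseteq>?A. U = W F)" for U
 proof
  assume "openin (zariski X ?A) U" thus "\<exists>F\<subseteq>?A. U = W F"
   using op by (simp add: zariski_def openin_topology_generated_by_iff)
 next
  assume "\<exists>F\<subseteq>?A. U = W F"
  then obtain F where F: "F \<subseteq> ?A" "U = W F" by metis
  have "U = \<Union>((%f. {x:X. f x ~= 0}) ` F)" unfolding F(2) W_def by auto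
  moreover have "generate_topology_on ?S (\<Union>((%f. {x:X. f x ~= 0}) ` F))"
  proof (rule generate_topology_on.UN)
   fix k assume "k : (%f. {x:X. f x ~= 0}) ` F"
   hence "k : ?S" using F(1) by auto
   thus "generate_topology_on ?S k" by (rule generate_topology_on.Basis)
  qed
  ultimately show "openin (zariski X ?A) U" by (simp add: zariski_def openin_topology_generated_by_iff)
 qed
 have one: "restr X (%_. 1) : ?A" by (rule generated_algebra.const)
 have top: "topspace (zariski X ?A) = X"
 proof -
  have "X = W {restr X (%_. 1)}" by (auto simp: W_def restr_def)
  hence "openin (zariski X ?A) X" unfolding op2 using one by auto
  moreover obtain F where "topspace (zariski X ?A) = W F" using op2[of "topspace (zariski X ?A)"] by auto
  hence "topspace (zariski X ?A) \<subseteq> X" by (auto simp: W_def)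
  ultimately show ?thesis using openin_subset by auto
 qed
 show ?thesis unfolding zero_loci_def closedin_def top op2
 proof (intro allI iffI)
  fix C assume C: "C \<subseteq> X & (\<exists>F\<subseteq>?A. X - C = W F)"
  then obtain F where F: "F \<subseteq> ?A" "X - C = W F" by metis
  have "F \<subseteq> ?R" using F(1) generated_algebra_restr by fastforce
  moreover have "C = X - W F" using C F(2) by auto
  hence "C = locus X F" by (auto simp: W_def mem_locus)
  ultimately show "\<exists>F\<subseteq>?R. C = locus X F" by auto
 next
  fix C assume "\<exists>F\<subseteq>?R. C = locus X F"
  then obtain F where F: "F \<subseteq> ?R" "C = locus X F" by metis
  have "X - C = W (restr X ` F)" unfolding F(2) by (auto simp: W_def restr_def mem_locus)
  moreover have "restr X ` F \<subseteq> ?A" using F(1) by auto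
  moreover have "C \<subseteq> X" using F(2) by (auto simp: mem_locus)
  ultimately show "C \<subseteq> X & (\<exists>F\<subseteq>?A. X - C = W F)" by auto
 qed
qed

lemma zero_loci_subtopology:
 assumes "zero_loci T X R" "Y \<subseteq> X" shows "zero_loci (subtopology T Y) Y R" unfolding zero_loci_def closedin_subtopology
proof (intro allI iffI)
 fix C assume "EX U. closedin T U & C = U \<inter> Y"
 then obtain U where U: "closedin T U" "C = U \<inter> Y" by metis
 then obtain F where F: "F \<subseteq> R" "U = locus X F" using zero_lociD[OF assms(1)] by metis
 hence "C = locus Y F" using assms(2) U(2) by (auto simp: mem_locus)
 thus "\<exists>F\<subseteq>R. C = locus Y F" using F(1) by metis
next
 fix C assume "\<exists>F\<subseteq>R. C = locus Y F"
 then obtain F where F: "F \<subseteq> R" "C = locus Y F" by metis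
 hence "C = locus X F \<inter> Y" using assms(2) by (auto simp: mem_locus)
 moreover have "closedin T (locus X F)" using zero_lociI[OF assms(1) F(1)] .
 ultimately show "EX U. closedin T U & C = U \<inter> Y" by metis
qed

text \<open>Irreducibility of the closure of a nonempty S, expressed by functions only: those in R
  that vanish on S form a prime ideal.\<close>

definition prime_on :: "('x => complex) set => 'x set => bool" where
 "prime_on R S \<longleftrightarrow> (ALL f:R. ALL g:R. (ALL x:S. f x * g x = 0) --> (ALL x:S. f x = 0) \<or> (ALL x:S. g x = 0))"

lemma irreducible_prime_on:
 assumes zl: "zero_loci T Y R" and Z: "closedin T Z" "irreducible_subset T Z" shows "prime_on R Z" unfolding prime_on_def
proof (intro ballI impI)
 fix f g assume fg: "f : R" "g : R" "ALL x:Z. f x * g x = 0"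
 have ZY: "Z \<subseteq> Y" using Z(1) zl unfolding zero_loci_def by (auto simp: mem_locus)
 have cl: "closedin T {x:Y. f x = 0}" if "f : R" for f
 proof -
  have "{x:Y. f x = 0} = locus Y {f}" "{f} \<subseteq> R" using that by (auto simp: mem_locus)
  thus ?thesis using zero_lociI[OF zl] by simp
 qed
 have "Z \<subseteq> {x:Y. f x = 0} \<union> {x:Y. g x = 0}" using fg(3) ZY by auto
 hence "Z \<subseteq> {x:Y. f x = 0} \<or> Z \<subseteq> {x:Y. g x = 0}"
  using Z(2)[unfolded irreducible_subset_def] cl[OF fg(1)] cl[OF fg(2)] by simp
 thus "(ALL x:Z. f x = 0) \<or> (ALL x:Z. g x = 0)" by blast
qed

subsection \<open>Lower bounds\<close>

text \<open>The sets S i need not be closed. A product vanishing on S i has a factor that does,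
  which makes the zero locus of the functions vanishing on S i irreducible; the separating functions
  make the inclusions strict.\<close>

lemma krull_dim_lower:
 assumes fa: "function_algebra R" and zl: "zero_loci T Y R"
  and S: "!!i. i \<le> n ==> S i ~= {} & S i \<subseteq> Y & prime_on R (S i)"
  and inc: "!!i. i < n ==> S i \<subseteq> S (Suc i)"
  and sep: "!!i. i < n ==> EX f:R. (ALL x:S i. f x = 0) & (EX x:S (Suc i). f x ~= 0)"
 shows "enat n \<le> krull_dim T"
proof -
 define I where "I i = {f:R. ALL x:S i. f x = 0}" for i
 define Z where "Z i = locus Y (I i)" for i
 have SZ: "S i \<subseteq> Z i" if "i \<le> n" for i using S[OF that] by (auto simp: Z_def I_def mem_locus)
 have cl: "closedin T (Z i)" for i unfolding Z_def by (rule zero_lociI[OF zl]) (auto simp: I_def)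
 have irr: "irreducible_subset T (Z i)" if i: "i \<le> n" for i unfolding irreducible_subset_def
 proof (intro conjI allI impI)
  show "Z i ~= {}" using S[OF i] SZ[OF i] by blast
  fix C D assume CD: "closedin T C & closedin T D & Z i \<subseteq> C \<union> D"
  obtain F where F: "F \<subseteq> R" "C = locus Y F" using zero_lociD[OF zl conjunct1[OF CD]] by metis
  obtain H where H: "H \<subseteq> R" "D = locus Y H" using zero_lociD[OF zl conjunct1[OF conjunct2[OF CD]]] by metis
  show "Z i \<subseteq> C \<or> Z i \<subseteq> D"
  proof (rule ccontr)
   assume "\<not> (Z i \<subseteq> C \<or> Z i \<subseteq> D)"
   then obtain x y where x: "x : Z i" "x ~: C" and y: "y : Z i" "y ~: D" by blast
   obtain f where f: "f : F" "f x ~= 0" using x F by (auto simp: Z_def mem_locus)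
   obtain g where g: "g : H" "g y ~= 0" using y H by (auto simp: Z_def mem_locus)
   have fR: "f : R" "g : R" using f g F H by auto
   have "f s * g s = 0" if s: "s : S i" for s
   proof -
    have "s : C \<union> D" using SZ[OF i] s CD by blast
    thus ?thesis using F H f g by (auto simp: mem_locus)
   qed
   hence "(ALL s:S i. f s = 0) \<or> (ALL s:S i. g s = 0)"
    using conjunct2[OF conjunct2[OF S[OF i]], unfolded prime_on_def, rule_format, OF fR] by simp
   hence "f : I i \<or> g : I i" using fR by (auto simp: I_def)
   thus False using x y f g by (auto simp: Z_def mem_locus)
  qed
 qed
 have st: "Z i \<subset> Z (Suc i)" if i: "i < n" for i
 proof -
  obtain f x where f: "f : R" "ALL x:S i. f x = 0" "x : S (Suc i)" "f x ~= 0" using sep[OF i] by blast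
  have "I (Suc i) \<subseteq> I i" using inc[OF i] by (auto simp: I_def)
  hence "Z i \<subseteq> Z (Suc i)" by (auto simp: Z_def mem_locus subset_iff)
  moreover have "x : Z (Suc i)" using SZ[of "Suc i"] i f by auto
  moreover have "x ~: Z i" using f by (auto simp: Z_def I_def mem_locus)
  ultimately show ?thesis by blast
 qed
 have "enat n : {enat n | n. EX Z :: nat => 'a set.
  (ALL i<=n. closedin T (Z i) & irreducible_subset T (Z i)) & (ALL i<n. Z i \<subset> Z (Suc i))}"
  by (intro CollectI exI[of _ n] conjI refl exI[of _ Z] allI impI cl irr st)
 thus ?thesis unfolding krull_dim_def by (rule Sup_upper)
qed

subsection \<open>Upper bounds\<close>

interpretation fs: vector_space "fun_scale :: complex => ('b => complex) => 'b => complex" by (rule vector_space_fun_scale)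

text \<open>A chain of irreducible closed sets of length \<open>n\<close> produces \<open>n\<close> algebraically independent
 functions: the \<open>i\<close>-th one vanishes on the \<open>i\<close>-th set of the chain but not on the next one.\<close>

primrec chain_monom :: "(nat => 'x => complex) => nat list => 'x => complex" where
 "chain_monom f [] x = 1"
| "chain_monom f (k # ks) x = f (length ks) x ^ k * chain_monom f ks x"

definition exps :: "nat => nat => nat list set" where
 "exps K n = {ks. set ks \<subseteq> {..<K} & length ks = n}"

lemma finite_exps: "finite (exps K n)" and card_exps: "card (exps K n) = K ^ n"
 using finite_lists_length_eq[of "{..<K}" n] card_lists_length_eq[of "{..<K}" n] by (auto simp: exps_def)

lemma sum_exps_Suc: "(\<Sum>ks\<in>exps K (Suc n). g ks) = (\<Sum>k<K. \<Sum>ks\<in>exps K n. (g (k # ks) :: complex))"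
proof -
 have "exps K (Suc n) = (%p. fst p # snd p) ` ({..<K} \<times> exps K n)" by (force simp: exps_def length_Suc_conv image_iff)
 moreover have "inj_on (%p. fst p # snd p) ({..<K} \<times> exps K n)" by (auto simp: inj_on_def)
 ultimately have "(\<Sum>ks\<in>exps K (Suc n). g ks) = (\<Sum>p\<in>{..<K} \<times> exps K n. g (fst p # snd p))"
  by (simp only: sum.reindex comp_def)
 thus ?thesis by (simp add: sum.cartesian_product case_prod_beta)
qed

lemma chain_monom_in: "function_algebra R ==> (!!i. i < length ks ==> f i : R) ==> chain_monom f ks : R"
proof (induction ks)
 case (Cons k ks)
 have "chain_monom f (k # ks) = (%x. f (length ks) x ^ k * chain_monom f ks x)" by auto
 thus ?case using Cons by (simp add: fa_mult fa_pow)
next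
 case Nil
 have "chain_monom f [] = (%_. 1)" by auto
 thus ?case using fa_const[OF Nil.prems(1)] by simp
qed

text \<open>Order a relation by powers of the last function f n. The lowest power cancels because Z
  (n + 1) is irreducible and f n is not zero there; restricted to Z n, where f n vanishes, its
  coefficient is a relation among fewer functions.\<close>

lemma chain_independent:
 assumes fa: "function_algebra R"
  and "!!i. i < n ==> f i : R"
  and "!!i. i < n ==> Z i \<subseteq> Z (Suc i)" "!!i. i \<le> n ==> prime_on R (Z i)" "Z 0 ~= {}"
  and "!!i. i < n ==> (ALL x:Z i. f i x = 0) & (EX x:Z (Suc i). f i x ~= 0)"
  and "!!x. x : Z n ==> (\<Sum>ks\<in>exps K n. c ks * chain_monom f ks x) = 0"
  and "ks : exps K n"
 shows "c ks = 0" using assms(2-)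
proof (induction n arbitrary: c ks)
 case 0
 then obtain x where "x : Z 0" by blast
 moreover have "exps K 0 = {[]}" by (auto simp: exps_def)
 ultimately show ?case using 0 by auto
next
 case (Suc n)
 define Q where "Q k x = (\<Sum>ks\<in>exps K n. c (k # ks) * chain_monom f ks x)" for k x
 have QR: "Q k : R" for k unfolding Q_def[abs_def]
  by (intro fa_sum[OF fa] fa_cmult[OF fa] chain_monom_in[OF fa]) (use Suc.prems(1) in \<open>auto simp: exps_def\<close>)
 have e: "(\<Sum>ks\<in>exps K (Suc n). c ks * chain_monom f ks x) = (\<Sum>k<K. f n x ^ k * Q k x)" for x
  unfolding sum_exps_Suc Q_def sum_distrib_left by (intro sum.cong refl) (auto simp: exps_def)
 have c0: "ALL ks:exps K n. c (k # ks) = 0" if "k < K" for k using that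
 proof (induction k rule: less_induct)
  case (less k)
  have Qz: "Q j x = 0" if "j < k" for j x using less that unfolding Q_def by auto
  define r where "r x = (\<Sum>j\<in>{Suc k..<K}. f n x ^ (j - Suc k) * Q j x)" for x
  have rR: "r : R" unfolding r_def[abs_def] by (intro fa_sum[OF fa] fa_mult[OF fa] fa_pow[OF fa] QR) (use Suc.prems(1) in auto)
  have sp: "(\<Sum>j<K. f n x ^ j * Q j x) = f n x ^ k * (Q k x + f n x * r x)" for x
  proof -
   have "(\<Sum>j<K. f n x ^ j * Q j x) = (\<Sum>j<k. f n x ^ j * Q j x) + (\<Sum>j\<in>{k..<K}. f n x ^ j * Q j x)"
    using sum.atLeastLessThan_concat[of 0 k K "%j. f n x ^ j * Q j x"] less.prems by (simp add: atLeast0LessThan)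
   also have "(\<Sum>j\<in>{k..<K}. f n x ^ j * Q j x) = f n x ^ k * Q k x + (\<Sum>j\<in>{Suc k..<K}. f n x ^ j * Q j x)"
    using less.prems by (rule sum.atLeast_Suc_lessThan)
   also have "(\<Sum>j<k. f n x ^ j * Q j x) = 0" using Qz by simp
   also have "(\<Sum>j\<in>{Suc k..<K}. f n x ^ j * Q j x) = f n x ^ k * (f n x * r x)" unfolding r_def sum_distrib_left
   proof (rule sum.cong[OF refl])
    fix j assume "j : {Suc k..<K}"
    hence "f n x ^ j = f n x ^ Suc k * f n x ^ (j - Suc k)" by (subst power_add[symmetric]) simp
    thus "f n x ^ j * Q j x = f n x ^ k * (f n x * (f n x ^ (j - Suc k) * Q j x))" by auto
   qed
   finally show ?thesis by (simp add: distrib_left)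
  qed
  let ?g = "%x. Q k x + f n x * r x"
  have fnR: "f n : R" using Suc.prems(1) by simp
  have gR: "?g : R" by (intro fa_add[OF fa] fa_mult[OF fa] QR rR fnR)
  have pr: "prime_on R (Z (Suc n))" using Suc.prems(3) by simp
  have z: "f n x ^ k * ?g x = 0" if "x : Z (Suc n)" for x using Suc.prems(6)[OF that] sp[of x] unfolding e by simp
  have "(ALL x:Z (Suc n). f n x ^ k = 0) \<or> (ALL x:Z (Suc n). ?g x = 0)"
   using pr[unfolded prime_on_def, rule_format, OF fa_pow[OF fa fnR, of k] gR] z by simp
  hence "ALL x:Z (Suc n). ?g x = 0" using Suc.prems(5)[of n] by auto
  hence "Q k x = 0" if "x : Z n" for x
  proof -
   have "x : Z (Suc n)" "f n x = 0" using that Suc.prems(2)[of n] Suc.prems(5)[of n] by auto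
   thus ?thesis using \<open>ALL x:Z (Suc n). ?g x = 0\<close> by force
  qed
  hence Q0: "(\<Sum>ks\<in>exps K n. c (k # ks) * chain_monom f ks x) = 0" if "x : Z n" for x using that by (simp only: Q_def)
  show ?case
  proof
   fix ks assume ks: "ks : exps K n"
   show "c (k # ks) = 0"
   proof (rule Suc.IH[of "%ks. c (k # ks)" ks])
    show "f i : R" "Z i \<subseteq> Z (Suc i)" "(ALL x:Z i. f i x = 0) & (EX x:Z (Suc i). f i x ~= 0)" if "i < n" for i
     using Suc.prems(1,2,5)[of i] that by auto
    show "prime_on R (Z i)" if "i \<le> n" for i using Suc.prems(3) that by simp
    show "Z 0 ~= {}" by (rule Suc.prems(4))
    show "(\<Sum>ks\<in>exps K n. c (k # ks) * chain_monom f ks x) = 0" if "x : Z n" for x by (rule Q0[OF that])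
    show "ks : exps K n" by (rule ks)
   qed
  qed
 qed
 obtain k ks' where "ks = k # ks'" "k < K" "ks' : exps K n" using Suc.prems(7) by (auto simp: exps_def length_Suc_conv)
 thus ?case using c0 by blast
qed

section \<open>Polynomials of bounded degree in given coordinates, and the counting bound\<close>

context
 fixes Y :: "'x set" and x :: "nat => 'x => complex" and r :: nat
begin

definition pmon :: "(nat => nat) => 'x => complex" where
 "pmon k = restr Y (%y. \<Prod>i<r. x i y ^ k i)"
text \<open>Functions agreeing on Y with a polynomial in the r coordinates x i. The bound D is on
  each exponent separately, so at most (D + 1)^r monomials have to be counted.\<close>

definition pol :: "nat => ('x => complex) set" where
 "pol D = {g. restr Y g : fs.span (pmon ` (PiE {..<r} (%_. {..D})))}"

lemma restr_restr: "restr Y (restr Y g) = restr Y g" by (auto simp: restr_def)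
lemma pol_cong: "g : pol D ==> (!!y. y : Y ==> g' y = g y) ==> g' : pol D"
proof -
 assume "g : pol D" "!!y. y : Y ==> g' y = g y"
 moreover hence "restr Y g' = restr Y g" by (auto simp: restr_def)
 ultimately show ?thesis by (simp add: pol_def)
qed
lemma pol_add: "g : pol D ==> g' : pol D ==> (%y. g y + g' y) : pol D"
proof -
 have "restr Y (%y. g y + g' y) = restr Y g + restr Y g'" by (auto simp: restr_def)
 thus "g : pol D ==> g' : pol D ==> ?thesis" by (simp add: pol_def fs.span_add)
qed
lemma pol_scale: "g : pol D ==> (%y. c * g y) : pol D"
proof -
 have "restr Y (%y. c * g y) = fun_scale c (restr Y g)" by (auto simp: restr_def fun_scale_def)
 thus "g : pol D ==> ?thesis" by (simp add: pol_def fs.span_scale)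
qed
lemma pmon_pol: "k : PiE {..<r} (%_. {..D}) ==> pmon k : pol D"
proof -
 assume k: "k : PiE {..<r} (%_. {..D})"
 have "restr Y (pmon k) = pmon k" by (simp only: pmon_def restr_restr)
 moreover have "pmon k : fs.span (pmon ` (PiE {..<r} (%_. {..D})))" by (rule fs.span_base[OF imageI[OF k]])
 ultimately show ?thesis by (simp only: pol_def mem_Collect_eq)
qed
lemma pol_1: "(%_. 1) : pol D" by (rule pol_cong[OF pmon_pol[of "\<lambda>i\<in>{..<r}. 0"]]) (auto simp: pmon_def restr_def)
lemma pol_const: "(%_. c) : pol D" using pol_scale[OF pol_1, of c] by simp
lemma pol_x: "i < r ==> x i : pol 1"
proof (rule pol_cong[OF pmon_pol[of "\<lambda>j\<in>{..<r}. if j = i then 1 else 0"]])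
 assume i: "i < r"
 fix y assume "y : Y"
 have "(\<Prod>j<r. x j y ^ (\<lambda>j\<in>{..<r}. if j = i then 1 else 0) j) = (\<Prod>j<r. if j = i then x i y else 1)" by (rule prod.cong) auto
 thus "x i y = pmon (\<lambda>j\<in>{..<r}. if j = i then 1 else 0) y" using i \<open>y : Y\<close> by (simp add: pmon_def restr_def)
qed auto
lemma pol_span_induct [consumes 1, case_names cong zero step]:
 assumes g: "g : pol D" and P: "!!g g'. (!!y. y : Y ==> g' y = g y) ==> P g ==> P g'" "P (%_. 0)"
  "!!c k g. k : PiE {..<r} (%_. {..D}) ==> P g ==> P (%y. c * pmon k y + g y)"
 shows "P g"
proof -
 have "restr Y g : fs.span (pmon ` (PiE {..<r} (%_. {..D})))" using g by (simp add: pol_def)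
 hence "P (restr Y g)"
 proof (induction rule: fs.span_induct_alt)
  case base thus ?case using P(2) by simp
 next
  case (step c m g)
  then obtain k where "k : PiE {..<r} (%_. {..D})" "m = pmon k" by blast
  thus ?case using P(3)[of k g c] step by (simp add: fun_scale_def)
 qed
 thus ?thesis by (rule P(1)[rotated]) (simp add: restr_def)
qed
lemma pol_mult: assumes g: "g : pol D" and g': "g' : pol D'" shows "(%y. g y * g' y) : pol (D + D')"
proof -
 have mm: "(%y. pmon k y * pmon l y) : pol (D + D')"
  if "k : PiE {..<r} (%_. {..D})" "l : PiE {..<r} (%_. {..D'})" for k l
 proof (rule pol_cong[OF pmon_pol[of "\<lambda>i\<in>{..<r}. k i + l i"]])
  show "(\<lambda>i\<in>{..<r}. k i + l i) : PiE {..<r} (%_. {..D + D'})" using that by (auto simp: PiE_iff add_mono)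
  show "pmon k y * pmon l y = pmon (\<lambda>i\<in>{..<r}. k i + l i) y" if "y : Y" for y
   by (simp add: pmon_def restr_def power_add prod.distrib)
 qed
 have m1: "(%y. pmon k y * g' y) : pol (D + D')" if k: "k : PiE {..<r} (%_. {..D})" for k using g'
 proof (induction rule: pol_span_induct)
  case (cong g g') thus ?case by (auto intro: pol_cong)
 next
  case zero thus ?case using pol_const[of 0] by simp
 next
  case (step c l g)
  thus ?case using pol_add[OF pol_scale[OF mm[OF k], of l c] step(2)] by (simp add: algebra_simps)
 qed
 show ?thesis using g
 proof (induction rule: pol_span_induct)
  case (cong g g') thus ?case by (auto intro: pol_cong)
 next
  case zero thus ?case using pol_const[of 0] by simp
 next
  case (step c k g)
  thus ?case using pol_add[OF pol_scale[OF m1, of k c] step(2)] by (simp add: algebra_simps)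
 qed
qed
lemma pol_mono: "g : pol D ==> D \<le> D' ==> g : pol D'" using pol_mult[of g D "%_. 1" "D' - D"] pol_1 by simp
lemma pol_pow: "g : pol D ==> (%y. g y ^ n) : pol (n * D)"
proof (induction n)
 case 0 thus ?case using pol_1 by simp
next
 case (Suc n) thus ?case using pol_mult[of g D "%y. g y ^ n" "n * D"] by simp
qed

text \<open>One power of dl clears all monomials with exponents below K, and the degree of the
  result grows linearly in K; the comparison of growth rates rests on this.\<close>

lemma chain_monom_pol:
 assumes f: "!!i. i < length ks ==> (%y. dl y ^ a * f i y) : pol d" and dl: "dl : pol d"
  and ks: "set ks \<subseteq> {..<K}"
 shows "(%y. dl y ^ (a * K * length ks) * chain_monom f ks y) : pol (length ks * K * (d + a * d))" using f ks
proof (induction ks)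
 case Nil thus ?case using pol_1 by simp
next
 case (Cons k ks)
 have k: "k < K" using Cons.prems by simp
 have IH: "(%y. dl y ^ (a * K * length ks) * chain_monom f ks y) : pol (length ks * K * (d + a * d))" using Cons by simp
 have 1: "(%y. (dl y ^ a * f (length ks) y) ^ k) : pol (k * d)" using pol_pow[OF Cons.prems(1)[of "length ks"]] by simp
 have 2: "(%y. dl y ^ (a * (K - k))) : pol (a * (K - k) * d)" using pol_pow[OF dl] by simp
 have 3: "k * d + a * (K - k) * d + length ks * K * (d + a * d) \<le> length (k # ks) * K * (d + a * d)"
 proof -
  have "k * d \<le> K * d" using k by simp
  moreover have "a * (K - k) * d \<le> a * K * d" by simp
  moreover have "length (k # ks) * K * (d + a * d) = K * d + a * K * d + length ks * K * (d + a * d)" by (simp add: algebra_simps)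
  ultimately show ?thesis by linarith
 qed
 have m: "(%y. (dl y ^ a * f (length ks) y) ^ k * dl y ^ (a * (K - k)) * (dl y ^ (a * K * length ks) * chain_monom f ks y))
  : pol (length (k # ks) * K * (d + a * d))" by (rule pol_mono[OF pol_mult[OF pol_mult[OF 1 2] IH] 3])
 show ?case
 proof (rule pol_cong[OF m])
  fix y
  have "a * K * length (k # ks) = a * k + a * (K - k) + a * K * length ks" using k by (simp add: distrib_left[symmetric])
  thus "dl y ^ (a * K * length (k # ks)) * chain_monom f (k # ks) y =
   (dl y ^ a * f (length ks) y) ^ k * dl y ^ (a * (K - k)) * (dl y ^ (a * K * length ks) * chain_monom f ks y)"
   by (simp add: power_add power_mult_distrib power_mult mult.assoc)
 qed
qed

text \<open>A chain of length n yields K^n independent products, which after clearing denominators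
  lie in a space with at most (M K + 1)^r generators, M independent of K. Growth in K forces n \<le>
  r.\<close>

lemma krull_dim_upper:
 assumes fa: "function_algebra R" and zl: "zero_loci T Y R"
  and dl: "dl : R" "dl : pol d"
  and canc: "!!f. f : R ==> (!!y. y : Y ==> dl y * f y = 0) ==> (!!y. y : Y ==> f y = 0)"
  and den: "!!f. f : R ==> EX a d. (%y. dl y ^ a * f y) : pol d"
 shows "krull_dim T \<le> enat r" unfolding krull_dim_def
proof (rule Sup_least, safe)
 fix n and Z :: "nat => 'x set"
 assume Z: "ALL i<=n. closedin T (Z i) & irreducible_subset T (Z i)" "ALL i<n. Z i \<subset> Z (Suc i)"
 have "EX f:R. (ALL y:Z i. f y = 0) & (EX y:Z (Suc i). f y ~= 0)" if i: "i < n" for i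
 proof -
  have "closedin T (Z i)" "closedin T (Z (Suc i))" using Z(1) i by auto
  then obtain F H where F: "F \<subseteq> R" "Z i = locus Y F" and H: "Z (Suc i) = locus Y H" using zero_lociD[OF zl] by metis
  obtain y where y: "y : Z (Suc i)" "y ~: Z i" using Z(2) i by blast
  have "y : Y" using y(1) H by (simp add: mem_locus)
  then obtain f where "f : F" "f y ~= 0" using y(2) F(2) by (auto simp: mem_locus)
  moreover have "ALL y:Z i. f y = 0" using F(2) \<open>f : F\<close> by (simp add: mem_locus)
  ultimately show ?thesis using y(1) F(1) by blast
 qed
 then obtain f where f: "!!i. i < n ==> f i : R" "!!i. i < n ==> (ALL y:Z i. f i y = 0) & (EX y:Z (Suc i). f i y ~= 0)" by metis
 have pr: "prime_on R (Z i)" if "i \<le> n" for i using irreducible_prime_on[OF zl] Z(1) that by blast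
 have Z0: "Z 0 ~= {}" using Z(1) by (auto simp: irreducible_subset_def)
 have ZY: "Z n \<subseteq> Y"
 proof -
  have "closedin T (Z n)" using Z(1) by auto
  then obtain F where "Z n = locus Y F" using zero_lociD[OF zl] by metis
  thus ?thesis by (auto simp: mem_locus)
 qed
 have "EX a d. (%y. dl y ^ a * f i y) : pol d" if "i < n" for i using den f that by blast
 then obtain a' d' where ad: "!!i. i < n ==> (%y. dl y ^ a' i * f i y) : pol (d' i)" by metis
 define a where "a = (\<Sum>i<n. a' i)"
 define D where "D = d + (\<Sum>i<n. d' i) + a * d"
 have ai: "a' i \<le> a" "d' i \<le> (\<Sum>i<n. d' i)" if "i < n" for i unfolding a_def using that by (auto intro: member_le_sum)
 have fD: "(%y. dl y ^ a * f i y) : pol D" if i: "i < n" for i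
 proof -
  have "(%y. dl y ^ (a - a' i) * (dl y ^ a' i * f i y)) : pol ((a - a' i) * d + d' i)" by (rule pol_mult[OF pol_pow[OF dl(2)] ad[OF i]])
  moreover have "(a - a' i) * d + d' i \<le> D"
  proof -
   have "(a - a' i) * d \<le> a * d" by simp
   thus ?thesis using ai(2)[OF i] unfolding D_def by linarith
  qed
  ultimately have "(%y. dl y ^ (a - a' i) * (dl y ^ a' i * f i y)) : pol D" by (rule pol_mono)
  thus ?thesis using ai(1)[OF i] by (simp add: mult.assoc[symmetric] power_add[symmetric])
 qed
 have dlD: "dl : pol D" by (rule pol_mono[OF dl(2)]) (simp add: D_def)
 have cancpow: "h y = 0" if "h : R" "!!y. y : Y ==> dl y ^ N * h y = 0" "y : Y" for N h y using that(2)
 proof (induction N)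
  case 0 thus ?case using that(3) by simp
 next
  case (Suc N)
  have "(%y. dl y ^ N * h y) : R" by (intro fa_mult[OF fa] fa_pow[OF fa] dl that)
  hence "dl y ^ N * h y = 0" if "y : Y" for y by (rule canc[OF _ _ that]) (use Suc.prems in \<open>simp add: mult.assoc\<close>)
  thus ?case using Suc.IH by blast
 qed
 define M where "M = n * (D + a * D)"
 have bound: "K ^ n \<le> (M * K + 1) ^ r" for K
 proof -
  define G where "G ks = restr Y (%y. dl y ^ (a * K * n) * chain_monom f ks y)" for ks
  have ind: "c ks = 0" if "(\<Sum>ks\<in>exps K n. fun_scale (c ks) (G ks)) = 0" "ks : exps K n" for c ks
  proof -
   have e: "(\<Sum>ks\<in>exps K n. fun_scale (c ks) (G ks)) y = dl y ^ (a * K * n) * (\<Sum>ks\<in>exps K n. c ks * chain_monom f ks y)"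
    if "y : Y" for y using that by (simp add: sum_function_apply G_def restr_def fun_scale_def sum_distrib_left mult.left_commute)
   have "(%y. \<Sum>ks\<in>exps K n. c ks * chain_monom f ks y) : R"
    by (intro fa_sum[OF fa] fa_cmult[OF fa] chain_monom_in[OF fa]) (use f in \<open>auto simp: exps_def\<close>)
   note R = this
   have z0: "(\<Sum>ks\<in>exps K n. c ks * chain_monom f ks y) = 0" if y: "y : Z n" for y
   proof (rule cancpow[where N = "a * K * n", OF R])
    show "dl y ^ (a * K * n) * (\<Sum>ks\<in>exps K n. c ks * chain_monom f ks y) = 0" if "y : Y" for y
     using e[OF that] \<open>(\<Sum>ks\<in>exps K n. fun_scale (c ks) (G ks)) = 0\<close> by simp
    show "y : Y" using y ZY by auto
   qed
   show ?thesis
   proof (rule chain_independent[where f = f and Z = Z and K = K and n = n and R = R, OF fa])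
    show "f i : R" "(ALL x:Z i. f i x = 0) & (EX x:Z (Suc i). f i x ~= 0)" if "i < n" for i by (rule f(1)[OF that], rule f(2)[OF that])
    show "Z i \<subseteq> Z (Suc i)" if "i < n" for i using Z(2) that by auto
    show "prime_on R (Z i)" if "i \<le> n" for i by (rule pr[OF that])
    show "Z 0 ~= {}" by (rule Z0)
    show "(\<Sum>ks\<in>exps K n. c ks * chain_monom f ks y) = 0" if "y : Z n" for y by (rule z0[OF that])
    show "ks : exps K n" by fact
   qed
  qed
  have inj: "inj_on G (exps K n)"
  proof (rule inj_onI, rule ccontr)
   fix ks ls assume kl: "ks : exps K n" "ls : exps K n" "G ks = G ls" "ks ~= ls"
   let ?c = "%m. (if m = ks then 1 else 0) - (if m = ls then 1 else (0::complex))"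
   have "fun_scale (?c m) (G m) = (if m = ks then G m else 0) - (if m = ls then G m else 0)" for m
    by simp
   hence "(\<Sum>m\<in>exps K n. fun_scale (?c m) (G m)) = G ks - G ls" using kl finite_exps[of K n] by (simp add: sum_subtractf)
   hence "?c ks = 0" by (intro ind kl(1)) (simp add: kl(3))
   thus False using kl(4) by simp
  qed
  have "fs.independent (G ` exps K n)"
  proof (rule fs.independent_if_scalars_zero)
   show "finite (G ` exps K n)" by (rule finite_imageI[OF finite_exps])
   fix c v assume v: "(\<Sum>v\<in>G ` exps K n. fun_scale (c v) v) = 0" "v : G ` exps K n"
   hence "(\<Sum>ks\<in>exps K n. fun_scale (c (G ks)) (G ks)) = 0" by (simp add: sum.reindex[OF inj])
   hence "c (G ks) = 0" if "ks : exps K n" for ks using that by (rule ind)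
   thus "c v = 0" using v(2) by auto
  qed
  moreover have "G ` exps K n \<subseteq> fs.span (pmon ` (PiE {..<r} (%_. {..M * K})))"
  proof safe
   fix ks assume ks: "ks : exps K n"
   have l: "length ks = n" "set ks \<subseteq> {..<K}" using ks by (auto simp: exps_def)
   have "(%y. dl y ^ (a * K * length ks) * chain_monom f ks y) : pol (length ks * K * (D + a * D))"
    by (rule chain_monom_pol) (use fD dlD l in auto)
   thus "G ks : fs.span (pmon ` (PiE {..<r} (%_. {..M * K})))"
    using l by (simp add: pol_def G_def M_def mult.assoc mult.commute)
  qed
  ultimately have "card (G ` exps K n) \<le> card (pmon ` (PiE {..<r} (%_. {..M * K})))"
   using fs.independent_span_bound[of "pmon ` (PiE {..<r} (%_. {..M * K}))"] finite_PiE[of "{..<r}" "%_. {..M * K}"] by blast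
  also have "\<dots> \<le> card (PiE {..<r} (%_. {..M * K}))" by (intro card_image_le finite_PiE) auto
  also have "\<dots> = (M * K + 1) ^ r" by (simp add: card_PiE)
  finally show ?thesis using card_image[OF inj] card_exps[of K n] by simp
 qed
 have "n \<le> r"
 proof (rule ccontr)
  assume "\<not> n \<le> r"
  hence n: "Suc r \<le> n" by simp
  \<comment> \<open>If r < n, then K^(r+1) \<le> ((M+1) K)^r, that is K \<le> (M+1)^r; this K is one
    too large.\<close>
  define K where "K = (M + 1) ^ r + 1"
  have K1: "K \<ge> 1" by (simp add: K_def)
  have "K ^ Suc r \<le> K ^ n" using n K1 by (intro power_increasing) auto
  also have "\<dots> \<le> (M * K + 1) ^ r" by (rule bound)
  also have "\<dots> \<le> ((M + 1) * K) ^ r" using K1 by (intro power_mono) auto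
  also have "\<dots> = (M + 1) ^ r * K ^ r" by (rule power_mult_distrib)
  finally have "K * K ^ r \<le> (M + 1) ^ r * K ^ r" by simp
  hence "K \<le> (M + 1) ^ r" by auto
  thus False by (simp add: K_def)
 qed
 thus "enat n \<le> enat r" by simp
qed

end

lemma holomorphic_mult_eq_0:
 fixes f g :: "complex => complex"
 assumes U: "open U" "connected U" and f: "f holomorphic_on U" and g: "g holomorphic_on U"
  and z: "!!t. t : U ==> f t * g t = 0" and s: "s : U" "f s ~= 0" and t: "t : U"
 shows "g t = 0"
proof -
 have c: "continuous_on U f" using f by (rule holomorphic_on_imp_continuous_on)
 have op: "open (f -` (- {0}) \<inter> U)" using continuous_on_open_vimage[OF U(1), of f] c by auto
 show ?thesis by (rule analytic_continuation_open[OF op U(1) _ U(2) _ g holomorphic_on_const _ t])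
   (use s z in auto)
qed

text \<open>If f p and g q are nonzero but f g = 0 on S, restrict both to a holomorphic curve in S
  from p to q: the identity theorem on the connected domain kills g.\<close>

lemma prime_on_curves:
 fixes R :: "('y => complex) set"
 assumes "!!p q. p : S ==> q : S ==> EX ga U. open U & connected U & (0::complex) : U & 1 : U & ga 0 = p & ga 1 = q
  & (ALL s:U. ga s : S) & (ALL f:R. (%s. f (ga s)) holomorphic_on U)"
 shows "prime_on R S" unfolding prime_on_def
proof (intro ballI impI, rule ccontr)
 fix f g assume fg: "f : R" "g : R" "ALL x:S. f x * g x = 0" "\<not> ((ALL x:S. f x = 0) \<or> (ALL x:S. g x = 0))"
 then obtain p q where p: "p : S" "f p ~= 0" and q: "q : S" "g q ~= 0" by auto
 obtain ga U where U: "open U" "connected U" "0 : U" "1 : U" "ga 0 = p" "ga 1 = q" "ALL s:U. ga s : S"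
  "ALL f:R. (%s. f (ga s)) holomorphic_on U" using assms[OF p(1) q(1)] by auto
 have "g (ga 1) = 0" by (rule holomorphic_mult_eq_0[of U "%s. f (ga s)" "%s. g (ga s)" 0 1]) (use U fg p in simp_all)
 thus False using U q by simp
qed

lemma connected_nonzero_affine: "(a::complex) ~= 0 ==> connected {t. a + t * b ~= 0}" "open {t::complex. a + t * b ~= 0}"
proof -
 show op: "open {t::complex. a + t * b ~= 0}" by (intro open_Collect_neq continuous_intros)
 assume a: "a ~= 0"
 show "connected {t. a + t * b ~= 0}"
 proof (cases "b = 0")
  case True thus ?thesis by auto
 next
  case False
  have "{t. a + t * b ~= 0} = UNIV - {- a / b}" using False by (auto simp: add_eq_0_iff2)
  thus ?thesis using connected_open_delete[of "UNIV :: complex set" "- a / b"] by auto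
 qed
qed

lemma connected_nonzero_affine2:
 assumes "(a::complex) ~= 0" "a' ~= 0"
 shows "connected ({t. a + t * b ~= 0} \<inter> {t. a' + t * b' ~= 0})"
proof (cases "b' = 0")
 case True thus ?thesis using assms connected_nonzero_affine by simp
next
 case False
 have "{t. a + t * b ~= 0} \<inter> {t. a' + t * b' ~= 0} = {t. a + t * b ~= 0} - {- a' / b'}"
  using False by (auto simp: add_eq_0_iff2)
 thus ?thesis using connected_open_delete[OF connected_nonzero_affine(2) connected_nonzero_affine(1)[OF assms(1)], of b "- a' / b'"] by simp
qed

text \<open>A parametrised family \<open>T\<close> carrying \<open>r\<close> coordinate functions, the first of which does not
 vanish, contains a flag of \<open>r + 1\<close> irreducible sets.\<close>

locale coordinate_family =
 fixes T :: "(nat => complex) => 'y" and R :: "('y => complex) set" and r :: nat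
 assumes fa: "function_algebra R"
  and r: "r \<ge> 1"
  and hol: "!!f c d. f : R ==> (%t. f (T (%i. c i + t * d i))) holomorphic_on {t. c 0 + t * d 0 ~= 0}"
  and coord: "!!i. i < r ==> EX g:R. ALL c. c 0 ~= 0 --> g (T c) = c i"
begin

text \<open>Coordinate 0 may not vanish, so the smallest member is the single point with c 0 = 1;
  from index 1 on, the first i coordinates vary with c 0 ~= 0. This gives r strict
  inclusions.\<close>

definition flag :: "nat => 'y set" where
 "flag i = (if i = 0 then {T (%j. if j = 0 then 1 else 0)} else T ` {c. c 0 ~= 0 & (ALL j>=i. c j = 0)})"

lemma flag_nonempty: "flag i ~= {}"
proof -
 have "T (%j. if j = 0 then 1 else 0) : flag i" by (cases "i = 0") (auto simp: flag_def intro!: imageI)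
 thus ?thesis by auto
qed
lemma flag_inc: "flag i \<subseteq> flag (Suc i)" by (auto simp: flag_def)
lemma flag_prime: "prime_on R (flag i)"
proof (cases "i = 0")
 case True thus ?thesis by (auto simp: prime_on_def flag_def)
next
 case False
 show ?thesis
 proof (rule prime_on_curves)
  fix p q assume "p : flag i" "q : flag i"
  then obtain c d where c: "p = T c" "c 0 ~= 0" "ALL j>=i. c j = 0" and d: "q = T d" "d 0 ~= 0" "ALL j>=i. d j = 0"
   using False by (auto simp: flag_def)
  let ?ga = "%t. T (%j. c j + t * (d j - c j))" and ?U = "{t. c 0 + t * (d 0 - c 0) ~= 0}"
  have "open ?U & connected ?U & (0::complex) : ?U & 1 : ?U & ?ga 0 = p & ?ga 1 = q
  & (ALL s:?U. ?ga s : flag i) & (ALL f:R. (%s. f (?ga s)) holomorphic_on ?U)"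
   by (use connected_nonzero_affine(2) connected_nonzero_affine(1) c(2) c d flag_def hol in \<open>fastforce\<close>)
  thus "EX ga U. open U & connected U & (0::complex) : U & 1 : U & ga 0 = p & ga 1 = q
  & (ALL s:U. ga s : flag i) & (ALL f:R. (%s. f (ga s)) holomorphic_on U)" by (intro exI)
 qed
qed
lemma flag_sep: assumes "i < r" shows "EX f:R. (ALL x:flag i. f x = 0) & (EX x:flag (Suc i). f x ~= 0)"
proof -
 obtain g where g: "g : R" "!!c. c 0 ~= 0 ==> g (T c) = c i" using coord[OF assms] by auto
 show ?thesis
 proof (cases "i = 0")
  case True
  let ?c = "%j. if j = 0 then 2 else 0 :: complex"
  have "(%x. g x - 1) : R" by (intro fa_diff[OF fa] fa_const[OF fa] g(1))
  moreover have "ALL x:flag i. g x - 1 = 0" using g(2) True by (auto simp: flag_def)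
  moreover have "T ?c : flag (Suc i)" using True by (auto simp: flag_def)
  moreover have "g (T ?c) - 1 ~= 0" using g(2)[of ?c] by simp
  ultimately show ?thesis by (intro bexI[of _ "%x. g x - 1"] conjI bexI[of _ "T ?c"])
 next
  case False
  let ?c = "%j. if j = 0 \<or> j = i then 1 else 0 :: complex"
  have "ALL x:flag i. g x = 0" using g(2) False by (auto simp: flag_def)
  moreover have "T ?c : flag (Suc i)" by (auto simp: flag_def)
  moreover have "g (T ?c) ~= 0" using g(2)[of ?c] by simp
  ultimately show ?thesis using g(1) by auto
 qed
qed

lemma krull_dim_ge:
 assumes "zero_loci Top Y R" "!!c. c 0 ~= 0 ==> T c : Y" shows "enat r \<le> krull_dim Top"
proof (rule krull_dim_lower[OF fa assms(1), where S = flag])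
 show "flag i ~= {} & flag i \<subseteq> Y & prime_on R (flag i)" for i using flag_nonempty flag_prime assms(2) by (auto simp: flag_def)
qed (use flag_inc flag_sep in auto)

end

section \<open>The orbit of extremal elements\<close>

context lie_alg begin

text \<open>With Q the polynomials, the holomorphic functions or the functions in some
  \<open>pol D\<close>, this covers polynomial maps, holomorphic curves and maps polynomial in
  coordinates at once.\<close>

definition vec_in :: "('p => complex) set => ('p => 'g) => bool" where
 "vec_in Q ga \<longleftrightarrow> (ALL l. lf l --> (%p. l (ga p)) : Q)"

lemma vec_in_const: "function_algebra Q ==> vec_in Q (%_. c)" by (simp add: vec_in_def fa_const)
lemma vec_in_add: "function_algebra Q ==> vec_in Q ga ==> vec_in Q dl ==> vec_in Q (%p. ga p + dl p)" by (simp add: vec_in_def lfs fa_add)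
lemma vec_in_scale: "function_algebra Q ==> g : Q ==> vec_in Q ga ==> vec_in Q (%p. g p *s ga p)" by (simp add: vec_in_def lfs fa_mult)
lemma vec_in_sum: "function_algebra Q ==> (!!i. i : I ==> vec_in Q (ga i)) ==> vec_in Q (%p. \<Sum>i\<in>I. ga i p)"
 by (induction I rule: infinite_finite_induct) (simp_all add: vec_in_const vec_in_add)
lemma vec_in_le: "le T ==> vec_in Q ga ==> vec_in Q (%p. T (ga p))" unfolding vec_in_def using lf_comp by blast
lemma vec_in_br: assumes Q: "function_algebra Q" "vec_in Q ga" "vec_in Q dl" shows "vec_in Q (%p. br (ga p) (dl p))" unfolding vec_in_def
proof (intro allI impI)
 fix l assume l: "lf l"
 show "(%p. l (br (ga p) (dl p))) : Q" unfolding lf_bilin_expand[OF l, of "ga _" "dl _"]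
  using Q(2,3)[unfolded vec_in_def, rule_format, OF lf_co] by (intro fa_sum[OF Q(1)] fa_mult[OF Q(1)] fa_const[OF Q(1)])
qed
lemma vec_in_pow: "function_algebra Q ==> vec_in Q ga ==> vec_in Q dl ==> vec_in Q (%p. (br (ga p) ^^ k) (dl p))"
 by (induction k) (simp_all add: vec_in_br)
lemma fa_holomorphic: "function_algebra {g. g holomorphic_on U}" by (auto simp: function_algebra_def intro!: holomorphic_intros)
lemma vec_in_vhol: "vec_in {g. g holomorphic_on U} ga \<longleftrightarrow> vhol ga U" by (simp add: vec_in_def vhol_def)

abbreviation "Rg \<equiv> coordinate_ring smul UNIV"

lemma Rg_induct [consumes 1, case_names const gen add mult]:
 assumes "P : Rg" "!!c. Q (%_. c)" "!!l. lf l ==> Q l"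
  "!!f g. f : Rg ==> Q f ==> g : Rg ==> Q g ==> Q (%x. f x + g x)" "!!f g. f : Rg ==> Q f ==> g : Rg ==> Q g ==> Q (%x. f x * g x)"
 shows "Q P" using assms(1) unfolding coordinate_ring_def
proof (induction rule: generated_algebra.induct)
 case (const c) thus ?case using assms(2) by (simp add: restr_def)
next
 case (gen f) thus ?case using assms(3) by (simp add: restr_def)
next
 case (add f h) thus ?case using assms(4)[of f h] by (simp add: coordinate_ring_def)
next
 case (mult f h) thus ?case using assms(5)[of f h] by (simp add: coordinate_ring_def)
qed
lemma restr_UNIV: "restr UNIV f = f" by (simp add: restr_def)
lemma fa_Rg: "function_algebra Rg" using function_algebra_generated[of UNIV "{l. lf l}"] by (simp add: coordinate_ring_def restr_UNIV)
lemma lf_Rg: "lf l ==> l : Rg" using generated_algebra.gen[of l "{l. lf l}" UNIV] by (simp add: coordinate_ring_def restr_UNIV)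
lemma vec_in_id: "vec_in Rg (%x. x)" by (simp add: vec_in_def lf_Rg)
lemma zero_loci_Rg: "zero_loci (zariski_space smul) UNIV Rg"
 using zero_loci_zariski[of UNIV "{l. lf l}"] by (simp add: coordinate_ring_def restr_UNIV)

lemma Rg_vec_in: assumes "P : Rg" "function_algebra Q" "vec_in Q ga" shows "(%p. P (ga p)) : Q"
 using assms(1) by (induction rule: Rg_induct) (use assms(2,3) in \<open>auto simp: fa_const fa_add fa_mult vec_in_def\<close>)
lemma Rg_vhol: "P : Rg ==> vhol ga U ==> (%t. P (ga t)) holomorphic_on U"
 using Rg_vec_in[OF _ fa_holomorphic, of P U ga] by (simp add: vec_in_vhol)

text \<open>A power of dl clears the denominators that P acquires on ga / dl.\<close>

lemma Rg_fraction:
 assumes "P : Rg" and Q: "function_algebra Q" "vec_in Q ga" "dl : Q"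
 shows "EX K. EX q:Q. ALL p. dl p ~= 0 --> dl p ^ K * P ((1 / dl p) *s ga p) = q p" using assms(1)
proof (induction rule: Rg_induct)
 case (const c) thus ?case using fa_const[OF Q(1), of c] by (intro exI[of _ 0] bexI[of _ "%_. c"]) auto
next
 case (gen l)
 hence "(%p. l (ga p)) : Q" using Q(2) by (simp add: vec_in_def)
 thus ?case using gen by (intro exI[of _ 1] bexI[of _ "%p. l (ga p)"]) (auto simp: lfs)
next
 case (add f g)
 then obtain K q K' q' where q: "q : Q" "!!p. dl p ~= 0 ==> dl p ^ K * f ((1 / dl p) *s ga p) = q p"
  "q' : Q" "!!p. dl p ~= 0 ==> dl p ^ K' * g ((1 / dl p) *s ga p) = q' p" by metis
 have "(%p. dl p ^ K' * q p + dl p ^ K * q' p) : Q" by (intro fa_add[OF Q(1)] fa_mult[OF Q(1)] fa_pow[OF Q(1)] Q(3) q(1,3))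
 moreover have "dl p ^ (K + K') * (f ((1 / dl p) *s ga p) + g ((1 / dl p) *s ga p)) = dl p ^ K' * q p + dl p ^ K * q' p" if "dl p ~= 0" for p
  using q(2)[OF that, symmetric] q(4)[OF that, symmetric] by (simp add: power_add algebra_simps)
 ultimately show ?case by (intro exI[of _ "K + K'"] bexI[of _ "%p. dl p ^ K' * q p + dl p ^ K * q' p"]) auto
next
 case (mult f g)
 then obtain K q K' q' where q: "q : Q" "!!p. dl p ~= 0 ==> dl p ^ K * f ((1 / dl p) *s ga p) = q p"
  "q' : Q" "!!p. dl p ~= 0 ==> dl p ^ K' * g ((1 / dl p) *s ga p) = q' p" by metis
 have "(%p. q p * q' p) : Q" by (intro fa_mult[OF Q(1)] q(1,3))
 moreover have "dl p ^ (K + K') * (f ((1 / dl p) *s ga p) * g ((1 / dl p) *s ga p)) = q p * q' p" if "dl p ~= 0" for p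
  using q(2)[OF that, symmetric] q(4)[OF that, symmetric] by (simp add: power_add)
 ultimately show ?case by (intro exI[of _ "K + K'"] bexI[of _ "%p. q p * q' p"]) auto
qed

end

section \<open>Charts of the orbit from exponentials of negative weight\<close>

context triple begin

definition wb :: "'g list" where
 "wb = (SOME ws. distinct ws & independent (set ws) & span (set ws) = G (-1))"
lemma wb: "distinct wb" "independent (set wb)" "span (set wb) = G (-1)"
proof -
 obtain Bs where Bs: "Bs \<subseteq> G (-1)" "independent Bs" "G (-1) = span Bs" using basis_subspace_exists[OF subspace_G] by metis
 obtain ws where ws: "set ws = Bs" "distinct ws" using finite_distinct_list[OF finiteI_independent[OF Bs(2)]] by blast
 have "distinct wb & independent (set wb) & span (set wb) = G (-1)" unfolding wb_def by (rule someI[of _ ws]) (use Bs ws in auto)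
 thus "distinct wb" "independent (set wb)" "span (set wb) = G (-1)" by auto
qed
definition mw where "mw = length wb"
definition rk where "rk = mw + 2"
text \<open>The pairings with f, a basis of G (-1) and h are the coordinates on E; index 0 is the
  one that must not vanish.\<close>

definition ws where "ws = f # wb @ [h]"
lemma wbG: "k < mw ==> wb ! k : G (-1)" using wb(3) span_base[of "wb ! k" "set wb"] by (simp add: mw_def)
lemma ws_nth: "ws ! 0 = f" "k < mw ==> ws ! Suc k = wb ! k" "ws ! Suc mw = h" by (simp_all add: ws_def nth_append mw_def)
lemma Gm1_span: "d : G (-1) ==> (!!k. k < mw ==> l (wb ! k) = 0) ==> lf l ==> l d = 0"
proof -
 assume d: "d : G (-1)" and z: "!!k. k < mw ==> l (wb ! k) = 0" and l: "lf l"
 have zz: "l b = 0" if "b : set wb" for b using that z by (metis in_set_conv_nth mw_def)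
 have "d : span (set wb)" using d wb(3) by simp
 thus "l d = 0" by (induction rule: span_induct_alt) (simp_all add: lfs[OF l] zz)
qed

lemma dual_basis: assumes j: "j < mw" shows "EX u:G (-1). ALL k<mw. B u (br e (wb ! k)) = (if k = j then 1 else 0)"
proof -
 interpret vp: vector_space_pair smul smul by unfold_locales
 interpret vq: vector_space_pair smul "(*) :: complex => complex => complex" by unfold_locales
 have inj: "inj_on (br e) (G (-1))"
 proof (rule inj_onI)
  fix x y assume "x : G (-1)" "y : G (-1)" "br e x = br e y"
  thus "x = y" by (metis fe_Gm1)
 qed
 have ind: "independent (br e ` set wb)" by (rule vp.linear_independent_injective_image[OF le_br wb(2)]) (use inj wb(3) in simp)
 obtain l where l: "lf l" "ALL v:br e ` set wb. l v = (if v = br e (wb ! j) then 1 else 0)"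
  using vq.linear_independent_extend[OF ind, of "%v. if v = br e (wb ! j) then 1 else 0"] by blast
 obtain z where z: "!!y. l y = B z y" using B_representing[OF l(1)] by blast
 have "B (pm z) (br e (wb ! k)) = (if k = j then 1 else 0)" if k: "k < mw" for k
 proof -
  have G: "br e (wb ! k) : G 1" by (rule e_Gm1[OF wbG[OF k]])
  have "B z (br e (wb ! k)) = B (pm z) (br e (wb ! k))"
   using G_orth[OF eG G] G_orth[OF fG G] G_orth[OF p1G G, of z] G_orth[OF p0G G, of z] by (subst decomp[of z]) (simp add: bs)
  moreover have "wb ! k : set wb" "wb ! j : set wb" using k j by (auto simp: mw_def)
  hence "br e (wb ! k) = br e (wb ! j) \<longleftrightarrow> k = j"
   using inj_onD[OF inj _ wbG[OF k] wbG[OF j]] nth_eq_iff_index_eq[OF wb(1)] k j by (auto simp: mw_def)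
  ultimately show ?thesis using l(2) z \<open>wb ! k : set wb\<close> by (metis (no_types, lifting) imageI)
 qed
 thus ?thesis using pmG by blast
qed
definition ub where "ub j = (SOME u. u : G (-1) & (ALL k<mw. B u (br e (wb ! k)) = (if k = j then 1 else 0)))"
lemma ub: "j < mw ==> ub j : G (-1)" "j < mw ==> k < mw ==> B (ub j) (br e (wb ! k)) = (if k = j then 1 else 0)"
proof -
 assume j: "j < mw"
 have "ub j : G (-1) & (ALL k<mw. B (ub j) (br e (wb ! k)) = (if k = j then 1 else 0))"
  unfolding ub_def by (rule someI_ex) (use dual_basis[OF j] in blast)
 thus "ub j : G (-1)" "k < mw ==> B (ub j) (br e (wb ! k)) = (if k = j then 1 else 0)" by auto
qed
text \<open>The element of G (-1) whose exponential, after division by c 0, produces the middle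
  coordinates c 1, ..., c mw; \<open>ub\<close> is dual to \<open>wb\<close> for this
  purpose.\<close>

definition yv :: "(nat => complex) => 'g" where "yv c = (\<Sum>j<mw. c (Suc j) *s ub j)"
lemma yvG: "yv c : G (-1)" unfolding yv_def by (intro subspace_sum subspace_scale subspace_G ub) auto
lemma swap_e: "B (br y w) e = - B y (br e w)" using anti[of e w] by (simp add: B_inv bs)
lemma yv_pair: "k < mw ==> B (br (yv c) (wb ! k)) e = - c (Suc k)"
proof -
 assume k: "k < mw"
 have "B (yv c) (br e (wb ! k)) = (\<Sum>j<mw. c (Suc j) * (if k = j then 1 else 0))"
  unfolding yv_def lf_sum[OF B_lf2] by (rule sum.cong) (auto simp: bs ub k)
 also have "\<dots> = c (Suc k)" using k by (simp add: if_distrib[of "%x. _ * x"] cong: if_cong)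
 finally show ?thesis by (simp add: swap_e)
qed
lemma Gm1_eqI: assumes "d : G (-1)" "!!k. k < mw ==> B (br d (wb ! k)) e = 0" shows "d = 0"
proof (rule Gm1_0[OF assms(1)])
 fix y assume y: "y : G 1"
 have "- B d (br e (br f y)) = 0" by (rule Gm1_span[OF f_G1[OF y], of "%w. - B d (br e w)"])
   (use assms(2) swap_e in \<open>auto simp: lf_iff brs bs\<close>)
 thus "B d y = 0" using ef_G1[OF y] by simp
qed

text \<open>Inverse of \<open>normal_form\<close>: it starts from a slice point N with B N f = 1 and
  undoes the two exponentials. N = e parametrises E, other N the larger orbits.\<close>

definition chart :: "'g => (nat => complex) => 'g" where
 "chart N c = ex (yv c) (1 / c 0) (ex f (- c (Suc mw) / (2 * c 0)) (c 0 *s N))"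
text \<open>c 0 ^ 7 times the chart. Since ad y has fifth power 0 and ad f third power 0, the chart
  contains c 0 to the powers 1 - k - j with k \<le> 4 and j \<le> 2, so the exponent 8 - k - j never
  truncates.\<close>

definition chart_poly :: "'g => (nat => complex) => 'g" where
 "chart_poly N c = (\<Sum>k<5. \<Sum>j<3. (c 0 ^ (8 - k - j) * (- c (Suc mw) / 2) ^ j / (fact k * fact j)) *s (br (yv c) ^^ k) ((br f ^^ j) N))"

lemma chart_coords:
 assumes N: "slice N" "B N f = 1" and c: "c 0 ~= 0" and i: "i < rk"
 shows "B (chart N c) (ws ! i) = c i"
proof -
 let ?y = "(1 / c 0) *s yv c"
 have y: "?y : G (-1)" by (intro subspace_scale subspace_G yvG)
 define x where "x = ex f (- c (Suc mw) / (2 * c 0)) (c 0 *s N)"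
 have ch: "chart N c = ex ?y 1 x" by (simp add: chart_def ex_scaleD x_def)
 have x: "B x f = c 0" "z : G (-1) ==> B x z = 0" "B x h = c (Suc mw)" for z using N c by (simp_all add: x_def coords_f bs slice_def)
 consider "i = 0" | k where "i = Suc k" "k < mw" | "i = Suc mw" using i by (cases i) (auto simp: rk_def less_Suc_eq)
 thus ?thesis
 proof cases
  case 1 thus ?thesis by (simp add: ch ws_nth coords_ex[OF y] x)
 next
  case 2
  have "B (br ?y (wb ! k)) e = - c (Suc k) / c 0" using yv_pair[OF 2(2), of c] by (simp add: brs bs)
  thus ?thesis using 2 c wbG[OF 2(2)] by (simp add: ch ws_nth coords_ex[OF y] x)
 next
  case 3 thus ?thesis using x(2)[OF y] by (simp add: ch ws_nth coords_ex[OF y] x(3))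
 qed
qed

text \<open>On E the normal form of x is \<open>B x f *s e\<close> by \<open>slice_extremal\<close>.
  The exponents that lead to it are determined by the coordinates of x, so the chart rebuilds
  x.\<close>

lemma chart_inverse:
 assumes x: "x : E" and C: "B x f ~= 0" shows "chart e (%i. B x (ws ! i)) = x"
proof -
 obtain y s where ys: "y : G (-1)" "slice (ex f s (ex y 1 x))" "B (ex f s (ex y 1 x)) f = B x f" using normal_form[OF C] by blast
 have "ex f s (ex y 1 x) = B x f *s e" using slice_extremal[OF ys(2)] ys(3) C E0_ex E_E0[OF x] by simp
 hence x': "x = ex y (-1) (ex f (- s) (B x f *s e))" by (metis ex_inv(2))
 let ?z = "ex f (- s) (B x f *s e)"
 have y': "- y : G (-1)" using ys(1) by (rule subspace_neg[OF subspace_G])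
 have x1: "x = ex (- y) 1 ?z" using x' by (simp add: ex_minus)
 have z: "B ?z f = B x f" "!!w. w : G (-1) ==> B ?z w = 0" "B ?z h = 2 * s * B x f"
  using G_orth[OF eG] by (simp_all add: coords_f bs ef Bs)
 let ?c = "%i. B x (ws ! i)"
 have ch: "B x h = 2 * s * B x f" using z(2)[OF y'] by (subst x1) (simp only: coords_ex[OF y'] z(3) diff_0_right)
 have "(1 / B x f) *s yv ?c - (- y) = 0"
 proof (rule Gm1_eqI)
  show "(1 / B x f) *s yv ?c - (- y) : G (-1)" by (intro subspace_diff subspace_scale subspace_G yvG y')
  fix k assume k: "k < mw"
  have "B x (wb ! k) = - B (br (- y) (wb ! k)) e * B x f"
   by (subst (1) x1) (simp only: coords_ex(2)[OF y' wbG[OF k]] z(1) z(2)[OF wbG[OF k]] diff_0 mult_minus_left)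
  thus "B (br ((1 / B x f) *s yv ?c - - y) (wb ! k)) e = 0" using yv_pair[OF k, of ?c] C by (simp add: brs bs ws_nth(2)[OF k])
 qed
 hence "(1 / B x f) *s yv ?c = - y" by (simp only: right_minus_eq)
 hence "ex (yv ?c) (1 / B x f) = ex (- y) 1" using ex_scaleD[of "1 / B x f" "yv ?c" 1] by simp
 thus ?thesis using x1 ch C by (simp add: chart_def ws_nth)
qed

lemma pow_grade: "y : G (-1) ==> x : G k ==> (br y ^^ n) x : G (k - of_nat n)"
proof (induction n)
 case (Suc n) thus ?case using G_br'[of y "-1" "(br y ^^ n) x" "k - of_nat n" "k - of_nat (Suc n)"] by simp
qed simp
lemma Gm1_nilp: assumes y: "y : G (-1)" shows "(br y ^^ 5) x = 0"
proof -
 have "(br y ^^ 5) z = 0" if "z : G k" "k : {-2,-1,0,1,2}" for z k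
  by (rule G_other[of _ "k - 5"]) (use pow_grade[OF y that(1), of 5] that(2) in auto)
 hence "(br y ^^ 5) e = 0" "(br y ^^ 5) f = 0" "(br y ^^ 5) (p1 x) = 0" "(br y ^^ 5) (p0 x) = 0" "(br y ^^ 5) (pm x) = 0"
  using eG fG p1G p0G pmG by blast+
 thus ?thesis by (subst decomp[of x]) (simp only: les[OF le_pow[OF le_br]] scale_zero_right add_0_right)
qed
lemma f_nilp: "(br f ^^ 3) x = 0" by (simp add: numeral_3_eq_3 FF brs)

lemma chart_poly: assumes c: "c 0 ~= 0" shows "chart_poly N c = c 0 ^ 7 *s chart N c"
proof -
 have i: "ex f (- c (Suc mw) / (2 * c 0)) (c 0 *s N) = (\<Sum>j<3. ((- c (Suc mw) / (2 * c 0)) ^ j / fact j * c 0) *s (br f ^^ j) N)"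
  by (subst ex_nilp[OF f_nilp]) (simp add: les[OF le_pow[OF le_br]])
 have "chart N c = (\<Sum>k<5. ((1 / c 0) ^ k / fact k) *s (br (yv c) ^^ k) (\<Sum>j<3. ((- c (Suc mw) / (2 * c 0)) ^ j / fact j * c 0) *s (br f ^^ j) N))"
  unfolding chart_def i by (rule ex_nilp[OF Gm1_nilp[OF yvG]])
 also have "\<dots> = (\<Sum>k<5. \<Sum>j<3. (((1 / c 0) ^ k / fact k) * ((- c (Suc mw) / (2 * c 0)) ^ j / fact j * c 0)) *s (br (yv c) ^^ k) ((br f ^^ j) N))"
  by (simp only: le_sum[OF le_pow[OF le_br]] le_scale[OF le_pow[OF le_br]] scale_sum_right scale_scale)
 finally have "c 0 ^ 7 *s chart N c = (\<Sum>k<5. \<Sum>j<3. (c 0 ^ 7 * (((1 / c 0) ^ k / fact k) * ((- c (Suc mw) / (2 * c 0)) ^ j / fact j * c 0))) *s (br (yv c) ^^ k) ((br f ^^ j) N))"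
  by (simp only: scale_sum_right scale_scale)
 also have "\<dots> = chart_poly N c" unfolding chart_poly_def
 proof (intro sum.cong refl)
  fix k j :: nat assume kj: "k : {..<5}" "j : {..<3}"
  have "c 0 ^ 8 = c 0 ^ (8 - k - j) * (c 0 ^ k * c 0 ^ j)" using kj by (simp flip: power_add)
  hence "c 0 ^ 7 * c 0 = c 0 ^ (8 - k - j) * (c 0 ^ k * c 0 ^ j)" by (simp flip: power_Suc2)
  moreover have "(- c (Suc mw) / 2) ^ j = (- c (Suc mw) / (2 * c 0)) ^ j * c 0 ^ j"
   unfolding power_mult_distrib[symmetric] using c by simp
  moreover have "a * ((1 / u) / F * (q / H * A)) = m * p / (F * H)" if "a * A = m * (u * v)" "u ~= 0" "p = q * v"
   for a u F q H A m p v :: complex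
  proof -
   have "a * ((1 / u) / F * (q / H * A)) = (a * A) * (q / (u * F * H))" by simp
   thus ?thesis using that by simp
  qed
  ultimately have "c 0 ^ 7 * ((1 / c 0 ^ k / fact k) * ((- c (Suc mw) / (2 * c 0)) ^ j / fact j * c 0)) =
   c 0 ^ (8 - k - j) * (- c (Suc mw) / 2) ^ j / (fact k * fact j)" using c by (metis power_not_zero)
  hence "c 0 ^ 7 * (((1 / c 0) ^ k / fact k) * ((- c (Suc mw) / (2 * c 0)) ^ j / fact j * c 0)) =
   c 0 ^ (8 - k - j) * (- c (Suc mw) / 2) ^ j / (fact k * fact j)" by (simp only: power_one_over)
  thus "(c 0 ^ 7 * (((1 / c 0) ^ k / fact k) * ((- c (Suc mw) / (2 * c 0)) ^ j / fact j * c 0))) *s (br (yv c) ^^ k) ((br f ^^ j) N)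
   = (c 0 ^ (8 - k - j) * (- c (Suc mw) / 2) ^ j / (fact k * fact j)) *s (br (yv c) ^^ k) ((br f ^^ j) N)" by simp
 qed
 finally show ?thesis by simp
qed
lemma chart_eq: "c 0 ~= 0 ==> chart N c = (1 / c 0 ^ 7) *s chart_poly N c" by (simp add: chart_poly)

lemma chart_poly_vec_in:
 assumes Q: "function_algebra Q" and c: "!!i. i < rk ==> (%p. c p i) : Q" and N: "vec_in Q N"
 shows "vec_in Q (%p. chart_poly (N p) (c p))"
proof -
 have y: "vec_in Q (%p. yv (c p))" unfolding yv_def by (intro vec_in_sum[OF Q] vec_in_scale[OF Q] vec_in_const[OF Q] c) (auto simp: rk_def)
 have "(%p. (- 1 / 2) * c p (Suc mw)) : Q" by (intro fa_cmult[OF Q] c) (simp add: rk_def)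
 hence h: "(%p. - c p (Suc mw) / 2) : Q" by simp
 have k: "(%p. c p 0 ^ (8 - k - j) * (- c p (Suc mw) / 2) ^ j / (fact k * fact j)) : Q" for k j
  using fa_cmult[OF Q fa_mult[OF Q fa_pow[OF Q c[of 0]] fa_pow[OF Q h]], of "1 / (fact k * fact j)"] by (simp add: rk_def)
 show ?thesis unfolding chart_poly_def by (intro vec_in_sum[OF Q] vec_in_scale[OF Q k] vec_in_pow[OF Q y] vec_in_le[OF le_pow[OF le_br] N])
qed

lemma chart_vhol:
 assumes c: "!!i. i < rk ==> (%t. c t i) holomorphic_on U" and N: "vhol N U" and nz: "!!t. t : U ==> c t 0 ~= 0"
 shows "vhol (%t. chart (N t) (c t)) U"
proof -
 have "vec_in {g. g holomorphic_on U} (%t. chart_poly (N t) (c t))"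
  by (rule chart_poly_vec_in[OF fa_holomorphic]) (use c N in \<open>auto simp: vec_in_vhol\<close>)
 hence "vhol (%t. (1 / c t 0 ^ 7) *s chart_poly (N t) (c t)) U"
  using c[of 0] nz by (intro vhol_scale) (auto simp: vec_in_vhol rk_def intro!: holomorphic_intros)
 hence *: "lf l ==> (%t. l ((1 / c t 0 ^ 7) *s chart_poly (N t) (c t))) holomorphic_on U" for l unfolding vhol_def by simp
 show ?thesis unfolding vhol_def
 proof (intro allI impI)
  fix l assume "lf l"
  from *[OF this] show "(%t. l (chart (N t) (c t))) holomorphic_on U" by (rule holomorphic_transform) (simp add: chart_eq nz)
 qed
qed

end

context triple begin

lemma slice_e: "slice e" using G_orth[OF eG] by (simp add: slice_def Bs)
lemma chart_e_E: "c 0 ~= 0 ==> chart e c : E" unfolding chart_def by (intro E_ex E_scale eE)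

lemma Gr_e: assumes x: "x : E" "B x f ~= 0" shows "EX u:Gr. x = u e"
proof -
 let ?c = "%i. B x (ws ! i)"
 have c: "?c 0 ~= 0" using x by (simp add: ws_nth)
 define k where "k = B x (ws ! 0)"
 have k: "k ~= 0" using c by (simp add: k_def)
 \<comment> \<open>Scalars belong to the torus: e has weight 2, so exp((Ln k / 2) ad h) multiplies
   it by k.\<close>
 have c0: "k *s e = ex h (Ln k / 2) e" using ex_eigen[OF he, of "Ln k / 2"] exp_Ln[OF k] by simp
 define u where "u = ex (yv ?c) (1 / k) \<circ> (ex f (- ?c (Suc mw) / (2 * k)) \<circ> ex h (Ln k / 2))"
 have "chart e ?c = u e" by (simp only: chart_def k_def[symmetric] o_apply c0 u_def)
 hence "x = u e" unfolding chart_inverse[OF x] .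
 moreover have "u : Gr" unfolding u_def by (rule Gr_comp[OF ex_Gr Gr_comp[OF ex_Gr ex_Gr]])
 ultimately show ?thesis by auto
qed

end

section \<open>Transitivity on the extremal elements and irreducibility\<close>

context extremal_lie begin

lemma orbit_pairs: assumes y: "y ~= 0" and f: "f ~= 0" shows "EX u:Gr. B (u y) f ~= 0"
proof (rule ccontr)
 assume n: "\<not> ?thesis"
 let ?S = "(%u. u y) ` Gr"
 have "span ?S = UNIV"
 proof (rule orbit_spans[OF y])
  show "y : ?S" using adjoint_group.one[of smul br] by (rule rev_image_eqI) simp
  fix z a t assume "z : ?S"
  then obtain u where u: "u : Gr" "z = u y" by auto
  show "ex a t z : ?S" using Gr_comp[OF ex_Gr u(1), of a t] by (rule rev_image_eqI) (simp add: u)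
 qed
 moreover have "B z f = 0" if "z : span ?S" for z using that by (induction rule: span_induct_alt) (use n in \<open>auto simp: bs\<close>)
 ultimately have "B f z = 0" for z by (simp add: B_sym[of f])
 thus False using B_nondeg f by blast
qed

text \<open>Some group element moves y to a point with nonzero pairing with f, and all such points
  of E lie in the orbit of x by \<open>Gr_e\<close>.\<close>

lemma E_transitive: assumes "x : E" "y : E" shows "EX u:Gr. y = u x"
proof -
 obtain f where f: "f : E" "B x f = 1" using E_pair[OF assms(1)] by blast
 interpret t: triple smul Basis br B x f by unfold_locales (use assms f in auto)
 obtain u where u: "u : Gr" "B (u y) f ~= 0" using orbit_pairs[OF E_0[OF assms(2)] E_0[OF f(1)]] by blast
 obtain v where v: "v : Gr" "u y = v x" using t.Gr_e[OF E_Gr[OF u(1) assms(2)] u(2)] by blast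
 obtain w where w: "w : Gr" "!!z. w (u z) = z" using Gr_inv[OF u(1)] by blast
 have "y = (w \<circ> v) x" using w(2)[of y] v(2) by simp
 thus ?thesis using Gr_comp[OF w(1) v(1)] by blast
qed
lemma E_orbit: "x : E ==> adjoint_orbit smul br x = E"
proof (intro Set.set_eqI iffI)
 assume x: "x : E"
 show "y : E" if "y : adjoint_orbit smul br x" for y using that E_Gr[OF _ x] unfolding adjoint_orbit_def by auto
 show "y : adjoint_orbit smul br x" if "y : E" for y using E_transitive[OF x that] unfolding adjoint_orbit_def by auto
qed

lemma E_prime: "prime_on Rg E"
proof (rule prime_on_curves)
 fix p q assume p: "p : E" and q: "q : E"
 obtain u where u: "u : Gr" "q = u p" using E_transitive[OF p q] by blast
 obtain U where U: "!!x. U 0 x = x" "!!x. U 1 x = u x" "!!t. U t : Gr" "!!x. vhol (%t. U t x) UNIV" using Gr_path[OF u(1)] by blast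
 show "EX ga V. open V & connected V & (0::complex) : V & 1 : V & ga 0 = p & ga 1 = q
  & (ALL s:V. ga s : E) & (ALL f:Rg. (%s. f (ga s)) holomorphic_on V)" by (rule exI[of _ "%t. U t p"], rule exI[of _ UNIV])
   (use U u E_Gr p in \<open>auto intro: Rg_vhol connected_UNIV\<close>)
qed
lemma E_cancel: assumes "P : Rg" "Q : Rg" "!!x. x : E ==> P x * Q x = 0" "z : E" "P z ~= 0" "x : E" shows "Q x = 0"
 using E_prime assms unfolding prime_on_def by blast

end

section \<open>Tangent vectors and dimensions of orbits\<close>

context triple begin

text \<open>Tangent vectors at e dual to the coordinate functionals; the factor 1/2 undoes B h h =
  2.\<close>

definition tb :: "nat => 'g" where
 "tb i = (if i = 0 then e else if i = Suc mw then (1/2) *s h else - br e (ub (i - 1)))"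
lemma tb_tangent: "i < rk ==> EX a. tb i = br a e"
 using he fe anti[of e "ub (i - 1)"] anti[of e f] br_scale_l[of "1/2" h e] br_scale_l[of "-1/2" f e] unfolding tb_def
 by (auto intro: exI[of _ "(1/2) *s h"] exI[of _ "(-1/2) *s f"])
lemma ub_orth: "j < mw ==> B (br e (ub j)) f = 0" "j < mw ==> B (br e (ub j)) h = 0"
 using G_orth[OF e_Gm1[OF ub(1)] fG] G_orth[OF e_Gm1[OF ub(1)] hG] by auto
lemma ub_dual: "j < mw ==> k < mw ==> B (br e (ub j)) (wb ! k) = - (if k = j then 1 else 0)" by (simp only: B_inv2 ub(2))
lemma tb_dual: assumes "i < rk" "k < rk" shows "B (tb i) (ws ! k) = (if i = k then 1 else 0)"
proof -
 consider "i = 0" | j where "i = Suc j" "j < mw" | "i = Suc mw" using assms(1) by (cases i) (auto simp: rk_def less_Suc_eq)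
 note i = this
 consider "k = 0" | j where "k = Suc j" "j < mw" | "k = Suc mw" using assms(2) by (cases k) (auto simp: rk_def less_Suc_eq)
 note k = this
 have 1: "B e (wb ! j) = 0" "B h (wb ! j) = 0" if "j < mw" for j using G_orth[OF eG wbG[OF that]] G_orth[OF hG wbG[OF that]] by auto
 show ?thesis by (cases rule: i; cases rule: k) (auto simp: tb_def ws_nth ef Bs bs 1 ub_orth ub_dual)
qed
lemma tangent_coords: assumes "!!i. i < rk ==> B (br a e) (ws ! i) = 0" shows "br a e = 0"
proof -
 have 0: "B (br a e) f = 0" "B (br a e) h = 0" "k < mw ==> B (br a e) (wb ! k) = 0" for k
  using assms[of 0] assms[of "Suc mw"] assms[of "Suc k"] by (auto simp: rk_def ws_nth)
 have "br (p1 a) e = 0" using e_G1[OF p1G, of a] anti[of e "p1 a"] by simp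
 moreover have "br (p0 a) e = B a h *s e" using e_G0[OF p0G, of a] anti[of e "p0 a"] by (simp add: p0_h)
 ultimately have d: "br a e = B a h *s e + br (pm a) e + (- B a e) *s h" by (subst decomp[of a]) (simp add: brs fe)
 have pm1: "br (pm a) e : G 1" using G_br'[OF pmG eG] by simp
 have z: "B a h = 0" "B a e = 0" using 0(1,2) G_orth[OF pm1 fG] G_orth[OF pm1 hG] unfolding d by (simp_all add: bs ef Bs)
 hence d': "br a e = br (pm a) e" using d by simp
 have "br (pm a) e = 0"
 proof (rule G1_0[OF pm1])
  fix y assume "y : G (-1)"
  thus "B (br (pm a) e) y = 0" by (rule Gm1_span) (use 0(3) d' B_lf in simp_all)
 qed
 thus ?thesis using d' by simp
qed
lemma tangent_expand: "br a e = (\<Sum>i<rk. B (br a e) (ws ! i) *s tb i)"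
proof -
 have "EX b. ALL i<rk. tb i = br (b i) e" using tb_tangent by metis
 then obtain b where b: "!!i. i < rk ==> tb i = br (b i) e" by blast
 have s: "(\<Sum>i<rk. B (br a e) (ws ! i) *s tb i) = br (\<Sum>i<rk. B (br a e) (ws ! i) *s b i) e" by (simp add: br_sum_l brs b)
 have "br (a - (\<Sum>i<rk. B (br a e) (ws ! i) *s b i)) e = 0"
 proof (rule tangent_coords)
  fix k assume k: "k < rk"
  have "B (\<Sum>i<rk. B (br a e) (ws ! i) *s tb i) (ws ! k) = (\<Sum>i<rk. B (br a e) (ws ! i) * (if i = k then 1 else 0))"
   unfolding lf_sum[OF B_lf2] by (rule sum.cong) (auto simp: bs tb_dual k)
  also have "\<dots> = B (br a e) (ws ! k)" using k by (simp add: if_distrib[of "%x. _ * x"] cong: if_cong)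
  finally show "B (br (a - (\<Sum>i<rk. B (br a e) (ws ! i) *s b i)) e) (ws ! k) = 0" by (simp add: s[symmetric] brs bs)
 qed
 thus ?thesis unfolding s by (simp add: brs)
qed

lemma coord_Rg: "(%x. B x y) : Rg" by (rule lf_Rg[OF B_lf2])

text \<open>The chart expresses a point of E by its coordinates with denominator B(.,f)^7. The
  exponent \<open>Suc K\<close> leaves one such factor over, so that the identity also holds where
  B(.,f) = 0. The map ga is the identity for E and \<nu> for X.\<close>

lemma coords_pol: assumes P: "P : Rg" and ga: "!!x. x : Y ==> ga x : E0"
 shows "EX K D. (%x. (B (ga x) f ^ 7) ^ Suc K * P (ga x)) : pol Y (%i x. B (ga x) (ws ! i)) rk D"
proof -
 let ?pol = "pol Y (%i x. B (ga x) (ws ! i)) rk"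
 have xp: "(%x. B (ga x) (ws ! i)) : ?pol 1" if "i < rk" for i by (rule pol_x[OF that])
 have f1: "(%x. B (ga x) f) : ?pol 1" using xp[of 0] by (simp add: rk_def ws_nth)
 have dp: "(%x. B (ga x) f ^ 7) : ?pol 7" using pol_pow[OF f1, of 7] by simp
 let ?Q = "{g. EX D. g : ?pol D}"
 have faQ: "function_algebra ?Q" unfolding function_algebra_def
 proof (intro conjI allI ballI)
  show "(%_. c) : ?Q" for c using pol_const by blast
  fix g g' assume "g : ?Q" "g' : ?Q"
  then obtain D D' where D: "g : ?pol D" "g' : ?pol D'" by auto
  show "(%x. g x * g' x) : ?Q" using pol_mult[OF D] by blast
  have "g : ?pol (max D D')" "g' : ?pol (max D D')" by (rule pol_mono[OF D(1)], simp, rule pol_mono[OF D(2)], simp)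
  thus "(%x. g x + g' x) : ?Q" using pol_add by blast
 qed
 have "vec_in ?Q (%x. chart_poly e (%i. B (ga x) (ws ! i)))" by (rule chart_poly_vec_in[OF faQ _ vec_in_const[OF faQ]]) (use xp in blast)
 moreover have "(%x. B (ga x) f ^ 7) : ?Q" using dp by blast
 ultimately obtain K q where q: "q : ?Q"
  "!!x. B (ga x) f ^ 7 ~= 0 ==> (B (ga x) f ^ 7) ^ K * P ((1 / B (ga x) f ^ 7) *s chart_poly e (%i. B (ga x) (ws ! i))) = q x"
  using Rg_fraction[OF P faQ] by blast
 obtain D where D: "q : ?pol D" using q(1) by blast
 have "(%x. (B (ga x) f ^ 7) ^ Suc K * P (ga x)) : ?pol (7 + D)"
 proof (rule pol_cong[OF pol_mult[OF dp D]])
  fix x assume x: "x : Y"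
  show "(B (ga x) f ^ 7) ^ Suc K * P (ga x) = B (ga x) f ^ 7 * q x"
  proof (cases "B (ga x) f = 0")
   case False
   hence "ga x : E" using ga[OF x] by (auto simp: E_def bs)
   hence "(1 / B (ga x) f ^ 7) *s chart_poly e (%i. B (ga x) (ws ! i)) = ga x"
    using chart_eq[of "%i. B (ga x) (ws ! i)" e] chart_inverse[of "ga x"] False by (simp add: ws_nth)
   thus ?thesis using q(2)[of x] False by simp
  qed simp
 qed
 thus ?thesis by blast
qed

lemma E_dim_le: "variety_dim smul E \<le> enat rk" unfolding variety_dim_def
proof (rule krull_dim_upper[OF fa_Rg zero_loci_subtopology[OF zero_loci_Rg subset_UNIV],
  where x = "%i z. B z (ws ! i)" and dl = "%z. B z f ^ 7" and d = 7])
 let ?pol = "pol E (%i z. B z (ws ! i)) rk"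
 have "(%z. B z (ws ! 0)) : ?pol 1" by (rule pol_x) (simp add: rk_def)
 hence f1: "(%z. B z f) : ?pol 1" by (simp add: ws_nth)
 show "(%z. B z f ^ 7) : ?pol 7" using pol_pow[OF f1, of 7] by simp
 show dR: "(%z. B z f ^ 7) : Rg" by (rule fa_pow[OF fa_Rg coord_Rg])
 show "g y = 0" if "g : Rg" "!!y. y : E ==> B y f ^ 7 * g y = 0" "y : E" for g y
  by (rule E_cancel[OF dR that(1,2) eE _ that(3)]) (simp_all add: ef)
 fix P assume "P : Rg"
 hence "EX K D. (%x. (B x f ^ 7) ^ Suc K * P x) : ?pol D" by (rule coords_pol) (rule E_E0)
 thus "EX a d. (%y. (B y f ^ 7) ^ a * P y) : ?pol d" by blast
qed

lemma chart_family: assumes N: "slice N" "B N f = 1" shows "coordinate_family (chart N) Rg rk"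
proof
 show "function_algebra Rg" by (rule fa_Rg)
 show "1 \<le> rk" by (simp add: rk_def)
 show "(%t. P (chart N (%i. c i + t * d i))) holomorphic_on {t. c 0 + t * d 0 ~= 0}" if "P : Rg" for P c d
  by (rule Rg_vhol[OF that chart_vhol[OF _ vhol_const]]) (auto intro!: holomorphic_intros)
 show "EX g:Rg. ALL c. c 0 ~= 0 --> g (chart N c) = c i" if "i < rk" for i
  by (rule bexI[of _ "%x. B x (ws ! i)"]) (use chart_coords[OF N _ that] coord_Rg in auto)
qed

lemma E_dim: "variety_dim smul E = enat rk"
proof -
 interpret coordinate_family "chart e" Rg rk by (rule chart_family[OF slice_e ef])
 have "enat rk \<le> variety_dim smul E" unfolding variety_dim_def
  by (rule krull_dim_ge[OF zero_loci_subtopology[OF zero_loci_Rg subset_UNIV] chart_e_E])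
 thus ?thesis using E_dim_le by simp
qed

text \<open>The torus element is normalised so that the part of weight 2 stays fixed; weight w is
  then multiplied by b^(2-w).\<close>

lemma slice_torus: assumes s: "slice x" "B x f = 1" and b: "b ~= 0"
 shows "b\<^sup>2 *s ex h (- Ln b) x = e + b^2 *s p0 x + b^3 *s pm x + (b^4 * B x e) *s f"
proof -
 have x: "x = e + p0 x + pm x + B x e *s f" using slice_decomp[OF s(1)] s(2) by simp
 have E: "exp (Ln b) = b" by (rule exp_Ln[OF b])
 have m: "exp (- Ln b * 2) = 1 / b^2" using exp_double[of "- Ln b"] E by (simp add: exp_minus field_simps)
 have p: "exp (Ln b * 2) = b^2" using exp_double[of "Ln b"] E by (simp add: mult.commute)
 have 1: "ex h (- Ln b) e = (1 / b^2) *s e" using ex_eigen[OF he, of "- Ln b"] m by simp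
 have 2: "ex h (- Ln b) (p0 x) = p0 x" using ex_eigen[OF GD[OF p0G], of "- Ln b"] by simp
 have 3: "ex h (- Ln b) (pm x) = b *s pm x" using ex_eigen[OF GD[OF pmG], of "- Ln b"] E by simp
 have 4: "ex h (- Ln b) f = b^2 *s f" using ex_eigen[OF hf, of "- Ln b"] p by simp
 have "ex h (- Ln b) x = (1 / b^2) *s e + p0 x + b *s pm x + (B x e * b^2) *s f"
  by (subst x) (simp only: les[OF le_ex] 1 2 3 4 scale_scale)
 hence "b\<^sup>2 *s ex h (- Ln b) x = (b^2 * (1 / b^2)) *s e + b^2 *s p0 x + (b^2 * b) *s pm x + (b^2 * (B x e * b^2)) *s f"
  by (simp only: scale_right_distrib scale_scale)
 also have "b^2 * (1 / b^2) = 1" using b by simp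
 also have "b^2 * b = b^3" by (simp add: power2_eq_square power3_eq_cube)
 also have "b^2 * (B x e * b^2) = b^4 * B x e" by auto
 finally show ?thesis by simp
qed

text \<open>A slice point N1 of S differs from e because S misses E0. Its torus translates N b tend
  to e as b tends to 0, so they move, and the charts based at N b carry one parameter more than the
  rk coordinates.\<close>

lemma big_orbit_dim:
 assumes S: "!!a t x. x : S ==> ex a t x : S" "!!c x. c ~= 0 ==> x : S ==> c *s x : S"
  and n: "n : S" "B n f ~= 0" "S \<inter> E0 = {}"
 shows "enat (Suc rk) \<le> variety_dim smul S"
proof -
 obtain y s where ys: "slice (ex f s (ex y 1 n))" "B (ex f s (ex y 1 n)) f = B n f" using normal_form[OF n(2)] by blast
 define N1 where "N1 = (1 / B n f) *s ex f s (ex y 1 n)"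
 have N1: "N1 : S" "slice N1" "B N1 f = 1" using ys n(2) unfolding N1_def by (auto simp: slice_def bs intro!: S n)
 have N1d: "N1 = e + p0 N1 + pm N1 + B N1 e *s f" using slice_decomp[OF N1(2)] N1(3) by simp
 define N where "N b = e + b^2 *s p0 N1 + b^3 *s pm N1 + (b^4 * B N1 e) *s f" for b
 have N_1: "N 1 = N1" using N1d by (simp add: N_def)
 have NS: "N b : S" if "b ~= 0" for b
  using S(2)[OF _ S(1)[OF N1(1)], of "b^2" h "- Ln b"] slice_torus[OF N1(2,3) that] that by (simp add: N_def)
 have Ns: "slice (N b)" "B (N b) f = 1" for b
 proof -
  have p0h: "B (p0 N1) h = 0" using N1(2) by (simp add: p0_h slice_def)
  have "B (N b) z = 0" if z: "z : G (-1)" for z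
   using G_orth[OF eG z] G_orth[OF p0G z] G_orth[OF pmG z] G_orth[OF fG z] by (simp add: N_def bs)
  moreover have "B (N b) h = 0" using G_orth[OF pmG hG] p0h by (simp add: N_def bs Bs)
  ultimately show "slice (N b)" by (simp add: slice_def)
  show "B (N b) f = 1" using G_orth[OF p0G fG] G_orth[OF pmG fG] by (simp add: N_def bs Bs ef)
 qed
 have Nh: "vhol N U" for U unfolding N_def by (intro vhol_add vhol_const vhol_scale holomorphic_intros)
 \<comment> \<open>Otherwise N1 would equal the limit at b = 0, which is e and lies in E0.\<close>
 have "EX b. b ~= 0 & N b ~= N1"
 proof (rule ccontr)
  assume c: "\<not> ?thesis"
  have "N 0 = N1" by (rule vhol_eq_at_0[OF Nh vhol_const]) (use c in blast)
  moreover have "N 0 = e" by (simp add: N_def)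
  ultimately show False using N1(1) n(3) E_E0[OF eE] by auto
 qed
 then obtain b0 where b0: "b0 ~= 0" "N b0 ~= N1" by blast
 interpret coordinate_family "chart N1" Rg rk by (rule chart_family[OF N1(2,3)])
 define Top where "Top = {chart (N b) c | b c. b ~= 0 & c 0 ~= 0}"
 have TopS: "Top \<subseteq> S" unfolding Top_def chart_def by (auto intro!: S NS)
 have "chart N1 c : Top" if "c 0 ~= 0" for c unfolding Top_def by (intro CollectI exI[of _ "1::complex"] exI[of _ c]) (simp add: N_1 that)
 hence flagTop: "flag i \<subseteq> Top" for i unfolding flag_def by auto
 have prime: "prime_on Rg Top"
 proof (rule prime_on_curves)
  fix p q assume "p : Top" "q : Top"
  then obtain b c b' c' where c: "p = chart (N b) c" "b ~= 0" "c 0 ~= 0" and d: "q = chart (N b') c'" "b' ~= 0" "c' 0 ~= 0"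
   unfolding Top_def by auto
  let ?ga = "%t. chart (N (b + t * (b' - b))) (%j. c j + t * (c' j - c j))"
  let ?U = "{t. c 0 + t * (c' 0 - c 0) ~= 0} \<inter> {t. b + t * (b' - b) ~= 0}"
  have "open ?U & connected ?U & (0::complex) : ?U & 1 : ?U & ?ga 0 = p & ?ga 1 = q
  & (ALL s:?U. ?ga s : Top) & (ALL f:Rg. (%s. f (?ga s)) holomorphic_on ?U)"
  proof (intro conjI ballI)
   show "open ?U" by (intro open_Int connected_nonzero_affine(2))
   show "connected ?U" by (rule connected_nonzero_affine2[OF c(3,2)])
   show "?ga s : Top" if "s : ?U" for s using that unfolding Top_def by blast
   have v: "vhol ?ga ?U"
   proof (rule chart_vhol)
    show "vhol (%t. N (b + t * (b' - b))) ?U" unfolding N_def by (intro vhol_add vhol_const vhol_scale holomorphic_intros)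
   qed (auto intro!: holomorphic_intros)
   show "(%s. P (?ga s)) holomorphic_on ?U" if "P : Rg" for P by (rule Rg_vhol[OF that v])
  qed (use c d in auto)
  thus "EX ga U. open U & connected U & (0::complex) : U & 1 : U & ga 0 = p & ga 1 = q
  & (ALL s:U. ga s : Top) & (ALL f:Rg. (%s. f (ga s)) holomorphic_on U)" by (intro exI)
 qed
 obtain l where l: "lf l" "l N1 ~= l (N b0)" using eqI_lf[of N1 "N b0"] b0(2) by auto
 \<comment> \<open>F measures, after clearing denominators, whether l takes the value that the chart
   at N1 predicts from the coordinates of x. It vanishes on the chart at N1 and not on all of the
   one at N b0.\<close>
 define F where "F x = l (chart_poly N1 (%i. B x (ws ! i))) - B x f ^ 7 * l x" for x
 have F_Rg: "F : Rg"
 proof -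
  have "vec_in Rg (%x. chart_poly N1 (%i. B x (ws ! i)))" by (rule chart_poly_vec_in[OF fa_Rg _ vec_in_const[OF fa_Rg]]) (rule coord_Rg)
  hence "(%x. l (chart_poly N1 (%i. B x (ws ! i)))) : Rg" using l(1) by (simp add: vec_in_def)
  thus ?thesis unfolding F_def by (intro fa_diff[OF fa_Rg] fa_mult[OF fa_Rg] fa_pow[OF fa_Rg] coord_Rg lf_Rg[OF l(1)])
 qed
 have chart_cong: "chart_poly M c = chart_poly M c'" if "!!i. i < rk ==> c i = c' i" for M c c'
  using that unfolding chart_poly_def yv_def by (simp add: rk_def)
 have Fc: "F (chart (N b) c) = c 0 ^ 7 * (l (chart N1 c) - l (chart (N b) c))" if c: "c 0 ~= 0" for b c
 proof -
  have "chart_poly N1 (%i. B (chart (N b) c) (ws ! i)) = chart_poly N1 c" by (rule chart_cong) (rule chart_coords[where c = c, OF Ns c])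
  moreover have "B (chart (N b) c) f = c 0" using chart_coords[where c = c and i = 0, OF Ns c, of b] by (simp add: ws_nth rk_def)
  ultimately show ?thesis using chart_poly[where c = c and N = N1, OF c] l(1) by (simp add: F_def lfs algebra_simps)
 qed
 define T where "T i = (if i \<le> rk then flag i else Top)" for i
 show ?thesis unfolding variety_dim_def
 proof (rule krull_dim_lower[OF fa_Rg zero_loci_subtopology[OF zero_loci_Rg subset_UNIV], where S = T])
  show "T i ~= {} & T i \<subseteq> S & prime_on Rg (T i)" for i
   using flag_nonempty[of i] flagTop[of i] TopS flag_prime[of i] prime unfolding T_def by auto
  show "T i \<subseteq> T (Suc i)" if "i < Suc rk" for i using flag_inc[of i] flagTop[of i] unfolding T_def by auto
  show "EX f:Rg. (ALL x:T i. f x = 0) & (EX x:T (Suc i). f x ~= 0)" if i: "i < Suc rk" for i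
  proof (cases "i < rk")
   case True thus ?thesis using flag_sep[OF True] by (simp add: T_def)
  next
   case False
   hence ir: "i = rk" using i by simp
   have "F x = 0" if x: "x : T i" for x
   proof -
    have "x : chart N1 ` {c. c 0 ~= 0 & (ALL j>=rk. c j = 0)}" using x by (simp add: T_def ir flag_def rk_def)
    then obtain c where c: "x = chart N1 c" "c 0 ~= 0" by auto
    thus ?thesis using Fc[of c 1, OF c(2)] by (simp add: N_1)
   qed
   moreover define c where "c = (%i::nat. if i = 0 then 1 else 0 :: complex)"
   have c0: "c 0 = 1" by (simp add: c_def)
   have "yv c = 0" "c (Suc mw) = 0" by (simp_all add: yv_def c_def)
   hence ch: "chart M c = M" for M using ex_scaleD[of 0 0 1] by (simp add: chart_def c0 ex_0)
   have "F (chart (N b0) c) ~= 0" using Fc[of c b0] c0 l(2) by (simp add: ch)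
   moreover have "chart (N b0) c : Top" unfolding Top_def by (intro CollectI exI[of _ b0] exI[of _ c]) (simp add: b0 c0)
   hence "chart (N b0) c : T (Suc i)" by (simp add: T_def ir)
   ultimately show ?thesis by (intro bexI[OF _ F_Rg] conjI ballI bexI[of _ "chart (N b0) c"])
  qed
 qed
qed

end

section \<open>The minimal orbit and its closure\<close>

context extremal_lie begin

text \<open>The orbit of a nilpotent n is stable under scaling since [h',n] = n for some h'. If n
  were not extremal, \<open>big_orbit_dim\<close> would give it a dimension above that of E, which
  is itself a nilpotent orbit.\<close>

lemma minimal_orbit_E: assumes m: "minimal_nilpotent_orbit smul br Orb" shows "Orb = E"
proof -
 obtain n where n: "n ~= 0" "ad_nilpotent br n" "Orb = adjoint_orbit smul br n"
  using m unfolding minimal_nilpotent_orbit_def nonzero_nilpotent_orbit_def by blast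
 have OI: "u n : Orb" if "u : Gr" for u unfolding n(3) adjoint_orbit_def using that by auto
 have OD: "EX u:Gr. x = u n" if "x : Orb" for x using that unfolding n(3) adjoint_orbit_def by auto
 have "n : E0"
 proof (rule ccontr)
  assume nE: "n ~: E0"
  obtain f where f: "f : E" "B n f ~= 0" using E_pairing[OF n(1)] by blast
  obtain e where e: "e : E" "B f e = 1" using E_pair[OF f(1)] by blast
  interpret triple smul Basis br B e f by unfold_locales (use e f B_sym in auto)
  have "nonzero_nilpotent_orbit smul br E" unfolding nonzero_nilpotent_orbit_def
   by (rule exI[of _ e]) (simp add: E_0[OF e(1)] E_nilpotent[OF E_E0[OF e(1)]] E_orbit[OF e(1)])
  hence le: "variety_dim smul Orb \<le> enat rk" using m E_dim unfolding minimal_nilpotent_orbit_def by auto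
  have "enat (Suc rk) \<le> variety_dim smul Orb"
  proof (rule big_orbit_dim[where n = n])
   show st: "ex a t x : Orb" if x: "x : Orb" for a t x
    by (use OD x OI Gr_comp ex_Gr in \<open>fastforce\<close>)
   show "n : Orb" using OI[OF adjoint_group.one] by simp
   show "B n f ~= 0" by (rule f(2))
   obtain h' where h': "br h' n = n" using nilpotent_grading[OF n(2)] by blast
   show "c *s x : Orb" if c: "c ~= 0" and x: "x : Orb" for c x
   proof -
    obtain u where u: "u : Gr" "x = u n" using OD[OF x] by blast
    have "ex h' (Ln c) n = c *s n" using ex_eigen[of h' n 1 "Ln c"] h' exp_Ln[OF c] by simp
    hence "c *s x = (u \<circ> ex h' (Ln c)) n" using le_scale[OF Gr_le[OF u(1)], of c n] u(2) by simp
    thus ?thesis using OI[OF Gr_comp[OF u(1) ex_Gr]] by simp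
   qed
   show "Orb \<inter> E0 = {}"
   proof (rule ccontr)
    assume "Orb \<inter> E0 ~= {}"
    then obtain u where u: "u : Gr" "u n : E0" using OD by blast
    obtain v where v: "v : Gr" "!!x. v (u x) = x" using Gr_inv[OF u(1)] by blast
    have "u n ~= 0" using v(2)[of n] n(1) le_0[OF Gr_le[OF v(1)]] by metis
    hence "v (u n) : E" using u(2) by (intro E_Gr[OF v(1)]) (simp add: E_def)
    thus False using v(2) nE E_E0 by simp
   qed
  qed
  hence "enat (Suc rk) \<le> enat rk" using le by (rule order_trans)
  thus False by simp
 qed
 hence "n : E" using n(1) by (simp add: E_def)
 thus ?thesis using E_orbit n(3) by simp
qed

lemma Rg_zero_limit: assumes "P : Rg" "!!x. x : E ==> P x = 0" shows "P 0 = 0"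
proof -
 obtain e where e: "e : E" using E_nonempty by blast
 have "vhol (%t. t *s e) UNIV" by (intro vhol_scale vhol_const holomorphic_intros)
 from Rg_vhol[OF assms(1) this] have "(%t. P (t *s e)) holomorphic_on UNIV" .
 hence "P (0 *s e) = 0" by (rule hol_eq_at_0[of _ "%_. 0"]) (auto intro: assms(2) E_scale e)
 thus ?thesis by simp
qed

lemma closure_E: "zariski_space smul closure_of E = E0"
proof (rule antisym)
 define F where "F = {(%x. l (br x (br x y) - (- 2 * B x y) *s x)) | l y. lf l}"
 have "F \<subseteq> Rg"
 proof
  fix P assume "P : F"
  then obtain l y where l: "lf l" "P = (%x. l (br x (br x y) - (- 2 * B x y) *s x))" unfolding F_def by auto
  have "vec_in Rg (%x. br x (br x y))" by (intro vec_in_br[OF fa_Rg] vec_in_id vec_in_const[OF fa_Rg])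
  moreover have "vec_in Rg (%x. (2 * B x y) *s x)" by (intro vec_in_scale[OF fa_Rg] vec_in_id fa_cmult[OF fa_Rg] lf_Rg[OF B_lf2])
  ultimately have "vec_in Rg (%x. br x (br x y) + (2 * B x y) *s x)" by (rule vec_in_add[OF fa_Rg])
  thus "P : Rg" using l by (simp add: vec_in_def)
 qed
 moreover have "E0 = locus UNIV F"
 proof (intro Set.set_eqI iffI)
  fix x assume "x : E0" thus "x : locus UNIV F" by (auto simp: mem_locus F_def E0D lf_0)
 next
  fix x assume x: "x : locus UNIV F"
  have "br x (br x y) - (- 2 * B x y) *s x = 0" for y
  proof (rule eq0I_lf)
   fix l assume l: "lf l"
   have "(%x. l (br x (br x y) - (- 2 * B x y) *s x)) : F" unfolding F_def by (intro CollectI exI[of _ l] exI[of _ y]) (simp add: l)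
   with x show "l (br x (br x y) - (- 2 * B x y) *s x) = 0" unfolding mem_locus by fast
  qed
  thus "x : E0" unfolding E0_def right_minus_eq by blast
 qed
 ultimately have "closedin (zariski_space smul) E0" using zero_lociI[OF zero_loci_Rg] by simp
 thus "zariski_space smul closure_of E \<subseteq> E0" by (rule closure_of_minimal[rotated]) (auto simp: E_def)
 show "E0 \<subseteq> zariski_space smul closure_of E"
 proof
  fix x assume x: "x : E0"
  obtain F where F: "F \<subseteq> Rg" "zariski_space smul closure_of E = locus UNIV F"
   using zero_lociD[OF zero_loci_Rg closedin_closure_of[of _ E]] by auto
  have ts: "topspace (zariski_space smul) = UNIV"
  proof -
   have "closedin (zariski_space smul) (locus UNIV {})" by (rule zero_lociI[OF zero_loci_Rg]) simp
   moreover have "locus UNIV {} = (UNIV :: 'g set)" by (simp add: locus_def)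
   ultimately have "closedin (zariski_space smul) UNIV" by simp
   from closedin_subset[OF this] show ?thesis by (rule top_le)
  qed
  have "E \<subseteq> locus UNIV F" using closure_of_subset[of E "zariski_space smul"] ts F(2) by simp
  hence z: "P y = 0" if "P : F" "y : E" for P y using that by (auto simp: mem_locus)
  have "P x = 0" if P: "P : F" for P
  proof (cases "x = 0")
   case True
   have "P 0 = 0" by (rule Rg_zero_limit) (use F(1) P z in auto)
   thus ?thesis using True by simp
  next
   case False thus ?thesis using z[OF P] x by (simp add: E_def)
  qed
  thus "x : zariski_space smul closure_of E" by (simp add: F(2) mem_locus)
 qed
qed

end

section \<open>Lines through an extremal element\<close>

context triple begin

text \<open>The symplectic form of the contact grading: [x,y] = \<open>sg x y *s e\<close> on G
  1.\<close>

definition sg :: "'g => 'g => complex" where "sg x y = B (br x y) f"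
text \<open>Directions of planes through e in the cone: for these y the operator exp(t ad [y,f])
  sends e to e + t y. By \<open>Ssing_eq\<close> they are the points of the cone of weight
  1.\<close>

definition Ssing :: "'g set" where "Ssing = {y:G 1. br y (br y f) = 0}"

lemma sgs: "sg (x + y) z = sg x z + sg y z" "sg (c *s x) z = c * sg x z" "sg 0 z = 0" "sg (- x) z = - sg x z" "sg (x - y) z = sg x z - sg y z"
 "sg z (x + y) = sg z x + sg z y" "sg z (c *s x) = c * sg z x" "sg z 0 = 0" "sg z (- x) = - sg z x" "sg z (x - y) = sg z x - sg z y" "sg x x = 0"
 by (simp_all add: sg_def brs bs)
lemma sg_anti: "sg y x = - sg x y" using anti[of x y] by (simp add: sg_def bs)
lemma lf_sg: "lf (sg z)" by (rule lfI) (simp_all add: sgs)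
lemma G1_br: "x : G 1 ==> y : G 1 ==> br x y = sg x y *s e" using G1_G1 by (simp add: sg_def)
lemma B_f_br: "B (br f x) y = sg x y" by (simp add: sg_def B_inv B_sym[of f])
lemma B_br_f: "B (br x (br f y)) c = sg y (br c x)" using anti[of x c] by (simp add: B_inv2[of x] B_f_br sgs)
lemma sg_nondeg: "x : G 1 ==> (!!y. y : G 1 ==> sg x y = 0) ==> x = 0"
proof -
 assume x: "x : G 1" "!!y. y : G 1 ==> sg x y = 0"
 have "br f x = 0" by (rule Gm1_0[OF f_G1[OF x(1)]]) (simp add: B_f_br x(2))
 thus "x = 0" using ef_G1[OF x(1)] by (simp add: brs)
qed
lemma pm_pair: "y : G 1 ==> B z y = B (pm z) y"
 using G_orth[OF eG, of y 1] G_orth[OF fG, of y 1] G_orth[OF p1G, of y 1 z] G_orth[OF p0G, of y 1 z] by (subst decomp[of z]) (simp add: bs)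
lemma sg_representing: "lf l ==> EX z:G 1. ALL y:G 1. l y = sg z y"
 by (metis B_representing B_f_br fe_Gm1 pmG pm_pair e_Gm1)
lemma ex_G0: "c : G 0 ==> x : G k ==> ex c t x : G k"
proof -
 assume c: "c : G 0" and x: "x : G k"
 have "br c h = 0" using GD[OF c] anti[of h c] by simp
 hence "ex c t h = h" using ex_nilp[of 1 c h t] by simp
 hence "br h (ex c t x) = ex c t (br h x)" using ex_hom[of c t h x] by simp
 thus ?thesis using GD[OF x] by (simp add: G_def les[OF le_ex])
qed
lemma limit_E0: "(!!r. r ~= 0 ==> x + r *s y + r^2 *s z + r^3 *s w : E0) ==> x : E0"
proof -
 assume r: "!!r. r ~= 0 ==> x + r *s y + r^2 *s z + r^3 *s w : E0"
 have "x + 0 *s y + 0^2 *s z + 0^3 *s w : E0" by (rule E0_limit[where ga = "%r. x + r *s y + r^2 *s z + r^3 *s w"])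
   (intro vhol_add vhol_scale vhol_const holomorphic_intros, rule r)
 thus ?thesis by simp
qed
lemma limit_E0_1: "(!!s. s ~= 0 ==> x + s *s y : E0) ==> y : E0"
proof -
 assume r: "!!s. s ~= 0 ==> x + s *s y : E0"
 have "y + r *s x + r^2 *s 0 + r^3 *s 0 : E0" if "r ~= 0" for r
  using E0_scale[OF r[of "1 / r"], of r] that by (simp add: scale_right_distrib add.commute)
 thus ?thesis by (rule limit_E0)
qed

lemma e_in_G1_Gm1: "y : G 1 ==> br (br y f) e = y" using ef_G1[of y] anti[of f y] anti[of "br y f" e] by (simp add: brs)
lemma Ssing_plane: assumes y: "y : Ssing" shows "ex (br y f) t e = e + t *s y" "ex (br y f) t y = y"
proof -
 have y1: "y : G 1" and yy: "br y (br y f) = 0" using y by (auto simp: Ssing_def)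
 have wy: "br (br y f) y = 0" using yy anti[of y "br y f"] by simp
 thus "ex (br y f) t y = y" using ex_nilp[of 1 "br y f" y t] by simp
 have "(br (br y f) ^^ 2) e = 0" by (simp add: numeral_2_eq_2 e_in_G1_Gm1[OF y1] wy)
 from ex_nilp[OF this, of t] show "ex (br y f) t e = e + t *s y" by (simp add: numeral_2_eq_2 e_in_G1_Gm1[OF y1])
qed
lemma plane_E0: assumes "y : Ssing" shows "s *s e + t *s y : E0"
proof -
 have 1: "e + t *s y : E0" for t using Ssing_plane(1)[OF assms, of t] E0_ex[OF E_E0[OF eE], of "br y f" t] by simp
 have y: "y : E0" by (rule limit_E0_1[OF 1])
 show ?thesis
 proof (cases "s = 0")
  case True thus ?thesis using E0_scale[OF y] by simp
 next
  case False
  have "s *s (e + (t / s) *s y) : E0" by (rule E0_scale[OF 1])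
  thus ?thesis using False by (simp add: scale_right_distrib)
 qed
qed
lemma Ssing_eq: "Ssing = E0 \<inter> G 1"
proof (intro Set.set_eqI iffI)
 fix y assume y: "y : Ssing"
 thus "y : E0 \<inter> G 1" using plane_E0[OF y, of 0 1] by (simp add: Ssing_def)
next
 fix y assume y: "y : E0 \<inter> G 1"
 hence "B y f = 0" using G_orth[OF _ fG, of y 1] by simp
 thus "y : Ssing" using y E0D[of y f] by (simp add: Ssing_def)
qed

lemma br_f_swap: assumes "x : G 1" "y : G 1" shows "br y (br f x) = br x (br f y) + sg x y *s h"
proof -
 have "- (sg x y *s h) = br (br f x) y + br x (br f y)" using leib[of f x y] G1_br[OF assms] fe by (simp add: brs)
 thus ?thesis unfolding anti[of y "br f x"] by (rule comb1[where k = 1]) (simp add: lfs field_simps)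
qed
text \<open>Let N be the orthogonal of P. Stability of span P gives [y,[f,n]] = 0 for y in span P
  and n in N, by pairing with G 0. For n, n' in N the difference of [n',[f,n]] and [n,[f,n']] is
  \<open>sg n n' *s h\<close>; both kill y0 and h fixes y0, so N is isotropic. Hence N lies in its
  own orthogonal span P, and its elements are singular.\<close>

lemma cone_orthogonal:
 assumes PG: "P \<subseteq> G 1" and y0: "y0 : P" "y0 ~= 0"
  and st: "!!c y. c : G 0 ==> y : P ==> br c y : span P"
  and n: "n : G 1" "!!y. y : P ==> sg y n = 0"
 shows "n : span P" "n : Ssing"
proof -
 let ?N = "{n:G 1. ALL y:P. sg y n = 0}"
 have spG: "span P \<subseteq> G 1" by (rule span_minimal[OF PG subspace_G])
 have spN: "sg y n = 0" if "n : ?N" "y : span P" for n y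
  using that(2) by (induction rule: span_induct_alt) (use that(1) in \<open>auto simp: sgs\<close>)
 have yn: "br y (br f n) = 0" if n: "n : ?N" and y: "y : span P" for n y using y
 proof (induction rule: span_induct_alt)
  case (step c y y')
  have "br y (br f n) = 0"
  proof (rule G0_0)
   show "br y (br f n) : G 0" using G_br'[OF _ f_G1, of y 1 n 0] PG step(1) n by auto
   show "B (br y (br f n)) c = 0" if "c : G 0" for c using spN[OF n st[OF that step(1)]] sg_anti[of "br c y" n] by (simp add: B_br_f)
  qed
  thus ?case using step by (simp add: brs)
 qed (simp add: brs)
 have iso: "sg n n' = 0" if n: "n : ?N" and n': "n' : ?N" for n n'
 proof -
  have z: "br (br n (br f n')) y0 = 0" if n: "n : ?N" and n': "n' : ?N" for n n'
  proof -
   have "br (br f n') y0 = 0" using yn[OF n' span_base[OF y0(1)]] anti[of y0 "br f n'"] by simp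
   moreover have "br n y0 = 0" using G1_br[of n y0] n y0 PG sg_anti[of n y0] by auto
   ultimately show ?thesis by (simp add: leib2 brs)
  qed
  have "br n' (br f n) = br n (br f n') + sg n n' *s h" using br_f_swap n n' by blast
  hence "sg n n' *s br h y0 = 0" using z[OF n n'] z[OF n' n] by (simp add: brs)
  moreover have "br h y0 = y0" using GD[of y0 1] y0 PG by auto
  ultimately show ?thesis using y0 by simp
 qed
 have nN: "n : ?N" using n by simp
 show sp: "n : span P"
 proof (rule ccontr)
  assume "n ~: span P"
  then obtain l where l: "lf l" "ALL w:span P. l w = 0" "l n = 1" using lf_separate[OF subspace_span] by blast
  obtain z where z: "z : G 1" "!!y. y : G 1 ==> l y = sg z y" using sg_representing[OF l(1)] by blast
  have "z : ?N"
  proof (intro CollectI conjI ballI z(1))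
   fix y assume y: "y : P"
   hence "sg z y = 0" using z(2)[of y] l(2) PG span_base by auto
   thus "sg y z = 0" using sg_anti[of y z] by simp
  qed
  thus False using iso[OF _ nN, of z] z(2)[OF n(1)] l(3) by simp
 qed
 have "br n f = - br f n" by (rule anti)
 hence "br n (br n f) = 0" using yn[OF nN sp] by (simp add: brs)
 thus "n : Ssing" using n by (simp add: Ssing_def)
qed

lemma cone_spans:
 assumes PG: "P \<subseteq> G 1" and y0: "y0 : P" "y0 ~= 0"
  and st: "!!c y. c : G 0 ==> y : P ==> br c y : span P"
  and N: "!!n. n : Ssing ==> n : span P ==> (!!y. y : P ==> sg y n = 0) ==> n = 0"
 shows "span P = G 1"
proof (rule antisym)
 show "span P \<subseteq> G 1" by (rule span_minimal[OF PG subspace_G])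
 show "G 1 \<subseteq> span P"
 proof (rule subsetI, rule ccontr)
  fix x assume x: "x : G 1" "x ~: span P"
  then obtain l where l: "lf l" "ALL w:span P. l w = 0" "l x = 1" using lf_separate[OF subspace_span] by blast
  obtain z where z: "z : G 1" "!!y. y : G 1 ==> l y = sg z y" using sg_representing[OF l(1)] by blast
  have zP: "sg y z = 0" if "y : P" for y using z(2)[of y] l(2) PG span_base[OF that] that sg_anti[of y z] by auto
  have "z = 0" by (rule N) (use cone_orthogonal[OF PG y0 st z(1) zP] zP in auto)
  thus False using z(2)[OF x(1)] l(3) by (simp add: sgs)
 qed
qed

text \<open>Take z in E pairing with y, remove its f-component by the exponential of [y,f], and let
  the torus degenerate it to its part of weight -1, which is then in the cone. Applying exp(s ad e)
  and letting s grow turns it into a singular vector that pairs with y.\<close>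

lemma Ssing_pairing: assumes y: "y : Ssing" "y ~= 0" shows "EX y':Ssing. sg y y' ~= 0"
proof -
 obtain z where z: "z : E" "B y z ~= 0" using E_pairing[OF y(2)] by blast
 \<comment> \<open>Chosen so that B z (e + t y) = 0; the pairing with y is unchanged since exp(t ad
   [y,f]) fixes y.\<close>
 define t where "t = - B z e / B z y"
 define z' where "z' = ex (br y f) (- t) z"
 have zy: "B z y ~= 0" using z(2) B_sym by simp
 have "B z' e = B z (e + t *s y)" using B_ex[of "br y f" "- t" z e] Ssing_plane(1)[OF y(1), of t] by (simp add: z'_def)
 hence e0: "B z' e = 0" using zy by (simp add: bs t_def)
 have "B z' y = B z y" using B_ex[of "br y f" "- t" z y] Ssing_plane(2)[OF y(1), of t] by (simp add: z'_def)
 hence y0: "B z' y ~= 0" using zy by simp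
 have z'E: "z' : E0" unfolding z'_def by (rule E0_ex[OF E_E0[OF z(1)]])
 have zd: "z' = B z' f *s e + p1 z' + p0 z' + pm z'" using decomp[of z'] e0 by simp
 \<comment> \<open>This is r exp(Ln r ad h) z': weight w is multiplied by r^(w+1), and weight -2 is
   absent.\<close>
 have "pm z' + r *s p0 z' + r^2 *s p1 z' + r^3 *s (B z' f *s e) : E0" if r: "r ~= 0" for r
 proof -
  have E: "exp (Ln r) = r" by (rule exp_Ln[OF r])
  have E2: "exp (Ln r * 2) = r^2" using exp_double[of "Ln r"] E by (simp add: mult.commute)
  have 1: "ex h (Ln r) e = r^2 *s e" using ex_eigen[OF he, of "Ln r"] E2 by simp
  have 2: "ex h (Ln r) (p1 z') = r *s p1 z'" using ex_eigen[OF GD[OF p1G], of "Ln r"] E by simp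
  have 3: "ex h (Ln r) (p0 z') = p0 z'" using ex_eigen[OF GD[OF p0G], of "Ln r"] by simp
  have 4: "ex h (Ln r) (pm z') = (1/r) *s pm z'" using ex_eigen[OF GD[OF pmG], of "Ln r"] E by (simp add: exp_minus field_simps)
  have "r *s ex h (Ln r) z' = r *s (B z' f *s (r^2 *s e) + r *s p1 z' + p0 z' + (1/r) *s pm z')"
   by (subst zd) (simp only: les[OF le_ex] 1 2 3 4)
  also have "\<dots> = pm z' + r *s p0 z' + r^2 *s p1 z' + r^3 *s (B z' f *s e)"
   using r by (simp add: scale_right_distrib power2_eq_square power3_eq_cube)
  finally show ?thesis using E0_scale[OF E0_ex[OF z'E], of r h "Ln r"] by simp
 qed
 hence pE: "pm z' : E0" by (rule limit_E0)
 have "(br e ^^ 2) (pm z') = 0" using VV[of "pm z'"] G_orth[OF eG pmG] by (simp add: numeral_2_eq_2)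
 hence "ex e s (pm z') = pm z' + s *s br e (pm z')" for s using ex_nilp[of 2 e "pm z'" s] by (simp add: numeral_2_eq_2)
 hence "pm z' + s *s br e (pm z') : E0" for s using E0_ex[OF pE, of e s] by simp
 hence "br e (pm z') : E0" by (rule limit_E0_1)
 hence S: "br e (pm z') : Ssing" by (simp add: Ssing_eq e_Gm1 pmG)
 have "y : G 1" using y by (simp add: Ssing_def)
 hence "sg (br e (pm z')) y ~= 0" using y0 pm_pair[of y z'] by (simp add: B_f_br[symmetric] fe_Gm1[OF pmG])
 thus ?thesis using S sg_anti[of y] by auto
qed

lemma Ssing_spans: assumes "y0 : Ssing" "y0 ~= 0" shows "span Ssing = G 1"
proof (rule cone_spans[OF _ assms])
 show "Ssing \<subseteq> G 1" by (auto simp: Ssing_def)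
 show "br c y : span Ssing" if "c : G 0" "y : Ssing" for c y
  by (rule stable_derivative[OF subspace_span span_base]) (use that in \<open>auto simp: Ssing_eq E0_ex ex_G0\<close>)
 show "n = 0" if n: "n : Ssing" "!!y. y : Ssing ==> sg y n = 0" for n
  by (metis Ssing_pairing n(1) n(2) sg_anti n)
qed

subsection \<open>The case without lines\<close>

text \<open>Polarised moment map of the degree 0 algebra on G 1. \<open>QQ x y\<close> says that
  \<open>bb x y\<close> acts as the element of sp(G 1) belonging to the symmetric tensor x y; the
  aim is to have this for all x and y.\<close>

definition bb :: "'g => 'g => 'g" where "bb x y = br x (br f y) + br y (br f x)"
definition QQ :: "'g => 'g => bool" where
 "QQ x y \<longleftrightarrow> (ALL z:G 1. br (bb x y) z = sg x z *s y + sg y z *s x)"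

lemma bb_sym: "bb x y = bb y x" by (simp add: bb_def)
lemma bbs: "bb (x + x') y = bb x y + bb x' y" "bb (c *s x) y = c *s bb x y" "bb 0 y = 0"
 "bb y (x + x') = bb y x + bb y x'" "bb y (c *s x) = c *s bb y x" "bb y 0 = 0" by (simp_all add: bb_def brs scale_right_distrib)
lemma bb_G0: "x : G 1 ==> y : G 1 ==> bb x y : G 0"
 using G_br'[OF _ f_G1, of x 1 y 0] G_br'[OF _ f_G1, of y 1 x 0] unfolding bb_def by (intro subspace_add subspace_G) auto
lemma QQ_add: "QQ x y ==> QQ x' y ==> QQ (x + x') y" by (simp add: QQ_def bbs brs sgs scale_left_distrib scale_right_distrib)
lemma QQ_scale: "QQ x y ==> QQ (c *s x) y" by (simp add: QQ_def bbs brs sgs scale_right_distrib)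
lemma QQ_0: "QQ 0 y" by (simp add: QQ_def bbs brs sgs)
lemma QQ_sym: "QQ x y \<longleftrightarrow> QQ y x" by (simp add: QQ_def bb_sym[of x y] add.commute)
lemma QQ_span: "x : span P ==> (!!p. p : P ==> QQ p y) ==> QQ x y" by (induction rule: span_induct_alt) (auto intro: QQ_0 QQ_add QQ_scale)
lemma QQ_polar: assumes "QQ (x + y) (x + y)" "QQ x x" "QQ y y" shows "QQ x y" unfolding QQ_def
proof
 fix z assume z: "z : G 1"
 have e1: "br (bb x x) z + (br (bb x y) z + br (bb x y) z) + br (bb y y) z = sg (x + y) z *s (x + y) + sg (x + y) z *s (x + y)"
  using assms(1)[unfolded QQ_def, rule_format, OF z] by (simp only: bbs bb_sym[of y x] brs ac_simps)
 show "br (bb x y) z = sg x z *s y + sg y z *s x"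
 proof (rule eqI_lf)
  fix l assume l: "lf l"
  have "2 * l (br (bb x y) z) = 2 * l (sg x z *s y + sg y z *s x)"
   using arg_cong[OF e1, of l] arg_cong[OF assms(2)[unfolded QQ_def, rule_format, OF z], of l]
    arg_cong[OF assms(3)[unfolded QQ_def, rule_format, OF z], of l] by (simp add: lfs[OF l] sgs algebra_simps)
  thus "l (br (bb x y) z) = l (sg x z *s y + sg y z *s x)" by simp
 qed
qed
lemma bb_h: "x : G 1 ==> y : G 1 ==> B (bb x y) h = 0"
 unfolding bb_def B_l B_br_f using GD[of x 1] GD[of y 1] sg_anti[of x y] by auto
lemma sg_G0: assumes "x : G 1" "y : G 1" "c : G 0" "B c h = 0" shows "sg (br c x) y = - sg x (br c y)"
proof -
 have "br c e = 0" using e_G0[OF assms(3)] assms(4) anti[of e c] by simp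
 hence "br c (br x y) = 0" using G1_br[OF assms(1,2)] by (simp add: brs)
 hence "br (br c x) y + br x (br c y) = 0" using leib[of c x y] by simp
 hence "B (br (br c x) y + br x (br c y)) f = B 0 f" by simp
 thus ?thesis by (simp add: sg_def eq_neg_iff_add_eq_0 bs)
qed
text \<open>Elements of G 0 orthogonal to h that kill G 1 also kill e, f and G (-1); they form an
  ideal that does not contain e.\<close>

lemma G0_faithful: assumes c: "c : G 0" "B c h = 0" and z: "!!z. z : G 1 ==> br c z = 0" shows "c = 0"
proof (rule ccontr)
 assume c0: "c ~= 0"
 let ?K = "{c:G 0. B c h = 0 & (ALL z:G 1. br c z = 0)}"
 have "?K = UNIV"
 proof (rule ideal_UNIV[of _ c])
  show "subspace ?K" using subspace_G[of 0] by (auto simp: subspace_def bs brs)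
  show "c : ?K" "c ~= 0" using c z c0 by auto
  fix x k assume k: "k : ?K"
  hence k0: "k : G 0" "B k h = 0" "!!z. z : G 1 ==> br k z = 0" by auto
  have ke: "br k e = 0" using e_G0[OF k0(1)] k0(2) anti[of e k] by simp
  have kf: "br k f = 0" using f_G0[OF k0(1)] k0(2) anti[of f k] by simp
  have km: "br k z = 0" if "z : G (-1)" for z
  proof -
   have "br k (br f (br e z)) = 0" using leib[of k f "br e z"] kf k0(3)[OF e_Gm1[OF that]] by (simp add: brs)
   thus ?thesis using fe_Gm1[OF that] by simp
  qed
  have "br k x = br k (p0 x)" by (subst decomp[of x]) (simp add: brs ke kf km pmG k0(3) p1G)
  hence x: "br x k = br (p0 x) k" using anti[of x k] anti[of "p0 x" k] by simp
  show "br x k : ?K" unfolding x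
  proof (intro CollectI conjI ballI)
   show "br (p0 x) k : G 0" using G_br'[OF p0G k0(1)] by simp
   show "B (br (p0 x) k) h = 0" using GD[OF k0(1)] anti[of h k] by (simp add: B_inv bs)
   show "br (br (p0 x) k) z = 0" if "z : G 1" for z
    using k0(3)[OF that] k0(3)[of "br (p0 x) z"] G_br'[OF p0G that, of 1 x] by (simp add: leib2 brs)
  qed
 qed
 hence "e : ?K" by simp
 hence "e : G 0" by simp
 thus False using he e0 by (simp add: G_def)
qed

lemma E0_G0_h: assumes "a : E0" "a : G 0" "a ~= 0" shows "B a h = 0"
proof -
 have "br a h = 0" using GD[OF assms(2)] anti[of h a] by simp
 thus ?thesis using E0D[OF assms(1), of h] assms(3) by (simp add: brs)
qed

text \<open>B(ad(m)^4 f, f) is a quartic form on G 1. Along the line x + t y it is a polynomial in t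
  whose coefficient at t^4 is the value at y: either that is 0 or the polynomial has a root.\<close>

lemma quartic_zero: assumes x: "x : G 1" "x ~= 0"
 shows "EX m:G 1. m ~= 0 & (br m ^^ 4) f = 0"
proof -
 obtain y where y: "y : G 1" "sg x y ~= 0" using sg_nondeg[OF x(1)] x(2) by blast
 have "EX C. (ALL t. (br (x + t *s y) ^^ k) f = (\<Sum>i\<le>k. t ^ i *s C i)) & C k = (br y ^^ k) f" for k
 proof (induction k)
  case 0 show ?case by auto
 next
  case (Suc k)
  then obtain C where C: "!!t. (br (x + t *s y) ^^ k) f = (\<Sum>i\<le>k. t ^ i *s C i)" "C k = (br y ^^ k) f" by blast
  define D where "D i = (if i \<le> k then br x (C i) else 0) + (if i = 0 then 0 else br y (C (i - 1)))" for i
  have "(br (x + t *s y) ^^ Suc k) f = (\<Sum>i\<le>Suc k. t ^ i *s D i)" for t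
  proof -
   have "(br (x + t *s y) ^^ Suc k) f = (\<Sum>i\<le>k. t ^ i *s br x (C i)) + (\<Sum>i\<le>k. t ^ Suc i *s br y (C i))"
    by (simp add: C(1) br_sum_r brs scale_right_distrib sum.distrib mult.commute)
   also have "(\<Sum>i\<le>k. t ^ i *s br x (C i)) = (\<Sum>i\<le>Suc k. t ^ i *s (if i \<le> k then br x (C i) else 0))" by simp
   also have "(\<Sum>i\<le>k. t ^ Suc i *s br y (C i)) = (\<Sum>i\<le>Suc k. t ^ i *s (if i = 0 then 0 else br y (C (i - 1))))"
    by (subst sum.atMost_Suc_shift) simp
   finally show ?thesis by (simp only: D_def scale_right_distrib sum.distrib)
  qed
  moreover have "D (Suc k) = (br y ^^ Suc k) f" by (simp add: D_def C(2))
  ultimately show ?case by blast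
 qed
 then obtain C where C: "!!t. (br (x + t *s y) ^^ 4) f = (\<Sum>i\<le>4. t ^ i *s C i)" "C 4 = (br y ^^ 4) f" by blast
 have up: "(br z ^^ k) f : G (of_nat k - 2)" if "z : G 1" for z k
 proof (induction k)
  case (Suc k) thus ?case using G_br'[OF that Suc, of "of_nat (Suc k) - 2"] by simp
 qed (simp add: fG)
 have val: "(br z ^^ 4) f = B ((br z ^^ 4) f) f *s e" if "z : G 1" for z using up[OF that, of 4] by (intro G_2) simp
 show ?thesis
 proof (cases "B (C 4) f = 0")
  case True
  hence "(br y ^^ 4) f = 0" using val[OF y(1)] C(2) by simp
  moreover have "y ~= 0" using y(2) by (auto simp: sgs)
  ultimately show ?thesis using y(1) by blast
 next
  case False
  obtain t where t: "(\<Sum>i\<le>4. B (C i) f * t ^ i) = 0"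
   by (rule Cauchy_Integral_Formula.fundamental_theorem_of_algebra[of "%i. B (C i) f" 4]) (use False in auto)
  have m: "x + t *s y : G 1" by (intro subspace_add subspace_scale subspace_G x y)
  have "B ((br (x + t *s y) ^^ 4) f) f = (\<Sum>i\<le>4. B (C i) f * t ^ i)"
   unfolding C(1) lf_sum[OF B_lf2] by (simp add: bs mult.commute)
  hence "(br (x + t *s y) ^^ 4) f = 0" using t val[OF m] by simp
  moreover have "x + t *s y ~= 0"
  proof
   assume "x + t *s y = 0"
   hence "sg (x + t *s y) y = 0" by (simp add: sgs)
   thus False using y(2) by (simp add: sgs)
  qed
  ultimately show ?thesis using m by blast
 qed
qed

context
 assumes no_lines: "Ssing \<subseteq> {0}"
begin

text \<open>For a zero m of the quartic, exp(s ad m) f is a cubic in s inside E, so its leading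
  coefficient is in the cone; it has weight 1 and is therefore 0 without lines. Then the next
  coefficient, half of [m,[m,f]], is in the cone, and it is nonzero because m is not
  singular.\<close>

lemma extremal_degree0: assumes "x : G 1" "x ~= 0" shows "EX a. a : E & a : G 0"
proof -
 obtain m where m: "m : G 1" "m ~= 0" "(br m ^^ 4) f = 0" using quartic_zero[OF assms] by blast
 let ?u = "br m f" and ?b = "br m (br m f)" and ?T = "br m (br m (br m f))"
 have G: "?u : G (-1)" "?b : G 0" "?T : G 1"
  using G_br'[OF m(1) fG, of "-1"] G_br'[OF m(1), of ?u "-1" 0] G_br'[OF m(1), of ?b 0 1] by auto
 have ex: "ex m s f = f + s *s ?u + (s^2 / 2) *s ?b + (s^3 / 6) *s ?T" for s using ex_nilp[OF m(3), of s] by (simp add: eval_nat_numeral)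
 have "(1/6) *s ?T + r *s ((1/2) *s ?b) + r^2 *s ?u + r^3 *s f : E0" if "r ~= 0" for r
 proof -
  have "r^3 *s ex m (1/r) f = (1/6) *s ?T + r *s ((1/2) *s ?b) + r^2 *s ?u + r^3 *s f"
   unfolding ex using that by (simp add: scale_right_distrib power2_eq_square power3_eq_cube ac_simps)
  thus ?thesis using E0_scale[OF E0_ex[OF E_E0[OF fE]], of "r^3" m "1/r"] by simp
 qed
 hence "(1/6) *s ?T : E0" by (rule limit_E0)
 hence "6 *s (1/6) *s ?T : E0" by (rule E0_scale)
 hence T: "?T = 0" using G(3) no_lines by (auto simp: Ssing_eq)
 have "(1/2) *s ?b + r *s ?u + r^2 *s f + r^3 *s 0 : E0" if "r ~= 0" for r
 proof -
  have "r^2 *s ex m (1/r) f = (1/2) *s ?b + r *s ?u + r^2 *s f + r^3 *s 0"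
   unfolding ex T using that by (simp add: scale_right_distrib power2_eq_square ac_simps)
  thus ?thesis using E0_scale[OF E0_ex[OF E_E0[OF fE]], of "r^2" m "1/r"] by simp
 qed
 hence "(1/2) *s ?b : E0" by (rule limit_E0)
 hence "2 *s (1/2) *s ?b : E0" by (rule E0_scale)
 hence "?b : E0" by simp
 moreover have "?b ~= 0" using m no_lines by (auto simp: Ssing_def)
 ultimately show ?thesis using G(2) by (auto simp: E_def)
qed

text \<open>Consider the quadratic form sg x [a,x] on G 1. For isotropic x the curve exp(s ad x) a
  is a line, so [x,a] is a vector of weight 1 in the cone and thus 0. A complex quadratic form whose
  isotropic vectors all lie in the radical has rank at most one.\<close>

lemma rank_one: assumes a: "a : E" "a : G 0" shows "EX n:G 1. n ~= 0 & (ALL z:G 1. br a z = sg n z *s n)"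
proof -
 have ah: "B a h = 0" by (rule E0_G0_h) (use a E_E0 E_0 in auto)
 have aG: "br a z : G 1" if "z : G 1" for z using G_br'[OF a(2) that] by simp
 have iso: "br a x = 0" if x: "x : G 1" and q: "sg x (br a x) = 0" for x
 proof -
  have xa: "br x a = - br a x" by (rule anti)
  have "br x (br x a) = 0" unfolding xa using G1_br[OF x aG[OF x]] q by (simp add: brs)
  hence "(br x ^^ 2) a = 0" by (simp add: numeral_2_eq_2)
  hence "ex x s a = a + s *s br x a" for s using ex_nilp[of 2 x a s] by (simp add: numeral_2_eq_2)
  hence "a + s *s br x a : E0" for s using E0_ex[OF E_E0[OF a(1)], of x s] by simp
  hence "br x a : E0" by (rule limit_E0_1)
  moreover have "br x a : G 1" using xa aG[OF x] subspace_neg[OF subspace_G] by simp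
  ultimately have "br x a = 0" using no_lines by (auto simp: Ssing_eq)
  thus ?thesis using xa by simp
 qed
 obtain x0 where x0: "x0 : G 1" "br a x0 ~= 0" using G0_faithful[OF a(2) ah] E_0[OF a(1)] by blast
 define m where "m = br a x0"
 define q where "q = sg x0 m"
 have q0: "q ~= 0" using iso[OF x0(1)] x0(2) by (auto simp: q_def m_def)
 have mG: "m : G 1" by (simp add: m_def aG x0)
 have Bs: "sg x (br a x0) = sg x0 (br a x)" if "x : G 1" for x using sg_G0[OF that x0(1) a(2) ah] sg_anti[of x0 "br a x"] by simp
 have az: "br a x = (sg x m / q) *s m" if x: "x : G 1" for x
 proof -
  \<comment> \<open>t is a root of the quadratic equation making x - t x0 isotropic.\<close>
  define s where "s = csqrt ((sg x m)\<^sup>2 - q * sg x (br a x))"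
  define t where "t = (sg x m + s) / q"
  have s2: "s * s = (sg x m)\<^sup>2 - q * sg x (br a x)" using power2_csqrt unfolding s_def power2_eq_square by metis
  have xG: "x - t *s x0 : G 1" by (intro subspace_diff subspace_scale subspace_G x x0)
  have "sg (x - t *s x0) (br a (x - t *s x0)) = sg x (br a x) - 2 * t * sg x m + t * t * q"
   using Bs[OF x] by (simp add: brs sgs q_def m_def algebra_simps)
  also have "\<dots> = (q * sg x (br a x) - 2 * (t * q) * sg x m + (t * q) * (t * q)) / q" using q0 by (simp add: field_simps)
  also have "t * q = sg x m + s" using q0 by (simp add: t_def)
  also have "q * sg x (br a x) - 2 * (sg x m + s) * sg x m + (sg x m + s) * (sg x m + s) = 0"
   using s2 by (simp add: algebra_simps power2_eq_square)
  finally have "br a (x - t *s x0) = 0" using iso[OF xG] by simp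
  hence ax: "br a x = t *s m" by (simp add: brs m_def)
  hence "sg x m = t * q" using Bs[OF x] by (simp add: sgs m_def q_def)
  thus ?thesis using ax q0 by simp
 qed
 \<comment> \<open>This square root normalises the rank-one operator to z |->
   \<open>sg n z *s n\<close> with n = \<open>r *s m\<close>.\<close>
 define r where "r = csqrt (- 1 / q)"
 have r2: "r * r = - 1 / q" using power2_csqrt unfolding r_def power2_eq_square by metis
 have r0: "r ~= 0" using r2 q0 by auto
 have "br a z = sg (r *s m) z *s (r *s m)" if "z : G 1" for z
 proof -
  have "sg (r *s m) z *s (r *s m) = ((r * r) * sg m z) *s m" by (simp add: sgs)
  also have "\<dots> = br a z" using az[OF that] sg_anti[of m z] by (simp add: r2)
  finally show ?thesis by simp
 qed
 moreover have "r *s m : G 1" by (intro subspace_scale subspace_G mG)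
 moreover have "r *s m ~= 0" using r0 x0(2) by (simp add: m_def)
 ultimately show ?thesis by blast
qed

text \<open>With n from \<open>rank_one\<close>, apply ad [a,[a,c]] = -2 B a c ad a to G 1: it gives
  B a c = sg n [c,n] for all c of weight 0, which identifies 2 a with \<open>bb n n\<close>.\<close>

lemma QQ_exists: assumes "x : G 1" "x ~= 0" shows "EX n:G 1. n ~= 0 & QQ n n"
proof -
 obtain a where a: "a : E" "a : G 0" using extremal_degree0[OF assms] by blast
 obtain n where n: "n : G 1" "n ~= 0" "!!z. z : G 1 ==> br a z = sg n z *s n" using rank_one[OF a] by blast
 have "B (2 *s a - bb n n) c = 0" if c: "c : G 0" for c
 proof -
  have cG: "br c z : G 1" if "z : G 1" for z using G_br'[OF c that] by simp
  obtain z where z: "z : G 1" "sg n z ~= 0" using sg_nondeg[OF n(1)] n(2) by blast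
  have "br (br a (br a c)) z = br ((- 2 * B a c) *s a) z" using E0D[OF E_E0[OF a(1)], of c] by simp
  moreover have "br (br a (br a c)) z = - ((sg n z * sg n (br c n)) *s n) - (sg n z * sg n (br c n)) *s n"
   using n(3) z(1) cG n(1) by (simp add: leib2 brs sgs)
  moreover have "br ((- 2 * B a c) *s a) z = (- 2 * (sg n z * B a c)) *s n" using n(3)[OF z(1)] by (simp add: brs)
  ultimately have "(- 2 * (sg n z * B a c)) *s n = - ((sg n z * sg n (br c n)) *s n) - (sg n z * sg n (br c n)) *s n" by simp
  hence "(sg n z * B a c) *s n = (sg n z * sg n (br c n)) *s n" by (rule comb1[where k = "-1/2"]) (simp add: lfs field_simps)
  hence "B a c = sg n (br c n)" using z(2) n(2) by simp
  thus ?thesis by (simp add: bs bb_def B_br_f)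
 qed
 hence "2 *s a - bb n n = 0" by (intro G0_0) (auto intro: subspace_diff subspace_scale subspace_G a bb_G0 n)
 hence "bb n n = 2 *s a" by simp
 hence "QQ n n" using n(3) by (simp add: QQ_def brs scale_left_distrib[symmetric])
 thus ?thesis using n by blast
qed

definition PP :: "'g set" where "PP = {m:G 1. QQ m m}"

lemma PP_ex: assumes m: "m : PP" and c: "c : G 0" "B c h = 0" shows "ex c t m : PP"
proof -
 have f: "ex c t f = f" and e: "ex c t e = e" for t
  using f_G0[OF c(1)] e_G0[OF c(1)] c(2) anti[of f c] anti[of e c] ex_nilp[of 1 c _ t] by auto
 have mG: "m : G 1" using m by (simp add: PP_def)
 have b: "bb (ex c t m) (ex c t m) = ex c t (bb m m)" by (simp add: bb_def ex_hom f les[OF le_ex])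
 have s: "sg (ex c t x) (ex c t y) = sg x y" for x y using B_ex2[of c t "br x y" f] by (simp add: sg_def ex_hom f)
 have "br (bb (ex c t m) (ex c t m)) z = sg (ex c t m) z *s ex c t m + sg (ex c t m) z *s ex c t m" if z: "z : G 1" for z
 proof -
  have "br (bb m m) (ex c (- t) z) = sg m (ex c (- t) z) *s m + sg m (ex c (- t) z) *s m"
   using m ex_G0[OF c(1) z] by (simp add: PP_def QQ_def)
  hence "ex c t (br (bb m m) (ex c (- t) z)) = sg m (ex c (- t) z) *s ex c t m + sg m (ex c (- t) z) *s ex c t m"
   by (simp add: les[OF le_ex])
  moreover have "sg m (ex c (- t) z) = sg (ex c t m) z" using s[of m "ex c (- t) z"] by (simp add: ex_inv)
  ultimately show ?thesis by (simp add: b ex_hom ex_inv)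
 qed
 thus ?thesis using ex_G0[OF c(1) mG] by (simp add: PP_def QQ_def)
qed
lemma G0_split: assumes "c : G 0" shows "EX c' k. c' : G 0 & B c' h = 0 & c = c' + k *s h"
 by (rule exI[of _ "c - (B c h / 2) *s h"], rule exI[of _ "B c h / 2"])
  (use assms in \<open>auto simp: bs Bs intro: subspace_diff subspace_scale subspace_G hG\<close>)
lemma span_stable: assumes P: "P \<subseteq> G 1" and st: "!!c y t. c : G 0 ==> B c h = 0 ==> y : P ==> ex c t y : span P"
  and c: "c : G 0" and y: "y : P" shows "br c y : span P"
proof -
 obtain c' k where c': "c' : G 0" "B c' h = 0" "c = c' + k *s h" using G0_split[OF c] by blast
 have "br c' y : span P" by (rule stable_derivative[OF subspace_span]) (rule st[OF c'(1,2) y])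
 moreover have "br h y = y" using GD[of y 1] y P by auto
 ultimately show ?thesis using c' span_base[OF y] by (simp add: brs span_add span_scale)
qed

text \<open>\<open>PP\<close> spans G 1 by \<open>cone_spans\<close>, since there are no nonzero
  singular vectors. For m, p in \<open>PP\<close> with sg m p ~= 0 a suitable exponential of
  \<open>bb m m\<close> sends p to p + m, so p + m is in \<open>PP\<close> and polarisation gives
  \<open>QQ p m\<close>. Such p still span, and linearity finishes.\<close>

lemma QQ_all: assumes x: "x : G 1" and y: "y : G 1" shows "QQ x y"
proof (cases "x = 0")
 case True thus ?thesis by (simp add: QQ_0)
next
 case False
 obtain n where n: "n : G 1" "n ~= 0" "QQ n n" using QQ_exists[OF x False] by blast
 have PG: "PP \<subseteq> G 1" by (auto simp: PP_def)
 have nP: "n : PP" using n by (simp add: PP_def)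
 have N0: "s = 0" if "s : Ssing" for s using that no_lines by auto
 have sp: "span PP = G 1" by (rule cone_spans[OF PG nP n(2) span_stable[OF PG]]) (auto intro: span_base PP_ex dest: N0)
 have one: "QQ m v" if m: "m : PP" "m ~= 0" and v: "v : G 1" for m v
 proof -
  have mG: "m : G 1" and mQ: "QQ m m" using m by (auto simp: PP_def)
  let ?P = "{p:PP. sg m p ~= 0}"
  have PG1: "?P \<subseteq> G 1" using PG by auto
  \<comment> \<open>The condition sg m p ~= 0 is not stable, but the span is: a functional vanishing
    on the span vanishes on the curve wherever the pairing is nonzero, hence everywhere by the
    identity theorem.\<close>
  have st: "ex c t p : span ?P" if c: "c : G 0" "B c h = 0" and p: "p : ?P" for c p t
  proof (rule ccontr)
   assume "ex c t p ~: span ?P"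
   then obtain l where l: "lf l" "ALL w:span ?P. l w = 0" "l (ex c t p) = 1" using lf_separate[OF subspace_span] by blast
   have "l (ex c t p) = 0"
   proof (rule holomorphic_mult_eq_0[of UNIV "%t. sg m (ex c t p)" "%t. l (ex c t p)" 0])
    show "(%t. sg m (ex c t p)) holomorphic_on UNIV" "(%t. l (ex c t p)) holomorphic_on UNIV"
     using ex_vhol[of c p UNIV] lf_sg l(1) unfolding vhol_def by blast+
    show "sg m (ex c t p) * l (ex c t p) = 0" for t
    proof (cases "sg m (ex c t p) = 0")
     case False
     hence "ex c t p : ?P" using PP_ex[OF _ c] p by auto
     thus ?thesis using l(2) span_base by auto
    qed simp
    show "sg m (ex c 0 p) ~= 0" using p by (simp add: ex_0)
   qed (auto simp: connected_UNIV)
   thus False using l(3) by simp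
  qed
  have "EX p:PP. sg m p ~= 0"
  proof (rule ccontr)
   assume c: "\<not> ?thesis"
   have "sg m z = 0" if "z : span PP" for z using that by (induction rule: span_induct_alt) (use c in \<open>auto simp: sgs\<close>)
   thus False using sg_nondeg[OF mG] m(2) sp by auto
  qed
  then obtain p0 where p: "p0 : PP" "sg m p0 ~= 0" by blast
  hence p0: "p0 : ?P" "p0 ~= 0" by (auto simp: sgs)
  have sp1: "span ?P = G 1" by (rule cone_spans[OF PG1 p0 span_stable[OF PG1 st]]) (auto dest: N0)
  have "QQ p m" if p: "p : ?P" for p
  proof -
   have pG: "p : G 1" and pQ: "QQ p p" and s0: "sg m p ~= 0" using p by (auto simp: PP_def)
   have "br (bb m m) p = (2 * sg m p) *s m" using mQ pG by (simp add: QQ_def scale_left_distrib[symmetric])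
   moreover have "br (bb m m) m = 0" using mQ mG by (simp add: QQ_def sgs)
   ultimately have bp: "br (bb m m) p = (2 * sg m p) *s m" "(br (bb m m) ^^ 2) p = 0" by (simp_all add: numeral_2_eq_2 brs)
   have "ex (bb m m) (1 / (2 * sg m p)) p = p + m" using ex_nilp[OF bp(2), of "1 / (2 * sg m p)"] bp(1) s0 by (simp add: numeral_2_eq_2)
   moreover have "ex (bb m m) (1 / (2 * sg m p)) p : PP" by (rule PP_ex) (use p mG in \<open>auto intro: bb_G0 bb_h\<close>)
   ultimately have "QQ (p + m) (p + m)" by (simp add: PP_def)
   thus ?thesis by (rule QQ_polar[OF _ pQ mQ])
  qed
  hence "QQ v m" using QQ_span[of v ?P m] v sp1 by auto
  thus ?thesis by (simp add: QQ_sym)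
 qed
 have "QQ m y" if "m : PP" for m using one[OF that _ y] by (cases "m = 0") (auto simp: QQ_0)
 thus ?thesis using QQ_span[of x PP y] x sp by auto
qed

lemma G1_Gm1_act: assumes "x : G 1" "y : G 1" "z : G 1"
 shows "br (br x (br f y)) z = (1/2) *s (sg x z *s y + sg y z *s x - sg x y *s z)"
proof -
 have "br x (br f y) = (1/2) *s (bb x y - sg x y *s h)"
  using br_f_swap[OF assms(1,2)] by (simp add: bb_def scale_right_distrib scale_left_distrib[symmetric])
 thus ?thesis using QQ_all[OF assms(1,2)] GD[OF assms(3)] assms(3) by (simp add: QQ_def brs)
qed

end
end

section \<open>Recognising the symplectic Lie algebra\<close>

lemma sum_lessThan_add: "(\<Sum>j<(n::nat) + m. g j) = (\<Sum>j<n. g j) + (\<Sum>j<m. (g (j + n) :: 'a :: comm_monoid_add))"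
 by (induction m) (simp_all add: ac_simps)
lemma symplectic_gram_index:
 "i < 2 * n ==> j < 2 * n ==> symplectic_gram n $$ (i, j) = (if i < n then if j = i + n then 1 else 0 else if i = j + n then - 1 else 0)"
 by (auto simp: symplectic_gram_def)

text \<open>The entries of \<open>symplectic_gram n * M\<close>; belonging to sp means that this
  matrix is symmetric.\<close>

definition gramM :: "nat => complex mat => nat => nat => complex" where
 "gramM n M i j = (if i < n then M $$ (i + n, j) else - M $$ (i - n, j))"

lemma sp_carrier_iff:
 assumes M: "M : carrier_mat (2 * n) (2 * n)"
 shows "M : sp_carrier n \<longleftrightarrow> (ALL i<2 * n. ALL j<2 * n. gramM n M i j = gramM n M j i)"
proof -
 have J: "symplectic_gram n : carrier_mat (2 * n) (2 * n)" by (rule carrier_matI) (simp_all add: symplectic_gram_def)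
 have 1: "(symplectic_gram n * M) $$ (i, j) = gramM n M i j" if i: "i < 2 * n" and j: "j < 2 * n" for i j
 proof -
  have "(symplectic_gram n * M) $$ (i, j) = (\<Sum>k\<in>{0..<2*n}. symplectic_gram n $$ (i, k) * M $$ (k, j))"
   using M J i j by (simp add: scalar_prod_def)
  also have "\<dots> = (\<Sum>k\<in>{0..<2*n}. if k = (if i < n then i + n else i - n) then gramM n M i j else 0)"
   by (rule sum.cong) (use i in \<open>auto simp: symplectic_gram_index gramM_def\<close>)
  also have "\<dots> = gramM n M i j" using i by auto
  finally show ?thesis .
 qed
 have 2: "(transpose_mat M * symplectic_gram n) $$ (i, j) = - gramM n M j i" if i: "i < 2 * n" and j: "j < 2 * n" for i j
 proof -
  have "(transpose_mat M * symplectic_gram n) $$ (i, j) = (\<Sum>k\<in>{0..<2*n}. M $$ (k, i) * symplectic_gram n $$ (k, j))"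
   using M J i j by (simp add: scalar_prod_def)
  also have "\<dots> = (\<Sum>k\<in>{0..<2*n}. if k = (if j < n then j + n else j - n) then - gramM n M j i else 0)"
   by (rule sum.cong) (use j in \<open>auto simp: symplectic_gram_index gramM_def\<close>)
  also have "\<dots> = - gramM n M j i" using j by auto
  finally show ?thesis .
 qed
 define N where "N = transpose_mat M * symplectic_gram n + symplectic_gram n * M"
 have N: "N : carrier_mat (2 * n) (2 * n)" using M J by (simp add: N_def)
 have Ni: "N $$ (i, j) = - gramM n M j i + gramM n M i j" if "i < 2 * n" "j < 2 * n" for i j
  unfolding 1[OF that, symmetric] 2[OF that, symmetric] N_def using M J that by simp
 have "M : sp_carrier n \<longleftrightarrow> N = 0\<^sub>m (2 * n) (2 * n)" unfolding sp_carrier_def N_def using M by simp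
 also have "\<dots> \<longleftrightarrow> (ALL i<2 * n. ALL j<2 * n. N $$ (i, j) = 0)" using N by auto
 also have "\<dots> \<longleftrightarrow> (ALL i<2 * n. ALL j<2 * n. - gramM n M j i + gramM n M i j = 0)" using Ni by simp
 finally show ?thesis by simp
qed

section \<open>The natural module of the symplectic algebra inside the grading\<close>

context triple begin

lemma prc_graded: "x : G 1 ==> prc x = x" "x : G (-1) ==> prc x = x" "prc e = 0" "prc f = 0"
 using G_orth[of x 1, OF _ fG] G_orth[of x 1, OF _ eG] G_orth[of x 1, OF _ hG]
  G_orth[of x "-1", OF _ fG] G_orth[of x "-1", OF _ eG] G_orth[of x "-1", OF _ hG] by (simp_all add: prc_def Bs ef fe1)
lemma parts_graded:
 "x : G 1 ==> p1 x = x & p0 x = 0 & pm x = 0 & B x e = 0 & B x f = 0 & B x h = 0"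
 "x : G (-1) ==> p1 x = 0 & p0 x = 0 & pm x = x & B x e = 0 & B x f = 0 & B x h = 0"
 "x : G 0 ==> p1 x = 0 & p0 x = x & pm x = 0 & B x e = 0 & B x f = 0"
 "p1 e = 0 & p0 e = 0 & pm e = 0" "p1 f = 0 & p0 f = 0 & pm f = 0"
proof -
 assume x: "x : G 1"
 have b: "B x e = 0 & B x f = 0 & B x h = 0" using G_orth[OF x fG] G_orth[OF x eG] G_orth[OF x hG] by simp
 have "p1 x = x" "pm x = 0" using x by (simp_all add: p1_def pm_def prc_graded ef_G1 e_G1 brs)
 thus "p1 x = x & p0 x = 0 & pm x = 0 & B x e = 0 & B x f = 0 & B x h = 0" using b by (simp add: p0_def)
next
 assume x: "x : G (-1)"
 have b: "B x e = 0 & B x f = 0 & B x h = 0" using G_orth[OF x fG] G_orth[OF x eG] G_orth[OF x hG] by simp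
 have "p1 x = 0" "pm x = x" using x by (simp_all add: p1_def pm_def prc_graded fe_Gm1 f_Gm1 brs)
 thus "p1 x = 0 & p0 x = 0 & pm x = x & B x e = 0 & B x f = 0 & B x h = 0" using b by (simp add: p0_def)
next
 assume x: "x : G 0"
 have b: "B x e = 0" "B x f = 0" using G_orth[OF x fG] G_orth[OF x eG] by auto
 have "p1 x = 0" "pm x = 0" using b e_G0[OF x] f_G0[OF x] by (simp_all add: p1_def pm_def prc_def brs eh fh)
 thus "p1 x = 0 & p0 x = x & pm x = 0 & B x e = 0 & B x f = 0" using b by (simp add: p0_def)
next
 show "p1 e = 0 & p0 e = 0 & pm e = 0" "p1 f = 0 & p0 f = 0 & pm f = 0" by (simp_all add: p1_def pm_def p0_def prc_graded brs Bs ef fe1)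
qed

lemma sg_G0': assumes "x : G 1" "y : G 1" "c : G 0" shows "sg (br c x) y + sg x (br c y) = B c h * sg x y"
proof -
 have "br (br c x) y + br x (br c y) = br c (br x y)" by (simp add: leib[of c x y])
 also have "\<dots> = (sg x y * B c h) *s e" using e_G0[OF assms(3)] anti[of e c] by (simp add: G1_br[OF assms(1,2)] brs)
 finally have "B (br (br c x) y + br x (br c y)) f = B ((sg x y * B c h) *s e) f" by simp
 thus ?thesis by (simp add: sg_def bs ef)
qed

text \<open>Darboux pairs with value 2 in place of 1, because \<open>Jf\<close> contains half of
  \<open>sg\<close>.\<close>

definition darb :: "'g set => nat => (nat => 'g) => (nat => 'g) => bool" where
 "darb W k p q \<longleftrightarrow> (ALL i<k. p i : W & q i : W) &
  (ALL i<k. ALL j<k. sg (p i) (q j) = (if i = j then 2 else 0) & sg (p i) (p j) = 0 & sg (q i) (q j) = 0) &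
  (ALL w:W. w = (\<Sum>i<k. (sg w (q i) / 2) *s p i - (sg w (p i) / 2) *s q i))"
lemma darbD: assumes "darb W k p q" shows "!!i. i < k ==> p i : W & q i : W"
   "!!i j. i < k ==> j < k ==> sg (p i) (q j) = (if i = j then 2 else 0) & sg (p i) (p j) = 0 & sg (q i) (q j) = 0"
   "!!w. w : W ==> w = (\<Sum>i<k. (sg w (q i) / 2) *s p i - (sg w (p i) / 2) *s q i)" using assms unfolding darb_def by blast+
lemma darboux:
 assumes "subspace W" "W \<subseteq> G 1" "!!w. w : W ==> (!!y. y : W ==> sg w y = 0) ==> w = 0"
 shows "EX k p q. darb W k p q" using assms
proof (induction "dim W" arbitrary: W rule: less_induct)
 case less
 note W = less.prems
 show ?case
 proof (cases "W \<subseteq> {0}")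
  case True
  hence "darb W 0 (%_. 0) (%_. 0)" by (auto simp: darb_def)
  thus ?thesis by blast
 next
  case False
  then obtain a where a: "a : W" "a ~= 0" by blast
  then obtain b0 where b0: "b0 : W" "sg a b0 ~= 0" using W(3)[OF a(1)] by blast
  define b where "b = (2 / sg a b0) *s b0"
  have b: "b : W" "sg a b = 2" using b0 by (simp_all add: b_def sgs subspace_scale[OF W(1)])
  hence b: "b : W" "sg a b = 2" "sg b a = -2" using sg_anti[of b a] by auto
  define W' where "W' = {w:W. sg w a = 0 & sg w b = 0}"
  have sW': "subspace W'" using W(1) by (auto simp: subspace_def W'_def sgs)
  have "a ~: W'" using b by (simp add: W'_def)
  moreover have "W' \<subseteq> W" by (auto simp: W'_def)
  ultimately have "W' \<subset> W" using a(1) by blast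
  hence "dim W' < dim W" using dim_psubset[of W' W] span_eq_iff[THEN iffD2, OF sW'] span_eq_iff[THEN iffD2, OF W(1)] by simp
  define pr where "pr w = w - (sg w b / 2) *s a + (sg w a / 2) *s b" for w
  have pr: "pr w : W'" if "w : W" for w
   using that a(1) b W(1) by (auto simp: W'_def pr_def sgs intro!: subspace_add subspace_diff subspace_scale)
  have nd: "w = 0" if w: "w : W'" and z: "!!y. y : W' ==> sg w y = 0" for w
  proof (rule W(3))
   show "w : W" using w by (simp add: W'_def)
   show "sg w y = 0" if "y : W" for y
   proof -
    have "sg w (pr y) = 0" by (rule z[OF pr[OF that]])
    thus ?thesis using w by (simp add: pr_def sgs W'_def)
   qed
  qed
  have WG: "W' \<subseteq> G 1" using W(2) \<open>W' \<subseteq> W\<close> by (rule subset_trans[rotated])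
  have "EX k p q. darb W' k p q" by (rule less.hyps[OF \<open>dim W' < dim W\<close> sW' WG]) (rule nd)
  then obtain k p q where D: "darb W' k p q" by blast
  note IH = darbD[OF D]
  define P Q where "P i = (if i < k then p i else a)" and "Q i = (if i < k then q i else b)" for i
  have PQ: "sg (p i) a = 0" "sg (p i) b = 0" "sg a (p i) = 0" "sg b (p i) = 0"
    "sg (q i) a = 0" "sg (q i) b = 0" "sg a (q i) = 0" "sg b (q i) = 0" if "i < k" for i
   using IH(1)[OF that] sg_anti[of "p i" a] sg_anti[of "p i" b] sg_anti[of "q i" a] sg_anti[of "q i" b] by (auto simp: W'_def)
  have "darb W (Suc k) P Q" unfolding darb_def
  proof (intro conjI allI impI ballI)
   fix i assume "i < Suc k"
   thus "P i : W" "Q i : W" using IH(1)[of i] a b by (auto simp: P_def Q_def W'_def)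
   fix j assume "j < Suc k"
   thus "sg (P i) (Q j) = (if i = j then 2 else 0)" "sg (P i) (P j) = 0" "sg (Q i) (Q j) = 0"
    using \<open>i < Suc k\<close> IH(2)[of i j] PQ[of i] PQ[of j] b by (auto simp: P_def Q_def sgs less_Suc_eq)
  next
   fix w assume w: "w : W"
   have "pr w = (\<Sum>i<k. (sg (pr w) (q i) / 2) *s p i - (sg (pr w) (p i) / 2) *s q i)" by (rule IH(3)[OF pr[OF w]])
   also have "\<dots> = (\<Sum>i<k. (sg w (Q i) / 2) *s P i - (sg w (P i) / 2) *s Q i)"
    by (rule sum.cong) (simp_all add: pr_def sgs PQ P_def Q_def)
   finally have "pr w = (\<Sum>i<k. (sg w (Q i) / 2) *s P i - (sg w (P i) / 2) *s Q i)" .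
   moreover have "w = pr w + ((sg w b / 2) *s a - (sg w a / 2) *s b)" by (simp add: pr_def)
   ultimately show "w = (\<Sum>i<Suc k. (sg w (Q i) / 2) *s P i - (sg w (P i) / 2) *s Q i)" by (simp add: P_def Q_def)
  qed
  thus ?thesis by blast
 qed
qed

text \<open>The standard representation on \<open>\<complex> \<oplus> G 1 \<oplus> \<complex>\<close>.\<close>

definition vs :: "complex => complex \<times> 'g \<times> complex => complex \<times> 'g \<times> complex" where
 "vs c w = (c * fst w, c *s fst (snd w), c * snd (snd w))"
text \<open>The symplectic form of the module; its invariance under \<open>rho\<close>, see
  \<open>Jf_skew\<close>, fixes the factor 1/2.\<close>

definition Jf :: "complex \<times> 'g \<times> complex => complex \<times> 'g \<times> complex => complex" where
 "Jf w w' = fst w * snd (snd w') - snd (snd w) * fst w' + sg (fst (snd w)) (fst (snd w')) / 2"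
definition VS :: "(complex \<times> 'g \<times> complex) set" where "VS = {w. fst (snd w) : G 1}"
definition rho :: "'g => complex \<times> 'g \<times> complex => complex \<times> 'g \<times> complex" where
 "rho x w = (case w of (u, z, v) =>
  (B x h / 2 * u + sg (p1 x) z / 2 + B x f * v,
   br (p0 x) z - (B x h / 2) *s z - u *s br e (pm x) + v *s p1 x,
   B x e * u + sg (br e (pm x)) z / 2 - B x h / 2 * v))"

lemma Jf_simps: "Jf (w + w') y = Jf w y + Jf w' y" "Jf (vs c w) y = c * Jf w y" "Jf y (w + w') = Jf y w + Jf y w'" "Jf y (vs c w) = c * Jf y w"
 "Jf (- w) y = - Jf w y" "Jf (w - w') y = Jf w y - Jf w' y" "Jf y (w - w') = Jf y w - Jf y w'" "Jf 0 y = 0" "Jf y 0 = 0"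
 by (simp_all add: Jf_def vs_def sgs algebra_simps diff_divide_distrib)
lemma Jf_anti: "Jf w y = - Jf y w" using sg_anti[of "fst (snd w)" "fst (snd y)"] by (simp add: Jf_def)
lemma rho_add: "rho (x + y) w = rho x w + rho y w"
 by (cases w) (simp add: rho_def bs brs sgs les[OF le_p1] les[OF le_p0] les[OF le_pm] scale_right_distrib scale_left_distrib algebra_simps add_divide_distrib)
lemma rho_scale: "rho (c *s x) w = vs c (rho x w)"
 by (cases w) (simp add: rho_def vs_def bs brs sgs les[OF le_p1] les[OF le_p0] les[OF le_pm] scale_right_distrib scale_right_diff_distrib algebra_simps)
lemma rho_minus: "rho (- x) w = - rho x w" using rho_scale[of "-1" x w] by (simp add: vs_def prod_eq_iff)
lemma rho_diff: "rho (x - y) w = rho x w - rho y w" using rho_add[of x "- y" w] by (simp add: rho_minus)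
lemma rho_0: "rho 0 w = 0" using rho_scale[of 0 0 w] by (simp add: vs_def zero_prod_def)
lemma rho_add2: "rho x (w + w') = rho x w + rho x w'"
 by (cases w; cases w') (simp add: rho_def brs sgs scale_right_distrib scale_left_distrib algebra_simps add_divide_distrib)
lemma rho_scale2: "rho x (vs c w) = vs c (rho x w)"
 by (cases w) (simp add: rho_def vs_def brs sgs scale_right_distrib scale_right_diff_distrib algebra_simps)
lemma rho_VS: assumes w: "w : VS" shows "rho x w : VS"
proof -
 obtain u z v where [simp]: "w = (u, z, v)" by (cases w)
 have z: "z : G 1" using w by (simp add: VS_def)
 have "br (p0 x) z : G 1" using G_br'[OF p0G z] by simp
 thus ?thesis using z by (simp add: VS_def rho_def) (intro subspace_add subspace_diff subspace_scale subspace_G p1G e_Gm1 pmG)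
qed
lemma rho_graded:
 "rho e (u, z, v) = (v, 0, 0)" "rho f (u, z, v) = (0, 0, u)"
 "x : G 1 ==> rho x (u, z, v) = (sg x z / 2, v *s x, 0)"
 "x : G 1 ==> rho (br f x) (u, z, v) = (0, - (u *s x), sg x z / 2)"
 "c : G 0 ==> rho c (u, z, v) = (B c h / 2 * u, br c z - (B c h / 2) *s z, - (B c h / 2 * v))"
 using parts_graded(1)[of x] parts_graded(2)[OF f_G1[of x]] parts_graded(3)[of c] parts_graded(4,5) ef_G1[of x]
 by (auto simp: rho_def brs sgs Bs ef fe1)
lemma rho_h: "z : G 1 ==> rho h (u, z, v) = (u, 0, - v)" using rho_graded(5)[OF hG] GD[of z 1] by (simp add: Bs)

lemma Jf_skew: assumes w: "w : VS" "w' : VS" shows "Jf (rho x w) w' = - Jf w (rho x w')"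
proof -
 obtain u z v u' z' v' where [simp]: "w = (u, z, v)" "w' = (u', z', v')" by (cases w; cases w')
 have z: "z : G 1" "z' : G 1" using w by (simp_all add: VS_def)
 have "sg (br (p0 x) z) z' = B x h * sg z z' - sg z (br (p0 x) z')" using sg_G0'[OF z p0G, of x] by (simp add: p0_h algebra_simps)
 thus ?thesis using sg_anti[of z "p1 x"] sg_anti[of z "br e (pm x)"]
  by (simp add: rho_def Jf_def sgs add_divide_distrib diff_divide_distrib ring_distribs mult.commute mult.left_commute)
qed

definition rho_hom :: "'g => 'g => bool" where
 "rho_hom x y \<longleftrightarrow> (ALL w:VS. rho (br x y) w = rho x (rho y w) - rho y (rho x w))"
lemma rho_hom_sym: "rho_hom x y ==> rho_hom y x" using anti[of y x] by (simp add: rho_hom_def rho_minus)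
lemma rho_hom_add: "rho_hom x y ==> rho_hom x' y ==> rho_hom (x + x') y" by (simp add: rho_hom_def brs rho_add rho_add2)
lemma vs_diff: "vs c (w - w') = vs c w - vs c w'" by (simp add: vs_def scale_right_diff_distrib right_diff_distrib)
lemma rho_hom_scale: "rho_hom x y ==> rho_hom (c *s x) y" by (simp add: rho_hom_def brs rho_scale rho_scale2 vs_diff)
lemma rho_hom_graded:
 assumes "rho_hom e y" "rho_hom f y" "!!x. x : G 1 ==> rho_hom x y" "!!x. x : G 0 ==> rho_hom x y" "!!x. x : G 1 ==> rho_hom (br f x) y"
 shows "rho_hom x y"
 by (metis fe_Gm1 pmG assms(5) e_Gm1 decomp rho_hom_add rho_hom_scale assms(1,2) assms(3) p1G assms(4) p0G)
lemma rho_homI: "(!!u z v. z : G 1 ==> rho (br x y) (u, z, v) = rho x (rho y (u, z, v)) - rho y (rho x (u, z, v))) ==> rho_hom x y"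
 unfolding rho_hom_def VS_def by auto

context
 assumes no_lines: "Ssing \<subseteq> {0}"
begin

text \<open>Checked on pairs of graded pieces. Absence of lines enters for G 1 against G (-1), where
  [x,[f,y]] must act on G 1 as \<open>G1_Gm1_act\<close> prescribes.\<close>

lemma rho_hom_all: "rho_hom x y"
proof -
 have ee: "rho_hom e e" and ff: "rho_hom f f" by (auto intro!: rho_homI simp: brs rho_0)
 have ef': "rho_hom e f" by (rule rho_homI) (simp add: zero_prod_def h_def[symmetric] rho_h rho_graded)
 have e1: "rho_hom e x" if "x : G 1" for x by (rule rho_homI) (simp add: zero_prod_def rho_graded that e_G1[OF that] rho_0 sgs)
 have e0': "rho_hom e c" if "c : G 0" for c
  by (rule rho_homI) (simp add: zero_prod_def rho_graded that e_G0[OF that] rho_minus rho_scale vs_def brs)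
 have em: "rho_hom e (br f x)" if "x : G 1" for x by (rule rho_homI) (simp add: zero_prod_def rho_graded that ef_G1[OF that] sgs)
 have f1: "rho_hom f x" if "x : G 1" for x by (rule rho_homI) (simp add: zero_prod_def rho_graded that sgs)
 have f0': "rho_hom f c" if "c : G 0" for c by (rule rho_homI) (simp add: zero_prod_def rho_graded that f_G0[OF that] rho_scale vs_def brs)
 have fm: "rho_hom f (br f x)" if "x : G 1" for x
  by (rule rho_homI) (simp add: zero_prod_def rho_graded that f_Gm1[OF f_G1[OF that]] rho_0 sgs)
 have k11: "rho_hom x y" if "x : G 1" "y : G 1" for x y
  by (rule rho_homI) (use sg_anti[of x y] that in \<open>simp add: zero_prod_def rho_graded G1_br rho_scale rho_minus vs_def sgs\<close>)
 have k10: "rho_hom c x" if c: "c : G 0" and x: "x : G 1" for x c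
 proof (rule rho_homI)
  fix u z v assume z: "z : G 1"
  have cx: "br c x : G 1" using G_br'[OF c x] by simp
  have "sg x (br c z) = B c h * sg x z - sg (br c x) z" using sg_G0'[OF x z c] by (simp add: algebra_simps)
  thus "rho (br c x) (u, z, v) = rho c (rho x (u, z, v)) - rho x (rho c (u, z, v))"
   by (simp add: zero_prod_def rho_graded c x cx brs sgs add_divide_distrib diff_divide_distrib ring_distribs mult.commute mult.left_commute)
 qed
 have k1m: "rho_hom x (br f y)" if x: "x : G 1" and y: "y : G 1" for x y
 proof (rule rho_homI)
  fix u z v assume z: "z : G 1"
  have g: "br x (br f y) : G 0" using G_br'[OF x f_G1[OF y]] by simp
  have b: "B (br x (br f y)) h = - sg x y" using GD[OF x] sg_anti[of x y] by (simp add: B_br_f)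
  show "rho (br x (br f y)) (u, z, v) = rho x (rho (br f y) (u, z, v)) - rho (br f y) (rho x (u, z, v))"
   using sg_anti[of x y] by (simp add: zero_prod_def rho_graded g x y b G1_Gm1_act[OF no_lines x y z] sgs scale_right_distrib algebra_simps)
 qed
 have k00: "rho_hom c d" if c: "c : G 0" and d: "d : G 0" for c d
 proof (rule rho_homI)
  fix u z v assume z: "z : G 1"
  have g: "br c d : G 0" using G_br'[OF c d] by simp
  have b: "B (br c d) h = 0" using GD[OF d] anti[of h d] by (simp add: B_inv bs)
  show "rho (br c d) (u, z, v) = rho c (rho d (u, z, v)) - rho d (rho c (u, z, v))"
   by (simp add: zero_prod_def rho_graded g c d b leib2 brs algebra_simps)
 qed
 have k0m: "rho_hom c (br f y)" if c: "c : G 0" and y: "y : G 1" for c y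
 proof (rule rho_homI)
  fix u z v assume z: "z : G 1"
  have cy: "br c y - B c h *s y : G 1" using G_br'[OF c y] by (intro subspace_diff subspace_scale subspace_G y) simp
  have "br c f = - B c h *s f" using f_G0[OF c] anti[of c f] by simp
  hence b: "br c (br f y) = br f (br c y - B c h *s y)" using leib[of c f y] by (simp add: brs)
  have "sg y (br c z) = B c h * sg y z - sg (br c y) z" using sg_G0'[OF y z c] by (simp add: algebra_simps)
  thus "rho (br c (br f y)) (u, z, v) = rho c (rho (br f y) (u, z, v)) - rho (br f y) (rho c (u, z, v))"
   unfolding b rho_graded(4)[OF cy] by (simp add: zero_prod_def rho_graded c y brs sgs scale_right_diff_distrib add_divide_distrib diff_divide_distrib ring_distribs mult.commute mult.left_commute)
    (simp add: zero_prod_def scale_left_distrib[symmetric])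
 qed
 have mm: "rho_hom (br f x) (br f y)" if x: "x : G 1" and y: "y : G 1" for x y
 proof (rule rho_homI)
  fix u z v
  have "br (br f y) e = - y" using anti[of "br f y" e] ef_G1[OF y] by simp
  hence "B (br (br f x) (br f y)) e = - sg x y" by (simp add: B_inv[of "br f x"] bs B_f_br)
  hence b: "br (br f x) (br f y) = (- sg x y) *s f" using Gm1_Gm1[OF f_G1[OF x] f_G1[OF y]] by simp
  show "rho (br (br f x) (br f y)) (u, z, v) = rho (br f x) (rho (br f y) (u, z, v)) - rho (br f y) (rho (br f x) (u, z, v))"
   unfolding b rho_scale using sg_anti[of x y] by (simp add: rho_graded x y sgs vs_def)
 qed
 have A: "rho_hom e y" for y by (rule rho_hom_sym[OF rho_hom_graded]) (auto intro: rho_hom_sym ee ef' e1 e0' em)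
 have Bs: "rho_hom f y" for y by (rule rho_hom_sym[OF rho_hom_graded]) (auto intro: rho_hom_sym ff ef' f1 f0' fm)
 have C: "rho_hom x y" if "x : G 1" for x y by (rule rho_hom_sym[OF rho_hom_graded]) (auto intro: rho_hom_sym A Bs k11 k10 k1m that)
 have D: "rho_hom x y" if "x : G 0" for x y by (rule rho_hom_sym[OF rho_hom_graded]) (auto intro: rho_hom_sym A Bs C k00 k0m that)
 have F: "rho_hom (br f x) y" if "x : G 1" for x y by (rule rho_hom_sym[OF rho_hom_graded]) (auto intro: rho_hom_sym A Bs C D mm that)
 show ?thesis by (rule rho_hom_graded[OF A Bs C D F])
qed

lemma rho_faithful: assumes "!!w. w : VS ==> rho x w = 0" shows "x = 0"
proof (rule ccontr)
 assume x: "x ~= 0"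
 have "{x. ALL w:VS. rho x w = 0} = UNIV"
 proof (rule ideal_UNIV[of _ x])
  show "subspace {x. ALL w:VS. rho x w = 0}" by (auto simp: subspace_def rho_0 rho_add rho_scale vs_def zero_prod_def)
  fix a y assume y: "y : {x. ALL w:VS. rho x w = 0}"
  have "rho a 0 = 0" using rho_scale2[of a 0 0] by (simp add: vs_def zero_prod_def)
  thus "br a y : {x. ALL w:VS. rho x w = 0}" using rho_hom_all[of a y] y rho_VS by (auto simp: rho_hom_def)
 qed (use x assms in auto)
 hence "e : {x. ALL w:VS. rho x w = 0}" by simp
 hence "rho e (0, 0, 1) = 0" using subspace_0[OF subspace_G] by (auto simp: VS_def)
 thus False by (simp add: rho_graded zero_prod_def)
qed

text \<open>Inverse of \<open>rho\<close> on symmetric tensors: Sym^2 of a symplectic space is its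
  algebra sp, and \<open>rho_symm\<close> is the usual action of w w'. This provides preimages of
  all matrices in sp.\<close>

definition symm :: "complex \<times> 'g \<times> complex => complex \<times> 'g \<times> complex => 'g" where
 "symm w w' = (case w of (u, x, v) => case w' of (u', x', v') =>
  (2 * u * u') *s e - (u * v' + v * u') *s h - (2 * v * v') *s f + u *s x' + u' *s x
  + v *s br f x' + v' *s br f x + (1/2) *s bb x x')"

lemma rho_symm: assumes w: "w : VS" "w' : VS" "y : VS"
 shows "rho (symm w w') y = vs (Jf w y) w' + vs (Jf w' y) w"
proof -
 obtain u x v u' x' v' where [simp]: "w = (u, x, v)" "w' = (u', x', v')" by (cases w; cases w')
 obtain a z b where [simp]: "y = (a, z, b)" by (cases y)
 have z: "x : G 1" "x' : G 1" "z : G 1" using w by (simp_all add: VS_def)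
 have bG: "bb x x' : G 0" "B (bb x x') h = 0" by (rule bb_G0[OF z(1,2)], rule bb_h[OF z(1,2)])
 have q: "br (bb x x') z = sg x z *s x' + sg x' z *s x" using QQ_all[OF no_lines z(1,2)] z(3) by (simp add: QQ_def)
 show ?thesis by (simp add: symm_def rho_add rho_diff rho_scale rho_graded rho_h z bG q vs_def Jf_def)
   (simp add: add_divide_distrib diff_divide_distrib ring_distribs scale_left_distrib scale_right_distrib scale_left_diff_distrib scale_right_diff_distrib mult.commute mult.left_commute)
qed

lemma isomorphic_sp: "EX n. isomorphic_to_sp smul br n"
proof -
 obtain k p q where "darb (G 1) k p q" using darboux[OF subspace_G subset_refl sg_nondeg] by blast
 note D = darbD[OF this]
 define n where "n = Suc k"
 define P :: "nat => complex \<times> 'g \<times> complex" where "P i = (if i < k then (0, p i, 0) else (1, 0, 0))" for i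
 define Q :: "nat => complex \<times> 'g \<times> complex" where "Q i = (if i < k then (0, q i, 0) else (0, 0, 1))" for i
 have PVS: "P i : VS" and QVS: "Q i : VS" for i using D(1)[of i] subspace_0[OF subspace_G] by (auto simp: P_def Q_def VS_def)
 have PQ: "Jf (P i) (Q j) = (if i = j then 1 else 0)" "Jf (P i) (P j) = 0" "Jf (Q i) (Q j) = 0" if "i < n" "j < n" for i j
  using D(2)[of i j] that by (auto simp: P_def Q_def Jf_def n_def sgs)
 have expd: "w = (\<Sum>i<n. vs (Jf w (Q i)) (P i) - vs (Jf w (P i)) (Q i))" if w: "w : VS" for w
 proof -
  obtain u z v where [simp]: "w = (u, z, v)" by (cases w)
  have z: "z : G 1" using w by (simp add: VS_def)
  have "(\<Sum>i<k. vs (Jf w (Q i)) (P i) - vs (Jf w (P i)) (Q i)) = (\<Sum>i<k. (0, (sg z (q i) / 2) *s p i - (sg z (p i) / 2) *s q i, 0))"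
   by (rule sum.cong) (simp_all add: P_def Q_def Jf_def vs_def)
  also have "\<dots> = (0, \<Sum>i<k. (sg z (q i) / 2) *s p i - (sg z (p i) / 2) *s q i, 0)"
   by (induction k) (simp_all add: zero_prod_def)
  also have "\<dots> = (0, z, 0)" using D(3)[OF z] by simp
  finally show ?thesis by (simp add: n_def P_def Q_def Jf_def vs_def sgs)
 qed
 \<comment> \<open>\<open>vb\<close> is the symplectic basis ordered as in
   \<open>symplectic_gram\<close>, \<open>vd\<close> its dual basis with respect to
   \<open>Jf\<close>, and \<open>xi\<close> are the coordinates.\<close>
 define vb where "vb j = (if j < n then P j else Q (j - n))" for j
 define vd where "vd j = (if j < n then - Q j else P (j - n))" for j
 define xi where "xi i w = (if i < n then Jf w (Q i) else - Jf w (P (i - n)))" for i w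
 have vbVS: "vb j : VS" for j by (simp add: vb_def PVS QVS)
 have vdVS: "vd j : VS" for j using PVS[of "j - n"] QVS[of j] subspace_neg[OF subspace_G] by (auto simp: vd_def VS_def)
 have xi_lin: "xi i (w + w') = xi i w + xi i w'" "xi i (vs c w) = c * xi i w" "xi i (w - w') = xi i w - xi i w'" "xi i 0 = 0" for i c w w'
  by (simp_all add: xi_def Jf_simps)
 have xi_sum: "xi i (sum F A) = (\<Sum>a\<in>A. xi i (F a))" for i F and A :: "nat set"
  by (induction A rule: infinite_finite_induct) (simp_all add: xi_lin)
 have xi_vb: "xi i (vb j) = (if i = j then 1 else 0)" if "i < 2 * n" "j < 2 * n" for i j
 proof -
  have "Jf (Q j) (P i) = - (if i = j then 1 else 0)" if "i < n" "j < n" for i j using PQ(1)[OF that] Jf_anti[of "Q j" "P i"] by simp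
  thus ?thesis using that PQ by (auto simp: xi_def vb_def)
 qed
 have vexp: "w = (\<Sum>j<2*n. vs (xi j w) (vb j))" if w: "w : VS" for w
 proof -
  have "(\<Sum>j<2*n. vs (xi j w) (vb j)) = (\<Sum>j<n. vs (xi j w) (vb j)) + (\<Sum>j<n. vs (xi (j + n) w) (vb (j + n)))"
   unfolding mult_2 by (rule sum_lessThan_add)
  also have "\<dots> = (\<Sum>j<n. vs (Jf w (Q j)) (P j) - vs (Jf w (P j)) (Q j))"
   unfolding sum.distrib[symmetric] by (rule sum.cong) (simp_all add: xi_def vb_def vs_def prod_eq_iff)
  finally show ?thesis using expd[OF w] by simp
 qed
 define F where "F x = mat (2 * n) (2 * n) (%(i, j). xi i (rho x (vb j)))" for x
 have Fc: "F x : carrier_mat (2 * n) (2 * n)" for x by (simp add: F_def)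
 have Fd: "dim_row (F x) = 2 * n" "dim_col (F x) = 2 * n" for x by (simp_all add: F_def)
 have Fi: "F x $$ (i, j) = xi i (rho x (vb j))" if "i < 2 * n" "j < 2 * n" for x i j using that by (simp add: F_def)
 have gram: "(if i < n then xi (i + n) w else - xi (i - n) w) = Jf (vb i) w" if "i < 2 * n" for i w
 proof (cases "i < n")
  case True thus ?thesis using Jf_anti[of w "P i"] by (simp add: xi_def vb_def)
 next
  case False
  hence "i - n < n" using that by simp
  thus ?thesis using False Jf_anti[of w "Q (i - n)"] by (simp add: xi_def vb_def)
 qed
 have Fsp: "F x : sp_carrier n" for x unfolding sp_carrier_iff[OF Fc]
 proof (intro allI impI)
  fix i j assume ij: "i < 2 * n" "j < 2 * n"
  have g: "gramM n (F x) i j = Jf (vb i) (rho x (vb j))" if ij: "i < 2 * n" "j < 2 * n" for i j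
   unfolding gramM_def gram[OF ij(1), of "rho x (vb j)", symmetric] using ij by (auto simp: Fi)
  show "gramM n (F x) i j = gramM n (F x) j i" using Jf_skew[OF vbVS vbVS, of x i j] Jf_anti[of "rho x (vb i)" "vb j"] by (simp add: g ij)
 qed
 have sum_lin: "l (\<Sum>k<m. vs (c k) (b k)) = (\<Sum>k<m. c k * l (b k))"
  if "!!w w'. l (w + w') = l w + l w'" "!!c w. l (vs c w) = c * l w"
  for l :: "complex \<times> 'g \<times> complex => complex" and c b and m :: nat
 proof (induction m)
  case 0 show ?case using that(2)[of 0 0] by (simp add: vs_def zero_prod_def)
 qed (simp add: that)
 have prod: "(F x * F y) $$ (i, j) = xi i (rho x (rho y (vb j)))" if ij: "i < 2 * n" "j < 2 * n" for x y i j
 proof -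
  have "xi i (rho x (rho y (vb j))) = xi i (rho x (\<Sum>k<2*n. vs (xi k (rho y (vb j))) (vb k)))" using vexp[OF rho_VS[OF vbVS]] by simp
  also have "\<dots> = (\<Sum>k<2*n. xi k (rho y (vb j)) * xi i (rho x (vb k)))"
   by (rule sum_lin[of "%w. xi i (rho x w)"]) (simp_all add: rho_add2 rho_scale2 xi_lin)
  also have "\<dots> = (\<Sum>k\<in>{0..<2*n}. F x $$ (i, k) * F y $$ (k, j))"
   unfolding lessThan_atLeast0 by (rule sum.cong[OF refl], subst mult.commute) (simp add: Fi ij)
  finally show ?thesis using ij by (simp add: scalar_prod_def Fd)
 qed
 have "inj F"
 proof (rule injI)
  fix x y assume xy: "F x = F y"
  have "rho (x - y) w = 0" if w: "w : VS" for w
  proof -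
   have e: "xi i (rho (x - y) (vb j)) = 0" if "i < 2 * n" "j < 2 * n" for i j
    using xy Fi[OF that, of x] Fi[OF that, of y] by (simp add: rho_diff xi_lin)
   have z: "rho (x - y) (vb j) = 0" if "j < 2 * n" for j
    using vexp[OF rho_VS[OF vbVS], of "x - y" j] e[OF _ that] by (simp add: vs_def zero_prod_def[symmetric])
   have "xi i (rho (x - y) w) = 0" if i: "i < 2 * n" for i
   proof -
    have "xi i (rho (x - y) (\<Sum>k<2*n. vs (xi k w) (vb k))) = (\<Sum>k<2*n. xi k w * xi i (rho (x - y) (vb k)))"
     by (rule sum_lin[of "%w. xi i (rho (x - y) w)"]) (simp_all add: rho_add2 rho_scale2 xi_lin)
    thus ?thesis using vexp[OF w] z by (simp add: xi_lin)
   qed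
   thus ?thesis using vexp[OF rho_VS[OF w], of "x - y"] by (simp add: vs_def zero_prod_def[symmetric])
  qed
  hence "x - y = 0" by (rule rho_faithful)
  thus "x = y" by simp
 qed
 moreover have "range F = sp_carrier n"
 proof (intro antisym subsetI)
  fix M assume M: "M : sp_carrier n"
  hence Mc: "M : carrier_mat (2 * n) (2 * n)" by (simp add: sp_carrier_def)
  define T where "T j = (\<Sum>i<2*n. vs (M $$ (i, j)) (vb i))" for j
  have TVS: "T j : VS" for j
  proof -
   have VS_sum: "(\<Sum>i<m. vs (c i) (vb i)) : VS" for m :: nat and c
   proof (induction m)
    case (Suc m) thus ?case using vbVS[of m] by (auto simp: VS_def vs_def intro: subspace_add subspace_scale subspace_G)
   qed (simp add: VS_def subspace_0[OF subspace_G])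
   show ?thesis unfolding T_def by (rule VS_sum)
  qed
  have xiT: "xi i (T j) = M $$ (i, j)" if i: "i < 2 * n" for i j
  proof -
   have "xi i (T j) = (\<Sum>k<2*n. M $$ (k, j) * (if i = k then 1 else 0))"
    unfolding T_def xi_sum by (rule sum.cong) (simp_all add: xi_lin xi_vb i)
   thus ?thesis using i by (simp add: if_distrib[of "%x. _ * x"] cong: if_cong)
  qed
  have gT: "gramM n M i j = Jf (vb i) (T j)" if "i < 2 * n" "j < 2 * n" for i j
   unfolding gramM_def gram[OF that(1), of "T j", symmetric] using that by (auto simp: xiT)
  \<comment> \<open>The T j are the columns of M. Writing M as the sum of the tensors of T j and
    \<open>vd j\<close> and symmetrising counts M twice, since M is skew for \<open>Jf\<close>;
    hence the factor 1/2.\<close>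
  define x where "x = (1/2) *s (\<Sum>j<2*n. symm (T j) (vd j))"
  have rx: "rho x y = vs (1/2) (\<Sum>j<2*n. vs (Jf (T j) y) (vd j) + vs (Jf (vd j) y) (T j))" if y: "y : VS" for y
  proof -
   have rs: "rho (\<Sum>j<m. S j) y = (\<Sum>j<m. rho (S j) y)" for S and m :: nat by (induction m) (simp_all add: rho_0 rho_add)
   show ?thesis unfolding x_def rho_scale rs by (simp add: rho_symm TVS vdVS y)
  qed
  have vdJ: "Jf (vd j) w = xi j w" for j w using Jf_anti[of w "Q j"] Jf_anti[of w "P (j - n)"] by (simp add: vd_def xi_def Jf_simps)
  have xivd: "xi i (vd j) = (if j = (if i < n then i + n else i - n) then if i < n then 1 else - 1 else 0)" if "i < 2 * n" "j < 2 * n" for i j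
  proof -
   have "Jf (Q j) (P i) = - (if i = j then 1 else 0)" if "i < n" "j < n" for i j using PQ(1)[OF that] Jf_anti[of "Q j" "P i"] by simp
   thus ?thesis using that PQ by (auto simp: xi_def vd_def Jf_simps)
  qed
  have "F x = M"
  proof (rule eq_matI)
   fix i l assume "i < dim_row M" "l < dim_col M"
   hence il: "i < 2 * n" "l < 2 * n" using Mc by auto
   have "(\<Sum>j<2*n. Jf (T j) (vb l) * xi i (vd j)) = (\<Sum>j<2*n. if j = (if i < n then i + n else i - n) then M $$ (i, l) else 0)"
   proof (rule sum.cong[OF refl])
    fix j assume "j : {..<2*n}"
    hence j: "j < 2 * n" by simp
    have "Jf (T j) (vb l) = - gramM n M j l"
     using gT[OF il(2) j] Jf_anti[of "T j" "vb l"] M[unfolded sp_carrier_iff[OF Mc]] il(2) j by simp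
    thus "Jf (T j) (vb l) * xi i (vd j) = (if j = (if i < n then i + n else i - n) then M $$ (i, l) else 0)"
     using il by (auto simp: xivd[OF il(1) j] gramM_def)
   qed
   also have "\<dots> = M $$ (i, l)" using il by auto
   finally have 1: "(\<Sum>j<2*n. Jf (T j) (vb l) * xi i (vd j)) = M $$ (i, l)" .
   have "(\<Sum>j<2*n. Jf (vd j) (vb l) * xi i (T j)) = (\<Sum>j<2*n. if j = l then M $$ (i, l) else 0)"
    by (rule sum.cong) (auto simp: vdJ xi_vb xiT il)
   also have "\<dots> = M $$ (i, l)" using il by simp
   finally have 2: "(\<Sum>j<2*n. Jf (vd j) (vb l) * xi i (T j)) = M $$ (i, l)" .
   show "F x $$ (i, l) = M $$ (i, l)" by (simp add: Fi[OF il] rx[OF vbVS] xi_lin xi_sum sum.distrib 1 2)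
  qed (use Mc Fc in auto)
  thus "M : range F" by blast
 qed (use Fsp in auto)
 ultimately have "bij_betw F UNIV (sp_carrier n)" by (simp add: bij_betw_def)
 moreover have "F (x + y) = F x + F y" for x y by (rule eq_matI) (auto simp: F_def rho_add xi_lin)
 moreover have "F (c *s x) = c \<cdot>\<^sub>m F x" for c x by (rule eq_matI) (auto simp: F_def rho_scale xi_lin)
 moreover have "F (br x y) = F x * F y - F y * F x" for x y
 proof (rule eq_matI)
  fix i j assume "i < dim_row (F x * F y - F y * F x)" "j < dim_col (F x * F y - F y * F x)"
  hence ij: "i < 2 * n" "j < 2 * n" by (simp_all add: F_def)
  have "F (br x y) $$ (i, j) = (F x * F y) $$ (i, j) - (F y * F x) $$ (i, j)"
   using rho_hom_all[of x y] vbVS[of j] by (simp add: prod[OF ij] Fi[OF ij] rho_hom_def xi_lin)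
  thus "F (br x y) $$ (i, j) = (F x * F y - F y * F x) $$ (i, j)" using ij by (simp add: F_def)
 qed (simp_all add: F_def)
 ultimately show ?thesis unfolding isomorphic_to_sp_def by blast
qed

end

lemma Ssing_span_G1: assumes "\<not> (EX n. isomorphic_to_sp smul br n)" shows "span Ssing = G 1"
 using assms isomorphic_sp Ssing_spans by blast

end

section \<open>Regular functions on the orbit\<close>

context lie_alg begin

definition dd :: "('g => complex) => 'g => 'g => complex" where
 "dd P z v = deriv (%t. P (z + t *s v)) 0"

lemma Rg_differential:
 assumes "P : Rg"
 shows "EX l. lf l & (ALL ga v t. ga t = z --> vder ga v t --> ((%s. P (ga s)) has_field_derivative l v) (at t))" using assms
proof (induction rule: Rg_induct)
 case (const c) thus ?case by (intro exI[of _ "%_. 0"]) (auto simp: lf_iff)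
next
 case (gen l) thus ?case by (intro exI[of _ l]) (auto simp: vder_def)
next
 case (add f g)
 then obtain l l' where l: "lf l" "!!ga v t. ga t = z ==> vder ga v t ==> ((%s. f (ga s)) has_field_derivative l v) (at t)"
  and l': "lf l'" "!!ga v t. ga t = z ==> vder ga v t ==> ((%s. g (ga s)) has_field_derivative l' v) (at t)" by auto
 show ?case by (intro exI[of _ "%v. l v + l' v"] conjI lf_plus l(1) l'(1) allI impI DERIV_add l(2) l'(2))
next
 case (mult f g)
 then obtain l l' where l: "lf l" "!!ga v t. ga t = z ==> vder ga v t ==> ((%s. f (ga s)) has_field_derivative l v) (at t)"
  and l': "lf l'" "!!ga v t. ga t = z ==> vder ga v t ==> ((%s. g (ga s)) has_field_derivative l' v) (at t)" by auto
 show ?case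
 proof (intro exI[of _ "%v. g z * l v + f z * l' v"] conjI lf_plus lf_times l(1) l'(1) allI impI)
  fix ga v t assume g: "ga t = z" "vder ga v t"
  show "((%s. f (ga s) * g (ga s)) has_field_derivative g z * l v + f z * l' v) (at t)"
   using DERIV_mult[OF l(2)[OF g] l'(2)[OF g]] g(1) by (simp add: mult.commute)
 qed
qed
lemma lf_dd: "P : Rg ==> lf (dd P z)"
 and dd_chain: "P : Rg ==> vder ga v t ==> ((%s. P (ga s)) has_field_derivative dd P (ga t) v) (at t)"
proof -
 have *: "lf (dd P z) & (ALL ga v t. ga t = z --> vder ga v t --> ((%s. P (ga s)) has_field_derivative dd P z v) (at t))" if P: "P : Rg" for z
 proof -
  obtain l where l: "lf l" "!!ga v t. ga t = z ==> vder ga v t ==> ((%s. P (ga s)) has_field_derivative l v) (at t)"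
   using Rg_differential[OF P, of z] by blast
  have "dd P z v = l v" for v unfolding dd_def by (rule DERIV_imp_deriv, rule l(2)) (simp_all add: vder_line)
  hence "dd P z = l" by auto
  thus ?thesis using l by simp
 qed
 show "P : Rg ==> lf (dd P z)" using * by blast
 show "P : Rg ==> vder ga v t ==> ((%s. P (ga s)) has_field_derivative dd P (ga t) v) (at t)" using * by blast
qed
lemma dd_line: "P : Rg ==> ((%t. P (z + t *s v)) has_field_derivative dd P z v) (at 0)"
 using dd_chain[of P "%t. z + t *s v" v 0] by (simp add: vder_line)
lemma dd_const: "dd (%_. c) z v = 0" by (simp add: dd_def)
lemma dd_lf: "lf l ==> dd l z v = l v" unfolding dd_def by (rule DERIV_imp_deriv) (auto simp: lfs intro!: derivative_eq_intros)
lemma dd_add: "P : Rg ==> Q : Rg ==> dd (%x. P x + Q x) z v = dd P z v + dd Q z v"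
 unfolding dd_def[of "%x. P x + Q x"] by (rule DERIV_imp_deriv) (intro DERIV_add dd_line)
lemma dd_mult: "P : Rg ==> Q : Rg ==> dd (%x. P x * Q x) z v = dd P z v * Q z + P z * dd Q z v" unfolding dd_def[of "%x. P x * Q x"]
 by (rule DERIV_imp_deriv) (use DERIV_mult[OF dd_line dd_line, of P Q z v z v] in \<open>simp add: mult.commute\<close>)
lemma dd_diff: "P : Rg ==> Q : Rg ==> dd (%x. P x - Q x) z v = dd P z v - dd Q z v"
 unfolding dd_def[of "%x. P x - Q x"] by (rule DERIV_imp_deriv) (intro DERIV_diff dd_line)

lemma dd_field: assumes L: "le L" and P: "P : Rg" shows "(%z. dd P z (L z)) : Rg" using P
proof (induction rule: Rg_induct)
 case (const c) thus ?case by (simp add: dd_const fa_const[OF fa_Rg])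
next
 case (gen l) thus ?case by (simp add: dd_lf lf_Rg lf_comp L)
next
 case (add f g) thus ?case by (simp add: dd_add fa_add[OF fa_Rg])
next
 case (mult f g) thus ?case by (simp add: dd_mult) (intro fa_add[OF fa_Rg] fa_mult[OF fa_Rg])
qed
lemma dd_comm: assumes L: "le L" "le L'" and P: "P : Rg"
 shows "dd (%z. dd P z (L z)) z (L' z) - dd (%z. dd P z (L' z)) z (L z) = dd P z (L (L' z) - L' (L z))" using P
proof (induction rule: Rg_induct)
 case (const c) thus ?case by (simp add: dd_const)
next
 case (gen l) thus ?case using dd_lf[OF lf_comp[OF gen L(1)]] dd_lf[OF lf_comp[OF gen L(2)]] by (simp add: dd_lf lf_diff)
next
 case (add f g)
 note D = dd_field[OF L(1) add(1)] dd_field[OF L(1) add(2)] dd_field[OF L(2) add(1)] dd_field[OF L(2) add(2)]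
 show ?case using add(3,4) by (simp add: dd_add[OF add(1,2)] dd_add[OF D(1,2)] dd_add[OF D(3,4)] algebra_simps)
next
 case (mult f g)
 note D = dd_field[OF L(1) mult(1)] dd_field[OF L(1) mult(2)] dd_field[OF L(2) mult(1)] dd_field[OF L(2) mult(2)]
 note F = fa_mult[OF fa_Rg]
 have "dd (%z. dd (%x. f x * g x) z (L z)) z (L' z) - dd (%z. dd (%x. f x * g x) z (L' z)) z (L z)
  = (dd (%z. dd f z (L z)) z (L' z) - dd (%z. dd f z (L' z)) z (L z)) * g z
  + f z * (dd (%z. dd g z (L z)) z (L' z) - dd (%z. dd g z (L' z)) z (L z))"
  unfolding dd_mult[OF mult(1,2)] dd_add[OF F[OF D(1) mult(2)] F[OF mult(1) D(2)]] dd_add[OF F[OF D(3) mult(2)] F[OF mult(1) D(4)]]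
   dd_mult[OF D(1) mult(2)] dd_mult[OF mult(1) D(2)] dd_mult[OF D(3) mult(2)] dd_mult[OF mult(1) D(4)] by (simp add: algebra_simps)
 also have "\<dots> = dd (%x. f x * g x) z (L (L' z) - L' (L z))" unfolding dd_mult[OF mult(1,2)] mult(3,4) ..
 finally show ?case .
qed
lemma dd_hol: assumes P: "P : Rg" and g: "vhol ga U" "vhol v U" shows "(%t. dd P (ga t) (v t)) holomorphic_on U" using P
proof (induction rule: Rg_induct)
 case (const c) thus ?case by (simp add: dd_const)
next
 case (gen l) thus ?case using g(2) by (simp add: dd_lf vhol_def)
next
 case (add f h) thus ?case by (simp add: dd_add) (intro holomorphic_intros)
next
 case (mult f h) thus ?case using Rg_vhol[OF mult(1) g(1)] Rg_vhol[OF mult(2) g(1)] by (simp add: dd_mult) (intro holomorphic_intros)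
qed
lemma Rg_le: assumes "P : Rg" "le T" shows "(%z. P (T z)) : Rg" by (rule Rg_vec_in[OF assms(1) fa_Rg vec_in_le[OF assms(2) vec_in_id]])

definition Tg :: "'g => 'g set" where "Tg z = range (%a. br a z)"
lemma Tg_br: "br a z : Tg z" by (simp add: Tg_def)
lemma TgE: "v : Tg z ==> EX a. v = br a z" by (auto simp: Tg_def)
lemma Tg_scale: "t ~= 0 ==> Tg (t *s z) = Tg z"
proof -
 assume t: "t ~= 0"
 have 1: "br a (t *s z) : Tg z" for a using Tg_br[of "t *s a" z] by (simp add: brs)
 have 2: "br a z : Tg (t *s z)" for a using Tg_br[of "(1/t) *s a" "t *s z"] t by (simp add: brs)
 show ?thesis unfolding Tg_def[of "t *s z"] using 1 2 unfolding Tg_def by blast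
qed

end

context extremal_lie begin

lemma subspace_Tg: "subspace (Tg z)" unfolding Tg_def by (rule subspace_image_le[OF le_br2 subspace_UNIV])
text \<open>The hypothesis is the derivative at z of the equations of E0. Taking y = f puts a
  combination of the parts of v of weights 0, -1, -2 into [g,z]; but [g,z] lies in weights 2 and 1
  and along h, which kills the parts of weight -1 and -2. So the cone has no tangent directions at z
  besides those of the orbit.\<close>

lemma tangentI:
 assumes z: "z : E" and v: "!!y. br v (br z y) + br z (br v y) + (2 * B v y) *s z + (2 * B z y) *s v = 0"
 shows "v : Tg z"
proof -
 obtain f where f: "f : E" "B z f = 1" using E_pair[OF z] by blast
 interpret t: triple smul Basis br B z f by unfold_locales (use z f in auto)
 have T: "br z a : Tg z" for a using Tg_br[of "- a" z] anti[of a z] by (simp add: brs)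
 have zT: "z : Tg z" using subspace_scale[OF subspace_Tg Tg_br[of "t.h" z], of "1/2"] t.he by simp
 have hT: "t.h : Tg z" using T[of f] by (simp add: t.h_def)
 have G1T: "x : Tg z" if "x : t.G 1" for x using T[of "br f x"] t.ef_G1[OF that] by simp
 let ?r = "t.p0 v + (3/2) *s t.pm v + (2 * B v z) *s f"
 have vd: "v = B v f *s z + t.p1 v + t.p0 v + t.pm v + B v z *s f" by (rule t.decomp)
 have hv: "br t.h v = (2 * B v f) *s z + t.p1 v - t.pm v - (2 * B v z) *s f"
  using t.GD[OF t.p1G, of v] t.GD[OF t.p0G, of v] t.GD[OF t.pmG, of v] by (subst vd) (simp add: brs t.he t.hf mult.commute)
 have "br v t.h + br z (br v f) + (2 * B v f) *s z + 2 *s v = 0" using v[of f] f(2) by (simp add: t.h_def)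
 hence "2 *s v - br t.h v = - br z (br v f) - (2 * B v f) *s z"
  unfolding anti[of v t.h] by (rule comb1[where k = 1]) (simp add: lfs field_simps)
 hence "2 *s v - br t.h v : Tg z" using T zT by (simp) (intro subspace_diff subspace_neg subspace_scale subspace_Tg T zT)
 moreover have "2 *s v - br t.h v = t.p1 v + 2 *s ?r"
 proof (rule eqI_lf)
  fix l assume l: "lf l"
  have "l v = l (B v f *s z + t.p1 v + t.p0 v + t.pm v + B v z *s f)" by (rule arg_cong[OF vd])
  thus "l (2 *s v - br t.h v) = l (t.p1 v + 2 *s ?r)" unfolding hv by (simp add: lfs[OF l])
 qed
 ultimately have "2 *s ?r : Tg z" using subspace_diff[OF subspace_Tg _ G1T[OF t.p1G[of v]], of "t.p1 v + 2 *s ?r"] by simp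
 hence "(1/2) *s 2 *s ?r : Tg z" by (rule subspace_scale[OF subspace_Tg])
 then obtain a where a: "?r = br a z" by (auto simp: Tg_def)
 have "br (t.p1 a) z = 0" using t.e_G1[OF t.p1G, of a] anti[of "t.p1 a" z] by simp
 moreover have "br (t.p0 a) z = B a t.h *s z" using t.e_G0[OF t.p0G, of a] anti[of "t.p0 a" z] by (simp add: t.p0_h)
 ultimately have d: "br a z = B a t.h *s z + br (t.pm a) z + (- B a z) *s t.h" by (subst t.decomp[of a]) (simp add: brs t.fe)
 have pm1: "br (t.pm a) z : t.G 1" using t.G_br'[OF t.pmG t.eG] by simp
 have r1: "?r = B a t.h *s z + br (t.pm a) z + (- B a z) *s t.h" using a d by simp
 have "B ?r z = B (B a t.h *s z + br (t.pm a) z + (- B a z) *s t.h) z" by (simp only: r1)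
 hence vz: "B v z = 0" using t.G_orth[OF t.p0G t.eG, of v] t.G_orth[OF t.pmG t.eG, of v] t.G_orth[OF pm1 t.eG] by (simp add: bs t.Bs t.fe1)
 have "t.pm v = 0"
 proof (rule t.Gm1_0[OF t.pmG])
  fix y assume y: "y : t.G 1"
  have "B ?r y = B (B a t.h *s z + br (t.pm a) z + (- B a z) *s t.h) y" by (simp only: r1)
  thus "B (t.pm v) y = 0"
   using t.G_orth[OF t.p0G y, of v] t.G_orth[OF t.fG y] t.G_orth[OF t.eG y] t.G_orth[OF pm1 y] t.G_orth[OF t.hG y] by (simp add: bs)
 qed
 hence "v = B v f *s z + t.p1 v + br a z" using vd vz a by simp
 thus ?thesis using zT G1T[OF t.p1G[of v]] Tg_br[of a z] by (metis subspace_add subspace_scale subspace_Tg)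
qed

lemma dd_vanish: assumes P: "P : Rg" "!!y. y : E ==> P y = 0" and z: "z : E" and v: "v : Tg z" shows "dd P z v = 0"
proof -
 obtain a where a: "v = br a z" using TgE[OF v] by blast
 have "vder (%t. ex a t z) (br a (ex a 0 z)) 0" by (rule ex_vder)
 from dd_chain[OF P(1) this] have "((%s. P (ex a s z)) has_field_derivative dd P z v) (at 0)" by (simp add: ex_0 a)
 moreover have "(%s. P (ex a s z)) = (%_. 0)" using P(2) E_ex[OF z] by auto
 ultimately show ?thesis using DERIV_unique DERIV_const by metis
qed
lemma z_Tg: assumes "z : E" shows "z : Tg z"
proof -
 obtain h where "br h z = z" using nilpotent_grading[OF E_nilpotent[OF E_E0[OF assms]]] by blast
 thus ?thesis using Tg_br[of h z] by simp
qed

definition rep :: "('g => complex) => ('g => complex) => ('g => complex) => bool" where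
 "rep F b P \<longleftrightarrow> b : Rg & P : Rg & (ALL y:E. F y * b y = P y)"
text \<open>Functions on E that are locally fractions of polynomials. A fraction is kept as the
  equation F b = P, valid also where b vanishes.\<close>

definition Reg :: "('g => complex) set" where
 "Reg = {F. ALL z:E. EX b P. rep F b P & b z ~= 0}"

lemma repD: "rep F b P ==> b : Rg" "rep F b P ==> P : Rg" "rep F b P ==> y : E ==> F y * b y = P y" by (auto simp: rep_def)
lemma RegD: "F : Reg ==> z : E ==> EX b P. rep F b P & b z ~= 0" by (simp add: Reg_def)
lemma RegI: "(!!z. z : E ==> EX b P. rep F b P & b z ~= 0) ==> F : Reg" by (simp add: Reg_def)
lemma rep_cong: "rep F b P ==> (!!y. y : E ==> F' y = F y) ==> rep F' b P" by (simp add: rep_def)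
lemma Reg_cong: "F : Reg ==> (!!y. y : E ==> F' y = F y) ==> F' : Reg" unfolding Reg_def using rep_cong by blast
lemma rep_Rg: "P : Rg ==> rep P (%_. 1) P" by (simp add: rep_def fa_const[OF fa_Rg])
lemma Rg_Reg: "P : Rg ==> P : Reg" by (rule RegI, rule exI[of _ "%_. 1"], rule exI[of _ P]) (simp add: rep_Rg)
lemma rep_add: "rep F b P ==> rep H c Q ==> rep (%x. F x + H x) (%x. b x * c x) (%x. P x * c x + Q x * b x)" unfolding rep_def
proof (intro conjI ballI)
 assume a: "b : Rg & P : Rg & (ALL y:E. F y * b y = P y)" "c : Rg & Q : Rg & (ALL y:E. H y * c y = Q y)"
 show "(%x. b x * c x) : Rg" "(%x. P x * c x + Q x * b x) : Rg" using a by (auto intro!: fa_mult[OF fa_Rg] fa_add[OF fa_Rg])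
 fix y assume "y : E"
 hence "P y = F y * b y" "Q y = H y * c y" using a by auto
 thus "(F y + H y) * (b y * c y) = P y * c y + Q y * b y" by (simp add: algebra_simps)
qed
lemma rep_mult: "rep F b P ==> rep H c Q ==> rep (%x. F x * H x) (%x. b x * c x) (%x. P x * Q x)" unfolding rep_def
proof (intro conjI ballI)
 assume a: "b : Rg & P : Rg & (ALL y:E. F y * b y = P y)" "c : Rg & Q : Rg & (ALL y:E. H y * c y = Q y)"
 show "(%x. b x * c x) : Rg" "(%x. P x * Q x) : Rg" using a by (auto intro: fa_mult[OF fa_Rg])
 fix y assume "y : E"
 hence "P y = F y * b y" "Q y = H y * c y" using a by auto
 thus "F y * H y * (b y * c y) = P y * Q y" by simp
qed
lemma fa_Reg: "function_algebra Reg" unfolding function_algebra_def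
proof (intro conjI allI ballI)
 show "(%_. c) : Reg" for c by (rule Rg_Reg[OF fa_const[OF fa_Rg]])
 fix F H assume FH: "F : Reg" "H : Reg"
 show "(%x. F x + H x) : Reg"
 proof (rule RegI)
  fix z assume z: "z : E"
  obtain b P where 1: "rep F b P" "b z ~= 0" using RegD[OF FH(1) z] by blast
  obtain c Q where 2: "rep H c Q" "c z ~= 0" using RegD[OF FH(2) z] by blast
  show "EX b P. rep (%x. F x + H x) b P & b z ~= 0" using rep_add[OF 1(1) 2(1)] 1(2) 2(2)
   by auto
 qed
 show "(%x. F x * H x) : Reg"
 proof (rule RegI)
  fix z assume z: "z : E"
  obtain b P where 1: "rep F b P" "b z ~= 0" using RegD[OF FH(1) z] by blast
  obtain c Q where 2: "rep H c Q" "c z ~= 0" using RegD[OF FH(2) z] by blast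
  show "EX b P. rep (%x. F x * H x) b P & b z ~= 0" using rep_mult[OF 1(1) 2(1)] 1(2) 2(2)
   by auto
 qed
qed
lemma Reg_cancel: assumes F: "F : Reg" and H: "H : Reg" and z: "!!y. y : E ==> F y * H y = 0" "z : E" "F z ~= 0" and x: "x : E"
 shows "H x = 0"
proof -
 obtain b P where 1: "rep F b P" "b z ~= 0" using RegD[OF F z(2)] by blast
 obtain c Q where 2: "rep H c Q" "c x ~= 0" using RegD[OF H x] by blast
 have "P y * Q y = 0" if "y : E" for y
 proof -
  have "P y * Q y = (F y * H y) * (b y * c y)" using repD(3)[OF 1(1) that] repD(3)[OF 2(1) that] by (simp add: ac_simps flip: repD(3))
  thus ?thesis using z(1)[OF that] by simp
 qed
 moreover have "P z ~= 0" using repD(3)[OF 1(1) z(2)] 1(2) z(3) by auto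
 ultimately have "Q x = 0" using E_cancel[OF repD(2)[OF 1(1)] repD(2)[OF 2(1)] _ z(2) _ x] by blast
 thus ?thesis using repD(3)[OF 2(1) x] 2(2) by simp
qed

text \<open>Quotient rule for an arbitrarily chosen fraction; along vectors of \<open>Tg z\<close>
  the value does not depend on the choice, by \<open>dE_rep\<close>.\<close>

definition dE :: "('g => complex) => 'g => 'g => complex" where
 "dE F z v = (let r = SOME r. rep F (fst r) (snd r) & fst r z ~= 0 in (dd (snd r) z v - F z * dd (fst r) z v) / fst r z)"

lemma dE_ex: assumes "F : Reg" "z : E"
 shows "EX b P. rep F b P & b z ~= 0 & (ALL v. dE F z v = (dd P z v - F z * dd b z v) / b z)"
proof -
 let ?r = "SOME r. rep F (fst r) (snd r) & fst r z ~= 0"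
 have "EX r. rep F (fst r) (snd r) & fst r z ~= 0" using RegD[OF assms] by auto
 hence "rep F (fst ?r) (snd ?r) & fst ?r z ~= 0" by (rule someI_ex)
 thus ?thesis by (intro exI[of _ "fst ?r"] exI[of _ "snd ?r"]) (simp add: dE_def Let_def)
qed
lemma lf_dE: assumes "F : Reg" "z : E" shows "lf (dE F z)"
proof -
 obtain b P where 1: "rep F b P" "b z ~= 0" "!!v. dE F z v = (dd P z v - F z * dd b z v) / b z" using dE_ex[OF assms] by blast
 note l = lfs[OF lf_dd[OF repD(1)[OF 1(1)]]] lfs[OF lf_dd[OF repD(2)[OF 1(1)]]]
 show ?thesis by (rule lfI) (use 1(2) in \<open>simp_all add: 1(3) l field_simps\<close>)
qed
text \<open>Two fractions of F satisfy P c = Q b on E, so the difference has zero derivative along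
  the orbit; then divide by c z.\<close>

lemma dE_rep: assumes F: "F : Reg" and z: "z : E" and v: "v : Tg z" and r: "rep F b P"
 shows "dE F z v * b z + F z * dd b z v = dd P z v"
proof -
 obtain c Q where 1: "rep F c Q" "c z ~= 0" "!!v. dE F z v = (dd Q z v - F z * dd c z v) / c z" using dE_ex[OF F z] by blast
 note R = repD(1,2)[OF r] repD(1,2)[OF 1(1)]
 have "dd (%x. P x * c x - Q x * b x) z v = 0"
 proof (rule dd_vanish[OF _ _ z v])
  show "(%x. P x * c x - Q x * b x) : Rg" by (intro fa_diff[OF fa_Rg] fa_mult[OF fa_Rg] R)
  fix y assume y: "y : E"
  show "P y * c y - Q y * b y = 0" unfolding repD(3)[OF r y, symmetric] repD(3)[OF 1(1) y, symmetric] by simp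
 qed
 hence "dd P z v * c z + P z * dd c z v - (dd Q z v * b z + Q z * dd b z v) = 0" using R by (simp add: dd_diff dd_mult fa_mult[OF fa_Rg])
 hence e: "dd P z v * c z + F z * b z * dd c z v - dd Q z v * b z - F z * c z * dd b z v = 0"
  unfolding repD(3)[OF r z, symmetric] repD(3)[OF 1(1) z, symmetric] by simp
 have q: "dE F z v * c z = dd Q z v - F z * dd c z v" using 1(2,3) by simp
 have "(dE F z v * b z + F z * dd b z v) * c z = (dE F z v * c z) * b z + F z * c z * dd b z v" by (simp add: algebra_simps)
 also have "\<dots> = dd P z v * c z" unfolding q using e by (simp add: algebra_simps)
 finally have "(dE F z v * b z + F z * dd b z v) * c z = dd P z v * c z" .
 thus ?thesis using 1(2) by simp
qed
lemma dE_eq: assumes "F : Reg" "z : E" "v : Tg z" "rep F b P" "b z ~= 0" shows "dE F z v = (dd P z v - F z * dd b z v) / b z"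
 using dE_rep[OF assms(1-4)] assms(5) by (simp add: field_simps)
lemma dE_Rg: "P : Rg ==> z : E ==> v : Tg z ==> dE P z v = dd P z v" using dE_eq[OF Rg_Reg _ _ rep_Rg] by (simp add: dd_const)
lemma dE_cong: assumes "F : Reg" "z : E" "v : Tg z" "!!y. y : E ==> F' y = F y" shows "dE F' z v = dE F z v"
 by (metis RegD assms(1,2) dE_eq assms(1-3) Reg_cong assms(1,4) assms(2,3) rep_cong assms(4) assms(2,4))
lemma dE_add: assumes F: "F : Reg" and H: "H : Reg" and z: "z : E" and v: "v : Tg z"
 shows "dE (%x. F x + H x) z v = dE F z v + dE H z v"
proof -
 obtain b P where 1: "rep F b P" "b z ~= 0" using RegD[OF F z] by blast
 obtain c Q where 2: "rep H c Q" "c z ~= 0" using RegD[OF H z] by blast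
 note R = repD(1,2)[OF 1(1)] repD(1,2)[OF 2(1)]
 have a: "dE (%x. F x + H x) z v * (b z * c z) + (F z + H z) * dd (%x. b x * c x) z v = dd (%x. P x * c x + Q x * b x) z v"
  by (rule dE_rep[OF fa_add[OF fa_Reg F H] z v rep_add[OF 1(1) 2(1)]])
 have "dd (%x. P x * c x + Q x * b x) z v = dd P z v * c z + P z * dd c z v + (dd Q z v * b z + Q z * dd b z v)"
  using R by (simp add: dd_add dd_mult fa_mult[OF fa_Rg])
 also have "\<dots> = (dE F z v * b z + F z * dd b z v) * c z + F z * b z * dd c z v + ((dE H z v * c z + H z * dd c z v) * b z + H z * c z * dd b z v)"
  unfolding dE_rep[OF F z v 1(1)] dE_rep[OF H z v 2(1)] repD(3)[OF 1(1) z] repD(3)[OF 2(1) z] ..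
 finally have "dE (%x. F x + H x) z v * (b z * c z) = (dE F z v + dE H z v) * (b z * c z)" using a by (simp add: dd_mult R algebra_simps)
 thus ?thesis using 1(2) 2(2) by simp
qed
lemma dE_mult: assumes F: "F : Reg" and H: "H : Reg" and z: "z : E" and v: "v : Tg z"
 shows "dE (%x. F x * H x) z v = dE F z v * H z + F z * dE H z v"
proof -
 obtain b P where 1: "rep F b P" "b z ~= 0" using RegD[OF F z] by blast
 obtain c Q where 2: "rep H c Q" "c z ~= 0" using RegD[OF H z] by blast
 note R = repD(1,2)[OF 1(1)] repD(1,2)[OF 2(1)]
 have a: "dE (%x. F x * H x) z v * (b z * c z) + (F z * H z) * dd (%x. b x * c x) z v = dd (%x. P x * Q x) z v"
  by (rule dE_rep[OF fa_mult[OF fa_Reg F H] z v rep_mult[OF 1(1) 2(1)]])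
 have "dd (%x. P x * Q x) z v = dd P z v * Q z + P z * dd Q z v" using R by (simp add: dd_mult)
 also have "\<dots> = (dE F z v * b z + F z * dd b z v) * (H z * c z) + F z * b z * (dE H z v * c z + H z * dd c z v)"
  unfolding dE_rep[OF F z v 1(1)] dE_rep[OF H z v 2(1)] repD(3)[OF 1(1) z] repD(3)[OF 2(1) z] ..
 finally have "dE (%x. F x * H x) z v * (b z * c z) = (dE F z v * H z + F z * dE H z v) * (b z * c z)"
  using a by (simp add: dd_mult R algebra_simps)
 thus ?thesis using 1(2) 2(2) by simp
qed
lemma dE_const: "z : E ==> v : Tg z ==> dE (%_. c) z v = 0" using dE_Rg[OF fa_const[OF fa_Rg]] by (simp add: dd_const)
lemma dE_cmult: "F : Reg ==> z : E ==> v : Tg z ==> dE (%x. c * F x) z v = c * dE F z v"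
 using dE_mult[OF fa_const[OF fa_Reg], of F z v c] by (simp add: dE_const)
lemma dE_diff: assumes "F : Reg" "H : Reg" "z : E" "v : Tg z"
 shows "dE (%x. F x - H x) z v = dE F z v - dE H z v"
 using dE_add[OF assms(1) fa_cmult[OF fa_Reg assms(2), of "-1"] assms(3,4)] dE_cmult[OF assms(2-4), of "-1"] by simp
text \<open>Linear vector fields tangent to E. The fields ad a and the Euler field are of this kind,
  and the values of the former exhaust the tangent spaces.\<close>

definition fld :: "('g => 'g) => bool" where "fld L \<longleftrightarrow> le L & (ALL z:E. L z : Tg z)"
lemma fldD: "fld L ==> le L" "fld L ==> z : E ==> L z : Tg z" by (auto simp: fld_def)
lemma fld_br: "fld (br a)" by (simp add: fld_def le_br Tg_br)
lemma fld_id: "fld (%x. x)" by (simp add: fld_def le_id z_Tg)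

lemma rep_fld: assumes F: "F : Reg" and L: "fld L" and r: "rep F b P"
 shows "rep (%z. dE F z (L z)) (%z. b z * b z) (%z. dd P z (L z) * b z - P z * dd b z (L z))" unfolding rep_def
proof (intro conjI ballI)
 note R = repD(1,2)[OF r]
 show "(%z. b z * b z) : Rg" by (intro fa_mult[OF fa_Rg] R)
 show "(%z. dd P z (L z) * b z - P z * dd b z (L z)) : Rg" by (intro fa_diff[OF fa_Rg] fa_mult[OF fa_Rg] R dd_field fldD[OF L])
 fix y assume y: "y : E"
 show "dE F y (L y) * (b y * b y) = dd P y (L y) * b y - P y * dd b y (L y)"
  unfolding dE_rep[OF F y fldD(2)[OF L y] r, symmetric] repD(3)[OF r y, symmetric] by (simp add: algebra_simps)
qed
lemma Reg_fld: assumes F: "F : Reg" and L: "fld L" shows "(%z. dE F z (L z)) : Reg"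
proof (rule RegI)
 fix z assume "z : E"
 then obtain b P where 1: "rep F b P" "b z ~= 0" using RegD[OF F] by blast
 show "EX b P. rep (%z. dE F z (L z)) b P & b z ~= 0"
  by (rule exI[of _ "%z. b z * b z"], rule exI[of _ "%z. dd P z (L z) * b z - P z * dd b z (L z)"])
   (use rep_fld[OF F L 1(1)] 1(2) in simp)
qed
text \<open>Differentiate F b = P along both fields and use the commutator rule for
  polynomials.\<close>

lemma dE_comm: assumes F: "F : Reg" and L: "fld L" "fld L'" and z: "z : E" and M: "M = L (L' z) - L' (L z)" "M : Tg z"
 shows "dE (%z. dE F z (L z)) z (L' z) - dE (%z. dE F z (L' z)) z (L z) = dE F z M"
proof -
 obtain b P where 1: "rep F b P" "b z ~= 0" using RegD[OF F z] by blast
 note R = repD(1,2)[OF 1(1)]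
 have e: "dE (%z. dE F z (L z)) z (L' z) * b z + dE F z (L z) * dd b z (L' z) + dE F z (L' z) * dd b z (L z) + F z * dd (%z. dd b z (L z)) z (L' z)
  = dd (%z. dd P z (L z)) z (L' z)" if L: "fld L" "fld L'" for L L'
 proof -
  note T = fldD(2)[OF L(2) z]
  note DL = dd_field[OF fldD(1)[OF L(1)] R(1)] dd_field[OF fldD(1)[OF L(1)] R(2)]
  note M = fa_mult[OF fa_Reg] Reg_fld[OF F L(1)] Rg_Reg[OF R(1)] Rg_Reg[OF DL(1)] F
  have "dd (%z. dd P z (L z)) z (L' z) = dE (%z. dd P z (L z)) z (L' z)" by (rule dE_Rg[symmetric, OF DL(2) z T])
  also have "\<dots> = dE (%z. dE F z (L z) * b z + F z * dd b z (L z)) z (L' z)"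
   by (rule dE_cong) (use dE_rep[OF F _ fldD(2)[OF L(1)] 1(1)] z T in \<open>auto intro!: fa_add[OF fa_Reg] M\<close>)
  also have "\<dots> = dE (%z. dE F z (L z)) z (L' z) * b z + dE F z (L z) * dE b z (L' z) + (dE F z (L' z) * dd b z (L z) + F z * dE (%z. dd b z (L z)) z (L' z))"
   by (simp add: dE_add[OF M(1)[OF M(2,3)] M(1)[OF M(5,4)] z T] dE_mult[OF M(2,3) z T] dE_mult[OF M(5,4) z T])
  finally show ?thesis by (simp add: dE_Rg[OF R(1) z T] dE_Rg[OF DL(1) z T])
 qed
 have c: "dd (%z. dd Q z (L z)) z (L' z) - dd (%z. dd Q z (L' z)) z (L z) = dd Q z M" if "Q : Rg" for Q
  unfolding M(1) by (rule dd_comm[OF fldD(1)[OF L(1)] fldD(1)[OF L(2)] that])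
 have "(dE (%z. dE F z (L z)) z (L' z) - dE (%z. dE F z (L' z)) z (L z)) * b z + F z * dd b z M = dd P z M"
  unfolding c[OF R(1), symmetric] c[OF R(2), symmetric] e[OF L, symmetric] e[OF L(2,1), symmetric] by (simp add: algebra_simps)
 also have "\<dots> = dE F z M * b z + F z * dd b z M" by (rule dE_rep[OF F z M(2) 1(1), symmetric])
 finally show ?thesis using 1(2) by simp
qed

lemma hol_local: 
 fixes g :: "complex => complex"
 assumes U: "open U" and "!!t0. t0 : U ==> EX b p. b holomorphic_on U & p holomorphic_on U & b t0 ~= 0 & (ALL t:U. b t ~= 0 --> g t = p t / b t)"
 shows "g holomorphic_on U" unfolding holomorphic_on_open[OF U]
proof (intro ballI)
 fix t0 assume t0: "t0 : U"
 then obtain b p where b: "b holomorphic_on U" "p holomorphic_on U" "b t0 ~= 0" "ALL t:U. b t ~= 0 --> g t = p t / b t" using assms(2) by blast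
 let ?V = "b -` (- {0}) \<inter> U"
 have V: "open ?V" using continuous_on_open_vimage[OF U, of b] holomorphic_on_imp_continuous_on[OF b(1)] by auto
 have "(%t. p t / b t) holomorphic_on ?V" by (intro holomorphic_intros holomorphic_on_subset[OF b(1)] holomorphic_on_subset[OF b(2)]) auto
 hence "g holomorphic_on ?V" by (rule holomorphic_transform) (use b(4) in auto)
 thus "EX f'. (g has_field_derivative f') (at t0)" using holomorphic_on_open[OF V] t0 b(3) by auto
qed
lemma Reg_hol: assumes F: "F : Reg" and U: "open U" and g: "vhol ga U" "!!t. t : U ==> ga t : E"
 shows "(%t. F (ga t)) holomorphic_on U"
proof (rule hol_local[OF U])
 fix t0 assume t0: "t0 : U"
 obtain b P where 1: "rep F b P" "b (ga t0) ~= 0" using RegD[OF F g(2)[OF t0]] by blast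
 show "EX b p. b holomorphic_on U & p holomorphic_on U & b t0 ~= 0 & (ALL t:U. b t ~= 0 --> F (ga t) = p t / b t)"
  by (rule exI[of _ "%t. b (ga t)"], rule exI[of _ "%t. P (ga t)"])
   (use 1 g in \<open>auto intro: Rg_vhol repD simp: repD(3)[OF 1(1), symmetric]\<close>)
qed
lemma dE_hol: assumes F: "F : Reg" and U: "open U" and g: "vhol ga U" "!!t. t : U ==> ga t : E" and v: "vhol v U" "!!t. t : U ==> v t : Tg (ga t)"
 shows "(%t. dE F (ga t) (v t)) holomorphic_on U"
proof (rule hol_local[OF U])
 fix t0 assume t0: "t0 : U"
 obtain b P where 1: "rep F b P" "b (ga t0) ~= 0" using RegD[OF F g(2)[OF t0]] by blast
 note R = repD(1,2)[OF 1(1)]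
 show "EX b p. b holomorphic_on U & p holomorphic_on U & b t0 ~= 0 & (ALL t:U. b t ~= 0 --> dE F (ga t) (v t) = p t / b t)"
  by (rule exI[of _ "%t. b (ga t)"], rule exI[of _ "%t. dd P (ga t) (v t) - F (ga t) * dd b (ga t) (v t)"])
   (use 1 g in \<open>auto intro!: Rg_vhol R holomorphic_intros dd_hol v Reg_hol[OF F U] dE_eq[OF F _ _ 1(1)]\<close>)
qed
lemma dE_chain: assumes F: "F : Reg" and U: "open U" "t : U" and g: "!!s. s : U ==> ga s : E" and d: "vder ga v t" and v: "v : Tg (ga t)"
 shows "((%s. F (ga s)) has_field_derivative dE F (ga t) v) (at t)"
proof -
 obtain b P where 1: "rep F b P" "b (ga t) ~= 0" using RegD[OF F g[OF U(2)]] by blast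
 note db = dd_chain[OF repD(1)[OF 1(1)] d] and dP = dd_chain[OF repD(2)[OF 1(1)] d]
 have D: "((%s. P (ga s) / b (ga s)) has_field_derivative (dd P (ga t) v * b (ga t) - P (ga t) * dd b (ga t) v) / (b (ga t) * b (ga t))) (at t)"
  by (rule DERIV_divide[OF dP db 1(2)])
 have e: "(dd P (ga t) v * b (ga t) - P (ga t) * dd b (ga t) v) / (b (ga t) * b (ga t)) = dE F (ga t) v"
  unfolding dE_rep[OF F g[OF U(2)] v 1(1), symmetric] repD(3)[OF 1(1) g[OF U(2)], symmetric] using 1(2) by (simp add: field_simps)
 have "isCont (%s. b (ga s)) t" using db by (rule DERIV_isCont)
 hence "eventually (%s. b (ga s) ~= 0) (at t)" using 1(2) by (simp add: continuous_at tendsto_imp_eventually_ne)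
 moreover have "eventually (%s. s : U) (at t)" using U by (simp add: eventually_at_in_open')
 ultimately have "eventually (%s. P (ga s) / b (ga s) = F (ga s)) (at t)" by eventually_elim (simp add: repD(3)[OF 1(1) g, symmetric])
 hence "eventually (%s. P (ga s) / b (ga s) = F (ga s)) (nhds t)"
  using repD(3)[OF 1(1) g[OF U(2)], symmetric] 1(2) by (simp add: eventually_nhds_conv_at)
 thus ?thesis using D unfolding e by (subst (asm) DERIV_cong_ev[OF refl _ refl]) auto
qed

definition eta :: "(('g => complex) \<times> ('g => complex) \<times> ('g => complex)) => 'g => 'g => 'g => complex" where
 "eta q z v w = (case q of (p, g, h) => p z * (dE g z v * dE h z w - dE g z w * dE h z v))"

text \<open>Cartan's formula for \<open>d (p dg & dh)\<close> on linear vector fields; note that the derivation along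
 \<open>L\<close> composed with the one along \<open>L'\<close> differs from the opposite composition by the derivation
 along \<open>L \<circ> L' - L' \<circ> L\<close>.\<close>

lemma koszul_term:
 assumes q: "p : Reg" "g : Reg" "h : Reg" and L: "fld L1" "fld L2" "fld L3" and z: "z : E"
  and M: "M12 = L1 (L2 z) - L2 (L1 z)" "M23 = L2 (L3 z) - L3 (L2 z)" "M31 = L3 (L1 z) - L1 (L3 z)"
  and MT: "M12 : Tg z" "M23 : Tg z" "M31 : Tg z"
 shows "dE (%y. eta (p, g, h) y (L2 y) (L3 y)) z (L1 z) + dE (%y. eta (p, g, h) y (L3 y) (L1 y)) z (L2 z)
   + dE (%y. eta (p, g, h) y (L1 y) (L2 y)) z (L3 z)
   + eta (p, g, h) z M12 (L3 z) + eta (p, g, h) z M23 (L1 z) + eta (p, g, h) z M31 (L2 z)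
  = dE p z (L1 z) * (dE g z (L2 z) * dE h z (L3 z) - dE g z (L3 z) * dE h z (L2 z))
  - dE p z (L2 z) * (dE g z (L1 z) * dE h z (L3 z) - dE g z (L3 z) * dE h z (L1 z))
  + dE p z (L3 z) * (dE g z (L1 z) * dE h z (L2 z) - dE g z (L2 z) * dE h z (L1 z))"
proof -
 define D where "D F L y = dE F y (L y)" for F and L :: "'g => 'g" and y
 have DR: "D F L : Reg" if "F : Reg" "fld L" for F L unfolding D_def using Reg_fld[OF that] .
 have e: "dE (%y. eta (p, g, h) y (L y) (L' y)) z (K z) = D p K z * (D g L z * D h L' z - D g L' z * D h L z)
  + p z * (D (D g L) K z * D h L' z + D g L z * D (D h L') K z - D (D g L') K z * D h L z - D g L' z * D (D h L) K z)"
  if L: "fld L" "fld L'" "fld K" for L L' K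
 proof -
  note T = fldD(2)[OF L(3) z]
  note R = DR[OF q(2) L(1)] DR[OF q(3) L(2)] DR[OF q(2) L(2)] DR[OF q(3) L(1)]
  have "dE (%y. eta (p, g, h) y (L y) (L' y)) z (K z) = dE (%y. p y * (D g L y * D h L' y - D g L' y * D h L y)) z (K z)"
   by (simp add: eta_def D_def)
  also have "\<dots> = dE p z (K z) * (D g L z * D h L' z - D g L' z * D h L z) + p z * dE (%y. D g L y * D h L' y - D g L' y * D h L y) z (K z)"
   by (rule dE_mult[OF q(1) _ z T]) (intro fa_diff[OF fa_Reg] fa_mult[OF fa_Reg] R)
  also have "dE (%y. D g L y * D h L' y - D g L' y * D h L y) z (K z) = dE (%y. D g L y * D h L' y) z (K z) - dE (%y. D g L' y * D h L y) z (K z)"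
   by (rule dE_diff[OF _ _ z T]) (intro fa_mult[OF fa_Reg] R)+
  finally show ?thesis by (simp add: dE_mult[OF R(1,2) z T] dE_mult[OF R(3,4) z T] D_def[of _ K])
 qed
 have c: "D (D F L) L' z - D (D F L') L z = dE F z M" if "F : Reg" "fld L" "fld L'" "M = L (L' z) - L' (L z)" "M : Tg z" for F L L' M
  unfolding D_def by (rule dE_comm[OF that(1-3) z that(4,5)])
 note c1 = c[OF q(2) L(1,2) M(1) MT(1), symmetric] c[OF q(3) L(1,2) M(1) MT(1), symmetric]
 note c2 = c[OF q(2) L(2,3) M(2) MT(2), symmetric] c[OF q(3) L(2,3) M(2) MT(2), symmetric]
 note c3 = c[OF q(2) L(3,1) M(3) MT(3), symmetric] c[OF q(3) L(3,1) M(3) MT(3), symmetric]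
 show ?thesis unfolding e[OF L(2,3,1)] e[OF L(3,1,2)] e[OF L(1,2,3)]
  unfolding eta_def prod.case c1 c2 c3 unfolding D_def[symmetric] by (simp add: algebra_simps)
qed

end

section \<open>The normalisation\<close>

definition polyR :: "('p => complex) set => ('p => complex poly) => bool" where
 "polyR Q p \<longleftrightarrow> (ALL i. (%y. coeff (p y) i) : Q)"
lemma polyR_const: "function_algebra Q ==> c : Q ==> polyR Q (%y. [:c y:])" unfolding polyR_def
proof
 fix i assume "function_algebra Q" "c : Q"
 thus "(%y. coeff [:c y:] i) : Q" by (cases i) (simp_all add: fa_const)
qed
lemma polyR_fixed: "function_algebra Q ==> polyR Q (%y. p)" by (simp add: polyR_def fa_const)
lemma polyR_add: "function_algebra Q ==> polyR Q p ==> polyR Q q ==> polyR Q (%y. p y + q y)" by (simp add: polyR_def fa_add)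
lemma polyR_mult: "function_algebra Q ==> polyR Q p ==> polyR Q q ==> polyR Q (%y. p y * q y)"
 by (simp add: polyR_def coeff_mult fa_sum fa_mult)
lemma polyR_sum: "function_algebra Q ==> (!!i. i : I ==> polyR Q (p i)) ==> polyR Q (%y. \<Sum>i\<in>I. p i y)"
 by (induction I rule: infinite_finite_induct) (simp_all add: polyR_fixed polyR_add)
lemma polyR_prod: "function_algebra Q ==> (!!i. i : I ==> polyR Q (p i)) ==> polyR Q (%y. \<Prod>i\<in>I. p i y)"
 by (induction I rule: infinite_finite_induct) (simp_all add: polyR_fixed polyR_mult)
lemma polyR_char_poly:
 assumes Q: "function_algebra Q" and c: "!!i j. i < n ==> j < n ==> c i j : Q"
 shows "polyR Q (%y. char_poly (mat n n (%(i, j). c i j y)))"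
proof -
 let ?M = "%y. mat n n (%(i, j). c i j y)"
 have "char_poly (?M y) = (\<Sum>p\<in>{p. p permutes {0..<n}}. signof p * (\<Prod>i = 0..<n. (if i = p i then [:0, 1:] else 0) + [:- c i (p i) y:]))" for y
 proof -
  have m: "char_poly_matrix (?M y) : carrier_mat n n" by simp
  have "char_poly_matrix (?M y) $$ (i, j) = (if i = j then [:0, 1:] else 0) + [:- c i j y:]" if "i < n" "j < n" for i j
   using that by (simp add: char_poly_matrix_def)
  thus ?thesis unfolding char_poly_def det_def'[OF m]
   by simp
 qed
 moreover have "polyR Q (%y. \<Sum>p\<in>{p. p permutes {0..<n}}. signof p * (\<Prod>i = 0..<n. (if i = p i then [:0, 1:] else 0) + [:- c i (p i) y:]))"
 proof (intro polyR_sum[OF Q] polyR_mult[OF Q] polyR_prod[OF Q] polyR_add[OF Q] polyR_fixed[OF Q] polyR_const[OF Q])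
  fix p i assume "p : {p. p permutes {0..<n}}" "i : {0..<n}"
  hence "c i (p i) : Q" by (intro c) (use permutes_in_image[of p "{0..<n}" i] in auto)
  thus "(%y. - c i (p i) y) : Q" using fa_cmult[OF Q, of "c i (p i)" "-1"] by simp
 qed
 ultimately show ?thesis by simp
qed

lemma pow_function_apply: "((p :: 'a => complex) ^ n) x = p x ^ n" by (induction n) simp_all

context lie_alg begin
lemma coordinate_ring_iff: "f : coordinate_ring smul Y \<longleftrightarrow> (EX P:Rg. f = restr Y P)"
proof
 assume "f : coordinate_ring smul Y"
 thus "EX P:Rg. f = restr Y P" unfolding coordinate_ring_def[of smul Y]
 proof (induction rule: generated_algebra.induct)
  case (const c) show ?case by (rule bexI[of _ "%_. c"]) (simp_all add: fa_const[OF fa_Rg])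
 next
  case (gen l) hence "lf l" by simp
  thus ?case by (intro bexI[of _ l] lf_Rg refl)
 next
  case (add f g)
  obtain P where P: "P : Rg" "f = restr Y P" using add.IH(1) by auto
  obtain Q where Q: "Q : Rg" "g = restr Y Q" using add.IH(2) by auto
  show ?case using P Q fa_add[OF fa_Rg, of P Q] by (intro bexI[of _ "%x. P x + Q x"]) (auto simp: restr_def fun_eq_iff)
 next
  case (mult f g)
  obtain P where P: "P : Rg" "f = restr Y P" using mult.IH(1) by auto
  obtain Q where Q: "Q : Rg" "g = restr Y Q" using mult.IH(2) by auto
  show ?case using P Q fa_mult[OF fa_Rg, of P Q] by (intro bexI[of _ "%x. P x * Q x"]) (auto simp: restr_def fun_eq_iff)
 qed
next
 have "restr Y P : coordinate_ring smul Y" if "P : Rg" for P using that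
 proof (induction rule: Rg_induct)
  case (const c) show ?case unfolding coordinate_ring_def by (rule generated_algebra.const)
 next
  case (gen l) thus ?case unfolding coordinate_ring_def by (intro generated_algebra.gen) simp
 next
  case (add f g)
  have "restr Y (%x. f x + g x) = restr Y f + restr Y g" by (auto simp: restr_def)
  thus ?case using generated_algebra.add[OF add(3,4)[unfolded coordinate_ring_def]] unfolding coordinate_ring_def by (simp only:)
 next
  case (mult f g)
  have "restr Y (%x. f x * g x) = restr Y f * restr Y g" by (auto simp: restr_def)
  thus ?case using generated_algebra.mult[OF mult(3,4)[unfolded coordinate_ring_def]] unfolding coordinate_ring_def by (simp only:)
 qed
 thus "EX P:Rg. f = restr Y P ==> f : coordinate_ring smul Y" by auto
qed
end

section \<open>The normalisation as a ring: fractions, integrality, conductor\<close>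

locale normal_cover = extremal_lie smul Basis br B
 for smul :: "complex => 'g::ab_group_add => 'g" (infixr "*s" 75)
  and Basis :: "'g set" and br B +
 fixes X :: "'x set" and A :: "('x => complex) set" and \<nu> :: "'x => 'g"
 assumes normalisation: "normalisation X A E0 (coordinate_ring smul E0) \<nu>"
begin

definition RA :: "('x => complex) set" where "RA = {g. restr X g : A}"

lemma affine: "affine_variety X A" and normal: "normal_variety X A"
 and finite_mor: "finite_morphism X A E0 (coordinate_ring smul E0) \<nu>" and birat: "birational_morphism X A E0 (coordinate_ring smul E0) \<nu>"
 using normalisation by (simp_all add: normalisation_def normal_variety_def)
lemma birat_inj: "f : coordinate_ring smul E0 ==> pullback X \<nu> f = 0 ==> f = 0"
 by (rule birat[unfolded birational_morphism_def, THEN conjunct2, THEN conjunct1, rule_format])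
lemma birat_frac: "p : A ==> q : A ==> q ~= 0 ==>
  EX f:coordinate_ring smul E0. EX k:coordinate_ring smul E0. k ~= 0 & p * pullback X \<nu> k = q * pullback X \<nu> f"
 by (rule birat[unfolded birational_morphism_def, THEN conjunct2, THEN conjunct2, rule_format])
lemma finite_gen: "EX G. finite G & G \<subseteq> A & (ALL a:A. EX c. (ALL e:G. c e : coordinate_ring smul E0) & a = (\<Sum>e\<in>G. pullback X \<nu> (c e) * e))"
 by (rule finite_mor[unfolded finite_morphism_def, THEN conjunct2])
lemma pullback_A: "f : coordinate_ring smul E0 ==> pullback X \<nu> f : A"
 by (rule finite_mor[unfolded finite_morphism_def variety_morphism_def, THEN conjunct1, THEN conjunct2, rule_format])
lemma A_domain: "f : A ==> h : A ==> f * h = 0 ==> f = 0 \<or> h = 0"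
 by (rule affine[unfolded affine_variety_def, THEN conjunct2, THEN conjunct2, THEN conjunct1, rule_format])
lemma A_normal: "p : A ==> q : A ==> q ~= 0 ==> n > 0 ==> (!!i. i < n ==> c i : A) ==>
  p ^ n + (\<Sum>i<n. c i * p ^ i * q ^ (n - i)) = 0 ==> EX r:A. p = r * q"
 by (rule normal[unfolded normal_variety_def, THEN conjunct2, rule_format]) (assumption, assumption, assumption, rule exI[of _ n], rule conjI, assumption, rule exI[of _ c], simp)
lemma A_generated: "EX Gs. finite Gs & A = generated_algebra X Gs" using affine by (simp add: affine_variety_def)
lemma X_nonempty: "X ~= {}" using affine by (simp add: affine_variety_def)
lemma fa_RA: "function_algebra RA"
 by (metis A_generated RA_def function_algebra_generated)
lemma zero_loci_RA: "zero_loci (zariski X A) X RA"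
 by (metis A_generated RA_def zero_loci_zariski)
lemma A_restr: "a : A ==> restr X a = a"
 by (metis A_generated generated_algebra_restr)
lemma A_RA: "a : A ==> a : RA" by (simp add: RA_def A_restr)
lemma RA_restr: "a : RA ==> restr X a : A" by (simp add: RA_def)
lemma A_closed: "a : A ==> b : A ==> a + b : A" "a : A ==> b : A ==> a * b : A" "restr X (%_. c) : A" "a : A ==> fun_scale c a : A"
proof -
 obtain Gs where A: "A = generated_algebra X Gs" using A_generated by blast
 show "a : A ==> b : A ==> a + b : A" "a : A ==> b : A ==> a * b : A" "restr X (%_. c) : A"
  unfolding A by (auto intro: generated_algebra.intros)
 assume a: "a : A"
 have "(%x. c * a x) : RA" by (rule fa_cmult[OF fa_RA A_RA[OF a]])
 hence "restr X (%x. c * a x) : A" by (rule RA_restr)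
 moreover have "restr X (%x. c * a x) = fun_scale c a" using fun_cong[OF A_restr[OF a]] by (auto simp: restr_def fun_scale_def fun_eq_iff split: if_splits) metis
 ultimately show "fun_scale c a : A" by simp
qed
lemma RA_prime: "prime_on RA X" unfolding prime_on_def
proof (intro ballI impI)
 fix f g assume f: "f : RA" and g: "g : RA" and z: "ALL x:X. f x * g x = 0"
 have "restr X f * restr X g = 0" using z by (auto simp: restr_def)
 hence "restr X f = 0 \<or> restr X g = 0" using A_domain[OF RA_restr[OF f] RA_restr[OF g]] by simp
 thus "(ALL x:X. f x = 0) \<or> (ALL x:X. g x = 0)" by (auto simp: restr_def fun_eq_iff split: if_splits)
qed
lemma RA_cancel: "f : RA ==> g : RA ==> (!!x. x : X ==> f x * g x = 0) ==> x0 : X ==> f x0 ~= 0 ==> x : X ==> g x = 0"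
 using RA_prime unfolding prime_on_def by blast
lemma hom_point: "algebra_hom X A \<eta> ==> EX! x. x : X & (ALL f:A. \<eta> f = f x)" using affine by (simp add: affine_variety_def)

lemma \<nu>_E0: "x : X ==> \<nu> x : E0" using finite_mor by (auto simp: finite_morphism_def variety_morphism_def)
definition nu :: "('g => complex) => 'x => complex" where "nu P = restr X (%x. P (\<nu> x))"
lemma pullback_nu: "pullback X \<nu> (restr E0 P) = nu P" using \<nu>_E0 by (auto simp: pullback_def nu_def restr_def)
lemma nu_A: "P : Rg ==> nu P : A" using coordinate_ring_iff[of "restr E0 P" E0] pullback_A[of "restr E0 P"] by (auto simp: pullback_nu)
lemma nu_RA: "P : Rg ==> (%x. P (\<nu> x)) : RA" using nu_A by (simp add: RA_def nu_def)
lemma nu_inj: "P : Rg ==> (!!x. x : X ==> P (\<nu> x) = 0) ==> y : E0 ==> P y = 0"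
proof -
 assume P: "P : Rg" and z: "!!x. x : X ==> P (\<nu> x) = 0" and y: "y : E0"
 have "restr E0 P : coordinate_ring smul E0" using P coordinate_ring_iff by blast
 moreover have "pullback X \<nu> (restr E0 P) = 0" unfolding pullback_nu using z by (auto simp: nu_def restr_def)
 ultimately have "restr E0 P = 0" by (rule birat_inj)
 thus "P y = 0" using y by (auto simp: restr_def fun_eq_iff split: if_splits)
qed
lemma nu_eq: "P : Rg ==> Q : Rg ==> (!!x. x : X ==> P (\<nu> x) = Q (\<nu> x)) ==> y : E0 ==> P y = Q y"
 using nu_inj[OF fa_diff[OF fa_Rg], of P Q y] by simp
lemma nu_nonzero: "P : Rg ==> y : E0 ==> P y ~= 0 ==> EX x:X. P (\<nu> x) ~= 0" using nu_inj by blast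
lemma E_nonzero: "P : Rg ==> y : E0 ==> P y ~= 0 ==> EX y:E. P y ~= 0" using Rg_zero_limit[of P] by (cases "y = 0") (auto simp: E_def)

lemma fraction: assumes p: "p : RA"
 shows "EX P:Rg. EX Q:Rg. (EX y:E. Q y ~= 0) & (ALL x:X. p x * Q (\<nu> x) = P (\<nu> x))"
proof -
 have one: "restr X (%_. 1 :: complex) ~= 0" using X_nonempty by (auto simp: restr_def fun_eq_iff)
 obtain f k where f: "f : coordinate_ring smul E0" "k : coordinate_ring smul E0" "k ~= 0"
  "restr X p * pullback X \<nu> k = restr X (%_. 1) * pullback X \<nu> f"
  using birat_frac[OF RA_restr[OF p] A_closed(3)[of 1] one] by auto
 obtain P where P: "P : Rg" "f = restr E0 P" using f(1)[unfolded coordinate_ring_iff] by auto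
 obtain Q where Q: "Q : Rg" "k = restr E0 Q" using f(2)[unfolded coordinate_ring_iff] by auto
 obtain y where y: "y : E0" "Q y ~= 0" using f(3) Q(2) by (auto simp: restr_def fun_eq_iff split: if_splits)
 have "p x * Q (\<nu> x) = P (\<nu> x)" if "x : X" for x
  using fun_cong[OF f(4), of x] that unfolding P(2) Q(2) pullback_nu by (simp add: restr_def nu_def)
 thus ?thesis using E_nonzero[OF Q(1) y] by (intro bexI[OF _ P(1)] bexI[OF _ Q(1)] conjI ballI)
qed
lemma module_finite: "EX Gs. finite Gs & Gs \<subseteq> RA & (ALL a:RA. EX C. (ALL g:Gs. C g : Rg) & (ALL x:X. a x = (\<Sum>g\<in>Gs. C g (\<nu> x) * g x)))"
proof -
 obtain Gs where Gs: "finite Gs" "Gs \<subseteq> A" "!!a. a : A ==> EX c. (ALL g:Gs. c g : coordinate_ring smul E0) & a = (\<Sum>g\<in>Gs. pullback X \<nu> (c g) * g)"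
  using finite_gen by auto
 have "EX C. (ALL g:Gs. C g : Rg) & (ALL x:X. a x = (\<Sum>g\<in>Gs. C g (\<nu> x) * g x))" if a: "a : RA" for a
 proof -
  obtain c where c: "ALL g:Gs. c g : coordinate_ring smul E0" "restr X a = (\<Sum>g\<in>Gs. pullback X \<nu> (c g) * g)" using Gs(3)[OF RA_restr[OF a]] by auto
  have "ALL g:Gs. EX P. P : Rg & c g = restr E0 P" using c(1)[unfolded coordinate_ring_iff] unfolding Bex_def .
  from bchoice[OF this] obtain C where C: "!!g. g : Gs ==> C g : Rg & c g = restr E0 (C g)" by auto
  have "a x = (\<Sum>g\<in>Gs. C g (\<nu> x) * g x)" if x: "x : X" for x
  proof -
   have "a x = (\<Sum>g\<in>Gs. pullback X \<nu> (c g) x * g x)" using fun_cong[OF c(2), of x] x by (simp add: restr_def sum_function_apply)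
   also have "\<dots> = (\<Sum>g\<in>Gs. C g (\<nu> x) * g x)"
    by (rule sum.cong[OF refl]) (use C x in \<open>simp add: pullback_nu\<close>, simp add: nu_def restr_def x)
   finally show ?thesis .
  qed
  thus ?thesis using C by auto
 qed
 moreover have "Gs \<subseteq> RA" using Gs(2) A_RA by auto
 ultimately show ?thesis using Gs(1) by auto
qed
lemma integrally_closed:
 assumes p: "p : RA" and q: "q : RA" "x0 : X" "q x0 ~= 0" and n: "n > 0" and c: "!!i. c i : RA"
  and eq: "!!x. x : X ==> p x ^ n + (\<Sum>i<n. c i x * p x ^ i * q x ^ (n - i)) = 0"
 shows "EX r:RA. ALL x:X. p x = r x * q x"
proof -
 have q0: "restr X q ~= 0" using q by (auto simp: restr_def fun_eq_iff)
 have "(restr X p) ^ n + (\<Sum>i<n. restr X (c i) * (restr X p) ^ i * (restr X q) ^ (n - i)) = 0"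
 proof
  fix x
  show "((restr X p) ^ n + (\<Sum>i<n. restr X (c i) * (restr X p) ^ i * (restr X q) ^ (n - i))) x = 0 x"
   using eq[of x] n by (simp add: pow_function_apply sum_function_apply restr_def)
 qed
 from A_normal[OF RA_restr[OF p] RA_restr[OF q(1)] q0 n RA_restr[OF c] this]
 obtain r where r: "r : A" "restr X p = r * restr X q" by auto
 have "p x = r x * q x" if "x : X" for x using fun_cong[OF r(2), of x] that by (simp add: restr_def)
 thus ?thesis using A_RA[OF r(1)] by blast
qed

text \<open>Multiplication by \<open>a\<close> on module generators is given by a matrix over the base, of which \<open>a\<close>
 is pointwise an eigenvalue.\<close>

lemma integral: assumes a: "a : RA"
 shows "EX n>0. EX c. (ALL i. c i : Rg) & (ALL x:X. a x ^ n + (\<Sum>i<n. c i (\<nu> x) * a x ^ i) = 0)"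
proof -
 obtain Gs where Gs: "finite Gs" "Gs \<subseteq> RA"
  "!!a. a : RA ==> EX C. (ALL g:Gs. C g : Rg) & (ALL x:X. a x = (\<Sum>g\<in>Gs. C g (\<nu> x) * g x))"
  using module_finite by auto
 obtain gs where gs: "set gs = Gs" "distinct gs" using finite_distinct_list[OF Gs(1)] by blast
 define n where "n = length gs"
 have bij: "bij_betw ((!) gs) {..<n} Gs" by (rule bij_betw_nth[OF gs(2)]) (simp_all add: n_def gs(1))
 have sumG: "(\<Sum>g\<in>Gs. F g) = (\<Sum>j<n. F (gs ! j))" for F :: "('x => complex) => complex"
  by (rule sum.reindex_bij_betw[OF bij, symmetric])
 have "ALL i. EX C. i < n --> (ALL g:Gs. C g : Rg) & (ALL x:X. a x * (gs ! i) x = (\<Sum>g\<in>Gs. C g (\<nu> x) * g x))"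
 proof
  fix i
  show "EX C. i < n --> (ALL g:Gs. C g : Rg) & (ALL x:X. a x * (gs ! i) x = (\<Sum>g\<in>Gs. C g (\<nu> x) * g x))"
  proof (cases "i < n")
   case True
   hence "gs ! i : RA" using Gs(2) gs(1) by (auto simp: n_def)
   from Gs(3)[OF fa_mult[OF fa_RA a this]] show ?thesis by simp
  qed simp
 qed
 from choice[OF this] obtain C0 where C0: "ALL i. i < n --> (ALL g:Gs. C0 i g : Rg) & (ALL x:X. a x * (gs ! i) x = (\<Sum>g\<in>Gs. C0 i g (\<nu> x) * g x))"
  by auto
 define C where "C = C0"
 have C: "!!i g. i < n ==> g : Gs ==> C i g : Rg"
  "!!i x. i < n ==> x : X ==> a x * (gs ! i) x = (\<Sum>g\<in>Gs. C i g (\<nu> x) * g x)" using C0 unfolding C_def by simp_all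
 define M where "M y = mat n n (%(i, j). C i (gs ! j) y)" for y
 have Mc: "M y : carrier_mat n n" for y by (simp add: M_def)
 have root: "poly (char_poly (M (\<nu> x))) (a x) = 0" if x: "x : X" for x
 proof -
  define w where "w = vec n (%i. (gs ! i) x)"
  have "M (\<nu> x) *\<^sub>v w = a x \<cdot>\<^sub>v w"
  proof (rule eq_vecI)
   fix i assume "i < dim_vec (a x \<cdot>\<^sub>v w)"
   hence i: "i < n" by (simp add: w_def)
   show "(M (\<nu> x) *\<^sub>v w) $ i = (a x \<cdot>\<^sub>v w) $ i"
    using i C(2)[OF i x] by (simp add: M_def w_def scalar_prod_def sumG lessThan_atLeast0)
  qed (simp add: M_def w_def)
  \<comment> \<open>The constant 1 is a combination of the generators, so they have no common
    zero.\<close>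
  moreover have "w ~= 0\<^sub>v n"
  proof
   assume w: "w = 0\<^sub>v n"
   obtain D where D: "ALL x:X. 1 = (\<Sum>g\<in>Gs. D g (\<nu> x) * g x)" using Gs(3)[OF fa_const[OF fa_RA, of 1]] by auto
   have "(gs ! j) x = 0" if j: "j < n" for j
   proof -
    have "w $ j = (gs ! j) x" using j by (simp add: w_def)
    thus ?thesis using j by (simp add: w)
   qed
   hence "(\<Sum>j<n. D (gs ! j) (\<nu> x) * (gs ! j) x) = 0" by simp
   thus False using bspec[OF D x] unfolding sumG by simp
  qed
  ultimately have "eigenvalue (M (\<nu> x)) (a x)"
   unfolding eigenvalue_def eigenvector_def using Mc[of "\<nu> x"] by (intro exI[of _ w]) (auto simp: w_def)
  thus ?thesis using eigenvalue_root_char_poly[OF Mc] by simp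
 qed
 define c where "c i y = coeff (char_poly (M y)) i" for i y
 have cR: "c i : Rg" for i
 proof -
  have "C i (gs ! j) : Rg" if "i < n" "j < n" for i j using C(1)[OF that(1)] gs(1) nth_mem[of j gs] that(2) by (simp add: n_def)
  from polyR_char_poly[OF fa_Rg this] show ?thesis unfolding polyR_def c_def[abs_def] M_def by simp
 qed
 have e: "a x ^ n + (\<Sum>i<n. c i (\<nu> x) * a x ^ i) = 0" if x: "x : X" for x
 proof -
  have "poly (char_poly (M (\<nu> x))) (a x) = (\<Sum>i\<le>n. c i (\<nu> x) * a x ^ i)"
   using degree_monic_char_poly[OF Mc] by (simp add: poly_altdef c_def)
  also have "\<dots> = a x ^ n + (\<Sum>i<n. c i (\<nu> x) * a x ^ i)"
   using degree_monic_char_poly[OF Mc, of "\<nu> x"] by (simp add: lessThan_Suc_atMost[symmetric] c_def)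
  finally show ?thesis using root[OF x] by simp
 qed
 moreover have "n > 0" using e X_nonempty by force
 ultimately show ?thesis using cR by blast
qed

text \<open>The conductor of the coordinate ring in its normalisation, as a set of polynomials on
  g.\<close>

definition Cond :: "('g => complex) set" where
 "Cond = {b:Rg. ALL a:RA. EX P:Rg. ALL x:X. a x * b (\<nu> x) = P (\<nu> x)}"
lemma Cond_Rg: "b : Cond ==> b : Rg" by (simp add: Cond_def)
lemma CondD: "b : Cond ==> a : RA ==> EX P:Rg. ALL x:X. a x * b (\<nu> x) = P (\<nu> x)" by (simp add: Cond_def)

text \<open>A common denominator of finitely many module generators; it is not zero on E because E
  is irreducible.\<close>

lemma Cond_exists: "EX b:Cond. EX y:E. b y ~= 0"
proof -
 obtain Gs where Gs: "finite Gs" "Gs \<subseteq> RA"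
  "!!a. a : RA ==> EX C. (ALL g:Gs. C g : Rg) & (ALL x:X. a x = (\<Sum>g\<in>Gs. C g (\<nu> x) * g x))"
  using module_finite by auto
 have main: "finite H ==> H \<subseteq> RA ==> EX b:Rg. (EX y:E. b y ~= 0) & (ALL g:H. EX P:Rg. ALL x:X. g x * b (\<nu> x) = P (\<nu> x))" for H
 proof (induction H rule: finite_induct)
  case empty
  obtain y where "y : E" using E_nonempty by blast
  thus ?case using fa_const[OF fa_Rg, of 1] by force
 next
  case (insert g H)
  have "H \<subseteq> RA" and gRA: "g : RA" using insert.prems by auto
  from insert.IH[OF this(1)] obtain b y where b: "b : Rg" "y : E" "b y ~= 0" and ball: "ALL g:H. EX P:Rg. ALL x:X. g x * b (\<nu> x) = P (\<nu> x)"
   by auto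
  obtain P Q y' where P: "P : Rg" "Q : Rg" "y' : E" "Q y' ~= 0" "ALL x:X. g x * Q (\<nu> x) = P (\<nu> x)"
   using fraction[OF gRA] by auto
  have bQ: "(%y. b y * Q y) : Rg" by (intro fa_mult[OF fa_Rg] b P)
  have nz: "EX y:E. b y * Q y ~= 0" using E_cancel[OF b(1) P(2) _ b(2,3) P(3)] P(4) by blast
  have ex: "EX R:Rg. ALL x:X. k x * (b (\<nu> x) * Q (\<nu> x)) = R (\<nu> x)" if k: "k : insert g H" for k
  proof (cases "k = g")
   case True
   thus ?thesis using P(5) by (intro bexI[of _ "%y. b y * P y"] fa_mult[OF fa_Rg] b P) (auto simp: ac_simps)
  next
   case False
   hence "k : H" using k by simp
   from ball[rule_format, OF this] obtain R where R: "R : Rg" "ALL x:X. k x * b (\<nu> x) = R (\<nu> x)" by auto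
   thus ?thesis by (intro bexI[of _ "%y. R y * Q y"] fa_mult[OF fa_Rg] P R) (simp add: ac_simps)
  qed
  show ?case
  proof (rule bexI[of _ "%y. b y * Q y"], intro conjI nz ballI)
   fix k assume "k : insert g H"
   thus "EX P:Rg. ALL x:X. k x * (b (\<nu> x) * Q (\<nu> x)) = P (\<nu> x)" by (rule ex)
  qed (rule bQ)
 qed
 obtain b y where b: "b : Rg" "y : E" "b y ~= 0" and ball: "ALL g:Gs. EX P:Rg. ALL x:X. g x * b (\<nu> x) = P (\<nu> x)"
  using main[OF Gs(1,2)] by auto
 have "ALL g:Gs. EX P. P : Rg & (ALL x:X. g x * b (\<nu> x) = P (\<nu> x))" using ball unfolding Bex_def .
 from bchoice[OF this] obtain P where P0: "ALL g:Gs. P g : Rg & (ALL x:X. g x * b (\<nu> x) = P g (\<nu> x))" by auto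
 have P: "!!g. g : Gs ==> P g : Rg" "!!g x. g : Gs ==> x : X ==> g x * b (\<nu> x) = P g (\<nu> x)" using P0 by auto
 have "EX Q:Rg. ALL x:X. a x * b (\<nu> x) = Q (\<nu> x)" if a: "a : RA" for a
 proof -
  obtain C where C: "ALL g:Gs. C g : Rg" "ALL x:X. a x = (\<Sum>g\<in>Gs. C g (\<nu> x) * g x)" using Gs(3)[OF a] by auto
  have "a x * b (\<nu> x) = (\<Sum>g\<in>Gs. C g (\<nu> x) * P g (\<nu> x))" if "x : X" for x
  proof -
   have "a x = (\<Sum>g\<in>Gs. C g (\<nu> x) * g x)" using C(2) that by blast
   hence "a x * b (\<nu> x) = (\<Sum>g\<in>Gs. C g (\<nu> x) * g x) * b (\<nu> x)" by simp
   also have "\<dots> = (\<Sum>g\<in>Gs. C g (\<nu> x) * P g (\<nu> x))"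
    unfolding sum_distrib_right by (rule sum.cong) (use P(2)[OF _ that] in \<open>auto simp: mult.assoc\<close>)
   finally show ?thesis .
  qed
  moreover have "(%y. \<Sum>g\<in>Gs. C g y * P g y) : Rg" using C(1) P(1) by (intro fa_sum[OF fa_Rg] fa_mult[OF fa_Rg]) auto
  ultimately show ?thesis by auto
 qed
 hence "b : Cond" using b(1) by (simp add: Cond_def)
 thus ?thesis using b(2,3) by blast
qed

lemma E0_Gr: "u : Gr ==> y : E0 ==> u y : E0" using E_Gr[of u y] le_0[OF Gr_le, of u] by (cases "y = 0") (auto simp: E_def zero_E0)
lemma Rg_Gr: "u : Gr ==> P : Rg ==> (%y. P (u y)) : Rg" using Rg_le Gr_le by blast

text \<open>If a = P0 / b0, then the translated fraction satisfies the translated integral equation,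
  so it is in the ring by normality. In this way the adjoint group acts on the functions of
  X.\<close>

lemma translate: assumes a: "a : RA" and u: "u : Gr"
 shows "EX a':RA. ALL b:Rg. ALL P:Rg. (ALL x:X. a x * b (\<nu> x) = P (\<nu> x)) --> (ALL x:X. a' x * b (u (\<nu> x)) = P (u (\<nu> x)))"
proof -
 obtain b0 y0 where b0: "b0 : Cond" "y0 : E" "b0 y0 ~= 0" using Cond_exists by blast
 note b0R = Cond_Rg[OF b0(1)]
 obtain P0 where P0: "P0 : Rg" "!!x. x : X ==> a x * b0 (\<nu> x) = P0 (\<nu> x)" using CondD[OF b0(1) a] by auto
 obtain n c where n: "n > 0" "!!i. c i : Rg" "!!x. x : X ==> a x ^ n + (\<Sum>i<n. c i (\<nu> x) * a x ^ i) = 0" using integral[OF a] by auto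
 \<comment> \<open>The integral equation of a with denominators cleared; it holds on all of E0 and
   may therefore be evaluated at u (\<nu> x).\<close>
 define F where "F y = P0 y ^ n + (\<Sum>i<n. c i y * P0 y ^ i * b0 y ^ (n - i))" for y
 have FR: "F : Rg" unfolding F_def by (intro fa_add[OF fa_Rg] fa_sum[OF fa_Rg] fa_mult[OF fa_Rg] fa_pow[OF fa_Rg] P0 n b0R)
 have F0: "F y = 0" if "y : E0" for y
 proof (rule nu_inj[OF FR _ that])
  fix x assume x: "x : X"
  have "F (\<nu> x) = (a x ^ n + (\<Sum>i<n. c i (\<nu> x) * a x ^ i)) * b0 (\<nu> x) ^ n"
  proof -
   have "b0 (\<nu> x) ^ n = b0 (\<nu> x) ^ i * b0 (\<nu> x) ^ (n - i)" if "i < n" for i using that by (simp flip: power_add)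
   hence "(\<Sum>i<n. c i (\<nu> x) * P0 (\<nu> x) ^ i * b0 (\<nu> x) ^ (n - i)) = (\<Sum>i<n. c i (\<nu> x) * a x ^ i * b0 (\<nu> x) ^ n)"
    unfolding P0(2)[OF x, symmetric] by (intro sum.cong) (auto simp: power_mult_distrib)
   thus ?thesis unfolding F_def by (simp add: P0(2)[OF x, symmetric] power_mult_distrib distrib_right sum_distrib_right)
  qed
  thus "F (\<nu> x) = 0" using n(3)[OF x] by simp
 qed
 obtain w where w: "w : Gr" "!!x. u (w x) = x" using Gr_inv[OF u] by blast
 have "EX x:X. b0 (u (\<nu> x)) ~= 0" by (rule nu_nonzero[OF Rg_Gr[OF u b0R], of "w y0"]) (use b0(2,3) w E_E0 E0_Gr in auto)
 then obtain x0 where x0: "x0 : X" "b0 (u (\<nu> x0)) ~= 0" by blast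
 have uR: "(%x. P (u (\<nu> x))) : RA" if "P : Rg" for P by (rule nu_RA[OF Rg_Gr[OF u that]])
 have "EX r:RA. ALL x:X. P0 (u (\<nu> x)) = r x * b0 (u (\<nu> x))"
 proof (rule integrally_closed[OF uR[OF P0(1)] uR[OF b0R] x0 n(1) uR[OF n(2)]])
  fix x assume "x : X"
  hence "F (u (\<nu> x)) = 0" by (intro F0 E0_Gr[OF u] \<nu>_E0)
  thus "P0 (u (\<nu> x)) ^ n + (\<Sum>i<n. c i (u (\<nu> x)) * P0 (u (\<nu> x)) ^ i * b0 (u (\<nu> x)) ^ (n - i)) = 0" by (simp add: F_def)
 qed
 then obtain r where r: "r : RA" "!!x. x : X ==> P0 (u (\<nu> x)) = r x * b0 (u (\<nu> x))" by blast
 have "r x * b (u (\<nu> x)) = P (u (\<nu> x))" if b: "b : Rg" "P : Rg" "ALL x:X. a x * b (\<nu> x) = P (\<nu> x)" and x: "x : X" for b P x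
 proof -
  have e: "P y * b0 y = P0 y * b y" if "y : E0" for y
  proof (rule nu_eq[OF fa_mult[OF fa_Rg b(2) b0R] fa_mult[OF fa_Rg P0(1) b(1)] _ that])
   fix x assume x: "x : X"
   show "P (\<nu> x) * b0 (\<nu> x) = P0 (\<nu> x) * b (\<nu> x)" using b(3) x P0(2)[OF x] by (simp flip: P0(2))
  qed
  have "r x * b (u (\<nu> x)) - P (u (\<nu> x)) = 0"
  proof (rule RA_cancel[OF uR[OF b0R] _ _ x0 x])
   show "(%x. r x * b (u (\<nu> x)) - P (u (\<nu> x))) : RA" by (intro fa_diff[OF fa_RA] fa_mult[OF fa_RA] r uR b)
   fix x assume x: "x : X"
   have "b0 (u (\<nu> x)) * (r x * b (u (\<nu> x)) - P (u (\<nu> x))) = (r x * b0 (u (\<nu> x))) * b (u (\<nu> x)) - P (u (\<nu> x)) * b0 (u (\<nu> x))" by (simp add: algebra_simps)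
   also have "\<dots> = 0" unfolding r(2)[OF x, symmetric] e[OF E0_Gr[OF u \<nu>_E0[OF x]]] by simp
   finally show "b0 (u (\<nu> x)) * (r x * b (u (\<nu> x)) - P (u (\<nu> x))) = 0" .
  qed
  thus ?thesis by simp
 qed
 thus ?thesis using r(1) by blast
qed

text \<open>Translate a by the inverse of u, multiply by b and translate back. As the group is
  transitive on E, the conductor has no zero there.\<close>

lemma Cond_Gr: assumes b: "b : Cond" and u: "u : Gr" shows "(%y. b (u y)) : Cond"
proof -
 obtain w where w: "w : Gr" "!!x. w (u x) = x" using Gr_inv[OF u] by blast
 obtain b0 y0 where b0: "b0 : Cond" "y0 : E" "b0 y0 ~= 0" using Cond_exists by blast
 note b0R = Cond_Rg[OF b0(1)] and bR = Cond_Rg[OF b]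
 obtain x0 where x0: "x0 : X" "b0 (\<nu> x0) ~= 0" using nu_nonzero[OF b0R E_E0[OF b0(2)] b0(3)] by blast
 have "EX P:Rg. ALL x:X. a x * b (u (\<nu> x)) = P (\<nu> x)" if a: "a : RA" for a
 proof -
  obtain P0 where P0: "P0 : Rg" "ALL x:X. a x * b0 (\<nu> x) = P0 (\<nu> x)" using CondD[OF b0(1) a] by auto
  obtain a' where a': "a' : RA" and a'2: "!!b P. b : Rg ==> P : Rg ==> (ALL x:X. a x * b (\<nu> x) = P (\<nu> x)) ==> (ALL x:X. a' x * b (w (\<nu> x)) = P (w (\<nu> x)))"
   using translate[OF a w(1)] by blast
  obtain a'' where a'': "a'' : RA" and a''2: "!!b P. b : Rg ==> P : Rg ==> (ALL x:X. a' x * b (\<nu> x) = P (\<nu> x)) ==> (ALL x:X. a'' x * b (u (\<nu> x)) = P (u (\<nu> x)))"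
   using translate[OF a' u] by blast
  obtain P where P: "P : Rg" "ALL x:X. a' x * b (\<nu> x) = P (\<nu> x)" using CondD[OF b a'] by auto
  have 1: "a'' x * b0 (\<nu> x) = P0 (\<nu> x)" if "x : X" for x
   using a''2[OF Rg_Gr[OF w(1) b0R] Rg_Gr[OF w(1) P0(1)] a'2[OF b0R P0]] that by (simp add: w(2))
  have aa: "a'' x - a x = 0" if x: "x : X" for x
  proof (rule RA_cancel[OF nu_RA[OF b0R] fa_diff[OF fa_RA a'' a] _ x0 x])
   show "b0 (\<nu> x) * (a'' x - a x) = 0" if "x : X" for x using 1[OF that] P0(2) that by (simp add: algebra_simps)
  qed
  have "a x * b (u (\<nu> x)) = P (u (\<nu> x))" if "x : X" for x using bspec[OF a''2[OF bR P] that] aa[OF that] by simp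
  thus ?thesis by (intro bexI[OF _ Rg_Gr[OF u P(1)]] ballI)
 qed
 thus ?thesis unfolding Cond_def using Rg_Gr[OF u bR] by auto
qed
lemma Cond_at: assumes "z : E" shows "EX b:Cond. b z ~= 0"
 by (metis Cond_exists E_transitive assms Cond_Gr)

text \<open>With b in the conductor and b z ~= 0, every a has the forced value num a z / b z over z.
  These values form an algebra homomorphism, so exactly one point realises them.\<close>

lemma point_over: assumes z: "z : E" shows "EX! x. x : X & \<nu> x = z"
proof -
 obtain b where b: "b : Cond" "b z ~= 0" using Cond_at[OF z] by blast
 note bR = Cond_Rg[OF b(1)]
 have "ALL a:RA. EX P. P : Rg & (ALL x:X. a x * b (\<nu> x) = P (\<nu> x))" using CondD[OF b(1)] by auto
 then obtain num where num: "ALL a:RA. num a : Rg & (ALL x:X. a x * b (\<nu> x) = num a (\<nu> x))"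
  by (drule_tac bchoice) (elim exE, rule that)
 note num = bspec[OF num]
 have uniq: "num a z = Q z" if a: "a : RA" and P: "Q : Rg" "!!x. x : X ==> a x * b (\<nu> x) = Q (\<nu> x)" for a Q
  by (rule nu_eq[OF _ P(1) _ E_E0[OF z]]) (use num[OF a] P(2) in auto)
 define \<eta> where "\<eta> a = num a z / b z" for a
 have "algebra_hom X A \<eta>" unfolding algebra_hom_def
 proof (intro conjI allI ballI)
  fix c
  have "num (restr X (%_. c)) z = c * b z"
   by (rule uniq[of _ "%y. c * b y"]) (use A_RA[OF A_closed(3), of c] fa_cmult[OF fa_Rg bR] in \<open>simp_all add: restr_def\<close>)
  thus "\<eta> (restr X (%_. c)) = c" using b(2) by (simp add: \<eta>_def)
 next
  fix f k assume fk: "f : A" "k : A"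
  note nf = num[OF A_RA[OF fk(1)]] and nk = num[OF A_RA[OF fk(2)]]
  have "num (f + k) z = num f z + num k z"
   by (rule uniq[of _ "%y. num f y + num k y"]) (use nf nk A_RA[OF A_closed(1)[OF fk]] in \<open>simp_all add: distrib_right fa_add[OF fa_Rg]\<close>)
  thus "\<eta> (f + k) = \<eta> f + \<eta> k" by (simp add: \<eta>_def add_divide_distrib)
  have nfk: "num (f * k) : Rg" "!!x. x : X ==> f x * k x * b (\<nu> x) = num (f * k) (\<nu> x)" using num[OF A_RA[OF A_closed(2)[OF fk]]] by auto
  have "num (f * k) z * b z = num f z * num k z"
  proof (rule nu_eq[where P = "%y. num (f * k) y * b y" and Q = "%y. num f y * num k y", OF _ _ _ E_E0[OF z]])
   fix x assume x: "x : X"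
   have "num f (\<nu> x) = f x * b (\<nu> x)" "num k (\<nu> x) = k x * b (\<nu> x)" using nf nk x by auto
   thus "num (f * k) (\<nu> x) * b (\<nu> x) = num f (\<nu> x) * num k (\<nu> x)" using nfk(2)[OF x, symmetric] by simp
  qed (use nf nk nfk bR in \<open>auto intro: fa_mult[OF fa_Rg]\<close>)
  thus "\<eta> (f * k) = \<eta> f * \<eta> k" using b(2) by (simp add: \<eta>_def field_simps)
 qed
 from hom_point[OF this] obtain x where x: "x : X" "!!f. f : A ==> \<eta> f = f x"
  and ux: "!!y. y : X ==> (!!f. f : A ==> \<eta> f = f y) ==> y = x" by blast
 have "\<nu> x = z"
 proof (rule eqI_lf)
  fix l assume l: "lf l"
  have "num (nu l) z = l z * b z"
   by (rule uniq[of _ "%y. l y * b y"]) (use A_RA[OF nu_A[OF lf_Rg[OF l]]] fa_mult[OF fa_Rg lf_Rg[OF l] bR] in \<open>simp_all add: nu_def restr_def\<close>)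
  hence "\<eta> (nu l) = l z" using b(2) by (simp add: \<eta>_def)
  thus "l (\<nu> x) = l z" using x(2)[OF nu_A[OF lf_Rg[OF l]]] x(1) by (simp add: nu_def restr_def)
 qed
 moreover have "y = x" if y: "y : X" "\<nu> y = z" for y
 proof (rule ux[OF y(1)])
  fix f assume f: "f : A"
  have "f y * b (\<nu> y) = num f (\<nu> y)" using num[OF A_RA[OF f]] y(1) by blast
  thus "\<eta> f = f y" using b(2) y(2) by (simp add: \<eta>_def field_simps)
 qed
 ultimately show ?thesis using x(1) by blast
qed

definition sec :: "'g => 'x" where "sec z = (THE x. x : X & \<nu> x = z)"
lemma sec: "z : E ==> sec z : X" "z : E ==> \<nu> (sec z) = z" using theI'[OF point_over, of z] by (simp_all add: sec_def)
lemma sec_\<nu>: "x : X ==> \<nu> x : E ==> sec (\<nu> x) = x" unfolding sec_def by (rule the1_equality[OF point_over]) auto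
lemma rep_sec: "b : Rg ==> P : Rg ==> (ALL x:X. a x * b (\<nu> x) = P (\<nu> x)) ==> rep (%z. a (sec z)) b P"
 unfolding rep_def by (intro conjI ballI) (use sec in \<open>auto dest: bspec[OF _ sec(1)]\<close>)
lemma sec_Reg: assumes a: "a : RA" shows "(%z. a (sec z)) : Reg"
 by (metis RegI Cond_at CondD a rep_sec Cond_Rg)
lemma nu_sec: "z : E ==> nu P (sec z) = P z" by (simp add: nu_def restr_def sec)
lemma RA_zero: assumes a: "a : RA" "!!z. z : E ==> a (sec z) = 0" and x: "x : X" shows "a x = 0"
proof -
 obtain b y where b: "b : Cond" "y : E" "b y ~= 0" using Cond_exists by blast
 note bR = Cond_Rg[OF b(1)]
 obtain P where P: "P : Rg" "ALL x:X. a x * b (\<nu> x) = P (\<nu> x)" using CondD[OF b(1) a(1)] by auto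
 have z: "P y = 0" if "y : E" for y using bspec[OF P(2) sec(1)[OF that]] sec(2)[OF that] a(2)[OF that] by simp
 have "P y = 0" if "y : E0" for y using z Rg_zero_limit[OF P(1) z] that by (cases "y = 0") (auto simp: E_def)
 hence z0: "b (\<nu> x) * a x = 0" if "x : X" for x using P(2) \<nu>_E0[OF that] that by auto
 obtain x0 where x0: "x0 : X" "b (\<nu> x0) ~= 0" using nu_nonzero[OF bR E_E0[OF b(2)] b(3)] by blast
 show ?thesis by (rule RA_cancel[OF nu_RA[OF bR] a(1) z0 x0 x])
qed

subsection \<open>Tangent spaces and dimension\<close>

text \<open>\<open>DD\<close> and \<open>vecD\<close> identify the Zariski tangent space at the
  point over z with [g,z]; see \<open>tangent_space_DD\<close>.\<close>

definition DD :: "'g => 'g => ('x => complex) => complex" where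
 "DD z v = (%a. if a : A then dE (%y. a (sec y)) z v else 0)"
definition vecD :: "(('x => complex) => complex) => 'g" where "vecD D = (\<Sum>b\<in>Basis. D (nu (co b)) *s b)"

lemma DD_nu: assumes "P : Rg" "z : E" "v : Tg z" shows "DD z v (nu P) = dd P z v"
 by (use dE_cong Rg_Reg assms nu_sec DD_def nu_A dE_Rg in \<open>fastforce\<close>)
lemma vecD_DD: assumes "z : E" "v : Tg z" shows "vecD (DD z v) = v"
 using co_sum[of v] by (simp add: vecD_def DD_nu[OF lf_Rg[OF lf_co] assms] dd_lf[OF lf_co])
lemma DD_derivation: assumes z: "z : E" and v: "v : Tg z" shows "DD z v : tangent_space A (sec z)" unfolding tangent_space_def
proof (intro CollectI conjI allI ballI impI)
 show "DD z v f = 0" if "f ~: A" for f using that by (simp add: DD_def)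
 fix f assume f: "f : A"
 note fR = sec_Reg[OF A_RA[OF f]]
 show "DD z v (fun_scale c f) = c * DD z v f" for c
  using dE_cmult[OF fR z v, of c] f A_closed(4)[OF f, of c] by (simp add: DD_def fun_scale_def)
 fix k assume k: "k : A"
 note kR = sec_Reg[OF A_RA[OF k]]
 show "DD z v (f + k) = DD z v f + DD z v k" using dE_add[OF fR kR z v] f k A_closed(1)[OF f k] by (simp add: DD_def)
 show "DD z v (f * k) = f (sec z) * DD z v k + k (sec z) * DD z v f"
  using dE_mult[OF fR kR z v] f k A_closed(2)[OF f k] by (simp add: DD_def)
qed
lemma vecD_lf: assumes D: "D : tangent_space A x" and l: "lf l" shows "l (vecD D) = D (nu l)"
proof -
 have D0: "D 0 = 0"
 proof -
  have "fun_scale 0 (restr X (%_. 0)) = (0 :: 'x => complex)" by auto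
  moreover have h: "ALL c. ALL f:A. D (fun_scale c f) = c * D f" using D unfolding tangent_space_def by simp
  have "D (fun_scale 0 (restr X (%_. 0))) = 0 * D (restr X (%_. 0))" by (rule bspec[OF spec[OF h] A_closed(3)])
  ultimately show ?thesis by simp
 qed
 have A0: "(0 :: 'x => complex) : A" using A_closed(3)[of 0] by (simp add: restr_def zero_fun_def)
 have S: "D (\<Sum>b\<in>I. fun_scale (c b) (g b)) = (\<Sum>b\<in>I. c b * D (g b)) & (\<Sum>b\<in>I. fun_scale (c b) (g b)) : A"
  if "!!b. b : I ==> g b : A" for I :: "'g set" and c g using that
 proof (induction I rule: infinite_finite_induct)
  case (insert b I)
  hence g: "g b : A" "(\<Sum>b\<in>I. fun_scale (c b) (g b)) : A" "D (\<Sum>b\<in>I. fun_scale (c b) (g b)) = (\<Sum>b\<in>I. c b * D (g b))" by auto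
  have "D (fun_scale (c b) (g b) + (\<Sum>b\<in>I. fun_scale (c b) (g b))) = c b * D (g b) + D (\<Sum>b\<in>I. fun_scale (c b) (g b))"
   using D g(1,2) A_closed(4)[OF g(1), of "c b"] unfolding tangent_space_def by simp
  thus ?case unfolding sum.insert[OF insert.hyps(1,2)] using g(3) A_closed(1)[OF A_closed(4)[OF g(1)] g(2)] by (intro conjI) (simp only:)+
 qed (simp_all add: D0 A0)
 have "nu l = (\<Sum>b\<in>Basis. fun_scale (l b) (nu (co b)))"
 proof
  fix x
  have "l (\<nu> x) = (\<Sum>b\<in>Basis. l b * co b (\<nu> x))" using co_lf[OF l, of "\<nu> x"] by (simp add: mult.commute)
  thus "nu l x = (\<Sum>b\<in>Basis. fun_scale (l b) (nu (co b))) x" by (simp add: nu_def restr_def sum_function_apply fun_scale_def)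
 qed
 hence "D (nu l) = (\<Sum>b\<in>Basis. l b * D (nu (co b)))" using S[of Basis "%b. nu (co b)" l] nu_A[OF lf_Rg[OF lf_co]] by simp
 also have "\<dots> = l (vecD D)" unfolding vecD_def lf_sum[OF l] by (simp add: lf_scale[OF l] mult.commute)
 finally show ?thesis by simp
qed
lemma D_nu: assumes D: "D : tangent_space A x" and x: "x : X" and P: "P : Rg" shows "D (nu P) = dd P (\<nu> x) (vecD D)"
proof -
 have TD: "D (f + k) = D f + D k" "D (fun_scale c f) = c * D f" "D (f * k) = f x * D k + k x * D f" if "f : A" "k : A" for f k c
  using D that unfolding tangent_space_def by auto
 show ?thesis using P
 proof (induction rule: Rg_induct)
  case (const c)
  let ?o = "restr X (%_. 1 :: complex)"
  have "?o * ?o = ?o" by (auto simp: restr_def)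
  hence "D ?o = 2 * D ?o" using TD(3)[OF A_closed(3) A_closed(3), of 1 1] x by (simp add: restr_def)
  hence "D ?o = 0" by simp
  moreover have "nu (%_. c) = fun_scale c ?o" by (auto simp: nu_def restr_def fun_scale_def)
  ultimately show ?case using TD(2)[OF A_closed(3) A_closed(3), of c 1] by (simp add: dd_const)
 next
  case (gen l) thus ?case using vecD_lf[OF D gen] by (simp add: dd_lf)
 next
  case (add f g)
  have e: "nu (%x. f x + g x) = nu f + nu g" by (auto simp: nu_def restr_def)
  show ?case unfolding e TD(1)[OF nu_A[OF add(1)] nu_A[OF add(2)]] add(3,4) dd_add[OF add(1,2)] ..
 next
  case (mult f g)
  have e: "nu (%x. f x * g x) = nu f * nu g" by (auto simp: nu_def restr_def)
  have "nu f x = f (\<nu> x)" "nu g x = g (\<nu> x)" using x by (auto simp: nu_def restr_def)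
  thus ?case unfolding e TD(3)[OF nu_A[OF mult(1)] nu_A[OF mult(2)]] mult(3,4) dd_mult[OF mult(1,2)] by simp
 qed
qed

text \<open>A derivation vanishes on the pulled back equations of E0, so its vector is tangent by
  \<open>tangentI\<close>. This vector determines it on all of A, since a conductor element b gives
  a b = P with P polynomial and b z ~= 0.\<close>

lemma tangent_space_DD: assumes z: "z : E" shows "tangent_space A (sec z) = DD z ` Tg z"
proof (intro antisym subsetI)
 fix D assume "D : DD z ` Tg z" thus "D : tangent_space A (sec z)" using DD_derivation[OF z] by auto
next
 fix D assume D: "D : tangent_space A (sec z)"
 note x = sec[OF z]
 let ?v = "vecD D"
 have van: "dd P z ?v = 0" if P: "P : Rg" "!!y. y : E0 ==> P y = 0" for P
 proof -
  have "nu P = nu (%_. 0)" using P(2) \<nu>_E0 by (auto simp: nu_def restr_def)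
  thus ?thesis using D_nu[OF D x(1) P(1)] D_nu[OF D x(1) fa_const[OF fa_Rg, of 0]] x(2) by (simp add: dd_const)
 qed
 have v: "?v : Tg z"
 proof (rule tangentI[OF z], rule eq0I_lf)
  fix y l assume l: "lf l"
  let ?P = "%x. l (br x (br x y) + (2 * B x y) *s x)"
  have "vec_in Rg (%x. br x (br x y) + (2 * B x y) *s x)"
   by (intro vec_in_add[OF fa_Rg] vec_in_br[OF fa_Rg] vec_in_scale[OF fa_Rg] vec_in_id vec_in_const[OF fa_Rg] fa_cmult[OF fa_Rg] lf_Rg[OF B_lf2])
  hence PR: "?P : Rg" using l by (simp add: vec_in_def)
  have "?P y = 0" if "y : E0" for y using E0D[OF that] by (simp add: lfs[OF l])
  hence 0: "dd ?P z ?v = 0" by (rule van[OF PR])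
  have "vder (%t. br (z + t *s ?v) (br (z + t *s ?v) y) + (2 * B (z + t *s ?v) y) *s (z + t *s ?v))
   ((br ?v (br (z + 0 *s ?v) y) + br (z + 0 *s ?v) (br ?v y + br (z + 0 *s ?v) 0)) + ((2 * B ?v y) *s (z + 0 *s ?v) + (2 * B (z + 0 *s ?v) y) *s ?v)) 0"
  proof (intro vder_add vder_br vder_line vder_const vder_scale)
   show "((%t. 2 * B (z + t *s ?v) y) has_field_derivative 2 * B ?v y) (at 0)" by (auto simp: bs intro!: derivative_eq_intros)
  qed
  hence "((%t. ?P (z + t *s ?v)) has_field_derivative l ((br ?v (br z y) + br z (br ?v y)) + ((2 * B ?v y) *s z + (2 * B z y) *s ?v))) (at 0)"
   using l unfolding vder_def by (simp add: brs)
  from DERIV_unique[OF this dd_line[OF PR]] show "l (br ?v (br z y) + br z (br ?v y) + (2 * B ?v y) *s z + (2 * B z y) *s ?v) = 0"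
   using 0 by (simp add: add.assoc)
 qed
 have "D = DD z ?v"
 proof
  fix a
  show "D a = DD z ?v a"
  proof (cases "a : A")
   case False thus ?thesis using D by (simp add: DD_def tangent_space_def)
  next
   case True
   obtain b where b: "b : Cond" "b z ~= 0" using Cond_at[OF z] by blast
   note bR = Cond_Rg[OF b(1)]
   obtain P where P: "P : Rg" "ALL x:X. a x * b (\<nu> x) = P (\<nu> x)" using CondD[OF b(1) A_RA[OF True]] by auto
   have "a * nu b = nu P" using P(2) by (auto simp: nu_def restr_def)
   moreover have "D (a * nu b) = a (sec z) * D (nu b) + nu b (sec z) * D a" using D True nu_A[OF bR] unfolding tangent_space_def by simp
   ultimately have "D (nu P) = a (sec z) * D (nu b) + nu b (sec z) * D a" by simp
   hence e: "dd P z ?v = a (sec z) * dd b z ?v + b z * D a" using D_nu[OF D x(1)] P(1) bR x by (simp add: nu_sec z)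
   have "rep (%z. a (sec z)) b P" by (rule rep_sec[OF bR P])
   from dE_rep[OF sec_Reg[OF A_RA[OF True]] z v this] have "b z * dE (%z. a (sec z)) z ?v = b z * D a" using e by (simp add: algebra_simps)
   thus ?thesis using b(2) True by (simp add: DD_def)
  qed
 qed
 thus "D : DD z ` Tg z" using v by blast
qed

end

section \<open>Krull dimension and smooth points of the normalisation\<close>

locale cover_triple = normal_cover smul Basis br B X A \<nu> + triple smul Basis br B e f
 for smul :: "complex => 'g::ab_group_add => 'g" (infixr "*s" 75)
  and Basis :: "'g set" and br B and X :: "'x set" and A \<nu> e f
begin

lemma krull_ge: "enat rk \<le> krull_dim (zariski X A)"
proof -
 have chv: "vhol (%t. chart e (%i. c i + t * d i)) {t. c 0 + t * d 0 ~= 0}" for c d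
  by (rule chart_vhol[OF _ vhol_const]) (auto intro!: holomorphic_intros)
 interpret coordinate_family "%c. sec (chart e c)" RA rk
 proof
  show "function_algebra RA" by (rule fa_RA)
  show "1 \<le> rk" by (simp add: rk_def)
  show "(%t. a (sec (chart e (%i. c i + t * d i)))) holomorphic_on {t. c 0 + t * d 0 ~= 0}" if "a : RA" for a c d
   by (rule Reg_hol[OF sec_Reg[OF that] connected_nonzero_affine(2) chv]) (simp add: chart_e_E)
  show "EX g:RA. ALL c. c 0 ~= 0 --> g (sec (chart e c)) = c i" if "i < rk" for i by (rule bexI[of _ "%x. B (\<nu> x) (ws ! i)"])
    (use chart_coords[OF slice_e ef _ that] nu_RA[OF coord_Rg] in \<open>auto simp: sec chart_e_E\<close>)
 qed
 show ?thesis by (rule krull_dim_ge[OF zero_loci_RA]) (intro sec(1) chart_e_E)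
qed

lemma krull_le: "krull_dim (zariski X A) \<le> enat rk"
proof -
 let ?pol = "pol X (%i x. B (\<nu> x) (ws ! i)) rk"
 let ?c = "%x. B (\<nu> x) f ^ 7"
 obtain b where b: "b : Cond" "b e ~= 0" using Cond_at[OF eE] by blast
 note bR = Cond_Rg[OF b(1)]
 have xp: "(%x. B (\<nu> x) (ws ! i)) : ?pol 1" if "i < rk" for i by (rule pol_x[OF that])
 have "(%x. B (\<nu> x) f) : ?pol 1" using xp[of 0] by (simp add: rk_def ws_nth)
 hence cp: "?c : ?pol 7" using pol_pow[of _ X _ rk 1 7] by simp
 have cpol: "EX K D. (%x. ?c x ^ Suc K * P (\<nu> x)) : ?pol D" if "P : Rg" for P by (rule coords_pol[OF that \<nu>_E0])
 obtain K D where K: "(%x. ?c x ^ Suc K * b (\<nu> x)) : ?pol D" using cpol[OF bR] by auto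
 define dl0 where "dl0 = (%x. ?c x ^ Suc K * b (\<nu> x))"
 \<comment> \<open>\<open>dl0\<close> contains the conductor element b and is polynomial in the
   coordinates; the additional factor \<open>?c\<close> supplies the powers of B(.,f) that make the
   numerator P polynomial in them as well.\<close>
 define dl where "dl = (%x. ?c x * dl0 x)"
 have dl0: "dl0 : ?pol D" unfolding dl0_def by (rule K)
 have cR: "?c : RA" by (rule fa_pow[OF fa_RA nu_RA[OF coord_Rg]])
 have dlR: "dl : RA" unfolding dl_def dl0_def by (rule fa_mult[OF fa_RA cR fa_mult[OF fa_RA fa_pow[OF fa_RA cR] nu_RA[OF bR]]])
 show ?thesis
 proof (rule krull_dim_upper[OF fa_RA zero_loci_RA dlR, where x = "%i x. B (\<nu> x) (ws ! i)" and d = "7 + D"])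
  show "dl : ?pol (7 + D)" unfolding dl_def by (rule pol_mult[OF cp dl0])
  show "a y = 0" if "a : RA" "!!y. y : X ==> dl y * a y = 0" "y : X" for a y
   by (rule RA_cancel[OF dlR that(1,2) sec(1)[OF eE] _ that(3)]) (simp_all add: dl_def dl0_def sec eE ef b(2))
  fix a assume a: "a : RA"
  obtain P where P: "P : Rg" "ALL x:X. a x * b (\<nu> x) = P (\<nu> x)" using CondD[OF b(1) a] by auto
  obtain K' D' where K': "(%x. ?c x ^ Suc K' * P (\<nu> x)) : ?pol D'" using cpol[OF P(1)] by auto
  have "(%y. dl y ^ Suc (Suc K') * a y) : ?pol (Suc K' * D + (Suc (Suc K) * 7 + D'))"
  proof (rule pol_cong[OF pol_mult[OF pol_pow[OF dl0] pol_mult[OF pol_pow[OF cp] K']]])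
   fix x assume "x : X"
   hence "a x * b (\<nu> x) = P (\<nu> x)" using P(2) by simp
   hence "dl x * a x = ?c x ^ Suc (Suc K) * P (\<nu> x)" by (simp add: dl_def dl0_def ac_simps)
   hence "dl x ^ Suc (Suc K') * a x = dl x ^ Suc K' * (?c x ^ Suc (Suc K) * P (\<nu> x))" unfolding power_Suc2[of "dl x" "Suc K'"] by simp
   also have "dl x ^ Suc K' = ?c x ^ Suc K' * dl0 x ^ Suc K'" unfolding dl_def by (rule power_mult_distrib)
   finally show "dl x ^ Suc (Suc K') * a x = dl0 x ^ Suc K' * (?c x ^ Suc (Suc K) * (?c x ^ Suc K' * P (\<nu> x)))" by simp
  qed
  thus "EX k d. (%y. dl y ^ k * a y) : ?pol d" by blast
 qed
qed

lemma krull: "krull_dim (zariski X A) = enat rk" using krull_ge krull_le by auto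

end

lemma sum_pick: "(k::nat) < n ==> (\<Sum>i<n. (g i :: complex) * (if i = k then 1 else 0)) = g k"
 by (simp add: if_distrib[of "%x. _ * x"] cong: if_cong)

interpretation fs: vector_space fun_scale by (rule vector_space_fun_scale)

context normal_cover begin
lemma DD_sum: assumes z: "z : E" shows "DD z (\<Sum>i\<in>I. c i *s v i) = (\<Sum>i\<in>I. fun_scale (c i) (DD z (v i)))"
proof
 fix a
 show "DD z (\<Sum>i\<in>I. c i *s v i) a = (\<Sum>i\<in>I. fun_scale (c i) (DD z (v i))) a" unfolding sum_function_apply
  by (cases "a : A") (simp_all add: DD_def fun_scale_def lf_sum[OF lf_dE[OF sec_Reg[OF A_RA] z]] lf_scale[OF lf_dE[OF sec_Reg[OF A_RA] z]])
qed
end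

context cover_triple begin

lemma dim_tangent: "fs.dim (tangent_space A (sec e)) = rk"
proof -
 let ?D = "%i. DD e (tb i)" and ?P = "%k x. B x (ws ! k)"
 have tT: "tb i : Tg e" if "i < rk" for i using tb_tangent[OF that] by (auto simp: Tg_def)
 have ev: "?D i (nu (?P k)) = (if i = k then 1 else 0)" if "i < rk" "k < rk" for i k
  by (simp only: DD_nu[OF coord_Rg eE tT[OF that(1)]] dd_lf[OF B_lf2] tb_dual[OF that])
 have inj: "inj_on ?D {..<rk}"
 proof (rule inj_onI)
  fix i j assume ij: "i : {..<rk}" "j : {..<rk}" "?D i = ?D j"
  have "(if i = i then 1 else 0 :: complex) = (if j = i then 1 else 0)"
   using ev[of i i] ev[of j i] ij(1,2) unfolding ij(3) by (simp only: lessThan_iff)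
  thus "i = j" by (simp split: if_splits)
 qed
 have ind: "fs.independent (?D ` {..<rk})"
 proof
  assume "fs.dependent (?D ` {..<rk})"
  then obtain c where s: "(\<Sum>x\<in>?D ` {..<rk}. fun_scale (c x) x) = 0" and c: "EX x:?D ` {..<rk}. c x ~= 0"
   unfolding fs.dependent_finite[OF finite_imageI[OF finite_lessThan]] by auto
  from c obtain k where k: "k < rk" "c (?D k) ~= 0" by auto
  have "c (?D k) = (\<Sum>i<rk. c (?D i) * (if i = k then 1 else 0))" by (rule sum_pick[OF k(1), symmetric])
  also have "\<dots> = (\<Sum>i<rk. fun_scale (c (?D i)) (?D i)) (nu (?P k))"
   unfolding sum_function_apply fun_scale_def by (intro sum.cong refl) (simp only: ev[OF _ k(1)] lessThan_iff)
  also have "\<dots> = (\<Sum>x\<in>?D ` {..<rk}. fun_scale (c x) x) (nu (?P k))" by (simp only: sum.reindex[OF inj] o_def)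
  also have "\<dots> = 0" unfolding s by simp
  finally show False using k(2) by auto
 qed
 have sub: "tangent_space A (sec e) \<subseteq> fs.span (?D ` {..<rk})"
 proof
  fix D assume "D : tangent_space A (sec e)"
  then obtain a where "D = DD e (br a e)" unfolding tangent_space_DD[OF eE] by (auto simp: Tg_def)
  hence "D = DD e (\<Sum>i<rk. B (br a e) (ws ! i) *s tb i)" by (rule trans[OF _ arg_cong[OF tangent_expand]])
  hence "D = (\<Sum>i<rk. fun_scale (B (br a e) (ws ! i)) (?D i))" unfolding DD_sum[OF eE] .
  thus "D : fs.span (?D ` {..<rk})" by (simp only:) (intro fs.span_sum fs.span_scale fs.span_base imageI, assumption)
 qed
 have "?D ` {..<rk} \<subseteq> tangent_space A (sec e)" unfolding tangent_space_DD[OF eE] using tT by auto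
 hence "fs.dim (tangent_space A (sec e)) = card (?D ` {..<rk})" using fs.dim_unique[OF _ sub ind refl] by simp
 thus ?thesis using card_image[OF inj] by simp
qed

end

context normal_cover begin
lemma smooth_sec: assumes z: "z : E" shows "sec z : smooth_locus X A"
proof -
 obtain f where f: "f : E" "B z f = 1" using E_pair[OF z] by blast
 interpret t: cover_triple smul Basis br B X A \<nu> z f by unfold_locales (use z f in auto)
 show ?thesis using t.dim_tangent t.krull sec(1)[OF z] by (simp add: smooth_locus_def)
qed
end

section \<open>The points over the origin\<close>

lemma monic_root_bound:
 assumes "(a::complex) ^ n + (\<Sum>i<n. c i * a ^ i) = 0"
 shows "cmod a \<le> 1 + (\<Sum>i<n. cmod (c i))"
proof (cases "cmod a \<le> 1")
 case True thus ?thesis using sum_nonneg[of "{..<n}" "%i. cmod (c i)"] by simp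
next
 case False
 have n: "n > 0" using assms by (cases n) auto
 have "cmod a ^ n = cmod (\<Sum>i<n. c i * a ^ i)" using assms by (metis add_eq_0_iff norm_minus_cancel norm_power)
 also have "\<dots> \<le> (\<Sum>i<n. cmod (c i) * cmod a ^ (n - 1))"
 proof (rule order.trans[OF norm_sum], rule sum_mono)
  fix i assume "i : {..<n}"
  hence "cmod a ^ i \<le> cmod a ^ (n - 1)" using False by simp
  thus "cmod (c i * a ^ i) \<le> cmod (c i) * cmod a ^ (n - 1)" by (simp add: norm_mult norm_power mult_left_mono)
 qed
 finally have "cmod a ^ (n - 1) * cmod a \<le> cmod a ^ (n - 1) * (\<Sum>i<n. cmod (c i))"
  using power_minus_mult[OF n, of "cmod a"] by (simp add: sum_distrib_right[symmetric] mult.commute)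
 moreover have "0 < cmod a ^ (n - 1)" using False by (intro zero_less_power) linarith
 ultimately show ?thesis by simp
qed

lemma poly_growth: assumes "degree p \<le> N" shows "EX C. ALL t::complex. cmod (poly p t) \<le> C * (1 + cmod t) ^ N"
proof (intro exI allI)
 fix t :: complex
 have "cmod (poly p t) \<le> (\<Sum>i\<le>degree p. cmod (coeff p i) * (1 + cmod t) ^ N)" unfolding poly_altdef
 proof (rule order.trans[OF norm_sum], rule sum_mono)
  fix i assume i: "i : {..degree p}"
  have "cmod t ^ i \<le> (1 + cmod t) ^ i" by (rule power_mono) auto
  also have "\<dots> \<le> (1 + cmod t) ^ N" using i assms by (intro power_increasing) auto
  finally show "cmod (coeff p i * t ^ i) \<le> cmod (coeff p i) * (1 + cmod t) ^ N" by (simp add: norm_mult norm_power mult_left_mono)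
 qed
 thus "cmod (poly p t) \<le> (\<Sum>i\<le>degree p. cmod (coeff p i)) * (1 + cmod t) ^ N" by (simp add: sum_distrib_right)
qed

text \<open>Bounded near 0, so the singularity is removable; polynomial growth at infinity then
  bounds the degree by Liouville's theorem.\<close>

lemma punctured_polynomial:
 assumes f: "f holomorphic_on - {0}" and b: "!!t. t ~= 0 ==> cmod (f t) \<le> C * (1 + cmod t) ^ N"
 shows "EX p. degree p \<le> N & (ALL t. t ~= 0 --> poly p t = f t)"
proof -
 have C: "C \<ge> 0" using order.trans[OF norm_ge_zero b[of 1]] zero_less_power[of "2 :: real" N] by (simp add: zero_le_mult_iff del: zero_less_power)
 have "EX Bs. eventually (%t. cmod (f t) \<le> Bs) (at 0)"
 proof (rule exI, rule eventually_at_ball'[THEN eventually_mono])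
  show "(0::real) < 1" by simp
  fix t :: complex assume t: "t : ball 0 1 & t ~= 0 & t : UNIV"
  have "(1 + cmod t) ^ N \<le> 2 ^ N" using t by (intro power_mono) auto
  thus "cmod (f t) \<le> C * 2 ^ N" using b[of t] t mult_left_mono[OF _ C, of "(1 + cmod t) ^ N" "2 ^ N"] by simp
 qed
 then obtain g where g: "g holomorphic_on UNIV" "!!t. t ~= 0 ==> g t = f t"
  using holomorphic_on_extend_bounded[of f UNIV 0] f by (auto simp: Compl_eq_Diff_UNIV)
 have "g t = (\<Sum>k\<le>N. (deriv ^^ k) g 0 / fact k * t ^ k)" for t
 proof (rule Liouville_polynomial[OF g(1), of 1 "C * 2 ^ N"])
  fix z :: complex assume z: "1 \<le> cmod z"
  have "(1 + cmod z) ^ N \<le> (2 * cmod z) ^ N" using z by (intro power_mono) auto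
  hence "C * (1 + cmod z) ^ N \<le> C * 2 ^ N * cmod z ^ N" using C by (simp add: mult_left_mono mult.assoc)
  moreover have "z ~= 0" using z by auto
  ultimately show "cmod (g z) \<le> C * 2 ^ N * cmod z ^ N" using b[of z] g(2)[of z] by simp
 qed
 hence v: "poly (\<Sum>k\<le>N. monom ((deriv ^^ k) g 0 / fact k) k) t = g t" for t by (simp add: poly_sum poly_monom)
 have dg: "degree (\<Sum>k\<le>N. monom ((deriv ^^ k) g 0 / fact k) k) \<le> N"
  by (rule degree_sum_le) (auto intro: order.trans[OF degree_monom_le])
 show ?thesis by (intro exI conjI allI impI) (rule dg, simp only: v, erule g(2))
qed

lemma poly_eqI_punctured: assumes "!!t. t ~= 0 ==> poly p t = poly q (t::complex)" shows "p = q"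
proof (rule ccontr)
 assume "p ~= q"
 hence "finite {t. poly (p - q) t = 0}" by (intro poly_roots_finite) simp
 moreover have "- {0} \<subseteq> {t. poly (p - q) t = 0}" using assms by auto
 ultimately have "finite (- {0::complex})" by (rule rev_finite_subset)
 hence "finite (UNIV :: complex set)" by simp
 thus False using infinite_UNIV_char_0 by blast
qed

section \<open>Restriction of functions to rays\<close>

context lie_alg begin

text \<open>The coefficients in t are the homogeneous components of P, again polynomials in z; for z
  = 0 only the constant P 0 is left.\<close>

lemma Rg_ray_poly: assumes "P : Rg"
 shows "EX q N. polyR Rg q & (ALL z t. poly (q z) t = P (t *s z)) & (ALL z. degree (q z) \<le> N) & q 0 = [:P 0:]" using assms
proof (induction rule: Rg_induct)
 case (const c)
 show ?case by (rule exI[of _ "%_. [:c:]"], rule exI[of _ 0]) (simp add: polyR_fixed[OF fa_Rg])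
next
 case (gen l)
 show ?case
  by (rule exI[of _ "%z. [:0, 1:] * [:l z:]"], rule exI[of _ 1], intro conjI polyR_mult[OF fa_Rg] polyR_fixed[OF fa_Rg] polyR_const[OF fa_Rg] lf_Rg[OF gen])
   (auto simp: lfs[OF gen])
next
 case (add f g)
 from add(3) obtain q N where q: "polyR Rg q" "!!z t. poly (q z) t = f (t *s z)" "!!z. degree (q z) \<le> N" "q 0 = [:f 0:]" by blast
 from add(4) obtain q' N' where q': "polyR Rg q'" "!!z t. poly (q' z) t = g (t *s z)" "!!z. degree (q' z) \<le> N'" "q' 0 = [:g 0:]" by blast
 show ?case
 proof (rule exI[of _ "%z. q z + q' z"], rule exI[of _ "max N N'"], intro conjI allI polyR_add[OF fa_Rg] q(1) q'(1))
  show "degree (q z + q' z) \<le> max N N'" for z using q(3)[of z] q'(3)[of z] by (intro degree_add_le) auto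
 qed (simp_all add: q q')
next
 case (mult f g)
 from mult(3) obtain q N where q: "polyR Rg q" "!!z t. poly (q z) t = f (t *s z)" "!!z. degree (q z) \<le> N" "q 0 = [:f 0:]" by blast
 from mult(4) obtain q' N' where q': "polyR Rg q'" "!!z t. poly (q' z) t = g (t *s z)" "!!z. degree (q' z) \<le> N'" "q' 0 = [:g 0:]" by blast
 show ?case
 proof (rule exI[of _ "%z. q z * q' z"], rule exI[of _ "N + N'"], intro conjI allI polyR_mult[OF fa_Rg] q(1) q'(1))
  show "degree (q z * q' z) \<le> N + N'" for z using degree_mult_le[of "q z" "q' z"] q(3)[of z] q'(3)[of z] by simp
 qed (simp_all add: q q')
qed
end

context lie_alg begin
lemma dual_card:
 assumes l: "!!k. lf (l k)" and d: "!!i k. i < n ==> k < n ==> l k (w i) = (if i = k then 1 else 0)"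
  and T: "finite T" "span T = UNIV"
 shows "n \<le> card (T :: 'g set)"
proof -
 have inj: "inj_on w {..<n}"
 proof (rule inj_onI)
  fix i j assume ij: "i : {..<n}" "j : {..<n}" "w i = w j"
  have "l i (w i) = l i (w j)" using ij(3) by simp
  thus "i = j" using d[of i i] d[of j i] ij(1,2) by (simp split: if_splits)
 qed
 have "independent (w ` {..<n})"
 proof
  assume "dependent (w ` {..<n})"
  then obtain c where s: "(\<Sum>x\<in>w ` {..<n}. c x *s x) = 0" and c: "EX x:w ` {..<n}. c x ~= 0"
   unfolding dependent_finite[OF finite_imageI[OF finite_lessThan]] by auto
  from c obtain k where k: "k < n" "c (w k) ~= 0" by auto
  have "c (w k) = (\<Sum>i<n. c (w i) * (if i = k then 1 else 0))" by (rule sum_pick[OF k(1), symmetric])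
  also have "\<dots> = (\<Sum>i<n. c (w i) * l k (w i))" by (rule sum.cong) (simp_all add: d k(1))
  also have "\<dots> = l k (\<Sum>x\<in>w ` {..<n}. c x *s x)" by (simp only: sum.reindex[OF inj] o_def lf_sum[OF l] lf_scale[OF l])
  also have "\<dots> = 0" unfolding s by (rule lf_0[OF l])
  finally show False using k(2) by auto
 qed
 hence "card (w ` {..<n}) \<le> card T" using independent_span_bound[OF T(1)] T(2) by blast
 thus ?thesis using card_image[OF inj] by simp
qed
end

context normal_cover begin

lemma ray_hol: assumes a: "a : RA" and z: "z : E" shows "(%t. a (sec (t *s z))) holomorphic_on - {0}"
proof (rule Reg_hol[OF sec_Reg[OF a]])
 show "vhol (%t. t *s z) (- {0})" by (intro vhol_scale vhol_const holomorphic_intros)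
qed (auto intro: E_scale z)

text \<open>A monic equation with polynomial coefficients bounds a along the ray by a multiple of a
  power of 1 + |t|, with exponent independent of z.\<close>

lemma ray_poly: assumes a: "a : RA"
 shows "EX N. ALL z:E. EX p. degree p \<le> N & (ALL t. t ~= 0 --> poly p t = a (sec (t *s z)))"
proof -
 obtain n c where c: "!!i. c i : Rg" "ALL x:X. a x ^ n + (\<Sum>i<n. c i (\<nu> x) * a x ^ i) = 0" using integral[OF a] by blast
 have "ALL i. EX q N. (ALL z t. poly (q z) t = c i (t *s z)) & (ALL z. degree (q z) \<le> N)" using Rg_ray_poly[OF c(1)] by blast
 from choice[OF this] obtain q where "ALL i. EX N. (ALL z t. poly (q i z) t = c i (t *s z)) & (ALL z. degree (q i z) \<le> N)" by auto
 from choice[OF this] obtain M where q: "!!i z t. poly (q i z) t = c i (t *s z)" "!!i z. degree (q i z) \<le> M i" by blast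
 define N where "N = (\<Sum>i<n. M i)"
 have MN: "degree (q i z) \<le> N" if "i < n" for i z using q(2)[of i z] member_le_sum[of i "{..<n}" M] that unfolding N_def by simp
 show ?thesis
 proof (intro exI[of _ N] ballI)
  fix z assume z: "z : E"
  have "ALL i:{..<n}. EX C. ALL t. cmod (poly (q i z) t) \<le> C * (1 + cmod t) ^ N" using poly_growth[OF MN] by auto
  then obtain C where C: "!!i t. i < n ==> cmod (c i (t *s z)) \<le> C i * (1 + cmod t) ^ N" by (drule_tac bchoice) (auto simp: q)
  show "EX p. degree p \<le> N & (ALL t. t ~= 0 --> poly p t = a (sec (t *s z)))"
  proof (rule punctured_polynomial[OF ray_hol[OF a z]])
   fix t :: complex assume t: "t ~= 0"
   have x: "sec (t *s z) : X" "\<nu> (sec (t *s z)) = t *s z" using sec E_scale[OF z t] by auto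
   have "cmod (a (sec (t *s z))) \<le> 1 + (\<Sum>i<n. cmod (c i (t *s z)))"
    using monic_root_bound[of "a (sec (t *s z))" n "%i. c i (t *s z)"] bspec[OF c(2) x(1)] x(2) by simp
   also have "\<dots> \<le> (1 + cmod t) ^ N + (\<Sum>i<n. C i * (1 + cmod t) ^ N)" by (intro add_mono sum_mono C one_le_power) auto
   finally show "cmod (a (sec (t *s z))) \<le> (1 + (\<Sum>i<n. C i)) * (1 + cmod t) ^ N" by (simp add: distrib_right sum_distrib_right)
  qed
 qed
qed

definition homog :: "nat => ('x => complex) => bool" where
 "homog k a \<longleftrightarrow> a : RA & (ALL z:E. ALL t. t ~= 0 --> a (sec (t *s z)) = t ^ k * a (sec z))"

text \<open>Extract the coefficient of t^(k n) from the monic equation along rays. The result is a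
  monic equation for a whose lower coefficients are homogeneous of positive degree and so vanish at
  the origin.\<close>

lemma homog_over_0: assumes a: "homog k a" and k: "k \<ge> 1" and p: "p : X" "\<nu> p = 0" shows "a p = 0"
proof -
 have aR: "a : RA" using a by (simp add: homog_def)
 obtain n c where n: "n > 0" and c: "!!i. c i : Rg" "ALL x:X. a x ^ n + (\<Sum>i<n. c i (\<nu> x) * a x ^ i) = 0" using integral[OF aR] by blast
 have "ALL i. EX q. polyR Rg q & (ALL z t. poly (q z) t = c i (t *s z)) & q 0 = [:c i 0:]" using Rg_ray_poly[OF c(1)] by blast
 from choice[OF this] obtain q where q: "!!i. polyR Rg (q i)" "!!i z t. poly (q i z) t = c i (t *s z)" "!!i. q i 0 = [:c i 0:]" by blast
 let ?C = "%i y. coeff (q i y) (k * n - k * i)"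
 have CR: "?C i : Rg" for i using q(1) by (simp add: polyR_def)
 have "a (sec z) ^ n + (\<Sum>i<n. ?C i (\<nu> (sec z)) * a (sec z) ^ i) = 0" if z: "z : E" for z
 proof -
  let ?\<alpha> = "a (sec z)"
  let ?F = "monom (?\<alpha> ^ n) (k * n) + (\<Sum>i<n. monom (?\<alpha> ^ i) (k * i) * q i z)"
  have "?F = 0"
  proof (rule poly_eqI_punctured)
   fix t :: complex assume t: "t ~= 0"
   have x: "sec (t *s z) : X" "\<nu> (sec (t *s z)) = t *s z" using sec E_scale[OF z t] by auto
   have at: "a (sec (t *s z)) = t ^ k * ?\<alpha>" using a z t by (simp add: homog_def)
   have "poly ?F t = a (sec (t *s z)) ^ n + (\<Sum>i<n. c i (t *s z) * a (sec (t *s z)) ^ i)"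
    by (simp add: poly_monom poly_sum q at power_mult[symmetric] power_mult_distrib ac_simps)
   thus "poly ?F t = poly 0 t" using bspec[OF c(2) x(1)] x(2) by simp
  qed
  hence "coeff ?F (k * n) = 0" by auto
  thus ?thesis unfolding coeff_add coeff_sum coeff_monom_mult coeff_monom sec(2)[OF z] by (simp add: mult.commute)
 qed
 hence "a p ^ n + (\<Sum>i<n. ?C i (\<nu> p) * a p ^ i) = 0"
  by (intro RA_zero[where a = "%x. a x ^ n + (\<Sum>i<n. ?C i (\<nu> x) * a x ^ i)", OF _ _ p(1)] fa_add[OF fa_RA] fa_sum[OF fa_RA] fa_mult[OF fa_RA] fa_pow[OF fa_RA] aR nu_RA[OF CR])
 moreover have "?C i (\<nu> p) = 0" if "i < n" for i
 proof -
  have "k * n - k * i ~= 0" using k that by simp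
  then obtain j where j: "k * n - k * i = Suc j" using not0_implies_Suc by blast
  show ?thesis unfolding p(2) q(3) j by simp
 qed
 ultimately have "a p ^ n = 0" by simp
 thus ?thesis by auto
qed

text \<open>Along a ray a is constant, so its monic equation may be evaluated at t = 0 and bounds a
  uniformly on E. Entire paths in the group and Liouville's theorem make a constant.\<close>

lemma homog_0_const: assumes a: "homog 0 a" and x: "x : X" "y : X" shows "a x = a y"
proof -
 have aR: "a : RA" using a by (simp add: homog_def)
 obtain n c where n: "n > 0" and c: "!!i. c i : Rg" "ALL x:X. a x ^ n + (\<Sum>i<n. c i (\<nu> x) * a x ^ i) = 0" using integral[OF aR] by blast
 have bound: "cmod (a (sec z)) \<le> 1 + (\<Sum>i<n. cmod (c i 0))" if z: "z : E" for z
 proof -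
  have "ALL i. EX q. ALL t. poly q t = c i (t *s z)" using Rg_ray_poly[OF c(1)] by blast
  from choice[OF this] obtain q where q: "!!i t. poly (q i) t = c i (t *s z)" by blast
  let ?F = "[:a (sec z) ^ n:] + (\<Sum>i<n. q i * [:a (sec z) ^ i:])"
  have "?F = 0"
  proof (rule poly_eqI_punctured)
   fix t :: complex assume t: "t ~= 0"
   have x: "sec (t *s z) : X" "\<nu> (sec (t *s z)) = t *s z" using sec E_scale[OF z t] by auto
   have at: "a (sec (t *s z)) = a (sec z)" using a z t by (simp add: homog_def)
   thus "poly ?F t = poly 0 t" using bspec[OF c(2) x(1)] x(2) by (simp add: poly_sum q mult.commute)
  qed
  hence "poly ?F 0 = 0" by simp
  thus ?thesis by (intro monic_root_bound) (simp add: poly_sum q mult.commute)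
 qed
 have const: "a (sec z) = a (sec z')" if z: "z : E" "z' : E" for z z'
 proof -
  obtain u where u: "u : Gr" "z' = u z" using E_transitive[OF z] by blast
  obtain U where U: "!!x. U 0 x = x" "!!x. U 1 x = u x" "!!t. U t : Gr" "!!x. vhol (%t. U t x) UNIV" using Gr_path[OF u(1)] by blast
  have "(%t. a (sec (U t z))) holomorphic_on UNIV" by (rule Reg_hol[OF sec_Reg[OF aR] open_UNIV U(4)]) (rule E_Gr[OF U(3) z(1)])
  moreover have "bounded (range (%t. a (sec (U t z))))" by (rule boundedI, erule rangeE, hypsubst) (rule bound[OF E_Gr[OF U(3) z(1)]])
  ultimately have "(%t. a (sec (U t z))) constant_on UNIV" by (rule Liouville_theorem)
  hence "a (sec (U 0 z)) = a (sec (U 1 z))" unfolding constant_on_def by auto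
  thus ?thesis using U u by simp
 qed
 obtain z0 where z0: "z0 : E" using Cond_exists by blast
 have "a w - a (sec z0) = 0" if "w : X" for w
  by (rule RA_zero[where a = "%x. a x - a (sec z0)", OF _ _ that]) (use const[OF _ z0] in \<open>auto intro: fa_diff[OF fa_RA aR] fa_const[OF fa_RA]\<close>)
 thus ?thesis using x by simp
qed

end

section \<open>Homogeneous components and derivations over the origin\<close>

locale cover_action = normal_cover smul Basis br B X A \<nu>
 for smul :: "complex => 'g::ab_group_add => 'g" (infixr "*s" 75)
  and Basis :: "'g set" and br B and X :: "'x set" and A \<nu> +
 fixes \<phi> :: "complex => 'x => 'x"
 assumes action: "induced_scaling_action smul X A \<nu> \<phi>"
begin

lemma \<phi>_X: "t ~= 0 ==> x : X ==> \<phi> t x : X" and \<phi>_A: "t ~= 0 ==> a : A ==> pullback X (\<phi> t) a : A"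
 and \<nu>_\<phi>: "t ~= 0 ==> x : X ==> \<nu> (\<phi> t x) = t *s \<nu> x"
 using action unfolding induced_scaling_action_def variety_morphism_def by blast+
lemma \<phi>_RA: assumes "t ~= 0" "a : RA" shows "(%x. a (\<phi> t x)) : RA"
proof -
 have "pullback X (\<phi> t) (restr X a) = restr X (%x. a (\<phi> t x))"
  using \<phi>_X[OF assms(1)] by (auto simp: pullback_def restr_def)
 thus ?thesis using \<phi>_A[OF assms(1) RA_restr[OF assms(2)]] by (simp add: RA_def)
qed
lemma \<phi>_sec: assumes "t ~= 0" "z : E" shows "\<phi> t (sec z) = sec (t *s z)"
proof -
 have e: "\<nu> (\<phi> t (sec z)) = t *s z" using \<nu>_\<phi>[OF assms(1) sec(1)[OF assms(2)]] unfolding sec(2)[OF assms(2)] .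
 show ?thesis using sec_\<nu>[OF \<phi>_X[OF assms(1) sec(1)[OF assms(2)]]] E_scale[OF assms(2,1)] unfolding e by simp
qed

text \<open>The pullback along the dilation by \<open>2\<close> separates the degrees along rays, so the homogeneous
 components of a regular function are regular.\<close>

lemma homog_decomposition:
 assumes "a : RA" "ALL z:E. EX p. degree p \<le> N & (ALL t. t ~= 0 --> poly p t = a (sec (t *s z)))"
 shows "EX H. (ALL k. homog k (H k)) & (ALL x:X. a x = (\<Sum>k\<le>N. H k x))" using assms
proof (induction N arbitrary: a)
 case 0
 have "a (sec (t *s z)) = a (sec z)" if z: "z : E" and t: "t ~= 0" for z t
 proof -
  obtain p where p: "degree p \<le> 0" "ALL t. t ~= 0 --> poly p t = a (sec (t *s z))" using bspec[OF 0(2) z] by auto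
  have "degree p = 0" using p(1) by simp
  then obtain c where c: "p = [:c:]" by (rule degree_eq_zeroE)
  have "poly p t = a (sec (t *s z))" "poly p 1 = a (sec (1 *s z))" using p(2) t by auto
  thus ?thesis unfolding c by simp
 qed
 hence "homog 0 a" unfolding homog_def using 0(1) by simp
 moreover have "homog k (%_. 0)" for k by (simp add: homog_def fa_const[OF fa_RA])
 ultimately show ?case by (intro exI[of _ "%k. if k = 0 then a else (%_. 0)"]) auto
next
 case (Suc N)
 \<comment> \<open>This kills the component of degree N + 1 and multiplies the one of degree k by
   2^k - 2^(N+1), which is undone in \<open>H0\<close>.\<close>
 define a' where "a' x = a (\<phi> 2 x) - 2 ^ Suc N * a x" for x
 have a'R: "a' : RA" unfolding a'_def by (intro fa_diff[OF fa_RA] fa_cmult[OF fa_RA] \<phi>_RA Suc.prems(1)) simp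
 have a'sec: "a' (sec z) = a (sec (2 *s z)) - 2 ^ Suc N * a (sec z)" if "z : E" for z using that by (simp add: a'_def \<phi>_sec)
 from bchoice[OF Suc.prems(2)] obtain p where p0: "ALL z:E. degree (p z) \<le> Suc N & (ALL t. t ~= 0 --> poly (p z) t = a (sec (t *s z)))"
  by auto
 have p: "degree (p z) \<le> Suc N" "t ~= 0 ==> poly (p z) t = a (sec (t *s z))" if "z : E" for z t using bspec[OF p0 that] by auto
 let ?p' = "%z. pcompose (p z) [:0, 2:] - [:2 ^ Suc N:] * p z"
 have cp': "coeff (?p' z) k = (2 ^ k - 2 ^ Suc N) * coeff (p z) k" for z k by (simp add: coeff_pcompose_linear algebra_simps)
 have p't: "poly (?p' z) t = a' (sec (t *s z))" if "z : E" "t ~= 0" for z t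
  using a'sec[OF E_scale[OF that]] p(2)[OF that] p(2)[OF that(1), of "2 * t"] that by (simp add: poly_pcompose mult.commute)
 have p'd: "degree (?p' z) \<le> N" if z: "z : E" for z
 proof (rule degree_le, intro allI impI)
  fix i assume "N < i"
  hence "i = Suc N \<or> degree (p z) < i" using p(1)[OF z] by auto
  thus "coeff (?p' z) i = 0" unfolding cp' by (auto simp: coeff_eq_0)
 qed
 have "ALL z:E. EX p. degree p \<le> N & (ALL t. t ~= 0 --> poly p t = a' (sec (t *s z)))"
  by (intro ballI exI conjI allI impI) (rule p'd, assumption, rule p't)
 from Suc.IH[OF a'R this] obtain H' where H'0: "ALL k. homog k (H' k)" "ALL x:X. a' x = (\<Sum>k\<le>N. H' k x)"
  by auto
 note H' = H'0(1)[THEN spec] H'0(2)[THEN bspec]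
 have H'c: "H' k (sec z) = (2 ^ k - 2 ^ Suc N) * coeff (p z) k" if z: "z : E" and k: "k \<le> N" for z k
 proof -
  have "?p' z = (\<Sum>k\<le>N. monom (H' k (sec z)) k)"
  proof (rule poly_eqI_punctured)
   fix t :: complex assume t: "t ~= 0"
   have "poly (?p' z) t = (\<Sum>k\<le>N. H' k (sec (t *s z)))" using p't[OF z t] H'(2)[OF sec(1)[OF E_scale[OF z t]]] by simp
   also have "\<dots> = poly (\<Sum>k\<le>N. monom (H' k (sec z)) k) t"
    using H'(1) z t by (simp add: poly_sum poly_monom homog_def mult.commute)
   finally show "poly (?p' z) t = poly (\<Sum>k\<le>N. monom (H' k (sec z)) k) t" .
  qed
  hence "coeff (?p' z) k = H' k (sec z)" using k by (simp add: coeff_sum)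
  thus ?thesis unfolding cp' by simp
 qed
 define H0 where "H0 k x = 1 / (2 ^ k - 2 ^ Suc N) * H' k x" for k x
 have pw: "(2::complex) ^ k - 2 ^ Suc N ~= 0" if "k \<le> N" for k
 proof
  assume "(2::complex) ^ k - 2 ^ Suc N = 0"
  hence "complex_of_nat (2 ^ k) = complex_of_nat (2 ^ Suc N)" by simp
  hence "(2::nat) ^ k = 2 ^ Suc N" by (simp only: of_nat_eq_iff)
  thus False using that by (simp only: power_inject_exp)
 qed
 have H0: "homog k (H0 k)" for k
  using H'(1)[of k] fa_cmult[OF fa_RA, of "H' k" "1 / (2 ^ k - 2 ^ Suc N)"] unfolding H0_def[abs_def] by (simp add: homog_def)
 have H0c: "H0 k (sec z) = coeff (p z) k" if "z : E" "k \<le> N" for z k using H'c[OF that] pw[OF that(2)] by (simp add: H0_def)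
 define H1 where "H1 x = a x - (\<Sum>k\<le>N. H0 k x)" for x
 have H1R: "H1 : RA" unfolding H1_def by (intro fa_diff[OF fa_RA] fa_sum[OF fa_RA] Suc.prems(1)) (use H0 in \<open>simp add: homog_def\<close>)
 have H1t: "H1 (sec (t *s z)) = t ^ Suc N * coeff (p z) (Suc N)" if z: "z : E" "t ~= 0" for z t
 proof -
  have "H1 (sec (t *s z)) = poly (p z) t - (\<Sum>k\<le>N. coeff (p z) k * t ^ k)"
   using H0 z p(2)[OF z] by (simp add: H1_def homog_def H0c mult.commute)
  also have "poly (p z) t = poly (\<Sum>k\<le>Suc N. monom (coeff (p z) k) k) t" by (simp only: poly_as_sum_of_monoms'[OF p(1)[OF z(1)]])
  also have "\<dots> = (\<Sum>k\<le>Suc N. coeff (p z) k * t ^ k)" by (simp only: poly_sum poly_monom)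
  finally show ?thesis by simp
 qed
 have "H1 (sec (t *s z)) = t ^ Suc N * H1 (sec z)" if z: "z : E" "t ~= 0" for z t using H1t[OF z(1), of 1] unfolding H1t[OF z] by simp
 hence "homog (Suc N) H1" unfolding homog_def using H1R by blast
 thus ?case using H0 by (intro exI[of _ "%k. if k = Suc N then H1 else H0 k"]) (auto simp: H1_def)
qed

text \<open>Of the homogeneous components only the one of degree 0 survives over the origin, and it
  is constant on X.\<close>

lemma ray_value: assumes a: "a : RA" and z: "z : E" and p: "p : X" "\<nu> p = 0"
 shows "EX q. poly q 0 = a p & (ALL t. t ~= 0 --> poly q t = a (sec (t *s z)))"
proof -
 obtain N where N: "ALL z:E. EX p. degree p \<le> N & (ALL t. t ~= 0 --> poly p t = a (sec (t *s z)))" using ray_poly[OF a] by auto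
 obtain H where H0: "ALL k. homog k (H k)" "ALL x:X. a x = (\<Sum>k\<le>N. H k x)" using homog_decomposition[OF a N] by auto
 note H = H0(1)[THEN spec] H0(2)[THEN bspec]
 let ?q = "\<Sum>k\<le>N. monom (H k (sec z)) k"
 have "a p = (\<Sum>k\<le>N. if k = 0 then H 0 p else 0)" unfolding H(2)[OF p(1)]
  by (rule sum.cong) (use homog_over_0[OF H(1) _ p] in auto)
 also have "\<dots> = H 0 (sec z)" using homog_0_const[OF H(1) p(1) sec(1)[OF z]] by simp
 finally have 1: "a p = H 0 (sec z)" .
 have "poly ?q 0 = (\<Sum>k\<le>N. if k = 0 then H 0 (sec z) else 0)" unfolding poly_sum poly_monom by simp
 hence "poly ?q 0 = a p" using 1 by simp
 moreover have "poly ?q t = a (sec (t *s z))" if t: "t ~= 0" for t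
  using H(2)[OF sec(1)[OF E_scale[OF z t]]] H(1) z t by (simp add: poly_sum poly_monom homog_def mult.commute)
 ultimately show ?thesis by auto
qed

text \<open>Take the coefficient of t in the polynomial of a along the ray of z; the product rule at
  p follows from the constant coefficient being a p.\<close>

lemma ray_derivation: assumes z: "z : E" and p: "p : X" "\<nu> p = 0"
 shows "EX D:tangent_space A p. vecD D = z"
proof -
 have "ALL a:RA. EX q. poly q 0 = a p & (ALL t. t ~= 0 --> poly q t = a (sec (t *s z)))" using ray_value[OF _ z p] by simp
 from bchoice[OF this] obtain Q where Q0: "ALL a:RA. poly (Q a) 0 = a p & (ALL t. t ~= 0 --> poly (Q a) t = a (sec (t *s z)))" by auto
 have Q: "poly (Q a) 0 = a p" "t ~= 0 ==> poly (Q a) t = a (sec (t *s z))" if "a : RA" for a t using bspec[OF Q0 that] by auto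
 have Qc: "coeff (Q a) 0 = a p" if "a : RA" for a using Q(1)[OF that] by (simp add: poly_0_coeff_0)
 have Qu: "Q a = q" if "a : RA" "!!t. t ~= 0 ==> poly q t = a (sec (t *s z))" for a q
  by (rule poly_eqI_punctured) (rule trans[OF Q(2)[OF that(1)] that(2)[symmetric]])
 define D where "D a = (if a : A then coeff (Q a) 1 else 0)" for a
 have "D : tangent_space A p" unfolding tangent_space_def
 proof (intro CollectI conjI allI ballI impI)
  show "D a = 0" if "a ~: A" for a using that by (simp add: D_def)
  fix a assume a: "a : A"
  show "D (fun_scale c a) = c * D a" for c
  proof -
   have "Q (fun_scale c a) = [:c:] * Q a" by (rule Qu[OF A_RA[OF A_closed(4)[OF a]]]) (simp add: fun_scale_def Q(2)[OF A_RA[OF a]])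
   thus ?thesis using a A_closed(4)[OF a, of c] by (simp add: D_def)
  qed
  fix b assume b: "b : A"
  have "Q (a + b) = Q a + Q b" by (rule Qu[OF A_RA[OF A_closed(1)[OF a b]]]) (simp add: Q(2)[OF A_RA[OF a]] Q(2)[OF A_RA[OF b]])
  thus "D (a + b) = D a + D b" unfolding D_def using a b A_closed(1)[OF a b] by auto
  have "Q (a * b) = Q a * Q b" by (rule Qu[OF A_RA[OF A_closed(2)[OF a b]]]) (simp add: Q(2)[OF A_RA[OF a]] Q(2)[OF A_RA[OF b]])
  moreover have "coeff (Q a * Q b) 1 = a p * coeff (Q b) 1 + b p * coeff (Q a) 1"
   by (simp add: coeff_mult Qc[OF A_RA[OF a]] Qc[OF A_RA[OF b]])
  ultimately show "D (a * b) = a p * D b + b p * D a" unfolding D_def using a b A_closed(2)[OF a b] by auto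
 qed
 moreover have "vecD D = z"
 proof (rule eqI_lf)
  fix l assume l: "lf l"
  have "Q (nu l) = [:0, l z:]" by (rule Qu[OF A_RA[OF nu_A[OF lf_Rg[OF l]]]]) (simp add: nu_sec[OF E_scale[OF z]] lf_scale[OF l])
  hence "D (nu l) = l z" using nu_A[OF lf_Rg[OF l]] by (simp add: D_def)
  thus "l (vecD D) = l z" using vecD_lf[OF calculation l] by simp
 qed
 ultimately show ?thesis by auto
qed

lemma vecD_span: assumes "D : fs.span S" shows "vecD D : span (vecD ` S)" using assms
proof (induction rule: fs.span_induct_alt)
 case base
 show ?case by (simp add: vecD_def span_zero)
next
 case (step c x y)
 have "vecD (fun_scale c x + y) = c *s vecD x + vecD y"
  by (simp add: vecD_def fun_scale_def scale_left_distrib sum.distrib scale_sum_right)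
 thus ?case using span_add[OF span_scale[OF span_base[OF imageI[OF step(1)]]] step(2)] by (simp only:)
qed

text \<open>Over the origin the ray derivations realise every z in E, and E spans g; so the tangent
  space has dimension at least dim g. Since dim g > rk, the point is not smooth.\<close>

lemma smooth_over_E: assumes "p : smooth_locus X A" shows "\<nu> p : E"
proof (rule ccontr)
 assume nE: "\<nu> p ~: E"
 have p: "p : X" and d: "enat (fs.dim (tangent_space A p)) = krull_dim (zariski X A)" using assms by (auto simp: smooth_locus_def)
 hence p0: "\<nu> p = 0" using nE \<nu>_E0 by (auto simp: E_def)
 obtain e where e: "e : E" using Cond_exists by blast
 obtain f where f: "f : E" "B e f = 1" using E_pair[OF e] by blast
 interpret t: cover_triple smul Basis br B X A \<nu> e f by unfold_locales (use e f in auto)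
 let ?T = "tangent_space A p"
 have dT: "fs.dim ?T = t.rk" using d t.krull by simp
 obtain S where S: "S \<subseteq> ?T" "fs.independent S" "?T \<subseteq> fs.span S" "card S = fs.dim ?T" by (rule fs.basis_exists)
 have cS: "card S = t.rk" using S(4) dT by simp
 hence fS: "finite S" by (intro card_ge_0_finite) (simp add: t.rk_def)
 have "E \<subseteq> span (vecD ` S)"
 proof
  fix z assume "z : E"
  then obtain D where D: "D : ?T" "vecD D = z" using ray_derivation[OF _ p p0] by blast
  show "z : span (vecD ` S)" using vecD_span[of D S] D S(3) by blast
 qed
 hence "span E \<subseteq> span (vecD ` S)" by (rule span_minimal) (rule subspace_span)
 hence sp: "span (vecD ` S) = UNIV" using E_spans by blast
 have tbe: "B (t.tb i) e = 0" if i: "i < t.rk" for i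
 proof -
  obtain a where a: "t.tb i = br a e" using t.tb_tangent[OF i] by auto
  have "B (br a e) e = - B (br e a) e" by (subst anti[of e a]) (simp add: bs)
  also have "B (br e a) e = 0" unfolding B_inv2 by (simp add: bs alternating)
  finally show ?thesis unfolding a by simp
 qed
 \<comment> \<open>u is f stripped of its coordinates. All \<open>t.tb i\<close> are orthogonal to e
   while B u e = 1, which gives rk + 1 independent vectors in g.\<close>
 define u where "u = f - (\<Sum>k<t.rk. B f (t.ws ! k) *s t.tb k)"
 have ue: "B u e = 1" using f by (simp add: u_def bs lf_sum[OF B_lf2] tbe B_sym[of f e])
 have uw: "B u (t.ws ! k) = 0" if "k < t.rk" for k
  unfolding u_def by (simp add: bs lf_sum[OF B_lf2] t.tb_dual that if_distrib[of "%x. _ * x"] cong: if_cong)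
 have "Suc t.rk \<le> card (vecD ` S)"
 proof (rule dual_card[where w = "%i. if i < t.rk then t.tb i else u" and l = "%k x. if k < t.rk then B x (t.ws ! k) else B x e"])
  show "lf (%x. if k < t.rk then B x (t.ws ! k) else B x e)" for k by (cases "k < t.rk") (simp_all add: B_lf2)
  fix i k assume "i < Suc t.rk" "k < Suc t.rk"
  then consider "i < t.rk" "k < t.rk" | "i < t.rk" "k = t.rk" | "i = t.rk" "k < t.rk" | "i = t.rk" "k = t.rk" by linarith
  thus "(if k < t.rk then B (if i < t.rk then t.tb i else u) (t.ws ! k) else B (if i < t.rk then t.tb i else u) e) = (if i = k then 1 else 0)"
   by cases (simp_all add: t.tb_dual tbe ue uw)
 qed (use fS sp in simp_all)
 thus False using card_image_le[OF fS, of vecD] cS by simp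
qed

end

section \<open>Two-forms on the normalisation\<close>

lemma three_term:
 fixes A :: complex
 assumes "X + Y = - 2 * A - 2 * Bs" "Y = 2 * D + X" "Y = - V"
 shows "A = V - Bs + D"
proof -
 have "X = - V - 2 * D" using assms(2,3) by simp
 hence "- V - 2 * D + - V = - 2 * A - 2 * Bs" using assms(1,3) by auto
 hence "2 * A = 2 * (V - Bs + D)" by (simp add: algebra_simps)
 thus ?thesis by (simp only: mult_cancel_left) simp
qed
lemma cancel_square:
 fixes Bs :: complex
 assumes "Bs\<^sup>2 * k = Bs\<^sup>2 * S + Bs * (n1 + n2 + n3)" "Bs ~= 0"
 shows "k = S + n1 / Bs + n2 / Bs + n3 / Bs"
proof -
 have "Bs\<^sup>2 * k = Bs\<^sup>2 * (S + n1 / Bs + n2 / Bs + n3 / Bs)" using assms(2) unfolding assms(1) by (simp add: field_simps power2_eq_square)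
 thus ?thesis using assms(2) by simp
qed
lemma koszul_arith:
 fixes Bs :: complex
 assumes "E1 + E2 + E3 + e1 + e2 + e3 = T"
 shows "Bs * T - (d1 * u1 + d2 * u2 + d3 * u3) + (Bs * (N1 + N2 + N3 + n1 + n2 + n3) - (d1 * v1 + d2 * v2 + d3 * v3))
  = Bs * (E1 + N1 + (E2 + N2) + (E3 + N3) + (e1 + n1) + (e2 + n2) + (e3 + n3)) - (d1 * (u1 + v1) + d2 * (u2 + v2) + d3 * (u3 + v3))"
 unfolding assms[symmetric] by (simp add: algebra_simps)

context normal_cover begin

definition along :: "(('x => complex) \<times> ('x => complex) \<times> ('x => complex)) => ('g => complex) \<times> ('g => complex) \<times> ('g => complex)" where
 "along q = (case q of (p, g, k) => (%y. p (sec y), %y. g (sec y), %y. k (sec y)))"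
text \<open>Numerator of a Kaehler form along the orbit; the form is this sum divided by b, see
  \<open>kaehler_form_num\<close>.\<close>

definition num :: "(('x => complex) \<times> ('x => complex) \<times> ('x => complex)) list => 'g => 'g => 'g => complex" where
 "num ts y v w = (\<Sum>q\<leftarrow>ts. eta (along q) y v w)"

lemma num_Nil: "num [] y v w = 0" and num_Cons: "num (q # ts) y v w = eta (along q) y v w + num ts y v w" by (simp_all add: num_def)
lemma eta_along: "eta (along (p, g, k)) y v w = p (sec y) * (dE (%y. g (sec y)) y v * dE (%y. k (sec y)) y w - dE (%y. g (sec y)) y w * dE (%y. k (sec y)) y v)"
 by (simp add: along_def eta_def)
lemma A_Reg: "a : A ==> (%y. a (sec y)) : Reg" by (rule sec_Reg[OF A_RA])

lemma kaehler_form_num: assumes "set ts \<subseteq> A \<times> A \<times> A"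
 shows "kaehler_form b ts (sec y) (DD y v) (DD y w) = num ts y v w / b (sec y)" using assms
proof (induction ts)
 case (Cons q ts)
 obtain p g k where q: "q = (p, g, k)" "g : A" "k : A" using Cons.prems by auto
 have "kaehler_form b (q # ts) (sec y) (DD y v) (DD y w) = p (sec y) / b (sec y) * wedge2 g k (DD y v) (DD y w) + kaehler_form b ts (sec y) (DD y v) (DD y w)"
  by (simp add: kaehler_form_def q(1))
 also have "wedge2 g k (DD y v) (DD y w) = dE (%y. g (sec y)) y v * dE (%y. k (sec y)) y w - dE (%y. k (sec y)) y v * dE (%y. g (sec y)) y w"
  using q(2,3) by (simp add: wedge2_def DD_def)
 finally show ?case using Cons by (simp add: num_Cons q(1) eta_along add_divide_distrib)
qed (simp add: kaehler_form_def num_Nil)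

lemma num_anti: "num ts y w v = - num ts y v w"
proof (induction ts)
 case (Cons q ts) thus ?case by (cases q) (simp add: num_Cons eta_along algebra_simps)
qed (simp add: num_Nil)

lemma num_lf: assumes "set ts \<subseteq> A \<times> A \<times> A" "y : E" shows "lf (num ts y v)" using assms(1)
proof (induction ts)
 case Nil thus ?case by (simp add: num_Nil[abs_def] lf_iff)
next
 case (Cons q ts)
 obtain p g k where q: "q = (p, g, k)" "g : A" "k : A" using Cons.prems by auto
 note l = lf_dE[OF A_Reg[OF q(2)] assms(2)] lf_dE[OF A_Reg[OF q(3)] assms(2)]
 have "lf (num ts y v)" using Cons by simp
 thus ?case by (simp add: num_Cons[abs_def] q(1) eta_along lf_iff) (simp add: lfs[OF l(1)] lfs[OF l(2)] algebra_simps)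
qed

lemma num_Reg: assumes "set ts \<subseteq> A \<times> A \<times> A" "fld L" "fld L'" shows "(%y. num ts y (L y) (L' y)) : Reg"
 using assms(1)
proof (induction ts)
 case (Cons q ts)
 obtain p g k where q: "q = (p, g, k)" "p : A" "g : A" "k : A" using Cons.prems by auto
 have "(%y. eta (along q) y (L y) (L' y)) : Reg" unfolding q(1) eta_along
  by (intro fa_mult[OF fa_Reg] fa_diff[OF fa_Reg] A_Reg q Reg_fld assms)
 thus ?case using fa_add[OF fa_Reg] Cons by (simp add: num_Cons)
qed (simp add: num_Nil fa_const[OF fa_Reg])

lemma num_koszul:
 assumes ts: "set ts \<subseteq> A \<times> A \<times> A" and L: "fld L1" "fld L2" "fld L3" and z: "z : E" and b: "b : A" "b (sec z) ~= 0"
  and M: "M12 = L1 (L2 z) - L2 (L1 z)" "M23 = L2 (L3 z) - L3 (L2 z)" "M31 = L3 (L1 z) - L1 (L3 z)"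
  and MT: "M12 : Tg z" "M23 : Tg z" "M31 : Tg z"
 shows "b (sec z) ^ 2 * kaehler_d b ts (sec z) (DD z (L1 z)) (DD z (L2 z)) (DD z (L3 z)) =
  b (sec z) * (dE (%y. num ts y (L2 y) (L3 y)) z (L1 z) + dE (%y. num ts y (L3 y) (L1 y)) z (L2 z) + dE (%y. num ts y (L1 y) (L2 y)) z (L3 z)
   + num ts z M12 (L3 z) + num ts z M23 (L1 z) + num ts z M31 (L2 z))
  - (dE (%y. b (sec y)) z (L1 z) * num ts z (L2 z) (L3 z) + dE (%y. b (sec y)) z (L2 z) * num ts z (L3 z) (L1 z) + dE (%y. b (sec y)) z (L3 z) * num ts z (L1 z) (L2 z))"
 using ts
proof (induction ts)
 case Nil thus ?case using fldD(2)[OF L(1) z] fldD(2)[OF L(2) z] fldD(2)[OF L(3) z] by (simp add: kaehler_d_def num_Nil dE_const z)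
next
 case (Cons q ts)
 obtain p g k where q: "q = (p, g, k)" "p : A" "g : A" "k : A" using Cons.prems by auto
 have ts: "set ts \<subseteq> A \<times> A \<times> A" using Cons.prems by auto
 note IH = Cons.IH[OF ts]
 let ?p = "%y. p (sec y)" and ?g = "%y. g (sec y)" and ?k = "%y. k (sec y)" and ?b = "%y. b (sec y)"
 have aq: "along q = (?p, ?g, ?k)" by (simp add: along_def q(1))
 note R = A_Reg[OF q(2)] A_Reg[OF q(3)] A_Reg[OF q(4)]
 note K = koszul_term[OF R L z M MT]
 have add: "dE (%y. num (q # ts) y (L y) (L' y)) z (J z) = dE (%y. eta (?p, ?g, ?k) y (L y) (L' y)) z (J z) + dE (%y. num ts y (L y) (L' y)) z (J z)"
  if L: "fld L" "fld L'" "fld J" for L L' J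
 proof -
  have "(%y. eta (?p, ?g, ?k) y (L y) (L' y)) : Reg" using num_Reg[of "[q]", OF _ L(1,2)] q unfolding num_Cons num_Nil aq by simp
  from dE_add[OF this num_Reg[OF ts L(1,2)] z fldD(2)[OF L(3) z]] show ?thesis by (simp add: num_Cons aq)
 qed
 have w: "wedge2 g k (DD z v) (DD z w) = dE ?g z v * dE ?k z w - dE ?g z w * dE ?k z v" for v w using q by (simp add: wedge2_def DD_def)
 have d: "DD z v p = dE ?p z v" "DD z v b = dE ?b z v" for v using q b by (simp_all add: DD_def)
 define dp1 dp2 dp3 db1 db2 db3 where dd: "dp1 = dE ?p z (L1 z)" "dp2 = dE ?p z (L2 z)" "dp3 = dE ?p z (L3 z)" "db1 = dE ?b z (L1 z)" "db2 = dE ?b z (L2 z)" "db3 = dE ?b z (L3 z)"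
 define w12 w13 w23 where ww: "w12 = dE ?g z (L1 z) * dE ?k z (L2 z) - dE ?g z (L2 z) * dE ?k z (L1 z)"
  "w13 = dE ?g z (L1 z) * dE ?k z (L3 z) - dE ?g z (L3 z) * dE ?k z (L1 z)" "w23 = dE ?g z (L2 z) * dE ?k z (L3 z) - dE ?g z (L3 z) * dE ?k z (L2 z)"
 have w31: "eta (?p, ?g, ?k) z (L3 z) (L1 z) = - (p (sec z) * w13)" "eta (?p, ?g, ?k) z (L1 z) (L2 z) = p (sec z) * w12" "eta (?p, ?g, ?k) z (L2 z) (L3 z) = p (sec z) * w23"
  by (simp_all add: eta_def ww algebra_simps)
 have mB: "(b (sec z))\<^sup>2 * (x / (b (sec z))\<^sup>2 * y) = x * y" for x y using b(2) by simp
 have "kaehler_d b (q # ts) (sec z) (DD z (L1 z)) (DD z (L2 z)) (DD z (L3 z)) =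
  ((dp1 * b (sec z) - p (sec z) * db1) / (b (sec z))\<^sup>2 * w23 - (dp2 * b (sec z) - p (sec z) * db2) / (b (sec z))\<^sup>2 * w13
   + (dp3 * b (sec z) - p (sec z) * db3) / (b (sec z))\<^sup>2 * w12) + kaehler_d b ts (sec z) (DD z (L1 z)) (DD z (L2 z)) (DD z (L3 z))"
  unfolding kaehler_d_def q(1) by (simp add: tangent_quot_def w d dd ww)
 hence "b (sec z) ^ 2 * kaehler_d b (q # ts) (sec z) (DD z (L1 z)) (DD z (L2 z)) (DD z (L3 z)) =
  ((dp1 * b (sec z) - p (sec z) * db1) * w23 - (dp2 * b (sec z) - p (sec z) * db2) * w13
   + (dp3 * b (sec z) - p (sec z) * db3) * w12) + b (sec z) ^ 2 * kaehler_d b ts (sec z) (DD z (L1 z)) (DD z (L2 z)) (DD z (L3 z))"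
  by (simp only: distrib_left right_diff_distrib mB)
 also have "\<dots> = b (sec z) * (dp1 * w23 - dp2 * w13 + dp3 * w12) - (db1 * (p (sec z) * w23) + db2 * (- (p (sec z) * w13)) + db3 * (p (sec z) * w12))
   + b (sec z) ^ 2 * kaehler_d b ts (sec z) (DD z (L1 z)) (DD z (L2 z)) (DD z (L3 z))" by (simp add: algebra_simps)
 finally have fin: "b (sec z) ^ 2 * kaehler_d b (q # ts) (sec z) (DD z (L1 z)) (DD z (L2 z)) (DD z (L3 z)) =
  b (sec z) * (dp1 * w23 - dp2 * w13 + dp3 * w12) - (db1 * (p (sec z) * w23) + db2 * (- (p (sec z) * w13)) + db3 * (p (sec z) * w12))
   + b (sec z) ^ 2 * kaehler_d b ts (sec z) (DD z (L1 z)) (DD z (L2 z)) (DD z (L3 z))" .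
 show ?case unfolding fin unfolding IH unfolding add[OF L(2,3,1)] add[OF L(3,1,2)] add[OF L(1,2,3)] unfolding num_Cons aq w31 dd[symmetric]
  by (rule koszul_arith[OF K[folded dd(1,2,3) ww]])
qed

text \<open>Turns the formal exterior derivative of one presentation into Koszul's formula, in which
  only the values of the form on linear vector fields occur. Multiplying by the square of b avoids
  quotients in the computation.\<close>

lemma kaehler_d_koszul:
 assumes ts: "set ts \<subseteq> A \<times> A \<times> A" and L: "fld L1" "fld L2" "fld L3" and z: "z : E" and b: "b : A" "b (sec z) ~= 0"
  and M: "M12 = L1 (L2 z) - L2 (L1 z)" "M23 = L2 (L3 z) - L3 (L2 z)" "M31 = L3 (L1 z) - L1 (L3 z)"
  and MT: "M12 : Tg z" "M23 : Tg z" "M31 : Tg z"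
  and W: "w12 : Reg" "w23 : Reg" "w31 : Reg"
  and w: "!!y. y : E ==> b (sec y) ~= 0 ==> kaehler_form b ts (sec y) (DD y (L1 y)) (DD y (L2 y)) = w12 y"
   "!!y. y : E ==> b (sec y) ~= 0 ==> kaehler_form b ts (sec y) (DD y (L2 y)) (DD y (L3 y)) = w23 y"
   "!!y. y : E ==> b (sec y) ~= 0 ==> kaehler_form b ts (sec y) (DD y (L3 y)) (DD y (L1 y)) = w31 y"
 shows "kaehler_d b ts (sec z) (DD z (L1 z)) (DD z (L2 z)) (DD z (L3 z)) =
  dE w23 z (L1 z) + dE w31 z (L2 z) + dE w12 z (L3 z) + kaehler_form b ts (sec z) (DD z M12) (DD z (L3 z))
  + kaehler_form b ts (sec z) (DD z M23) (DD z (L1 z)) + kaehler_form b ts (sec z) (DD z M31) (DD z (L2 z))"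
proof -
 let ?b = "%y. b (sec y)"
 note bR = A_Reg[OF b(1)]
 \<comment> \<open>The identity holds where b is nonzero and extends to all of E by
   irreducibility.\<close>
 have N: "num ts y (L y) (L' y) = ?b y * w y" if L: "fld L" "fld L'" and W: "w : Reg"
  and w: "!!y. y : E ==> b (sec y) ~= 0 ==> kaehler_form b ts (sec y) (DD y (L y)) (DD y (L' y)) = w y" and y: "y : E" for L L' w y
 proof -
  have "num ts y (L y) (L' y) - ?b y * w y = 0"
  proof (rule Reg_cancel[OF bR fa_diff[OF fa_Reg num_Reg[OF ts L] fa_mult[OF fa_Reg bR W]] _ z b(2) y])
   fix x assume x: "x : E"
   show "?b x * (num ts x (L x) (L' x) - ?b x * w x) = 0"
    using w[OF x] unfolding kaehler_form_num[OF ts] by (cases "b (sec x) = 0") (simp_all add: field_simps)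
  qed
  thus ?thesis by simp
 qed
 have dN: "dE (%y. num ts y (L y) (L' y)) z (J z) = dE ?b z (J z) * w z + ?b z * dE w z (J z)" if L: "fld L" "fld L'" "fld J" and W: "w : Reg"
  and w: "!!y. y : E ==> b (sec y) ~= 0 ==> kaehler_form b ts (sec y) (DD y (L y)) (DD y (L' y)) = w y" for L L' J w
  unfolding dE_mult[OF bR W z fldD(2)[OF L(3) z], symmetric]
  by (rule dE_cong[OF fa_mult[OF fa_Reg bR W] z fldD(2)[OF L(3) z]]) (rule N[OF L(1,2) W w])
 have N': "num ts z (L1 z) (L2 z) = ?b z * w12 z" "num ts z (L2 z) (L3 z) = ?b z * w23 z" "num ts z (L3 z) (L1 z) = ?b z * w31 z"
  by (rule N[OF L(1,2) W(1) _ z], rule w(1), assumption+) (rule N[OF L(2,3) W(2) _ z], rule w(2), assumption+, rule N[OF L(3,1) W(3) _ z], rule w(3), assumption+)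
 have dN': "dE (%y. num ts y (L1 y) (L2 y)) z (L3 z) = dE ?b z (L3 z) * w12 z + ?b z * dE w12 z (L3 z)"
  "dE (%y. num ts y (L2 y) (L3 y)) z (L1 z) = dE ?b z (L1 z) * w23 z + ?b z * dE w23 z (L1 z)"
  "dE (%y. num ts y (L3 y) (L1 y)) z (L2 z) = dE ?b z (L2 z) * w31 z + ?b z * dE w31 z (L2 z)"
  by (rule dN[OF L(1,2,3) W(1)], rule w(1), assumption+) (rule dN[OF L(2,3,1) W(2)], rule w(2), assumption+, rule dN[OF L(3,1,2) W(3)], rule w(3), assumption+)
 have "b (sec z) ^ 2 * kaehler_d b ts (sec z) (DD z (L1 z)) (DD z (L2 z)) (DD z (L3 z)) =
  b (sec z) ^ 2 * (dE w23 z (L1 z) + dE w31 z (L2 z) + dE w12 z (L3 z)) + b (sec z) * (num ts z M12 (L3 z) + num ts z M23 (L1 z) + num ts z M31 (L2 z))"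
  unfolding num_koszul[OF ts L z b M MT] N' dN' by (simp add: algebra_simps power2_eq_square)
 thus ?thesis unfolding kaehler_form_num[OF ts] by (rule cancel_square[OF _ b(2)])
qed

subsection \<open>The Kostant--Kirillov form\<close>

text \<open>The Kostant-Kirillov form in terms of tangent vectors; for tangent v the value B v b
  depends only on [b,z] = w, by \<open>B_swap\<close>.\<close>

definition KK :: "'g => 'g => 'g => complex" where "KK z v w = - B v (SOME b. br b z = w)"
lemma B_swap: "B (br a z) c = - B a (br c z)" using B_inv[of a z c] anti[of z c] by (simp add: bs)
lemma KK: "KK z (br a z) (br b z) = B z (br a b)"
proof -
 have "br (SOME c. br c z = br b z) z = br b z" by (rule someI[of "%c. br c z = br b z" b]) simp
 hence "KK z (br a z) (br b z) = - B (br a z) b" unfolding KK_def B_swap by simp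
 also have "\<dots> = B z (br a b)" by (simp add: B_inv2)
 finally show ?thesis .
qed

text \<open>Applying ad b to the extremal identity for [z,[z,f]] expresses B a w, and with it the
  form, by v and w instead of a and b. The result is an algebraic formula with denominator 2
  B(z,f)^2.\<close>

lemma KK_local: assumes z: "z : E0" and v: "v = br a z" and w: "w = br b z"
 shows "2 * (B z f)^2 * KK z v w = 2 * B z f * B v (br f w) + B w f * B v (br z f) - B w (br z f) * B v f"
proof -
 let ?C = "B z f"
 have zz: "br z (br z y) = (- 2 * B z y) *s z" for y by (rule E0D[OF z])
 have hw: "B (br c z) (br z f) = - 2 * ?C * B z c" for c
 proof -
  have "B (br c z) (br z f) = B c (br z (br z f))" by (rule B_inv)
  also have "\<dots> = - 2 * ?C * B z c" by (simp add: zz bs B_sym[of c z])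
  finally show ?thesis .
 qed
 have "br z w = - br z (br z b)" unfolding w by (subst anti[of b z]) (simp only: brs)
 hence zw: "br z w = (2 * B z b) *s z" by (simp add: zz)
 have bf: "B z (br b f) = - B w f" unfolding w B_inv[of z b f, symmetric] by (subst anti[of z b]) (simp only: bs)
 have "br b (br z (br z f)) = br w (br z f) + br z (br w f) + br z (br z (br b f))"
  unfolding leib[of b z "br z f"] leib[of b z f] w by (simp only: brs add.assoc)
 hence "br w (br z f) + br z (br w f) = br b (br z (br z f)) - br z (br z (br b f))" by simp
 also have "\<dots> = (- 2 * ?C) *s w + (- 2 * B w f) *s z" unfolding zz brs w[symmetric] bf by simp
 finally have 1: "br w (br z f) + br z (br w f) = (- 2 * ?C) *s w + (- 2 * B w f) *s z" .
 have 2: "br z (br w f) = (2 * B z b) *s br z f + br w (br z f)" unfolding leib[of z w f] zw by (simp only: brs)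
 have p1: "B a (br w (br z f)) + B a (br z (br w f)) = - 2 * (?C * B a w) - 2 * (B w f * B z a)"
  using arg_cong[OF 1, of "B a"] by (simp add: bs B_sym[of a z])
 have af: "B a (br z f) = B v f" unfolding v by (rule B_inv[symmetric])
 have p2: "B a (br z (br w f)) = 2 * (B z b * B v f) + B a (br w (br z f))" by (subst 2) (simp only: bs af mult.assoc)
 have p3: "B a (br z (br w f)) = - B v (br f w)" unfolding B_inv[of a z, symmetric] v[symmetric] by (subst anti[of w f]) (simp only: bs)
 have 3: "?C * B a w = B v (br f w) - B w f * B z a + B z b * B v f" using three_term[OF p1 p2 p3] .
 have "B z (br a b) = - B (br a z) b" by (simp only: B_inv2 minus_minus)
 hence K: "KK z v w = B a w" unfolding v w KK B_swap by simp
 have "2 * ?C^2 * B a w = 2 * ?C * (?C * B a w)" by (simp add: power2_eq_square)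
 also have "\<dots> = 2 * ?C * B v (br f w) + B w f * (- 2 * ?C * B z a) - (- 2 * ?C * B z b) * B v f" unfolding 3 by (simp add: algebra_simps)
 also have "\<dots> = 2 * ?C * B v (br f w) + B w f * B v (br z f) - B w (br z f) * B v f" unfolding v w hw ..
 finally show ?thesis unfolding K .
qed

lemma smooth_secE: assumes "x : smooth_locus X A" "\<nu> x : E" shows "EX z:E. x = sec z"
 using sec_\<nu>[OF _ assms(2)] assms by (intro bexI[of _ "\<nu> x"]) (auto simp: smooth_locus_def)
lemma tangentE: "z : E ==> D : tangent_space A (sec z) ==> EX a. D = DD z (br a z)" unfolding tangent_space_DD by (auto simp: Tg_def)

definition KKform :: "'x two_form" where "KKform x D D' = KK (\<nu> x) (vecD D) (vecD D')"
lemma KKform: "z : E ==> KKform (sec z) (DD z (br a z)) (DD z (br b z)) = B z (br a b)" by (simp add: KKform_def sec vecD_DD Tg_br KK)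

lemma wedge2_nu: assumes "lf l" "lf m" "z : E" "v : Tg z" "w : Tg z"
 shows "wedge2 (nu l) (nu m) (DD z v) (DD z w) = l v * m w - m v * l w"
 by (simp only: wedge2_def DD_nu[OF lf_Rg[OF assms(1)] assms(3)] DD_nu[OF lf_Rg[OF assms(2)] assms(3)] assms(4,5) dd_lf[OF assms(1)] dd_lf[OF assms(2)])

end

context cover_action begin

lemma KKform_algebraic: "algebraic_2form X A KKform" unfolding algebraic_2form_def
proof
 fix x assume "x : smooth_locus X A"
 then obtain z0 where z0: "z0 : E" "x = sec z0" using smooth_secE smooth_over_E by blast
 obtain f where f: "f : E" "B z0 f = 1" using E_pair[OF z0(1)] by blast
 obtain bs where bs: "set bs = Basis" "distinct bs" using finite_distinct_list[OF finite_Basis] by blast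
 \<comment> \<open>The right side of \<open>KK_local\<close> is spelled out in a basis:
   \<open>t1\<close> gives the term B v (br f w), \<open>t2\<close> the terms containing br z f, and
   d is the common denominator.\<close>
 define d where "d = nu (%y. 2 * (B y f)^2)"
 define t1 where "t1 b = (nu (%y. B y f), nu (co b), nu (%y. B b (br f y)))" for b
 define t2 where "t2 b = (nu (%y. - co b y), nu (%y. B y f), nu (%y. B y (br b f)))" for b
 have dA: "d : A" unfolding d_def by (intro nu_A fa_cmult[OF fa_Rg] fa_pow[OF fa_Rg] lf_Rg[OF B_lf2])
 have lB: "lf (%y. B b (br f y))" for b by (rule lf_comp[OF B_lf le_br])
 have "(%y. - co b y) : Rg" for b using fa_cmult[OF fa_Rg lf_Rg[OF lf_co], of "-1" b] by simp
 hence cA: "nu (%y. - co b y) : A" for b by (rule nu_A)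
 have tA: "set (map t1 bs @ map t2 bs) \<subseteq> A \<times> A \<times> A"
  by (auto simp: t1_def t2_def cA nu_A[OF lf_Rg[OF B_lf2]] nu_A[OF lf_Rg[OF lf_co]] nu_A[OF lf_Rg[OF lB]])
 have "KKform (sec z) D D' = kaehler_form d (map t1 bs @ map t2 bs) (sec z) D D'"
  if z: "z : E" and d0: "d (sec z) ~= 0" and D: "D : tangent_space A (sec z)" "D' : tangent_space A (sec z)" for z D D'
 proof -
  obtain a b where ab: "D = DD z (br a z)" "D' = DD z (br b z)" using tangentE[OF z D(1)] tangentE[OF z D(2)] by blast
  define v w where vw: "v = br a z" "w = br b z"
  have T: "v : Tg z" "w : Tg z" by (simp_all add: vw Tg_br)
  let ?C = "B z f"
  have dz: "d (sec z) = 2 * ?C^2" by (simp only: d_def nu_sec[OF z])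
  have C: "?C ~= 0" using d0 by (simp add: dz)
  have ex1: "(\<Sum>b\<in>Basis. co b v * B b y) = B v y" for v y using co_lf[OF B_lf2, of v y] by simp
  have ex2: "(\<Sum>b\<in>Basis. co b z * B v (br b f)) = B v (br z f)" for v
   using co_lf[OF lf_comp[OF B_lf[of v] le_br2[of f]], of z] by simp
  have fw: "B w (br f v) = - B v (br f w)" using B_inv2[of f v w] by (simp add: B_sym)
  have "kaehler_form d (map t1 bs @ map t2 bs) (sec z) D D' =
   (\<Sum>b\<in>Basis. ?C / (2 * ?C^2) * (co b v * B b (br f w) - B b (br f v) * co b w))
  + (\<Sum>b\<in>Basis. - co b z / (2 * ?C^2) * (B v f * B w (br b f) - B v (br b f) * B w f))"
   unfolding kaehler_form_def map_append sum_list_append map_map o_def bs(1) sum_list_distinct_conv_sum_set[OF bs(2)] t1_def t2_def prod.case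
    ab vw(1)[symmetric] vw(2)[symmetric] wedge2_nu[OF lf_co lB z T] wedge2_nu[OF B_lf2 B_lf2 z T] nu_sec[OF z] dz ..
  also have "(\<Sum>b\<in>Basis. ?C / (2 * ?C^2) * (co b v * B b (br f w) - B b (br f v) * co b w))
   = ?C / (2 * ?C^2) * ((\<Sum>b\<in>Basis. co b v * B b (br f w)) - (\<Sum>b\<in>Basis. co b w * B b (br f v)))"
   by (simp only: sum_distrib_left sum_subtractf[symmetric] mult.commute[of "B _ (br f v)"])
  also have "(\<Sum>b\<in>Basis. - co b z / (2 * ?C^2) * (B v f * B w (br b f) - B v (br b f) * B w f))
   = - 1 / (2 * ?C^2) * (B v f * (\<Sum>b\<in>Basis. co b z * B w (br b f)) - (\<Sum>b\<in>Basis. co b z * B v (br b f)) * B w f)"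
   by (simp add: sum_distrib_left sum_subtractf[symmetric] algebra_simps)
  finally have k: "kaehler_form d (map t1 bs @ map t2 bs) (sec z) D D' = ?C / (2 * ?C^2) * (B v (br f w) + B v (br f w))
   - 1 / (2 * ?C^2) * (B v f * B w (br z f) - B v (br z f) * B w f)" unfolding ex1 ex2 fw by simp
  have "2 * ?C^2 * kaehler_form d (map t1 bs @ map t2 bs) (sec z) D D' = 2 * ?C^2 * KK z v w"
   unfolding k KK_local[OF E_E0[OF z] vw] using C by (simp add: field_simps)
  hence "kaehler_form d (map t1 bs @ map t2 bs) (sec z) D D' = KK z v w" using C by simp
  thus ?thesis unfolding KKform_def ab vw[symmetric] vecD_DD[OF z T(1)] vecD_DD[OF z T(2)] sec(2)[OF z] by simp
 qed
 hence "represents_on_principal_open X A KKform d (map t1 bs @ map t2 bs)"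
  unfolding represents_on_principal_open_def using dA tA smooth_secE smooth_over_E by blast
 moreover have "d x ~= 0" by (simp only: d_def z0 nu_sec f(2)) simp
 ultimately show "EX b ts. b x ~= 0 & represents_on_principal_open X A KKform b ts" by auto
qed

text \<open>In Koszul's formula for ad a1, ad a2, ad a3 the two groups of terms are, up to sign,
  values of B z on Jacobi sums.\<close>

lemma KKform_closed: "d_closed X A KKform" unfolding d_closed_def
proof (intro allI impI ballI)
 fix b ts x D1 D2 D3
 assume r: "represents_on_principal_open X A KKform b ts" and x: "x : smooth_locus X A" and bx: "b x ~= 0"
  and D: "D1 : tangent_space A x" "D2 : tangent_space A x" "D3 : tangent_space A x"
 obtain z where z: "z : E" "x = sec z" using smooth_secE[OF x smooth_over_E[OF x]] by blast
 note D = D[unfolded z(2)]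
 obtain a1 where a1: "D1 = DD z (br a1 z)" using tangentE[OF z(1) D(1)] by blast
 obtain a2 where a2: "D2 = DD z (br a2 z)" using tangentE[OF z(1) D(2)] by blast
 obtain a3 where a3: "D3 = DD z (br a3 z)" using tangentE[OF z(1) D(3)] by blast
 have bA: "b : A" and ts: "set ts \<subseteq> A \<times> A \<times> A" using r by (simp_all add: represents_on_principal_open_def)
 have k: "kaehler_form b ts (sec y) (DD y (br a y)) (DD y (br a' y)) = B y (br a a')" if y: "y : E" "b (sec y) ~= 0" for y a a'
  using r smooth_sec[OF y(1)] y(2) DD_derivation[OF y(1) Tg_br] KKform[OF y(1)] unfolding represents_on_principal_open_def by metis
 have l: "(%y. B y c) : Reg" for c by (rule Rg_Reg[OF lf_Rg[OF B_lf2]])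
 have dl: "dE (%y. B y c) z (br a z) = B (br a z) c" for a c by (simp only: dE_Rg[OF lf_Rg[OF B_lf2] z(1) Tg_br] dd_lf[OF B_lf2])
 have br2: "br a (br a' z) - br a' (br a z) = br (br a a') z" for a a' using leib[of a a' z] by simp
 have T: "br a (br a' z) - br a' (br a z) : Tg z" for a a' unfolding br2 by (rule Tg_br)
 have jac: "br a1 (br a2 a3) + br a2 (br a3 a1) + br a3 (br a1 a2) = 0" by (rule jacobi)
 have jac': "br (br a1 a2) a3 + br (br a2 a3) a1 + br (br a3 a1) a2 = 0"
 proof -
  have "br (br a1 a2) a3 + br (br a2 a3) a1 + br (br a3 a1) a2 = - (br a1 (br a2 a3) + br a2 (br a3 a1) + br a3 (br a1 a2))"
   unfolding anti[of "br a1 a2" a3] anti[of "br a2 a3" a1] anti[of "br a3 a1" a2] by simp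
  thus ?thesis unfolding jac by simp
 qed
 have "kaehler_d b ts (sec z) (DD z (br a1 z)) (DD z (br a2 z)) (DD z (br a3 z)) =
  B (br a1 z) (br a2 a3) + B (br a2 z) (br a3 a1) + B (br a3 z) (br a1 a2)
  + B z (br (br a1 a2) a3) + B z (br (br a2 a3) a1) + B z (br (br a3 a1) a2)"
  using kaehler_d_koszul[OF ts fld_br fld_br fld_br z(1) bA _ refl refl refl T T T l l l k k k, of a1 a2 a3] bx
  unfolding br2 z(2) dl k[OF z(1) bx[unfolded z(2)]] by simp
 also have "\<dots> = - B z (br a1 (br a2 a3) + br a2 (br a3 a1) + br a3 (br a1 a2)) + B z (br (br a1 a2) a3 + br (br a2 a3) a1 + br (br a3 a1) a2)"
  by (simp only: B_inv2 bs) (simp add: algebra_simps)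
 also have "\<dots> = 0" unfolding jac jac' by simp
 finally show "kaehler_d b ts x D1 D2 D3 = 0" unfolding z(2) a1 a2 a3 .
qed

lemma DD_0: "z : E ==> DD z 0 = 0" by (auto simp: DD_def lf_0[OF lf_dE[OF A_Reg]])

lemma KKform_nondegenerate: "nondegenerate X A KKform" unfolding nondegenerate_def
proof (intro ballI impI)
 fix x D assume x: "x : smooth_locus X A" and D: "D : tangent_space A x" and 0: "ALL D':tangent_space A x. KKform x D D' = 0"
 obtain z where z: "z : E" "x = sec z" using smooth_secE[OF x smooth_over_E[OF x]] by blast
 obtain a where a: "D = DD z (br a z)" using tangentE[OF z(1) D[unfolded z(2)]] by blast
 have "B z (br a b) = 0" for b
  using bspec[OF 0 DD_derivation[OF z(1) Tg_br[of b], folded z(2)]] KKform[OF z(1), of a b] unfolding a z(2) by simp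
 hence "B (br a z) b = 0" for b by (simp add: B_inv2)
 hence "br a z = 0" by (rule B_nondeg)
 thus "D = 0" unfolding a using DD_0[OF z(1)] by simp
qed

lemma vecD_tangent_map: assumes t: "t ~= 0" and D: "D : tangent_space A x"
 shows "vecD (tangent_map X A (\<phi> t) D) = t *s vecD D"
proof -
 have "tangent_map X A (\<phi> t) D (nu (co b)) = t * D (nu (co b))" for b
 proof -
  have "pullback X (\<phi> t) (nu (co b)) = fun_scale t (nu (co b))"
   using \<phi>_X[OF t] \<nu>_\<phi>[OF t] by (auto simp: pullback_def restr_def nu_def fun_scale_def lf_scale[OF lf_co])
  moreover have "D (fun_scale t (nu (co b))) = t * D (nu (co b))" using D nu_A[OF lf_Rg[OF lf_co]] unfolding tangent_space_def by blast
  ultimately show ?thesis using nu_A[OF lf_Rg[OF lf_co]] by (simp add: tangent_map_def)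
 qed
 thus ?thesis by (simp add: vecD_def scale_sum_right)
qed

lemma KKform_weight: "has_weight X A \<phi> KKform 1" unfolding has_weight_def
proof (intro allI impI ballI)
 fix t :: complex and x D D' assume t: "t ~= 0" and x: "x : smooth_locus X A" and D: "D : tangent_space A x" "D' : tangent_space A x"
 obtain z where z: "z : E" "x = sec z" using smooth_secE[OF x smooth_over_E[OF x]] by blast
 obtain a where a: "D = DD z (br a z)" using tangentE[OF z(1) D(1)[unfolded z(2)]] by blast
 obtain b where b: "D' = DD z (br b z)" using tangentE[OF z(1) D(2)[unfolded z(2)]] by blast
 have v: "vecD D = br a z" "vecD D' = br b z" unfolding a b using vecD_DD[OF z(1) Tg_br] by auto
 have "KKform (\<phi> t x) (tangent_map X A (\<phi> t) D) (tangent_map X A (\<phi> t) D') = KK (t *s z) (br a (t *s z)) (br b (t *s z))"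
  unfolding KKform_def vecD_tangent_map[OF t D(1)] vecD_tangent_map[OF t D(2)] v z(2) \<nu>_\<phi>[OF t sec(1)[OF z(1)]] sec(2)[OF z(1)] by (simp only: brs)
 also have "\<dots> = t * KK z (br a z) (br b z)" unfolding KK by (simp only: bs)
 also have "KK z (br a z) (br b z) = KKform x D D'" unfolding KKform_def v z(2) sec(2)[OF z(1)] ..
 finally show "KKform (\<phi> t x) (tangent_map X A (\<phi> t) D) (tangent_map X A (\<phi> t) D') = t powi 1 * KKform x D D'" by simp
qed

lemma KKform_symplectic: "symplectic_structure X A KKform"
 unfolding symplectic_structure_def by (intro conjI KKform_algebraic KKform_closed KKform_nondegenerate)

end

section \<open>Uniqueness\<close>

context extremal_lie begin

lemma Reg_quotient:
 assumes "!!z. z : E ==> EX Bs:Reg. EX N:Reg. Bs z ~= 0 & (ALL y:E. F y * Bs y = N y)"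
 shows "F : Reg"
proof (rule RegI)
 fix z assume z: "z : E"
 obtain Bs N where BN: "Bs : Reg" "N : Reg" "Bs z ~= 0" "ALL y:E. F y * Bs y = N y" using assms[OF z] by (elim bexE conjE) (rule that)
 obtain d R where d: "rep Bs d R" "d z ~= 0" using RegD[OF BN(1) z] by (elim exE conjE) (rule that)
 obtain c Q where c: "rep N c Q" "c z ~= 0" using RegD[OF BN(2) z] by (elim exE conjE) (rule that)
 have "rep F (%y. R y * c y) (%y. Q y * d y)" unfolding rep_def
 proof (intro conjI ballI)
  show "(%y. R y * c y) : Rg" "(%y. Q y * d y) : Rg" by (intro fa_mult[OF fa_Rg] repD(1,2)[OF c(1)] repD(1,2)[OF d(1)])+
  fix y assume y: "y : E"
  have "F y * (R y * c y) = (F y * Bs y) * d y * c y" unfolding repD(3)[OF d(1) y, symmetric] by simp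
  also have "\<dots> = N y * c y * d y" unfolding bspec[OF BN(4) y] by simp
  finally show "F y * (R y * c y) = Q y * d y" unfolding repD(3)[OF c(1) y] .
 qed
 moreover have "R z * c z ~= 0" using repD(3)[OF d(1) z] BN(3) d(2) c(2) by auto
 ultimately show "EX b P. rep F b P & b z ~= 0" by auto
qed

text \<open>Polarise the extremal identities of z, v and z + v.\<close>

lemma tangent_polar: assumes z: "z : E" and v: "v : E0" "z + v : E0" shows "v : Tg z"
proof (rule tangentI[OF z])
 fix y
 have 1: "br (z + v) (br (z + v) y) = (- 2 * B (z + v) y) *s (z + v)" by (rule E0D[OF v(2)])
 have 2: "br z (br z y) = (- 2 * B z y) *s z" "br v (br v y) = (- 2 * B v y) *s v" by (rule E0D[OF E_E0[OF z]], rule E0D[OF v(1)])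
 have "br v (br z y) + br z (br v y) = br (z + v) (br (z + v) y) - br z (br z y) - br v (br v y)" by (simp add: brs)
 also have "\<dots> = - ((2 * B v y) *s z) - (2 * B z y) *s v" unfolding 1 2
  by (simp add: bs scale_right_distrib distrib_left scale_left_diff_distrib)
 finally show "br v (br z y) + br z (br v y) + (2 * B v y) *s z + (2 * B z y) *s v = 0" by simp
qed

end

context normal_cover begin

lemma num_hol: assumes ts: "set ts \<subseteq> A \<times> A \<times> A" and U: "open U" and g: "vhol ga U" "!!t. t : U ==> ga t : E"
  and v: "vhol v U" "!!t. t : U ==> v t : Tg (ga t)" and w: "vhol w U" "!!t. t : U ==> w t : Tg (ga t)"
 shows "(%t. num ts (ga t) (v t) (w t)) holomorphic_on U" using ts
proof (induction ts)
 case (Cons q ts)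
 obtain p g' k where q: "q = (p, g', k)" "p : A" "g' : A" "k : A" using Cons.prems by (cases q) auto
 have "set ts \<subseteq> A \<times> A \<times> A" using Cons.prems by simp
 note IH = Cons.IH[OF this]
 show ?case unfolding num_Cons q(1) eta_along
  by (intro holomorphic_on_add holomorphic_on_mult holomorphic_on_diff IH Reg_hol[OF A_Reg[OF q(2)] U g]
    dE_hol[OF A_Reg[OF q(3)] U g v] dE_hol[OF A_Reg[OF q(4)] U g v] dE_hol[OF A_Reg[OF q(3)] U g w] dE_hol[OF A_Reg[OF q(4)] U g w])
qed (simp add: num_Nil)

end

section \<open>A closed form of weight 1 read along the orbit\<close>

locale weighted_form = cover_action smul Basis br B X A \<nu> \<phi>
 for smul :: "complex => 'g::ab_group_add => 'g" (infixr "*s" 75)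
  and Basis :: "'g set" and br B and X :: "'x set" and A \<nu> \<phi> +
 fixes \<omega> :: "'x two_form"
 assumes algebraic: "algebraic_2form X A \<omega>" and closed: "d_closed X A \<omega>" and weight: "has_weight X A \<phi> \<omega> 1"
begin

definition Om :: "'g => 'g => 'g => complex" where "Om z v w = \<omega> (sec z) (DD z v) (DD z w)"

lemma local_form: assumes z: "z : E"
 shows "EX b ts. b : A & set ts \<subseteq> A \<times> A \<times> A & b (sec z) ~= 0 & represents_on_principal_open X A \<omega> b ts
  & (ALL y:E. ALL v:Tg y. ALL w:Tg y. b (sec y) ~= 0 --> Om y v w = num ts y v w / b (sec y))"
proof -
 obtain b ts where b: "b (sec z) ~= 0" and r: "represents_on_principal_open X A \<omega> b ts"
  using algebraic smooth_sec[OF z] unfolding algebraic_2form_def by blast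
 have bA: "b : A" and ts: "set ts \<subseteq> A \<times> A \<times> A"
  and r': "!!x D D'. x : smooth_locus X A ==> b x ~= 0 ==> D : tangent_space A x ==> D' : tangent_space A x ==> \<omega> x D D' = kaehler_form b ts x D D'"
  using r by (simp_all add: represents_on_principal_open_def)
 have "Om y v w = num ts y v w / b (sec y)" if "y : E" "v : Tg y" "w : Tg y" "b (sec y) ~= 0" for y v w
  unfolding Om_def kaehler_form_num[OF ts, symmetric] by (rule r'[OF smooth_sec[OF that(1)] that(4) DD_derivation[OF that(1,2)] DD_derivation[OF that(1,3)]])
 thus ?thesis using bA ts b r by blast
qed

lemma Om_anti: assumes "z : E" "v : Tg z" "w : Tg z" shows "Om z w v = - Om z v w"
proof -
 obtain b ts where b: "set ts \<subseteq> A \<times> A \<times> A" "b (sec z) ~= 0" "!!v w. v : Tg z ==> w : Tg z ==> Om z v w = num ts z v w / b (sec z)"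
  using local_form[OF assms(1)] assms(1) by blast
 show ?thesis unfolding b(3)[OF assms(2,3)] b(3)[OF assms(3,2)] num_anti[of ts z w v] by simp
qed
lemma Om_lf: assumes z: "z : E" and v: "v : Tg z" shows "EX l. lf l & (ALL w:Tg z. Om z v w = l w)"
proof -
 obtain b ts where b: "set ts \<subseteq> A \<times> A \<times> A" "b (sec z) ~= 0" "!!v w. v : Tg z ==> w : Tg z ==> Om z v w = num ts z v w / b (sec z)"
  using local_form[OF z] z by blast
 have "lf (%w. (1 / b (sec z)) * num ts z v w)" by (rule lf_times[OF num_lf[OF b(1) z]])
 moreover have "ALL w:Tg z. Om z v w = (1 / b (sec z)) * num ts z v w" using b(3)[OF v] by simp
 ultimately show ?thesis by auto
qed
lemma Om_scale_r: assumes "z : E" "v : Tg z" "w : Tg z" shows "Om z v (c *s w) = c * Om z v w"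
proof -
 obtain l where l: "lf l" "ALL w:Tg z. Om z v w = l w" using Om_lf[OF assms(1,2)] by (elim exE conjE) (rule that)
 show ?thesis using l(2) assms(3) subspace_scale[OF subspace_Tg assms(3), of c] by (simp add: lf_scale[OF l(1)])
qed
lemma Om_scale_l: assumes "z : E" "v : Tg z" "w : Tg z" shows "Om z (c *s v) w = c * Om z v w"
 using Om_scale_r[OF assms(1,3,2), of c] Om_anti[OF assms(1,3) subspace_scale[OF subspace_Tg assms(2), of c]] Om_anti[OF assms(1,3,2)] by simp
lemma Om_self: assumes "z : E" "v : Tg z" shows "Om z v v = 0" using Om_anti[OF assms assms(2)] by simp
lemma Om_0: assumes "z : E" "v : Tg z" shows "Om z v 0 = 0" "Om z 0 v = 0"
 using Om_scale_r[OF assms z_Tg[OF assms(1)], of 0] Om_scale_l[OF assms(1) z_Tg[OF assms(1)] assms(2), of 0] by auto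

lemma Om_Reg: assumes L: "fld L" "fld L'" shows "(%y. Om y (L y) (L' y)) : Reg"
proof (rule Reg_quotient)
 fix z assume z: "z : E"
 obtain b ts where b: "b : A" "set ts \<subseteq> A \<times> A \<times> A" "b (sec z) ~= 0"
  "ALL y:E. ALL v:Tg y. ALL w:Tg y. b (sec y) ~= 0 --> Om y v w = num ts y v w / b (sec y)"
  using local_form[OF z] by (elim exE conjE) (rule that)
 let ?b = "%y. b (sec y)"
 have "Om y (L y) (L' y) * (?b y * ?b y) = num ts y (L y) (L' y) * ?b y" if y: "y : E" for y
  using bspec[OF bspec[OF bspec[OF b(4) y] fldD(2)[OF L(1) y]] fldD(2)[OF L(2) y]] by (cases "?b y = 0") simp_all
 thus "EX Bs:Reg. EX N:Reg. Bs z ~= 0 & (ALL y:E. Om y (L y) (L' y) * Bs y = N y)"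
  by (intro bexI[of _ "%y. ?b y * ?b y"] bexI[of _ "%y. num ts y (L y) (L' y) * ?b y"] conjI ballI fa_mult[OF fa_Reg] A_Reg[OF b(1)] num_Reg[OF b(2) L])
   (use b(3) in simp_all)
qed

lemma Om_hol: assumes U: "open U" and g: "vhol ga U" "!!t. t : U ==> ga t : E"
  and v: "vhol v U" "!!t. t : U ==> v t : Tg (ga t)" and w: "vhol w U" "!!t. t : U ==> w t : Tg (ga t)"
 shows "(%t. Om (ga t) (v t) (w t)) holomorphic_on U"
proof (rule hol_local[OF U])
 fix t0 assume t0: "t0 : U"
 obtain b ts where b: "b : A" "set ts \<subseteq> A \<times> A \<times> A" "b (sec (ga t0)) ~= 0"
  "ALL y:E. ALL v:Tg y. ALL w:Tg y. b (sec y) ~= 0 --> Om y v w = num ts y v w / b (sec y)"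
  using local_form[OF g(2)[OF t0]] by (elim exE conjE) (rule that)
 show "EX b p. b holomorphic_on U & p holomorphic_on U & b t0 ~= 0 & (ALL t:U. b t ~= 0 --> Om (ga t) (v t) (w t) = p t / b t)"
 proof (intro exI conjI ballI impI)
  show "(%t. b (sec (ga t))) holomorphic_on U" by (rule Reg_hol[OF A_Reg[OF b(1)] U g])
  show "(%t. num ts (ga t) (v t) (w t)) holomorphic_on U" by (rule num_hol[OF b(2) U g v w])
  show "b (sec (ga t0)) ~= 0" by (rule b(3))
  show "Om (ga t) (v t) (w t) = num ts (ga t) (v t) (w t) / b (sec (ga t))" if "t : U" "b (sec (ga t)) ~= 0" for t
   using bspec[OF bspec[OF bspec[OF b(4) g(2)[OF that(1)]] v(2)[OF that(1)]] w(2)[OF that(1)]] that(2) by simp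
 qed
qed

lemma Om_koszul:
 assumes L: "fld L1" "fld L2" "fld L3" and z: "z : E"
  and M: "M12 = L1 (L2 z) - L2 (L1 z)" "M23 = L2 (L3 z) - L3 (L2 z)" "M31 = L3 (L1 z) - L1 (L3 z)"
  and MT: "M12 : Tg z" "M23 : Tg z" "M31 : Tg z"
 shows "dE (%y. Om y (L2 y) (L3 y)) z (L1 z) + dE (%y. Om y (L3 y) (L1 y)) z (L2 z) + dE (%y. Om y (L1 y) (L2 y)) z (L3 z)
  + Om z M12 (L3 z) + Om z M23 (L1 z) + Om z M31 (L2 z) = 0"
proof -
 obtain b ts where b: "b : A" "set ts \<subseteq> A \<times> A \<times> A" "b (sec z) ~= 0" "represents_on_principal_open X A \<omega> b ts"
  "ALL y:E. ALL v:Tg y. ALL w:Tg y. b (sec y) ~= 0 --> Om y v w = num ts y v w / b (sec y)"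
  using local_form[OF z] by (elim exE conjE) (rule that)
 have k: "kaehler_form b ts (sec y) (DD y v) (DD y w) = Om y v w" if "y : E" "b (sec y) ~= 0" "v : Tg y" "w : Tg y" for y v w
  using bspec[OF bspec[OF bspec[OF b(5) that(1)] that(3)] that(4)] that(2) unfolding kaehler_form_num[OF b(2)] by simp
 have k': "kaehler_form b ts (sec y) (DD y (L y)) (DD y (L' y)) = Om y (L y) (L' y)" if "fld L" "fld L'" "y : E" "b (sec y) ~= 0" for L L' y
  by (rule k[OF that(3,4) fldD(2)[OF that(1,3)] fldD(2)[OF that(2,3)]])
 have "kaehler_d b ts (sec z) (DD z (L1 z)) (DD z (L2 z)) (DD z (L3 z)) = 0"
  using closed b(4) smooth_sec[OF z] b(3) DD_derivation[OF z fldD(2)[OF L(1) z]] DD_derivation[OF z fldD(2)[OF L(2) z]] DD_derivation[OF z fldD(2)[OF L(3) z]]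
  unfolding d_closed_def by blast
 thus ?thesis
  using kaehler_d_koszul[OF b(2) L z b(1,3) M MT Om_Reg[OF L(1,2)] Om_Reg[OF L(2,3)] Om_Reg[OF L(3,1)] k'[OF L(1,2)] k'[OF L(2,3)] k'[OF L(3,1)]]
  unfolding k[OF z b(3) MT(1) fldD(2)[OF L(3) z]] k[OF z b(3) MT(2) fldD(2)[OF L(1) z]] k[OF z b(3) MT(3) fldD(2)[OF L(2) z]] by simp
qed

lemma tangent_map_DD: assumes t: "t ~= 0" and z: "z : E" and v: "v : Tg z"
 shows "tangent_map X A (\<phi> t) (DD z v) = DD (t *s z) (t *s v)"
proof -
 let ?D = "DD z v" and ?T = "tangent_map X A (\<phi> t) (DD z v)" and ?p = "pullback X (\<phi> t)"
 have D: "?D : tangent_space A (sec z)" by (rule DD_derivation[OF z v])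
 have pz: "?p f (sec z) = f (sec (t *s z))" for f using sec(1)[OF z] by (simp add: pullback_def restr_def \<phi>_sec[OF t z])
 have "?T : tangent_space A (sec (t *s z))" unfolding tangent_space_def
 proof (intro CollectI conjI allI ballI impI)
  show "?T f = 0" if "f ~: A" for f using that by (simp add: tangent_map_def)
  fix f assume f: "f : A"
  note pf = \<phi>_A[OF t f]
  show "?T (fun_scale c f) = c * ?T f" for c
  proof -
   have "?p (fun_scale c f) = fun_scale c (?p f)" by (auto simp: pullback_def restr_def fun_scale_def)
   thus ?thesis using D pf f A_closed(4)[OF f, of c] unfolding tangent_space_def by (simp add: tangent_map_def)
  qed
  fix k assume k: "k : A"
  note pk = \<phi>_A[OF t k]
  have "?p (f + k) = ?p f + ?p k" "?p (f * k) = ?p f * ?p k" by (auto simp: pullback_def restr_def)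
  thus "?T (f + k) = ?T f + ?T k" "?T (f * k) = f (sec (t *s z)) * ?T k + k (sec (t *s z)) * ?T f"
   using D pf pk f k A_closed(1,2)[OF f k] pz unfolding tangent_space_def tangent_map_def by simp_all
 qed
 then obtain w where w: "w : Tg (t *s z)" "?T = DD (t *s z) w" unfolding tangent_space_DD[OF E_scale[OF z t]] by blast
 have "w = t *s v" using vecD_DD[OF E_scale[OF z t] w(1)] vecD_tangent_map[OF t D] unfolding w(2) vecD_DD[OF z v] by simp
 thus ?thesis using w(2) by simp
qed

lemma Om_weight: assumes t: "t ~= 0" and z: "z : E" and v: "v : Tg z" "w : Tg z"
 shows "Om (t *s z) (t *s v) (t *s w) = t * Om z v w"
proof -
 have "\<omega> (\<phi> t (sec z)) (tangent_map X A (\<phi> t) (DD z v)) (tangent_map X A (\<phi> t) (DD z w)) = t powi 1 * \<omega> (sec z) (DD z v) (DD z w)"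
  using weight t smooth_sec[OF z] DD_derivation[OF z v(1)] DD_derivation[OF z v(2)] unfolding has_weight_def by blast
 thus ?thesis unfolding Om_def tangent_map_DD[OF t z v(1)] tangent_map_DD[OF t z v(2)] \<phi>_sec[OF t z] by simp
qed
text \<open>Weight 1 also scales both arguments; with the arguments fixed the degree is 1 - 2 =
  -1.\<close>

lemma Om_homog: assumes t: "t ~= 0" and z: "z : E" and v: "v : Tg z" "w : Tg z"
 shows "Om (t *s z) v w = Om z v w / t"
proof -
 have T: "v : Tg (t *s z)" "w : Tg (t *s z)" using v by (simp_all add: Tg_scale[OF t])
 have "t * Om z v w = t * (t * Om (t *s z) v w)"
  unfolding Om_weight[OF t z v, symmetric] using Om_scale_l[OF E_scale[OF z t] T(1) subspace_scale[OF subspace_Tg T(2), of t]] Om_scale_r[OF E_scale[OF z t] T] by simp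
 thus ?thesis using t by auto
qed

end

context weighted_form begin

text \<open>On the plane spanned by \<open>e\<close> and a singular vector \<open>y\<close> the coefficient of the form is
 homogeneous of degree \<open>-1\<close> and has no pole off the origin, hence vanishes.\<close>

lemma Om_plane:
 assumes ey: "e : E" "!!s t. s *s e + t *s y : E0" "!!s t. s ~= 0 \<or> t ~= 0 ==> s *s e + t *s y ~= 0"
 shows "Om e e y = 0"
proof -
 have pE: "s *s e + t *s y : E" if "s ~= 0 \<or> t ~= 0" for s t using ey(2) ey(3)[OF that] by (simp add: E_def)
 have pT: "e : Tg (s *s e + t *s y)" "y : Tg (s *s e + t *s y)" if st: "s ~= 0 \<or> t ~= 0" for s t
 proof -
  show "e : Tg (s *s e + t *s y)"
   using tangent_polar[OF pE[OF st], of e] E_E0[OF ey(1)] ey(2)[of "s + 1" t] by (simp add: scale_left_distrib ac_simps)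
  show "y : Tg (s *s e + t *s y)"
   using tangent_polar[OF pE[OF st], of y] ey(2)[of 0 1] ey(2)[of s "t + 1"] by (simp add: scale_left_distrib ac_simps)
 qed
 \<comment> \<open>F and H are the coefficient on two affine lines of the plane; homogeneity gives F
   t = H (1/t) / t, so F is entire and tends to 0 at infinity.\<close>
 define F where "F t = Om (1 *s e + t *s y) e y" for t
 define H where "H s = Om (s *s e + 1 *s y) e y" for s
 have vh: "vhol (%t. f t *s e + k t *s y) UNIV" if "f holomorphic_on UNIV" "k holomorphic_on UNIV" for f k
  by (intro vhol_add vhol_scale vhol_const that)
 have n1: "(1::complex) ~= 0" by simp
 have F: "F holomorphic_on UNIV" unfolding F_def[abs_def]
  by (rule Om_hol[OF open_UNIV vh[OF holomorphic_on_const holomorphic_on_ident] pE[OF disjI1[OF n1]] vhol_const pT(1)[OF disjI1[OF n1]] vhol_const pT(2)[OF disjI1[OF n1]]])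
 have H: "H holomorphic_on UNIV" unfolding H_def[abs_def]
  by (rule Om_hol[OF open_UNIV vh[OF holomorphic_on_ident holomorphic_on_const] pE[OF disjI2[OF n1]] vhol_const pT(1)[OF disjI2[OF n1]] vhol_const pT(2)[OF disjI2[OF n1]]])
 have FH: "F t = H (inverse t) * inverse t" if t: "t ~= 0" for t
 proof -
  have "1 *s e + t *s y = t *s (inverse t *s e + 1 *s y)" using t by (simp add: scale_right_distrib)
  hence "F t = H (inverse t) / t" unfolding F_def H_def using Om_homog[OF t pE pT, of "inverse t" 1] by simp
  thus ?thesis by (simp add: field_simps)
 qed
 have "isCont H 0" using holomorphic_on_imp_continuous_on[OF H] by (simp add: continuous_on_eq_continuous_at)
 hence "((%t. H (inverse t)) \<longlongrightarrow> H 0) at_infinity" by (rule isCont_tendsto_compose[OF _ tendsto_inverse_0])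
 hence "((%t. H (inverse t) * inverse t) \<longlongrightarrow> H 0 * 0) at_infinity" by (rule tendsto_mult[OF _ tendsto_inverse_0])
 moreover have "\<forall>\<^sub>F t in at_infinity. H (inverse t) * inverse t = F t" unfolding eventually_at_infinity
 proof (intro exI[of _ 1] allI impI)
  fix t :: complex assume "1 \<le> cmod t"
  hence "t ~= 0" by auto
  thus "H (inverse t) * inverse t = F t" by (rule FH[symmetric])
 qed
 ultimately have "(F \<longlongrightarrow> H 0 * 0) at_infinity" by (rule Lim_transform_eventually)
 hence "F 0 = H 0 * 0" by (rule Liouville_weak[OF F])
 thus ?thesis by (simp add: F_def)
qed

end

section \<open>Contraction with the Euler field and constancy of the factor\<close>

locale non_symplectic_form = weighted_form smul Basis br B X A \<nu> \<phi> \<omega>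
 for smul :: "complex => 'g::ab_group_add => 'g" (infixr "*s" 75)
  and Basis :: "'g set" and br B and X :: "'x set" and A \<nu> \<phi> \<omega> +
 assumes not_sp: "\<not> (EX n. isomorphic_to_sp smul br n)"
begin

text \<open>The functional w |-> Om z z w kills z by antisymmetry and all plane directions by
  \<open>Om_plane\<close>, hence G 1 because g is not symplectic. On [g,z] only the coefficient of h
  counts, and for [a,z] it is -B z a.\<close>

lemma Om_radial: assumes z: "z : E" shows "EX g. ALL a. Om z z (br a z) = - g * B z a"
proof -
 obtain f where f: "f : E" "B z f = 1" using E_pair[OF z] by blast
 interpret t: triple smul Basis br B z f by unfold_locales (use z f in auto)
 obtain l where l: "lf l" "ALL w:Tg z. Om z z w = l w" using Om_lf[OF z z_Tg[OF z]] by (elim exE conjE) (rule that)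
 have G1T: "y : Tg z" if "y : t.G 1" for y
 proof -
  have "br (br y f) z = y" by (rule t.e_in_G1_Gm1[OF that])
  thus ?thesis using Tg_br[of "br y f" z] by simp
 qed
 have S0: "l y = 0" if y: "y : t.Ssing" for y
 proof (cases "y = 0")
  case False
  have y1: "y : t.G 1" using y by (simp add: t.Ssing_def)
  have "Om z z y = 0"
  proof (rule Om_plane[OF z t.plane_E0[OF y]])
   fix s t :: complex assume st: "s ~= 0 \<or> t ~= 0"
   show "s *s z + t *s y ~= 0"
   proof
    assume 0: "s *s z + t *s y = 0"
    have "B (s *s z + t *s y) f = s" using t.G_orth[OF y1 t.fG] f(2) by (simp add: bs)
    hence "s = 0" unfolding 0 by (simp add: bs)
    thus False using 0 st False by simp
   qed
  qed
  thus ?thesis using l(2) G1T[OF y1] by simp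
 qed (simp add: lf_0[OF l(1)])
 have "l y = 0" if "y : span t.Ssing" for y using that by (induction rule: span_induct_alt) (simp_all add: S0 lfs[OF l(1)])
 hence l1: "l y = 0" if "y : t.G 1" for y using that t.Ssing_span_G1[OF not_sp] by simp
 have lz: "l z = 0" using l(2) z_Tg[OF z] Om_self[OF z z_Tg[OF z]] by simp
 have "Om z z (br a z) = - l t.h * B z a" for a
 proof -
  have "br (t.p1 a) z = 0" using t.e_G1[OF t.p1G, of a] anti[of "t.p1 a" z] by simp
  moreover have "br (t.p0 a) z = B a t.h *s z" using t.e_G0[OF t.p0G, of a] anti[of "t.p0 a" z] by (simp add: t.p0_h)
  ultimately have d: "br a z = B a t.h *s z + br (t.pm a) z + (- B a z) *s t.h" by (subst t.decomp[of a]) (simp add: brs t.fe)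
  have "br (t.pm a) z : t.G 1" using t.G_br'[OF t.pmG t.eG] by simp
  hence "l (br a z) = - l t.h * B z a" unfolding d by (simp add: lfs[OF l(1)] l1 lz B_sym[of a z])
  thus ?thesis using l(2) Tg_br[of a z] by simp
 qed
 thus ?thesis by auto
qed

text \<open>Near a point z the function g is the quotient of -Om(y,y,[a,y]) by B y a for some a with
  B z a ~= 0. Both have degree 1 under scaling, so g has degree 0.\<close>

lemma radial_function: "EX g. (ALL z:E. ALL a. Om z z (br a z) = - g z * B z a) & g : Reg & (ALL z:E. ALL t. t ~= 0 --> g (t *s z) = g z)"
proof -
 have "ALL z:E. EX g. ALL a. Om z z (br a z) = - g * B z a" using Om_radial by simp
 from bchoice[OF this] obtain g where g0: "ALL z:E. ALL a. Om z z (br a z) = - g z * B z a" by (elim exE) (rule that)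
 have g: "Om z z (br a z) = - g z * B z a" if "z : E" for z a using g0 that by blast
 have R: "g : Reg"
 proof (rule Reg_quotient)
  fix z assume z: "z : E"
  obtain a where a: "B z a ~= 0" using E_pair[OF z] by force
  have N: "(%y. - 1 * Om y y (br a y)) : Reg" by (rule fa_cmult[OF fa_Reg Om_Reg[OF fld_id fld_br]])
  show "EX Bs:Reg. EX N:Reg. Bs z ~= 0 & (ALL y:E. g y * Bs y = N y)"
  proof (rule bexI[of _ "%y. B y a"], rule bexI[of _ "%y. - 1 * Om y y (br a y)"], intro conjI ballI)
   show "g y * B y a = - 1 * Om y y (br a y)" if "y : E" for y unfolding g[OF that] by simp
  qed (rule a, rule N, rule Rg_Reg[OF lf_Rg[OF B_lf2]])
 qed
 have "g (t *s z) = g z" if z: "z : E" and t: "t ~= 0" for z t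
 proof -
  obtain a where a: "B z a ~= 0" using E_pair[OF z] by force
  have "Om (t *s z) (t *s z) (br a (t *s z)) = t * Om z z (br a z)" using Om_weight[OF t z z_Tg[OF z] Tg_br[of a]] by (simp add: brs)
  hence "g (t *s z) * (t * B z a) = g z * (t * B z a)" unfolding g[OF z] g[OF E_scale[OF z t]] by (simp add: bs)
  thus ?thesis using a t by simp
 qed
 thus ?thesis using g0 R by (intro exI conjI) auto
qed

text \<open>The curve exp(s ad f) z closes up to a conic in the projectivised cone, passing through
  f at infinity; g has degree 0, so it extends over that point and is constant along the conic. Such
  f detect the whole differential.\<close>

lemma radial_constant:
 assumes g: "ALL z:E. ALL t. t ~= 0 --> g (t *s z) = g z" "g : Reg" and z: "z : E"
 shows "dE g z (br a z) = 0"
proof -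
 have 1: "dE g z (br f z) = 0" if f: "f : E" "B z f = 1" for f
 proof -
  interpret t: triple smul Basis br B z f by unfold_locales (use z f in auto)
  have ff: "br f (br f z) = (- 2) *s f" using E0D[OF E_E0[OF f(1)], of z] f(2) B_sym[of f z] by simp
  have n: "(br f ^^ 3) z = 0" by (rule t.f_nilp)
  have e: "ex f s z = z + s *s br f z + (- (s^2)) *s f" for s using ex_nilp[OF n, of s] by (simp add: numeral_3_eq_3 ff power2_eq_square)
  \<comment> \<open>The curve seen from infinity: -s^2 exp((1/s) ad f) z is polynomial in s with
    value f at s = 0.\<close>
  define ga where "ga s = f + (- s) *s br f z + (- (s^2)) *s z" for s
  have ga: "ga s = (- (s^2)) *s ex f (inverse s) z" if "s ~= 0" for s
  proof -
   have "(- (s^2)) *s ex f (inverse s) z = (- (s^2)) *s z + (- (s^2) * inverse s) *s br f z + (- (s^2) * - (inverse s ^ 2)) *s f"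
    by (simp only: e scale_right_distrib scale_scale)
   also have "- (s^2) * inverse s = - s" using that by (simp add: power2_eq_square)
   also have "- (s^2) * - (inverse s ^ 2) = 1" using that by (simp add: power_inverse)
   finally show ?thesis by (simp add: ga_def)
  qed
  have gaE: "ga s : E" for s
  proof (cases "s = 0")
   case True thus ?thesis using f by (simp add: ga_def)
  next
   case False thus ?thesis unfolding ga[OF False] by (intro E_scale E_ex z) simp
  qed
  have F: "(%s. g (ex f s z)) holomorphic_on UNIV" by (rule Reg_hol[OF g(2) open_UNIV ex_vhol]) (rule E_ex[OF z])
  have H: "(%s. g (ga s)) holomorphic_on UNIV"
   by (rule Reg_hol[OF g(2) open_UNIV _ gaE]) (unfold ga_def, intro vhol_add vhol_const vhol_scale holomorphic_intros)
  have FH: "g (ex f s z) = g (ga (inverse s))" if "s ~= 0" for s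
  proof -
   have i: "inverse s ~= 0" using that by simp
   show ?thesis unfolding ga[OF i] inverse_inverse_eq by (rule bspec[OF g(1) E_ex[OF z], THEN spec, THEN mp, symmetric]) (use i in simp)
  qed
  have "isCont (%s. g (ga s)) 0" using holomorphic_on_imp_continuous_on[OF H] by (simp add: continuous_on_eq_continuous_at)
  hence "((%t. g (ga (inverse t))) \<longlongrightarrow> g (ga 0)) at_infinity" by (rule isCont_tendsto_compose[OF _ tendsto_inverse_0])
  moreover have "\<forall>\<^sub>F t in at_infinity. g (ga (inverse t)) = g (ex f t z)" unfolding eventually_at_infinity
  proof (intro exI[of _ 1] allI impI)
   fix t :: complex assume "1 \<le> cmod t"
   hence "t ~= 0" by auto
   thus "g (ga (inverse t)) = g (ex f t z)" by (rule FH[symmetric])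
  qed
  ultimately have "((%s. g (ex f s z)) \<longlongrightarrow> g (ga 0)) at_infinity" by (rule Lim_transform_eventually)
  hence c: "g (ex f s z) = g (ga 0)" for s by (rule Liouville_weak[OF F])
  have "((%s. g (ex f s z)) has_field_derivative 0) (at 0)" unfolding c by simp
  moreover have "((%s. g (ex f s z)) has_field_derivative dE g (ex f 0 z) (br f (ex f 0 z))) (at 0)"
   by (rule dE_chain[OF g(2) open_UNIV UNIV_I E_ex[OF z] ex_vder Tg_br])
  ultimately have "0 = dE g (ex f 0 z) (br f (ex f 0 z))" by (rule DERIV_unique)
  thus ?thesis unfolding ex_0 by simp
 qed
 define l where "l x = dE g z (br x z)" for x
 have l: "lf l" unfolding l_def[abs_def] by (rule lf_comp[OF lf_dE[OF g(2) z] le_br2])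
 have l0: "l f = 0" if f: "f : E" "B z f ~= 0" for f
 proof -
  have "l (inverse (B z f) *s f) = 0" unfolding l_def by (rule 1) (use f E_scale in \<open>simp_all add: bs\<close>)
  thus ?thesis using f(2) by (simp add: lf_scale[OF l])
 qed
 obtain f where f: "f : E" "B z f = 1" using E_pair[OF z] by blast
 \<comment> \<open>The condition B z x ~= 0 is removed by irreducibility of E.\<close>
 have lE: "l x = 0" if x: "x : E" for x
 proof (rule E_cancel[OF lf_Rg[OF B_lf[of z]] lf_Rg[OF l] _ f(1) _ x])
  show "B z x * l x = 0" if "x : E" for x using l0[OF that] by (cases "B z x = 0") auto
 qed (simp add: f)
 have "l a = 0" if "a : span E" for a using that by (induction rule: span_induct_alt) (simp_all add: lfs[OF l] lE)
 thus ?thesis unfolding l_def using E_spans by simp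
qed

lemma locally_constant: assumes g: "g : Reg" "!!z a. z : E ==> dE g z (br a z) = 0" and z: "z : E" "w : E" shows "g z = g w"
proof -
 have step: "g (ex x 1 y) = g y" if y: "y : E" for x y
 proof -
  have "EX c. ALL t:UNIV. g (ex x t y) = c"
  proof (rule has_field_derivative_zero_constant[OF convex_UNIV])
   fix t :: complex
   show "((%t. g (ex x t y)) has_field_derivative 0) (at t)"
    using dE_chain[OF g(1) open_UNIV UNIV_I E_ex[OF y] ex_vder[of x y t] Tg_br] g(2)[OF E_ex[OF y, of x t], of x] by simp
  qed
  hence "g (ex x 1 y) = g (ex x 0 y)" by auto
  thus ?thesis by (simp add: ex_0)
 qed
 obtain u where u: "u : Gr" "w = u z" using E_transitive[OF z] by blast
 have "g (u z) = g z" using u(1)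
 proof (induction rule: adjoint_group.induct)
  case (exp_ad u x)
  have "exp_endo smul (br x) (u z) = ex x 1 (u z)" by (simp add: ex_def)
  thus ?case using step[OF E_Gr[OF exp_ad(1) z(1)], of x] exp_ad(2) by simp
 qed simp
 thus ?thesis using u by simp
qed

text \<open>Use Koszul's formula for the Euler field, ad a and ad b. The Euler field commutes with
  the other two, and every term except the Euler derivative of Om([a,z],[b,z]) is zero or contains a
  known contraction.\<close>

lemma Om_constant: "EX c. ALL z:E. ALL a b. Om z (br a z) (br b z) = c * B z (br a b)"
proof -
 obtain g where g: "ALL z:E. ALL a. Om z z (br a z) = - g z * B z a" "g : Reg" "ALL z:E. ALL t. t ~= 0 --> g (t *s z) = g z"
  using radial_function by (elim exE conjE) (rule that)
 have dg: "dE g z (br a z) = 0" if "z : E" for z a by (rule radial_constant[OF g(3,2) that])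
 obtain z0 where z0: "z0 : E" using Cond_exists by blast
 have gc: "g z = g z0" if "z : E" for z by (rule locally_constant[OF g(2) dg that z0])
 let ?c = "g z0"
 have r: "Om z z (br a z) = - ?c * B z a" if "z : E" for z a using g(1) gc[OF that] that by simp
 have r': "Om z (br a z) z = ?c * B z a" if "z : E" for z a using Om_anti[OF that z_Tg[OF that] Tg_br[of a]] r[OF that] by simp
 have "Om z (br a z) (br b z) = ?c * B z (br a b)" if z: "z : E" for z a b
 proof -
  define W where "W y = Om y (br a y) (br b y)" for y
  have WR: "W : Reg" unfolding W_def[abs_def] by (rule Om_Reg[OF fld_br fld_br])
  \<comment> \<open>Euler's identity: W is homogeneous of degree 1, so its derivative in direction z
    is W z.\<close>
  have "((%t. W (t *s z)) has_field_derivative dE W (1 *s z) z) (at 1)"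
  proof (rule dE_chain[OF WR, of "- {0}"])
   show "vder (%t. t *s z) z 1" using vder_line[of 0 z 1] by simp
  qed (use z E_scale z_Tg in auto)
  moreover have "((%t. W (t *s z)) has_field_derivative W z) (at 1)"
  proof (rule has_field_derivative_transform_within_open)
   show "((%t. t * W z) has_field_derivative W z) (at 1)" by (auto intro!: derivative_eq_intros)
   show "t * W z = W (t *s z)" if "t : - {0}" for t using Om_weight[OF _ z Tg_br[of a] Tg_br[of b], of t] that by (simp add: W_def brs)
  qed auto
  ultimately have "dE W (1 *s z) z = W z" by (rule DERIV_unique)
  hence dW: "dE W z z = W z" by simp
  have l: "dE (%y. Om y (br b y) y) z (br a z) = ?c * B (br a z) b" "dE (%y. Om y y (br a y)) z (br b z) = - ?c * B (br b z) a"
  proof -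
   have R: "(%y. c * B y d) : Rg" for c d by (rule fa_cmult[OF fa_Rg lf_Rg[OF B_lf2]])
   have v: "dE (%y. c * B y d) z (br x z) = c * B (br x z) d" for c d x using dE_Rg[OF R z Tg_br] dd_lf[OF lf_times[OF B_lf2]] by simp
   have "dE (%y. Om y (br b y) y) z (br a z) = dE (%y. ?c * B y b) z (br a z)" by (rule dE_cong[OF Rg_Reg[OF R] z Tg_br]) (rule r')
   thus "dE (%y. Om y (br b y) y) z (br a z) = ?c * B (br a z) b" unfolding v .
   have "dE (%y. Om y y (br a y)) z (br b z) = dE (%y. - ?c * B y a) z (br b z)" by (rule dE_cong[OF Rg_Reg[OF R] z Tg_br]) (rule r)
   thus "dE (%y. Om y y (br a y)) z (br b z) = - ?c * B (br b z) a" unfolding v .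
  qed
  have M: "0 = br a z - br a z" "br (br a b) z = br a (br b z) - br b (br a z)" "0 = br b z - br b z" by (simp_all add: leib2)
  have T: "0 : Tg z" by (rule subspace_0[OF subspace_Tg])
  have "dE W z z + ?c * B (br a z) b + - ?c * B (br b z) a + Om z 0 (br b z) + Om z (br (br a b) z) z + Om z 0 (br a z) = 0"
   using Om_koszul[OF fld_id fld_br fld_br z M T Tg_br T] unfolding l W_def[abs_def] .
  hence "Om z (br a z) (br b z) + ?c * B (br a z) b - ?c * B (br b z) a + ?c * B z (br a b) = 0"
   unfolding dW r'[OF z] Om_0(2)[OF z Tg_br] by (simp add: W_def)
  moreover have "B (br a z) b = - B z (br a b)" by (rule B_inv2)
  moreover have "B (br b z) a = B z (br a b)" unfolding B_inv2 anti[of b a] by (simp add: bs)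
  ultimately show ?thesis by simp
 qed
 thus ?thesis by blast
qed

end

context non_symplectic_form begin

lemma proportional_KKform: assumes nd: "nondegenerate X A \<omega>"
 shows "EX c. c ~= 0 & (ALL x:smooth_locus X A. ALL D:tangent_space A x. ALL D':tangent_space A x. \<omega> x D D' = c * KKform x D D')"
proof -
 obtain c where c: "ALL z:E. ALL a b. Om z (br a z) (br b z) = c * B z (br a b)" using Om_constant by (elim exE) (rule that)
 have 1: "\<omega> x D D' = c * KKform x D D'" if x: "x : smooth_locus X A" and D: "D : tangent_space A x" "D' : tangent_space A x" for x D D'
 proof -
  obtain z where z: "z : E" "x = sec z" using smooth_secE[OF x smooth_over_E[OF x]] by blast
  obtain a where a: "D = DD z (br a z)" using tangentE[OF z(1) D(1)[unfolded z(2)]] by blast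
  obtain b where b: "D' = DD z (br b z)" using tangentE[OF z(1) D(2)[unfolded z(2)]] by blast
  show ?thesis unfolding z(2) a b KKform[OF z(1)] using c z(1) unfolding Om_def by blast
 qed
 \<comment> \<open>If c were 0, the Euler vector at a point of E would be a nonzero null
   vector.\<close>
 have "c ~= 0"
 proof
  assume "c = 0"
  obtain z where z: "z : E" using Cond_exists by blast
  have "DD z z = 0"
   using nd smooth_sec[OF z] DD_derivation[OF z z_Tg[OF z]] 1[OF smooth_sec[OF z] DD_derivation[OF z z_Tg[OF z]]] \<open>c = 0\<close>
   unfolding nondegenerate_def by simp
  hence "vecD (DD z z) = vecD (DD z 0)" by (simp only: DD_0[OF z])
  hence "z = 0" unfolding vecD_DD[OF z z_Tg[OF z]] vecD_DD[OF z subspace_0[OF subspace_Tg]] .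
  thus False using E_0[OF z] by simp
 qed
 thus ?thesis using 1 by blast
qed

end

theorem mainTheorem7:
  fixes smul :: "complex \<Rightarrow> 'g::ab_group_add \<Rightarrow> 'g"
    and br :: "'g \<Rightarrow> 'g \<Rightarrow> 'g"
    and Omin Obar :: "'g set"
    and X :: "'x set"
    and A :: "('x \<Rightarrow> complex) set"
    and \<nu> :: "'x \<Rightarrow> 'g"
    and \<phi> :: "complex \<Rightarrow> 'x \<Rightarrow> 'x"
  assumes simple: "simple_complex_lie_algebra smul br"
    and not_sp: "\<not> (\<exists>n. isomorphic_to_sp smul br n)"
    and minimal: "minimal_nilpotent_orbit smul br Omin"
    and closure: "Obar = zariski_space smul closure_of Omin"
    and normalisation: "normalisation X A Obar (coordinate_ring smul Obar) \<nu>"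
    and action: "induced_scaling_action smul X A \<nu> \<phi>"
  shows "(\<exists>\<omega>. symplectic_structure X A \<omega> \<and> has_weight X A \<phi> \<omega> 1) \<and>
    (\<forall>\<omega>\<^sub>1 \<omega>\<^sub>2.
       symplectic_structure X A \<omega>\<^sub>1 \<and> has_weight X A \<phi> \<omega>\<^sub>1 1 \<and>
       symplectic_structure X A \<omega>\<^sub>2 \<and> has_weight X A \<phi> \<omega>\<^sub>2 1 \<longrightarrow>
       (\<exists>c. c \<noteq> 0 \<and>
          (\<forall>x\<in>smooth_locus X A. \<forall>D\<in>tangent_space A x. \<forall>E\<in>tangent_space A x.
             \<omega>\<^sub>2 x D E = c * \<omega>\<^sub>1 x D E)))"
proof -
 interpret simple_complex_lie_algebra smul br by (rule simple)
 obtain Basis where "finite_dimensional_vector_space smul Basis" using finite_dimensional by blast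
 then interpret finite_dimensional_vector_space smul Basis .
 interpret simple_lie smul Basis br by unfold_locales
 have "EX n. n ~= 0 & ad_nilpotent br n" using minimal unfolding minimal_nilpotent_orbit_def nonzero_nilpotent_orbit_def by blast
 then obtain B where "extremal_lie smul Basis br B" using extremal_lie_exists by blast
 then interpret extremal_lie smul Basis br B .
 have Obar: "Obar = E0" unfolding closure minimal_orbit_E[OF minimal] by (rule closure_E)
 interpret cover_action smul Basis br B X A \<nu> \<phi> by unfold_locales (use normalisation action Obar in simp_all)
 show ?thesis
 proof (intro conjI allI impI)
  show "EX \<omega>. symplectic_structure X A \<omega> & has_weight X A \<phi> \<omega> 1"
   by (intro exI conjI) (rule KKform_symplectic, rule KKform_weight)
  \<comment> \<open>Both forms are compared with the Kostant-Kirillov form; the quotient of the two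
    factors is the constant sought.\<close>
  have unique: "EX c. c ~= 0 & (ALL x:smooth_locus X A. ALL D:tangent_space A x. ALL D':tangent_space A x. \<omega> x D D' = c * KKform x D D')"
   if \<omega>: "symplectic_structure X A \<omega>" "has_weight X A \<phi> \<omega> 1" for \<omega>
  proof -
   interpret non_symplectic_form smul Basis br B X A \<nu> \<phi> \<omega>
    by unfold_locales (use \<omega> not_sp in \<open>simp_all add: symplectic_structure_def\<close>)
   show ?thesis by (rule proportional_KKform) (use \<omega> in \<open>simp add: symplectic_structure_def\<close>)
  qed
  fix \<omega>\<^sub>1 \<omega>\<^sub>2
  assume "symplectic_structure X A \<omega>\<^sub>1 & has_weight X A \<phi> \<omega>\<^sub>1 1 & symplectic_structure X A \<omega>\<^sub>2 & has_weight X A \<phi> \<omega>\<^sub>2 1"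
  hence s: "symplectic_structure X A \<omega>\<^sub>1" "has_weight X A \<phi> \<omega>\<^sub>1 1" "symplectic_structure X A \<omega>\<^sub>2" "has_weight X A \<phi> \<omega>\<^sub>2 1" by auto
  obtain c1 where c1: "c1 ~= 0" "ALL x:smooth_locus X A. ALL D:tangent_space A x. ALL D':tangent_space A x. \<omega>\<^sub>1 x D D' = c1 * KKform x D D'"
   using unique[OF s(1,2)] by (elim exE conjE) (rule that)
  obtain c2 where c2: "c2 ~= 0" "ALL x:smooth_locus X A. ALL D:tangent_space A x. ALL D':tangent_space A x. \<omega>\<^sub>2 x D D' = c2 * KKform x D D'"
   using unique[OF s(3,4)] by (elim exE conjE) (rule that)
  show "EX c. c ~= 0 & (ALL x:smooth_locus X A. ALL D:tangent_space A x. ALL E:tangent_space A x. \<omega>\<^sub>2 x D E = c * \<omega>\<^sub>1 x D E)"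
   by (rule exI[of _ "c2 / c1"]) (use c1 c2 in simp)
 qed
qed

end
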